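(* Let $\frac{n-2\sigma}{n+2\sigma}<m<1$ and let $u\ge0$ be a solution of $(-\Delta)^\sigma u^m+u_t=0$ in $\Omega$, $u=0$ on $\mathbb{R}^n\setminus\Omega$, $u(\cdot,0)=u_0$, where $u_0\ge0$ with $u_0^m\in\dot H^\sigma_0$ and $(-\Delta)^\sigma u_0^m\ge0$, with extinction time $T^\ast$. Then for every sequence $t_n\to T^\ast$ there exist a subsequence $t_{n_k}$ and a function $\varphi$ such that $$\lim_{k\to\infty}(T^\ast-t_{n_k})^{-\frac1{1-m}}\big|u(x,t_{n_k})-(T^\ast-t_{n_k})^{\frac1{1-m}}\varphi^{1/m}(x)\big|=0$$ uniformly on compact subsets of $\Omega$, where $\varphi$ is a (weak) solution of $(-\Delta)^\sigma\varphi=\frac1{1-m}\varphi^{1/m}$ in $\Omega$, $\varphi=0$ on $\mathbb{R}^n\setminus\Omega$, $\varphi>0$ in $\Omega$.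
   Context: $0<\sigma<1$, $\Omega\subset\mathbb{R}^n$ bounded with smooth boundary; $(-\Delta)^{\sigma}f(x)=C_{n,\sigma}\int\frac{f(x)-f(y)}{|x-y|^{n+2\sigma}}dy$; $\dot H^\sigma_0$ is the space of $L^{2n/(n-2\sigma)}$ functions vanishing outside $\Omega$ with $\int\int\frac{|f(x)-f(y)|^2}{|x-y|^{n+2\sigma}}dxdy<\infty$. The extinction time $T^\ast$ is the time with $u(\cdot,t)\to0$ as $t\to T^\ast$. *)

theory Defs
  imports "HOL-Analysis.Analysis"
begin

abbreviation dimR :: "'a::euclidean_space itself \<Rightarrow> real" where
  "dimR _ \<equiv> real DIM('a)"

fun Ck :: "nat \<Rightarrow> 'a::euclidean_space set \<Rightarrow> ('a \<Rightarrow> real) \<Rightarrow> bool" where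
  "Ck 0 U f = continuous_on U f"
| "Ck (Suc k) U f = (f differentiable_on U \<and>
      (\<forall>v. Ck k U (\<lambda>x. frechet_derivative f (at x) v)))"

definition smooth_on :: "'a::euclidean_space set \<Rightarrow> ('a \<Rightarrow> real) \<Rightarrow> bool" where
  "smooth_on U f \<longleftrightarrow> (\<forall>k. Ck k U f)"

definition smooth_boundary :: "'a::euclidean_space set \<Rightarrow> bool" where
  "smooth_boundary \<Omega> \<longleftrightarrow> (\<forall>p\<in>frontier \<Omega>. \<exists>U \<rho>. open U \<and> p \<in> U \<and> smooth_on U \<rho> \<and>
      (\<forall>x\<in>U. frechet_derivative \<rho> (at x) \<noteq> (\<lambda>v. 0)) \<and>
      \<Omega> \<inter> U = {x\<in>U. \<rho> x < 0})"

definition test_fun :: "'a::euclidean_space set \<Rightarrow> ('a \<Rightarrow> real) \<Rightarrow> bool" where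
  "test_fun \<Omega> \<psi> \<longleftrightarrow> smooth_on UNIV \<psi> \<and>
      (\<exists>K. compact K \<and> K \<subseteq> \<Omega> \<and> (\<forall>x. x \<notin> K \<longrightarrow> \<psi> x = 0))"

definition Cns :: "'a::euclidean_space itself \<Rightarrow> real \<Rightarrow> real" where
  "Cns A \<sigma> = \<sigma> * 4 powr \<sigma> * Gamma (dimR A / 2 + \<sigma>) / (pi powr (dimR A / 2) * Gamma (1 - \<sigma>))"

definition frac_lap :: "real \<Rightarrow> ('a::euclidean_space \<Rightarrow> real) \<Rightarrow> 'a \<Rightarrow> real" where
  "frac_lap \<sigma> f x = Cns TYPE('a) \<sigma> *
     Lim (at_right 0) (\<lambda>\<epsilon>. set_lebesgue_integral lborel {y. \<epsilon> < dist x y}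
        (\<lambda>y. (f x - f y) / norm (x - y) powr (real DIM('a) + 2 * \<sigma>)))"

definition Hsigma0 :: "real \<Rightarrow> 'a::euclidean_space set \<Rightarrow> ('a \<Rightarrow> real) set" where
  "Hsigma0 \<sigma> \<Omega> = {f. f \<in> borel_measurable lborel \<and>
      integrable lborel (\<lambda>x. \<bar>f x\<bar> powr (2 * real DIM('a) / (real DIM('a) - 2 * \<sigma>))) \<and>
      (\<forall>x. x \<notin> \<Omega> \<longrightarrow> f x = 0) \<and>
      integrable (lborel \<Otimes>\<^sub>M lborel)
        (\<lambda>(x, y). (f x - f y)\<^sup>2 / norm (x - y) powr (real DIM('a) + 2 * \<sigma>))}"

text \<open>Bilinear form associated with the fractional Laplacian:
  int (-Delta)^sigma f * g = C/2 int int (f x - f y)(g x - g y)/|x-y|^(n+2 sigma).\<close>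
definition Eform :: "real \<Rightarrow> ('a::euclidean_space \<Rightarrow> real) \<Rightarrow> ('a \<Rightarrow> real) \<Rightarrow> real" where
  "Eform \<sigma> f g = Cns TYPE('a) \<sigma> / 2 *
     integral\<^sup>L (lborel \<Otimes>\<^sub>M lborel)
       (\<lambda>(x, y). (f x - f y) * (g x - g y) / norm (x - y) powr (real DIM('a) + 2 * \<sigma>))"

definition weak_frac_lap_nonneg :: "real \<Rightarrow> 'a::euclidean_space set \<Rightarrow> ('a \<Rightarrow> real) \<Rightarrow> bool" where
  "weak_frac_lap_nonneg \<sigma> \<Omega> f \<longleftrightarrow>
     (\<forall>\<psi>\<in>Hsigma0 \<sigma> \<Omega>. (\<forall>x. 0 \<le> \<psi> x) \<longrightarrow> 0 \<le> Eform \<sigma> f \<psi>)"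

definition weak_sol_elliptic :: "real \<Rightarrow> real \<Rightarrow> 'a::euclidean_space set \<Rightarrow> ('a \<Rightarrow> real) \<Rightarrow> bool" where
  "weak_sol_elliptic \<sigma> m \<Omega> \<phi> \<longleftrightarrow> \<phi> \<in> Hsigma0 \<sigma> \<Omega> \<and>
     (\<forall>\<psi>\<in>Hsigma0 \<sigma> \<Omega>.
        integrable lborel (\<lambda>x. \<phi> x powr (1 / m) * \<psi> x) \<and>
        Eform \<sigma> \<phi> \<psi> = (1 / (1 - m)) * integral\<^sup>L lborel (\<lambda>x. \<phi> x powr (1 / m) * \<psi> x))"

definition weak_sol_fde :: "real \<Rightarrow> real \<Rightarrow> 'a::euclidean_space set \<Rightarrow> ('a \<Rightarrow> real) \<Rightarrow>
    ('a \<Rightarrow> real \<Rightarrow> real) \<Rightarrow> bool" where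
  "weak_sol_fde \<sigma> m \<Omega> u0 u \<longleftrightarrow>
     (\<forall>x t. 0 \<le> u x t) \<and>
     (\<forall>x t. x \<notin> \<Omega> \<longrightarrow> u x t = 0) \<and>
     (AE x in lborel. u x 0 = u0 x) \<and>
     (\<forall>t\<ge>0. (\<lambda>x. u x t) \<in> borel_measurable lborel \<and>
              integrable lborel (\<lambda>x. u x t powr (1 + m))) \<and>
     (\<forall>t0\<ge>0. ((\<lambda>t. integral\<^sup>L lborel (\<lambda>x. \<bar>u x t - u x t0\<bar> powr (1 + m)))
                 \<longlongrightarrow> 0) (at t0 within {0..})) \<and>
     (\<forall>t>0. (\<lambda>x. u x t powr m) \<in> Hsigma0 \<sigma> \<Omega>) \<and>
     (\<forall>T>0. set_integrable lborel {0<..T}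
              (\<lambda>t. Eform \<sigma> (\<lambda>x. u x t powr m) (\<lambda>x. u x t powr m))) \<and>
     (\<forall>\<psi> t1 t2. test_fun \<Omega> \<psi> \<longrightarrow> 0 \<le> t1 \<longrightarrow> t1 \<le> t2 \<longrightarrow>
        set_integrable lborel {t1..t2} (\<lambda>t. Eform \<sigma> (\<lambda>x. u x t powr m) \<psi>) \<and>
        integral\<^sup>L lborel (\<lambda>x. u x t2 * \<psi> x) - integral\<^sup>L lborel (\<lambda>x. u x t1 * \<psi> x)
          = - set_lebesgue_integral lborel {t1..t2} (\<lambda>t. Eform \<sigma> (\<lambda>x. u x t powr m) \<psi>))"

definition extinction_time :: "real \<Rightarrow> ('a::euclidean_space \<Rightarrow> real \<Rightarrow> real) \<Rightarrow> real \<Rightarrow> bool" where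
  "extinction_time m u T \<longleftrightarrow> 0 < T \<and>
     (\<forall>t\<ge>0. (AE x in lborel. u x t = 0) \<longleftrightarrow> T \<le> t) \<and>
     ((\<lambda>t. integral\<^sup>L lborel (\<lambda>x. \<bar>u x t\<bar> powr (1 + m))) \<longlongrightarrow> 0) (at_left T)"

end

theory Submission
  imports Defs "HOL-Complex_Analysis.Great_Picard"
begin

text \<open>Put \<open>w = u\<^sup>m\<close> and let \<open>X(t)\<close> be the weak solution of \<open>(-\<Delta>)\<^sup>\<sigma> X(t) = u(t)\<close>, so that \<open>X' = -w\<close>.
  Comparison with the implicit Euler scheme, whose steps stay supersolutions, shows that \<open>u\<close> is nonincreasing in
  time; hence \<open>w\<close> is sandwiched between difference quotients of \<open>X\<close>. The quotient of the \<open>L\<^sup>1\<^sup>+\<^sup>m\<close> norm of \<open>u\<close>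
  and the energy norm of \<open>X\<close> is nonincreasing and, by the Sobolev inequality, bounded below. Therefore the norm of
  \<open>X(t)\<close> divided by \<open>(T-t)\<^sup>1\<^sup>/\<^sup>(\<^sup>1\<^sup>-\<^sup>m\<^sup>)\<close> has a positive limit, and on the time scale \<open>T - t\<close> the direction of \<open>X\<close> is
  asymptotically constant. Level-set iteration bounds the rescaled \<open>u\<close> and turns \<open>L\<^sup>2\<close>-smallness of differences
  of the rescaled \<open>X\<close> into uniform smallness, so that compactness in \<open>L\<^sup>2\<close> suffices and no Hoelder estimate is
  needed. Difference quotients over time steps \<open>\<delta> (T-t)\<close> with \<open>\<delta> \<rightarrow> 0\<close> then give uniform convergence of the
  rescaled \<open>w\<close>. The limit solves the elliptic equation, does not vanish because its norm is the limit above,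
  and is positive by a strong minimum principle.\<close>

section \<open>Integral inequalities\<close>

text \<open>No time derivative of \<open>u\<close> is available, so differential identities are
  replaced by monotonicity: once \<open>u\<close> decreases in time, every rate is trapped between
  its values at the ends of a time interval. The quotient \<open>A\<close> of the norms
  \<open>nU\<close> and \<open>N\<close> is best seen in the clock \<open>Im\<close>, the time
  integral of \<open>nU powr m\<close>. There \<open>N\<close> has slope \<open>- A\<close>, while
  Hoelder and Cauchy--Schwarz place each tangent of \<open>N\<close> below its graph on the right;
  this is convexity, hence monotonicity of \<open>A\<close>. Moreover
  \<open>N' = - A powr (1 + m) * N powr m\<close>, so convergence of \<open>A\<close> fixes the
  extinction rate \<open>1 / (1 - m)\<close>, and the angle between two directions of
  \<open>X\<close> is controlled by \<open>A t1 / A t2 - 1\<close>. The lower bound on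
  \<open>m\<close> says that \<open>p + 1\<close>, with \<open>p = 1 / m\<close>, lies strictly
  below the critical exponent \<open>qs\<close>; this gap drives the iteration for the nonlinear
  problem. Functions are handled pointwise and not as classes, so representatives have to be
  corrected on null sets, in particular for the final positivity.\<close>

lemma integrable_mult_of_squares:
  fixes F G :: "'b => real"
  assumes [measurable]: "F \<in> borel_measurable M" "G \<in> borel_measurable M"
    and "integrable M (\<lambda>x. (F x)\<^sup>2)" "integrable M (\<lambda>x. (G x)\<^sup>2)"
  shows "integrable M (\<lambda>x. F x * G x)"
proof (rule Bochner_Integration.integrable_bound[of M "\<lambda>x. (F x)\<^sup>2 + (G x)\<^sup>2"])
  have "\<bar>a * b\<bar> \<le> a\<^sup>2 + b\<^sup>2" for a b :: real
    using sum_squares_bound[of "\<bar>a\<bar>" "\<bar>b\<bar>"] mult_nonneg_nonneg[OF abs_ge_zero[of a] abs_ge_zero[of b]]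
    unfolding abs_mult power2_abs by linarith
  then show "AE x in M. norm (F x * G x) \<le> norm ((F x)\<^sup>2 + (G x)\<^sup>2)"
    by (simp add: abs_mult)
qed (use assms in auto)

lemma Cauchy_Schwarz_integral:
  fixes F G :: "'b => real"
  assumes [measurable]: "F \<in> borel_measurable M" "G \<in> borel_measurable M"
    and F: "integrable M (\<lambda>x. (F x)\<^sup>2)" and G: "integrable M (\<lambda>x. (G x)\<^sup>2)"
  shows "(\<integral>x. F x * G x \<partial>M)\<^sup>2 \<le> (\<integral>x. (F x)\<^sup>2 \<partial>M) * (\<integral>x. (G x)\<^sup>2 \<partial>M)"
proof -
  define A B C where "A = (\<integral>x. (F x)\<^sup>2 \<partial>M)" and "B = (\<integral>x. F x * G x \<partial>M)" and "C = (\<integral>x. (G x)\<^sup>2 \<partial>M)"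
  have FG: "integrable M (\<lambda>x. F x * G x)" by (rule integrable_mult_of_squares) (use assms in auto)
  have C0: "C \<ge> 0" unfolding C_def by simp
  show ?thesis
  proof (cases "C = 0")
    case True
    then have "AE x in M. (G x)\<^sup>2 = 0"
      unfolding C_def using integral_nonneg_eq_0_iff_AE[OF G] by simp
    then have "AE x in M. F x * G x = 0" by eventually_elim simp
    then have "B = 0" unfolding B_def by (subst integral_cong_AE[where g="\<lambda>_. 0"]) auto
    then show ?thesis by (simp add: B_def[symmetric])
  next
    case False
    \<comment> \<open>The minimiser of the quadratic polynomial in \<open>t\<close> expanded below;
      nonnegativity of its value there is the claim.\<close>
    define t where "t = - B / C"
    have "0 \<le> (\<integral>x. (F x + t * G x)\<^sup>2 \<partial>M)" by simp
    also have "\<dots> = (\<integral>x. (F x)\<^sup>2 + (2 * t) * (F x * G x) + t\<^sup>2 * (G x)\<^sup>2 \<partial>M)"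
      by (rule Bochner_Integration.integral_cong) (auto simp: power2_eq_square algebra_simps)
    also have "\<dots> = A + 2 * t * B + t\<^sup>2 * C"
      unfolding A_def B_def C_def using F G FG by simp
    also have "\<dots> = A - B\<^sup>2 / C" using False by (simp add: t_def power2_eq_square field_simps)
    finally have "B\<^sup>2 / C \<le> A" by simp
    then have "B\<^sup>2 \<le> A * C" using False C0 by (simp add: field_simps)
    then show ?thesis by (simp add: A_def B_def C_def)
  qed
qed

lemma abs_add_powr_le:
  fixes a b s :: real assumes "0 \<le> s"
  shows "\<bar>a + b\<bar> powr s \<le> 2 powr s * (\<bar>a\<bar> powr s + \<bar>b\<bar> powr s)"
proof -
  have "\<bar>a + b\<bar> powr s \<le> (2 * max \<bar>a\<bar> \<bar>b\<bar>) powr s"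
    by (rule powr_mono2) (use assms in auto)
  also have "\<dots> = 2 powr s * (max \<bar>a\<bar> \<bar>b\<bar>) powr s" by (simp add: powr_mult)
  also have "\<dots> \<le> 2 powr s * (\<bar>a\<bar> powr s + \<bar>b\<bar> powr s)"
    by (rule mult_left_mono) (auto simp: max_def)
  finally show ?thesis .
qed

text \<open>Homogeneity reduces subadditivity of the concave power to
  \<open>s \<le> s powr m\<close> on [0,1]. The estimate turns continuity of \<open>u\<close> in
  time with exponent \<open>1 + m\<close> into continuity of its power \<open>w\<close> with
  exponent \<open>p + 1\<close>.\<close>

lemma powr_diff_le:
  fixes a b m :: real assumes m: "0 < m" "m < 1" and "0 \<le> a" "0 \<le> b"
  shows "\<bar>a powr m - b powr m\<bar> \<le> \<bar>a - b\<bar> powr m"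
proof -
  have sub: "(x + y) powr m \<le> x powr m + y powr m" if "0 \<le> x" "0 \<le> y" for x y :: real
  proof (cases "x + y = 0")
    case False
    then have pos: "x + y > 0" using that by simp
    have *: "s \<le> s powr m" if "0 \<le> s" "s \<le> 1" for s :: real
      using powr_mono'[of m 1 s] that m by (cases "s = 0") auto
    have "1 = x / (x + y) + y / (x + y)" using pos by (simp flip: add_divide_distrib)
    also have "\<dots> \<le> (x / (x + y)) powr m + (y / (x + y)) powr m"
      using pos that by (intro add_mono *) auto
    also have "\<dots> = (x powr m + y powr m) / (x + y) powr m"
      using pos that by (simp add: powr_divide add_divide_distrib)
    finally show ?thesis using pos by (simp add: field_simps)
  qed auto
  show ?thesis
  proof (cases "a \<le> b")
    case True
    then show ?thesis using sub[of a "b - a"] assms powr_mono2[of m a b] by simp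
  next
    case False
    then show ?thesis using sub[of b "a - b"] assms powr_mono2[of m b a] by simp
  qed
qed

section \<open>Lebesgue norms with real exponents: Hoelder and Minkowski\<close>

definition Lp :: "real => ('a::euclidean_space => real) => bool" where
  "Lp s f \<longleftrightarrow> f \<in> borel_measurable lborel \<and> integrable lborel (\<lambda>x. \<bar>f x\<bar> powr s)"

text \<open>The integral of a non-integrable function has the value 0, so a bound on
  \<open>Lnorm\<close> carries information only together with \<open>Lp\<close>.\<close>

definition Lnorm :: "real => ('a::euclidean_space => real) => real" where
  "Lnorm s f = (LBINT x. \<bar>f x\<bar> powr s) powr (1 / s)"

lemma Lp_measurable [measurable_dest]: "Lp s f ==> f \<in> borel_measurable lborel"
  by (simp add: Lp_def)

lemma Lnorm_nonneg [simp]: "0 \<le> Lnorm s f"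
  by (simp add: Lnorm_def)

lemma Lnorm_powr: "0 < s ==> Lnorm s f powr s = (LBINT x. \<bar>f x\<bar> powr s)"
  by (simp add: Lnorm_def powr_powr)

lemma Lp_bound:
  assumes g: "Lp s g" and [measurable]: "f \<in> borel_measurable lborel" and "0 \<le> s"
    and le: "AE x in lborel. \<bar>f x\<bar> \<le> \<bar>g x\<bar>"
  shows "Lp s f" "Lnorm s f \<le> Lnorm s g"
proof -
  note [measurable] = Lp_measurable[OF g]
  have AE: "AE x in lborel. \<bar>f x\<bar> powr s \<le> \<bar>g x\<bar> powr s"
    using le by eventually_elim (use \<open>0 \<le> s\<close> in \<open>auto intro: powr_mono2\<close>)
  have i: "integrable lborel (\<lambda>x. \<bar>f x\<bar> powr s)"
    by (rule Bochner_Integration.integrable_bound[of _ "\<lambda>x. \<bar>g x\<bar> powr s"])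
       (use g AE in \<open>auto simp: Lp_def\<close>)
  then show "Lp s f" by (simp add: Lp_def)
  have "(LBINT x. \<bar>f x\<bar> powr s) \<le> (LBINT x. \<bar>g x\<bar> powr s)"
    using i g AE by (intro integral_mono_AE) (auto simp: Lp_def)
  then show "Lnorm s f \<le> Lnorm s g"
    unfolding Lnorm_def using \<open>0 \<le> s\<close> by (intro powr_mono2) auto
qed

lemma Lp_add:
  assumes f: "Lp s f" and g: "Lp s g" and "0 \<le> s"
  shows "Lp s (\<lambda>x. f x + g x)"
proof -
  note [measurable] = Lp_measurable[OF f] Lp_measurable[OF g]
  have "integrable lborel (\<lambda>x. \<bar>f x + g x\<bar> powr s)"
    by (rule Bochner_Integration.integrable_bound
          [of _ "\<lambda>x. 2 powr s * (\<bar>f x\<bar> powr s + \<bar>g x\<bar> powr s)"])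
       (use f g abs_add_powr_le[OF \<open>0 \<le> s\<close>] in \<open>auto simp: Lp_def\<close>)
  then show ?thesis by (simp add: Lp_def)
qed

lemma Lp_cmult:
  assumes f: "Lp s f" shows "Lp s (\<lambda>x. c * f x)"
  using f by (auto simp: Lp_def abs_mult powr_mult)

lemma Lp_diff:
  assumes f: "Lp s f" and g: "Lp s g" and "0 \<le> s"
  shows "Lp s (\<lambda>x. f x - g x)"
  using Lp_add[OF f Lp_cmult[OF g, of "-1"] \<open>0 \<le> s\<close>] by simp

lemma Lnorm_cmult: "0 < s ==> Lnorm s (\<lambda>x. c * f x) = \<bar>c\<bar> * Lnorm s f"
  by (simp add: Lnorm_def abs_mult powr_mult powr_powr)

lemma Lnorm_eq_0_AE:
  assumes "Lp s f" "0 < s" "Lnorm s f = 0" shows "AE x in lborel. f x = 0"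
proof -
  have "(LBINT x. \<bar>f x\<bar> powr s) = 0" using assms by (simp add: Lnorm_def)
  then have "AE x in lborel. \<bar>f x\<bar> powr s = 0"
    using integral_nonneg_eq_0_iff_AE[of lborel "\<lambda>x. \<bar>f x\<bar> powr s"] assms by (simp add: Lp_def)
  then show ?thesis by simp
qed

lemma Holder_integral:
  assumes s: "1 < s" "1 < t" "1 / s + 1 / t = 1" and f: "Lp s f" and g: "Lp t g"
  shows "integrable lborel (\<lambda>x. f x * g x)"
    and "(LBINT x. \<bar>f x * g x\<bar>) \<le> Lnorm s f * Lnorm t g"
    and "\<bar>\<integral>x. f x * g x \<partial>lborel\<bar> \<le> Lnorm s f * Lnorm t g"
proof -
  note [measurable] = Lp_measurable[OF f] Lp_measurable[OF g]
  have i: "integrable lborel (\<lambda>x. \<bar>f x\<bar> powr s)" "integrable lborel (\<lambda>x. \<bar>g x\<bar> powr t)"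
    using f g by (auto simp: Lp_def)
  show int: "integrable lborel (\<lambda>x. f x * g x)"
  proof (rule Bochner_Integration.integrable_bound
      [of _ "\<lambda>x. \<bar>f x\<bar> powr s / s + \<bar>g x\<bar> powr t / t"])
    have "\<bar>f x * g x\<bar> \<le> \<bar>f x\<bar> powr s / s + \<bar>g x\<bar> powr t / t" for x
      using Youngs_inequality[OF s, of "\<bar>f x\<bar>" "\<bar>g x\<bar>"] by (simp add: abs_mult)
    then show "AE x in lborel. norm (f x * g x) \<le> norm (\<bar>f x\<bar> powr s / s + \<bar>g x\<bar> powr t / t)"
      by (intro AE_I2) (metis abs_ge_self order_trans real_norm_def)
  qed (use i in auto)
  show main: "(LBINT x. \<bar>f x * g x\<bar>) \<le> Lnorm s f * Lnorm t g"
  proof (cases "Lnorm s f = 0 \<or> Lnorm t g = 0")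
    case True
    then have "AE x in lborel. \<bar>f x * g x\<bar> = 0"
    proof
      assume "Lnorm s f = 0"
      then have "AE x in lborel. f x = 0" using f s by (intro Lnorm_eq_0_AE) auto
      then show ?thesis by eventually_elim simp
    next
      assume "Lnorm t g = 0"
      then have "AE x in lborel. g x = 0" using g s by (intro Lnorm_eq_0_AE) auto
      then show ?thesis by eventually_elim simp
    qed
    then have "(LBINT x. \<bar>f x * g x\<bar>) = 0" by (rule integral_eq_zero_AE)
    then show ?thesis by simp
  next
    case False
    define a b where "a = Lnorm s f" and "b = Lnorm t g"
    have ab: "a > 0" "b > 0" using False Lnorm_nonneg[of s f] Lnorm_nonneg[of t g]
      unfolding a_def b_def by linarith+
    have A: "(LBINT x. \<bar>f x\<bar> powr s) = a powr s" "(LBINT x. \<bar>g x\<bar> powr t) = b powr t"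
      unfolding a_def b_def using s by (auto simp: Lnorm_powr)
    have "(LBINT x. \<bar>f x * g x\<bar>) / (a * b) = (LBINT x. \<bar>f x * g x\<bar> / (a * b))" by simp
    also have "\<dots> \<le> (LBINT x. \<bar>f x\<bar> powr s / (s * a powr s) + \<bar>g x\<bar> powr t / (t * b powr t))"
    proof (rule integral_mono)
      show "integrable lborel (\<lambda>x. \<bar>f x * g x\<bar> / (a * b))" using int by auto
      show "integrable lborel (\<lambda>x. \<bar>f x\<bar> powr s / (s * a powr s) + \<bar>g x\<bar> powr t / (t * b powr t))"
        using i by auto
      show "\<bar>f x * g x\<bar> / (a * b) \<le> \<bar>f x\<bar> powr s / (s * a powr s) + \<bar>g x\<bar> powr t / (t * b powr t)" for x
        using Youngs_inequality[OF s, of "\<bar>f x\<bar> / a" "\<bar>g x\<bar> / b"] ab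
        by (simp add: powr_divide abs_mult mult_ac)
    qed
    also have "\<dots> = 1 / s + 1 / t"
      using i ab A by simp
    finally have "(LBINT x. \<bar>f x * g x\<bar>) / (a * b) \<le> 1" using s by simp
    then show ?thesis using ab by (simp add: a_def b_def field_simps)
  qed
  have "\<bar>\<integral>x. f x * g x \<partial>lborel\<bar> \<le> (LBINT x. \<bar>f x * g x\<bar>)" by (rule integral_abs_bound)
  with main show "\<bar>\<integral>x. f x * g x \<partial>lborel\<bar> \<le> Lnorm s f * Lnorm t g" by linarith
qed

lemma Minkowski_integral:
  assumes s: "1 < s" and f: "Lp s f" and g: "Lp s g"
  shows "Lnorm s (\<lambda>x. f x + g x) \<le> Lnorm s f + Lnorm s g"
proof (cases "Lnorm s (\<lambda>x. f x + g x) = 0")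
  case True then show ?thesis by simp
next
  case False
  \<comment> \<open>The extremal function of the duality: its power with exponent \<open>t\<close>
    is again the integrand of the norm, so both Hoelder bounds carry the factor
    \<open>N powr (s - 1)\<close>, which is cancelled at the end because
    \<open>N > 0\<close>.\<close>
  define h where "h x = \<bar>f x + g x\<bar> powr (s - 1)" for x
  define t where "t = s / (s - 1)"
  have t: "1 < t" "1 / s + 1 / t = 1" using s by (auto simp: t_def field_simps)
  have fg: "Lp s (\<lambda>x. f x + g x)" using Lp_add[OF f g] s by simp
  note [measurable] = Lp_measurable[OF f] Lp_measurable[OF g]
  have hp: "\<bar>h x\<bar> powr t = \<bar>f x + g x\<bar> powr s" for x
    using s by (simp add: h_def powr_powr t_def)
  have [measurable]: "h \<in> borel_measurable borel" unfolding h_def by measurable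
  have h: "Lp t h" using fg unfolding Lp_def hp by simp
  define N where "N = Lnorm s (\<lambda>x. f x + g x)"
  have N: "N > 0" using False Lnorm_nonneg[of s "\<lambda>x. f x + g x"] unfolding N_def by linarith
  have Np: "N powr s = (LBINT x. \<bar>f x + g x\<bar> powr s)" using s by (simp add: N_def Lnorm_powr)
  have hN: "Lnorm t h = N powr (s - 1)"
    unfolding Lnorm_def hp Np[symmetric] powr_powr using s by (simp add: t_def)
  have "N powr s = (LBINT x. \<bar>(f x + g x) * h x\<bar>)"
    unfolding Np h_def using s
    by (intro Bochner_Integration.integral_cong) (auto simp: abs_mult powr_mult_base)
  also have "\<dots> \<le> (LBINT x. \<bar>f x * h x\<bar> + \<bar>g x * h x\<bar>)"
    using Holder_integral(1)[OF s t f h] Holder_integral(1)[OF s t g h] Holder_integral(1)[OF s t fg h]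
    by (intro integral_mono) (auto simp: distrib_right)
  also have "\<dots> = (LBINT x. \<bar>f x * h x\<bar>) + (LBINT x. \<bar>g x * h x\<bar>)"
    using Holder_integral(1)[OF s t f h] Holder_integral(1)[OF s t g h] by simp
  also have "\<dots> \<le> Lnorm s f * N powr (s - 1) + Lnorm s g * N powr (s - 1)"
    using Holder_integral(2)[OF s t f h] Holder_integral(2)[OF s t g h] by (simp add: hN)
  finally have "N * N powr (s - 1) \<le> (Lnorm s f + Lnorm s g) * N powr (s - 1)"
    using N by (simp add: powr_mult_base distrib_right)
  then show ?thesis using N by (simp add: N_def)
qed

lemma Lnorm_minus_commute: "Lnorm s (\<lambda>x. f x - g x) = Lnorm s (\<lambda>x. g x - f x)"
  by (simp add: Lnorm_def abs_minus_commute)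

lemma Lnorm_diff_triangle:
  assumes "1 < s" "Lp s f" "Lp s g" "Lp s h"
  shows "Lnorm s (\<lambda>x. f x - h x) \<le> Lnorm s (\<lambda>x. f x - g x) + Lnorm s (\<lambda>x. g x - h x)"
  using Minkowski_integral[of s "\<lambda>x. f x - g x" "\<lambda>x. g x - h x"] assms by (simp add: Lp_diff)

lemma Lnorm_abs_diff_le:
  assumes s: "1 < s" and f: "Lp s f" and g: "Lp s g"
  shows "\<bar>Lnorm s f - Lnorm s g\<bar> \<le> Lnorm s (\<lambda>x. f x - g x)"
  using Minkowski_integral[of s "\<lambda>x. f x - g x" g] Minkowski_integral[of s "\<lambda>x. g x - f x" f] assms
  by (simp add: Lp_diff Lnorm_minus_commute[of s f g])

lemma Lp_indicator:
  assumes "A \<in> sets lborel" "emeasure lborel A < \<infinity>"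
  shows "Lp t (indicator A)"
proof -
  have "(\<lambda>x. \<bar>indicator A x :: real\<bar> powr t) = indicator A" by (auto simp: indicator_def fun_eq_iff)
  then show ?thesis using assms by (simp add: Lp_def)
qed

text \<open>Hoelder against the indicator of \<open>A\<close>. Besides lowering exponents on
  \<Omega>, the explicit factor \<open>measure lborel A\<close> is what lets the level-set iteration
  profit from small superlevel sets.\<close>

lemma Lnorm_lower_exponent:
  assumes st: "0 < s" "s < t" and f: "Lp t f"
    and A: "A \<in> sets lborel" "emeasure lborel A < \<infinity>" and f0: "\<And>x. x \<notin> A ==> f x = 0"
  shows "Lp s f"
    and "(LBINT x. \<bar>f x\<bar> powr s) \<le> (LBINT x. \<bar>f x\<bar> powr t) powr (s / t) * measure lborel A powr (1 - s / t)"
proof -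
  define a b where "a = t / s" and "b = t / (t - s)"
  have ab: "1 < a" "1 < b" "1 / a + 1 / b = 1" using st by (auto simp: a_def b_def field_simps)
  note [measurable] = Lp_measurable[OF f]
  define F where "F x = \<bar>f x\<bar> powr s" for x
  have Fp: "\<bar>F x\<bar> powr a = \<bar>f x\<bar> powr t" for x using st by (simp add: F_def powr_powr a_def)
  have [measurable]: "F \<in> borel_measurable borel" unfolding F_def by measurable
  have F: "Lp a F" using f unfolding Lp_def Fp by simp
  have eq: "F x * indicator A x = F x" for x using f0[of x] st by (auto simp: F_def indicator_def)
  note H = Holder_integral[OF ab F Lp_indicator[OF A], unfolded eq]
  show "Lp s f" using H(1) by (simp add: Lp_def F_def)
  have "Lnorm a F = (LBINT x. \<bar>f x\<bar> powr t) powr (s / t)" unfolding Lnorm_def Fp by (simp add: a_def)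
  moreover have "Lnorm b (indicator A) = measure lborel A powr (1 - s / t)"
  proof -
    have "(\<lambda>x. \<bar>indicator A x :: real\<bar> powr b) = indicator A" by (auto simp: indicator_def fun_eq_iff)
    then show ?thesis using A st by (simp add: Lnorm_def b_def field_simps)
  qed
  ultimately show "(LBINT x. \<bar>f x\<bar> powr s) \<le> (LBINT x. \<bar>f x\<bar> powr t) powr (s / t) * measure lborel A powr (1 - s / t)"
    using H(3) by (simp add: F_def)
qed

section \<open>De Giorgi's sequence lemma\<close>

text \<open>The geometric ansatz with ratio \<open>b powr (- 1 / e)\<close> reproduces itself: the
  exponent \<open>1 + e\<close> gains a factor \<open>b powr (- j)\<close>, which cancels the growth
  \<open>b ^ j\<close>, and the constant left over is the one in \<open>small\<close>.\<close>

lemma De_Giorgi_sequence: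
  fixes Y :: "nat => real"
  assumes Y0: "\<And>j. 0 \<le> Y j" and A: "0 < A" and b: "1 < b" and e: "0 < e"
    and step: "\<And>j. Y (Suc j) \<le> A * b ^ j * Y j powr (1 + e)"
    and small: "A * Y 0 powr e * b powr (1 / e) \<le> 1"
  shows "Y \<longlonglongrightarrow> 0"
proof -
  have bd: "Y j \<le> Y 0 * b powr (- (real j / e))" for j
  proof (induction j)
    case 0 then show ?case using b by simp
  next
    case (Suc j)
    have "Y (Suc j) \<le> A * b ^ j * Y j powr (1 + e)" by (rule step)
    also have "\<dots> \<le> A * b ^ j * (Y 0 * b powr (- (real j / e))) powr (1 + e)"
      using Suc A b e Y0 by (intro mult_left_mono powr_mono2) auto
    also have "\<dots> = A * b powr j * (Y 0 powr (1 + e) * b powr (- (real j / e) * (1 + e)))"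
      using b Y0 by (simp add: powr_mult powr_powr powr_realpow)
    also have "\<dots> = A * Y 0 powr (1 + e) * b powr (real j + - (real j / e) * (1 + e))"
      by (simp add: powr_diff powr_minus_divide)
    also have "real j + - (real j / e) * (1 + e) = - (real (Suc j) / e) + 1 / e"
      using e by (simp add: field_simps)
    also have "A * Y 0 powr (1 + e) * b powr (- (real (Suc j) / e) + 1 / e)
        = (A * Y 0 powr e * b powr (1 / e)) * (Y 0 * b powr (- (real (Suc j) / e)))"
      using Y0[of 0] by (simp only: powr_add powr_one mult_ac)
    also have "\<dots> \<le> 1 * (Y 0 * b powr (- (real (Suc j) / e)))"
      using small Y0[of 0] by (intro mult_right_mono) auto
    finally show ?case by simp
  qed
  have "(\<lambda>j. Y 0 * b powr (- (real j / e))) = (\<lambda>j. Y 0 * (b powr (- 1 / e)) ^ j)"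
    using b by (auto simp: fun_eq_iff powr_powr simp flip: powr_realpow)
  moreover have "b powr (- 1 / e) < 1" using b e by (simp add: powr_less_one)
  then have "(\<lambda>j. Y 0 * (b powr (- 1 / e)) ^ j) \<longlonglongrightarrow> Y 0 * 0"
    by (intro tendsto_mult tendsto_const LIMSEQ_power_zero) auto
  ultimately have "(\<lambda>j. Y 0 * b powr (- (real j / e))) \<longlonglongrightarrow> 0" by simp
  then show ?thesis
    by (rule real_tendsto_sandwich[OF _ _ tendsto_const, rotated 2])
       (auto intro: always_eventually Y0 bd)
qed

section \<open>Invariance and the singular kernel\<close>

lemma nn_integral_lborel_shift:
  fixes c :: "'a::euclidean_space"
  assumes [measurable]: "F \<in> borel_measurable borel"
  shows "(\<integral>\<^sup>+x. F (x + c) \<partial>lborel) = (\<integral>\<^sup>+x. F x \<partial>lborel)"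
  by (subst (2) lborel_distr_plus[of c, symmetric]) (simp add: nn_integral_distr add.commute)

lemma nn_integral_lborel_reflect:
  fixes c :: "'a::euclidean_space"
  assumes [measurable]: "F \<in> borel_measurable borel"
  shows "(\<integral>\<^sup>+x. F (c - x) \<partial>lborel) = (\<integral>\<^sup>+x. F x \<partial>lborel)"
  by (subst (2) lborel_affine[of "-1" c]) (simp_all add: nn_integral_density nn_integral_distr)

lemma emeasure_ball_eq:
  fixes c :: "'a::euclidean_space" assumes "0 \<le> r"
  shows "emeasure lborel (ball c r) = ennreal (r ^ DIM('a) * measure lborel (ball (0::'a) 1))"
  using emeasure_lborel_ball_finite[of c r] content_ball_conv_unit_ball[OF assms, of c]
  by (subst emeasure_eq_ennreal_measure) auto

text \<open>Only volumes of balls enter, so radial singularities are integrated without polar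
  coordinates; it is enough that each point is covered by a single term of the series.\<close>

lemma nn_integral_ball_cover:
  fixes h :: "'a::euclidean_space => real"
  assumes [measurable]: "h \<in> borel_measurable borel"
    and cov: "\<And>z. \<exists>j. h z \<le> a j * indicator (ball 0 (R j)) z"
    and a: "\<And>j. 0 \<le> a j" and R: "\<And>j. 0 \<le> R j"
    and sm: "summable (\<lambda>j. a j * R j ^ DIM('a))"
  shows "(\<integral>\<^sup>+z. ennreal (h z) \<partial>lborel) < \<infinity>"
proof -
  have "(\<integral>\<^sup>+z. ennreal (h z) \<partial>lborel) \<le> (\<integral>\<^sup>+z. (\<Sum>j. ennreal (a j * indicator (ball (0::'a) (R j)) z)) \<partial>lborel)"
  proof (intro nn_integral_mono)
    fix z :: 'a
    obtain j where j: "h z \<le> a j * indicator (ball 0 (R j)) z" using cov by blast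
    have "ennreal (h z) \<le> ennreal (a j * indicator (ball 0 (R j)) z)" using j by (rule ennreal_leI)
    also have "\<dots> = (\<Sum>i\<in>{j}. ennreal (a i * indicator (ball 0 (R i)) z))" by simp
    also have "\<dots> \<le> (\<Sum>i. ennreal (a i * indicator (ball 0 (R i)) z))"
      by (rule sum_le_suminf) auto
    finally show "ennreal (h z) \<le> (\<Sum>i. ennreal (a i * indicator (ball 0 (R i)) z))" .
  qed
  also have "\<dots> = (\<Sum>j. \<integral>\<^sup>+z. ennreal (a j * indicator (ball (0::'a) (R j)) z) \<partial>lborel)"
    by (rule nn_integral_suminf)
       (auto intro!: measurable_compose[OF _ measurable_ennreal] borel_measurable_times borel_measurable_indicator)
  also have "\<dots> = (\<Sum>j. ennreal ((a j * R j ^ DIM('a)) * measure lborel (ball (0::'a) 1)))"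
  proof (rule suminf_cong)
    fix j
    have "(\<integral>\<^sup>+z. ennreal (a j * indicator (ball (0::'a) (R j)) z) \<partial>lborel)
        = (\<integral>\<^sup>+z. ennreal (a j) * indicator (ball (0::'a) (R j)) z \<partial>lborel)"
      using a by (intro nn_integral_cong) (auto simp: indicator_def)
    also have "\<dots> = ennreal (a j) * emeasure lborel (ball (0::'a) (R j))"
      by (simp add: nn_integral_cmult_indicator)
    finally show "(\<integral>\<^sup>+z. ennreal (a j * indicator (ball (0::'a) (R j)) z) \<partial>lborel) =
       ennreal ((a j * R j ^ DIM('a)) * measure lborel (ball (0::'a) 1))"
      using a[of j] R[of j] by (simp add: emeasure_ball_eq ennreal_mult mult_ac)
  qed
  also have "\<dots> < \<infinity>"
  proof -
    have "summable (\<lambda>j. (a j * R j ^ DIM('a)) * measure lborel (ball (0::'a) 1))"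
      using sm by (rule summable_mult2)
    then show ?thesis using a R
      by (subst suminf_ennreal2) auto
  qed
  finally show ?thesis .
qed

lemma dyadic_ge_1:
  fixes r :: real assumes "1 \<le> r"
  obtains j :: nat where "2 ^ j \<le> r" "r < 2 ^ Suc j"
proof -
  define j where "j = nat \<lfloor>log 2 r\<rfloor>"
  have l: "0 \<le> log 2 r" using assms by simp
  have "real j \<le> log 2 r" "log 2 r < real j + 1" unfolding j_def using l by linarith+
  then have "2 powr real j \<le> r" "r < 2 powr (real j + 1)"
    using assms by (simp_all add: le_log_iff log_less_iff)
  moreover have "2 powr (real j + 1) = 2 ^ Suc j"
    using powr_realpow[of 2 "Suc j"] by (simp add: add.commute)
  ultimately show ?thesis using that[of j] by (simp add: powr_realpow)
qed

lemma singular_kernel_finite: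
  assumes s: "0 < \<sigma>" "\<sigma> < 1"
  shows "(\<integral>\<^sup>+z. ennreal (min 1 ((norm z)\<^sup>2) / norm z powr (real DIM('a) + 2 * \<sigma>)) \<partial>(lborel :: 'a::euclidean_space measure)) < \<infinity>"
proof -
  define n where "n = real DIM('a)"
  have n: "n \<ge> 1" unfolding n_def using DIM_positive[where 'a='a] by linarith
  \<comment> \<open>\<open>e \<le> 2 - 2 * \<sigma>\<close> lets the kernel inside the unit ball be
    dominated by \<open>norm z powr (e - n)\<close>, and \<open>e \<le> 1 / 2\<close> keeps this
    exponent negative even in dimension one.\<close>
  define e where "e = min (2 - 2 * \<sigma>) (1 / 2)"
  have e: "0 < e" "e \<le> 1 / 2" "e \<le> 2 - 2 * \<sigma>" using s unfolding e_def by linarith+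
  define h1 :: "'a => real" where "h1 z = indicator {z. 1 \<le> norm z} z / norm z powr (n + 2 * \<sigma>)" for z
  define h2 :: "'a => real" where "h2 z = indicator {z. norm z < 1} z * ((norm z)\<^sup>2 / norm z powr (n + 2 * \<sigma>))" for z
  have m[measurable]: "h1 \<in> borel_measurable borel" "h2 \<in> borel_measurable borel"
    unfolding h1_def h2_def by measurable
  have "(\<integral>\<^sup>+z. ennreal (h1 z) \<partial>lborel) < \<infinity>"
  proof (rule nn_integral_ball_cover[where a="\<lambda>j. 2 powr (- (real j * (n + 2 * \<sigma>)))" and R="\<lambda>j. 2 ^ Suc j"])
    fix z :: 'a
    show "\<exists>j. h1 z \<le> 2 powr (- (real j * (n + 2 * \<sigma>))) * indicator (ball 0 (2 ^ Suc j)) z"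
    proof (cases "1 \<le> norm z")
      case True
      then obtain j where j: "2 ^ j \<le> norm z" "norm z < 2 ^ Suc j" by (rule dyadic_ge_1)
      have "(2 ^ j) powr (n + 2 * \<sigma>) \<le> norm z powr (n + 2 * \<sigma>)"
        using j n s by (intro powr_mono2) auto
      then have "2 powr (real j * (n + 2 * \<sigma>)) \<le> norm z powr (n + 2 * \<sigma>)"
        by (simp add: powr_powr flip: powr_realpow)
      then have "1 / norm z powr (n + 2 * \<sigma>) \<le> 1 / 2 powr (real j * (n + 2 * \<sigma>))"
        by (intro divide_left_mono mult_pos_pos) (use True in auto)
      then have "1 / norm z powr (n + 2 * \<sigma>) \<le> 2 powr (- (real j * (n + 2 * \<sigma>)))"
        by (simp add: powr_minus divide_inverse)
      then show ?thesis using True j by (intro exI[of _ j]) (simp add: h1_def)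
    qed (auto simp: h1_def)
  next
    have "(\<lambda>j. 2 powr (- (real j * (n + 2 * \<sigma>))) * (2 ^ Suc j) ^ DIM('a)) = (\<lambda>j. 2 powr n * (2 powr (- 2 * \<sigma>)) ^ j)"
    proof
      fix j
      have "(2 ^ Suc j :: real) ^ DIM('a) = 2 powr (n * (real j + 1))"
        using powr_realpow[of 2 "Suc j * DIM('a)"]
        unfolding n_def power_mult[symmetric] by (simp add: algebra_simps)
      then have "2 powr (- (real j * (n + 2 * \<sigma>))) * (2 ^ Suc j) ^ DIM('a) = 2 powr (- (real j * (n + 2 * \<sigma>)) + n * (real j + 1))"
        by (simp only: powr_add)
      also have "- (real j * (n + 2 * \<sigma>)) + n * (real j + 1) = n + (- 2 * \<sigma>) * real j" by (simp add: algebra_simps)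
      also have "2 powr (n + (- 2 * \<sigma>) * real j) = 2 powr n * (2 powr (- 2 * \<sigma>)) ^ j"
        unfolding powr_add by (simp add: powr_powr flip: powr_realpow)
      finally show "2 powr (- (real j * (n + 2 * \<sigma>))) * (2 ^ Suc j) ^ DIM('a) = 2 powr n * (2 powr (- 2 * \<sigma>)) ^ j" .
    qed
    moreover have "2 powr (- 2 * \<sigma>) < (1::real)" using s by (simp add: powr_less_one)
    ultimately show "summable (\<lambda>j. 2 powr (- (real j * (n + 2 * \<sigma>))) * (2 ^ Suc j) ^ DIM('a))"
      by (simp add: summable_mult summable_geometric)
  qed auto
  moreover have "(\<integral>\<^sup>+z. ennreal (h2 z) \<partial>lborel) < \<infinity>"
  proof (rule nn_integral_ball_cover[where a="\<lambda>j. 2 powr ((real j + 1) * (n - e))" and R="\<lambda>j. 2 powr (- real j)"])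
    fix z :: 'a
    show "\<exists>j. h2 z \<le> 2 powr ((real j + 1) * (n - e)) * indicator (ball 0 (2 powr (- real j))) z"
    proof (cases "0 < norm z \<and> norm z < 1")
      case True
      define r where "r = norm z"
      have r: "0 < r" "r < 1" using True by (auto simp: r_def)
      \<comment> \<open>Ceiling minus one rather than the floor: the point must lie strictly inside
        the open ball of radius \<open>2 powr (- real j)\<close>, also when \<open>r\<close> is a
        power of two.\<close>
      define j where "j = nat (\<lceil>- log 2 r\<rceil> - 1)"
      have l: "0 < - log 2 r" using r by simp
      have "real j < - log 2 r" "- log 2 r \<le> real j + 1" unfolding j_def using l by linarith+
      then have j: "r < 2 powr (- real j)" "2 powr (- (real j + 1)) \<le> r"
        using r by (simp_all add: le_log_iff[symmetric] log_less_iff[symmetric])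
      have "r\<^sup>2 / r powr (n + 2 * \<sigma>) = r powr (2 - (n + 2 * \<sigma>))"
        using r by (simp add: powr_diff powr_realpow[of r 2, simplified])
      also have "\<dots> = r powr (2 - 2 * \<sigma> - e) * r powr (e - n)" by (simp add: powr_add[symmetric] algebra_simps)
      also have "\<dots> \<le> 1 * (2 powr (- (real j + 1))) powr (e - n)"
        using r e n j by (intro mult_mono powr_le1 powr_mono2') auto
      also have "\<dots> = 2 powr ((real j + 1) * (n - e))" by (simp add: powr_powr algebra_simps)
      finally show ?thesis using r j by (intro exI[of _ j]) (simp add: h2_def flip: r_def)
    qed (auto simp: h2_def indicator_def)
  next
    have "(\<lambda>j. 2 powr ((real j + 1) * (n - e)) * (2 powr (- real j)) ^ DIM('a)) = (\<lambda>j. 2 powr (n - e) * (2 powr (- e)) ^ j)"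
    proof
      fix j
      have "(2 powr (- real j)) ^ DIM('a) = 2 powr (- real j * n)"
        unfolding n_def by (simp add: powr_powr flip: powr_realpow)
      then have "2 powr ((real j + 1) * (n - e)) * (2 powr (- real j)) ^ DIM('a) = 2 powr ((real j + 1) * (n - e) + (- real j * n))"
        by (simp only: powr_add)
      also have "(real j + 1) * (n - e) + (- real j * n) = (n - e) + (- e) * real j" by (simp add: algebra_simps)
      also have "2 powr ((n - e) + (- e) * real j) = 2 powr (n - e) * (2 powr (- e)) ^ j"
        unfolding powr_add by (simp add: powr_powr flip: powr_realpow)
      finally show "2 powr ((real j + 1) * (n - e)) * (2 powr (- real j)) ^ DIM('a) = 2 powr (n - e) * (2 powr (- e)) ^ j" .
    qed
    moreover have "2 powr (- e) < (1::real)" using e by (simp add: powr_less_one)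
    ultimately show "summable (\<lambda>j. 2 powr ((real j + 1) * (n - e)) * (2 powr (- real j)) ^ DIM('a))"
      by (simp add: summable_mult summable_geometric)
  qed auto
  moreover have "(\<integral>\<^sup>+z. ennreal (min 1 ((norm z)\<^sup>2) / norm z powr (real DIM('a) + 2 * \<sigma>)) \<partial>(lborel :: 'a measure))
      \<le> (\<integral>\<^sup>+z. ennreal (h1 z) + ennreal (h2 z) \<partial>lborel)"
  proof (intro nn_integral_mono)
    fix z :: 'a
    have "min 1 ((norm z)\<^sup>2) / norm z powr (n + 2 * \<sigma>) \<le> h1 z + h2 z"
      by (cases "norm z < 1") (auto simp: h1_def h2_def intro!: divide_right_mono)
    moreover have "0 \<le> h1 z" "0 \<le> h2 z" by (auto simp: h1_def h2_def)
    ultimately show "ennreal (min 1 ((norm z)\<^sup>2) / norm z powr (real DIM('a) + 2 * \<sigma>)) \<le> ennreal (h1 z) + ennreal (h2 z)"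
      unfolding n_def by (metis ennreal_leI ennreal_plus)
  qed
  moreover have "(\<integral>\<^sup>+z. ennreal (h1 z) + ennreal (h2 z) \<partial>lborel) = (\<integral>\<^sup>+z. ennreal (h1 z) \<partial>lborel) + (\<integral>\<^sup>+z. ennreal (h2 z) \<partial>lborel)"
    by (rule nn_integral_add) auto
  ultimately show ?thesis
    by (metis (no_types, lifting) ennreal_add_less_top infinity_ennreal_def order.strict_trans1)
qed


text \<open>Lower semicontinuity in the form used for completeness of the energy space and for the
  minimisation, where only almost everywhere convergence is at hand.\<close>

lemma Fatou_bound:
  fixes F :: "nat => 'b => real"
  assumes [measurable]: "\<And>l. F l \<in> borel_measurable M" "G \<in> borel_measurable M"
    and nonneg: "\<And>l x. 0 \<le> F l x" "\<And>x. 0 \<le> G x"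
    and int: "\<And>l. integrable M (F l)"
    and B: "\<forall>\<^sub>F l in sequentially. (\<integral>x. F l x \<partial>M) \<le> B"
    and lim: "AE x in M. (\<lambda>l. F l x) \<longlonglongrightarrow> G x"
  shows "integrable M G" "(\<integral>x. G x \<partial>M) \<le> B"
proof -
  have "(\<integral>\<^sup>+x. ennreal (G x) \<partial>M) = (\<integral>\<^sup>+x. liminf (\<lambda>l. ennreal (F l x)) \<partial>M)"
  proof (rule nn_integral_cong_AE)
    show "AE x in M. ennreal (G x) = liminf (\<lambda>l. ennreal (F l x))"
      using lim by eventually_elim (metis lim_imp_Liminf tendsto_ennrealI trivial_limit_sequentially)
  qed
  also have "\<dots> \<le> liminf (\<lambda>l. \<integral>\<^sup>+x. ennreal (F l x) \<partial>M)" by (rule nn_integral_liminf) measurable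
  also have "\<dots> = liminf (\<lambda>l. ennreal (\<integral>x. F l x \<partial>M))"
    using int nonneg by (simp add: nn_integral_eq_integral)
  also have "\<dots> \<le> liminf (\<lambda>l. ennreal B)"
    by (rule Liminf_mono) (use B in \<open>auto elim!: eventually_mono intro: ennreal_leI\<close>)
  also have "\<dots> = ennreal B" by (simp add: Liminf_const)
  finally have le: "(\<integral>\<^sup>+x. ennreal (G x) \<partial>M) \<le> ennreal B" .
  then show i: "integrable M G"
    using nonneg by (intro integrableI_nonneg) (auto simp: less_top[symmetric] top_unique)
  have B0: "0 \<le> B"
  proof -
    obtain l where "(\<integral>x. F l x \<partial>M) \<le> B" using B by (auto simp: eventually_sequentially)
    moreover have "0 \<le> (\<integral>x. F l x \<partial>M)" using nonneg by simp
    ultimately show ?thesis by linarith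
  qed
  have "ennreal (\<integral>x. G x \<partial>M) \<le> ennreal B"
    using le nonneg i by (simp add: nn_integral_eq_integral)
  then show "(\<integral>x. G x \<partial>M) \<le> B" using B0 by simp
qed

lemma AE_lborel_pair:
  assumes "AE x in (lborel :: 'a::euclidean_space measure). P x"
  shows "AE z in (lborel \<Otimes>\<^sub>M lborel). P (fst z) \<and> P (snd (z :: 'a \<times> 'a))"
proof -
  obtain N :: "'a set" where N: "{x. \<not> P x} \<subseteq> N" "N \<in> null_sets lborel"
    using assms by (auto elim!: AE_E simp: null_sets_def)
  have "N \<times> UNIV \<in> null_sets (lborel \<Otimes>\<^sub>M (lborel :: 'a measure))"
    "UNIV \<times> N \<in> null_sets ((lborel :: 'a measure) \<Otimes>\<^sub>M lborel)"
    using N by (auto simp: null_sets_def lborel.emeasure_pair_measure_Times)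
  then have "AE z in (lborel \<Otimes>\<^sub>M lborel). z \<notin> N \<times> (UNIV :: 'a set)"
     "AE z in (lborel \<Otimes>\<^sub>M lborel). z \<notin> (UNIV :: 'a set) \<times> N"
    by (auto intro: AE_not_in)
  then show ?thesis by eventually_elim (use N in \<open>auto simp: mem_Times_iff\<close>)
qed

text \<open>Convexity of the potential of the nonlinearity, written as a tangent inequality; Young's
  inequality yields it without differentiation. The minimisation uses it both for midpoint convexity
  and for the first variation.\<close>

lemma powr_tangent:
  fixes a b p :: real assumes p: "1 < p"
  shows "max 0 a powr (p + 1) / (p + 1) + max 0 a powr p * (b - a) \<le> max 0 b powr (p + 1) / (p + 1)"
proof -
  define A B where "A = max 0 a" and "B = max 0 b"
  have y: "A powr p * B \<le> (A powr p) powr ((p + 1) / p) / ((p + 1) / p) + B powr (p + 1) / (p + 1)"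
    using p by (intro Youngs_inequality) (auto simp: A_def B_def field_simps)
  have e1: "(A powr p) powr ((p + 1) / p) = A powr (p + 1)" using p by (simp add: powr_powr)
  have e2: "A powr (p + 1) = A powr p * A" by (cases "A = 0") (auto simp: powr_add A_def)
  have e3: "A powr p * a = A powr p * A" by (auto simp: A_def max_def)
  have "A powr p * b \<le> A powr p * B" by (intro mult_left_mono) (auto simp: B_def)
  then have "A powr (p + 1) / (p + 1) + A powr p * (b - a) \<le> A powr (p + 1) / (p + 1) + A powr p * B - A powr (p + 1)"
    using e2 e3 unfolding right_diff_distrib by linarith
  also have "\<dots> \<le> B powr (p + 1) / (p + 1)"
  proof -
    have "X / ((p + 1) / p) = X - X / (p + 1)" for X using p by (simp add: field_simps)
    then show ?thesis using y unfolding e1 by simp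
  qed
  finally show ?thesis by (simp add: A_def B_def)
qed

section \<open>The energy space\<close>

text \<open>The real parameters \<open>nn\<close>, \<open>cn\<close> and \<open>omg\<close> merely abbreviate the dimension, the constant of
  the fractional Laplacian and the volume of the unit ball.\<close>

locale frac =
  fixes \<sigma> :: real and \<Omega> :: "'a::euclidean_space set" and nn cn omg :: real
  assumes nn_def: "nn = real DIM('a)" and cn_def: "cn = Cns TYPE('a) \<sigma>"
    and omg_def: "omg = measure lborel (ball (0::'a) 1)"
    and s0: "0 < \<sigma>" and s1: "\<sigma> < 1" and dimn: "2 * \<sigma> < nn"
    and open_Omega: "open \<Omega>" and bounded_Omega: "bounded \<Omega>"
begin
definition \<nu> :: real where "\<nu> = nn + 2 * \<sigma>"
abbreviation V :: "('a => real) set" where "V \<equiv> Hsigma0 \<sigma> \<Omega>"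
abbreviation E :: "('a => real) => ('a => real) => real" where "E \<equiv> Eform \<sigma>"
definition qs :: real where "qs = 2 * nn / (nn - 2 * \<sigma>)"

abbreviation PP :: "('a \<times> 'a) measure" where "PP \<equiv> lborel \<Otimes>\<^sub>M lborel"

text \<open>Each factor takes half of the kernel, so \<open>E f g\<close> is a multiple of the
  \<open>L^2\<close> product of \<open>dq f\<close> and \<open>dq g\<close>. On the diagonal
  numerator and denominator both vanish and the quotient is 0.\<close>

definition dq :: "('a => real) => 'a \<times> 'a => real" where
  "dq f = (\<lambda>(x, y). (f x - f y) / norm (x - y) powr (\<nu> / 2))"

lemma nn_ge_1: "1 \<le> nn"
  using DIM_positive[where 'a='a] unfolding nn_def by linarith

lemma nu_pos: "0 < \<nu>" using nn_ge_1 s0 by (simp add: \<nu>_def)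

lemma cn_pos: "0 < cn"
  unfolding cn_def Cns_def nn_def[symmetric] using s0 s1 nn_ge_1
  by (intro divide_pos_pos mult_pos_pos Gamma_real_pos) auto

lemma qs_gt_2: "2 < qs"
  using dimn s0 by (simp add: qs_def field_simps)

lemma Omega_sets [measurable]: "\<Omega> \<in> sets borel" using open_Omega by simp

lemma Omega_finite: "emeasure lborel \<Omega> < \<infinity>"
  using bounded_Omega by (rule emeasure_bounded_finite)

lemma dq_measurable [measurable]:
  assumes [measurable]: "f \<in> borel_measurable lborel"
  shows "dq f \<in> borel_measurable PP"
  unfolding dq_def by measurable

lemma dq_mult: "dq f (x, y) * dq g (x, y) = (f x - f y) * (g x - g y) / norm (x - y) powr \<nu>"
  by (simp add: dq_def flip: powr_add)

lemma dq_sq: "(dq f (x, y))\<^sup>2 = (f x - f y)\<^sup>2 / norm (x - y) powr \<nu>"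
  using dq_mult[of f x y f] by (simp add: power2_eq_square)

lemma E_eq: "E f g = cn / 2 * (\<integral>z. dq f z * dq g z \<partial>PP)"
proof -
  have "(\<lambda>z. dq f z * dq g z) = (\<lambda>(x, y). (f x - f y) * (g x - g y) / norm (x - y) powr (nn + 2 * \<sigma>))"
    by (auto simp: fun_eq_iff dq_mult \<nu>_def)
  then show ?thesis unfolding Eform_def cn_def[symmetric] nn_def[symmetric] by simp
qed

lemma V_iff: "f \<in> V \<longleftrightarrow> Lp qs f \<and> (\<forall>x. x \<notin> \<Omega> \<longrightarrow> f x = 0) \<and> integrable PP (\<lambda>z. (dq f z)\<^sup>2)"
proof -
  have "(\<lambda>z. (dq f z)\<^sup>2) = (\<lambda>(x, y). (f x - f y)\<^sup>2 / norm (x - y) powr (nn + 2 * \<sigma>))"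
    by (auto simp: fun_eq_iff dq_sq \<nu>_def)
  then show ?thesis unfolding Hsigma0_def Lp_def qs_def nn_def[symmetric] by auto
qed

lemma V_Lp_qs: "f \<in> V ==> Lp qs f" by (simp add: V_iff)
lemma V_outside: "f \<in> V ==> x \<notin> \<Omega> ==> f x = 0" by (simp add: V_iff)
lemma V_dq: "f \<in> V ==> integrable PP (\<lambda>z. (dq f z)\<^sup>2)" by (simp add: V_iff)
lemma V_measurable [measurable_dest]: "f \<in> V ==> f \<in> borel_measurable lborel"
  by (simp add: V_iff Lp_def)

lemma V_mult: "f \<in> V ==> g \<in> V ==> integrable PP (\<lambda>z. dq f z * dq g z)"
  by (rule integrable_mult_of_squares) (auto simp: V_dq)

text \<open>The Markov property of the energy, in a form with two majorants: sums, multiples and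
  truncations are all instances, so the whole lattice structure of the space rests on one
  estimate.\<close>

lemma V_contraction:
  assumes f: "f \<in> V" and g: "g \<in> V" and [measurable]: "h \<in> borel_measurable lborel"
    and out: "\<And>x. x \<notin> \<Omega> ==> h x = 0" and A: "0 \<le> A"
    and h1: "\<And>x. \<bar>h x\<bar> \<le> A * (\<bar>f x\<bar> + \<bar>g x\<bar>)"
    and h2: "\<And>x y. \<bar>h x - h y\<bar> \<le> A * (\<bar>f x - f y\<bar> + \<bar>g x - g y\<bar>)"
  shows "h \<in> V"
proof -
  note [measurable] = V_measurable[OF f] V_measurable[OF g]
  have "Lp qs (\<lambda>x. \<bar>f x\<bar> + \<bar>g x\<bar>)"
    using Lp_add[of qs "\<lambda>x. \<bar>f x\<bar>" "\<lambda>x. \<bar>g x\<bar>"] V_Lp_qs[OF f] V_Lp_qs[OF g] qs_gt_2 by (auto simp: Lp_def)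
  then have "Lp qs (\<lambda>x. A * (\<bar>f x\<bar> + \<bar>g x\<bar>))" by (rule Lp_cmult)
  then have "Lp qs h"
    by (rule Lp_bound(1)) (use qs_gt_2 h1 A in \<open>auto simp: abs_mult\<close>)
  moreover have "integrable PP (\<lambda>z. (dq h z)\<^sup>2)"
  proof (rule Bochner_Integration.integrable_bound[of _ "\<lambda>z. 2 * A\<^sup>2 * ((dq f z)\<^sup>2 + (dq g z)\<^sup>2)"])
    have "(dq h z)\<^sup>2 \<le> 2 * A\<^sup>2 * ((dq f z)\<^sup>2 + (dq g z)\<^sup>2)" for z
    proof -
      obtain x y where z: "z = (x, y)" by (cases z)
      have "(h x - h y)\<^sup>2 \<le> (A * (\<bar>f x - f y\<bar> + \<bar>g x - g y\<bar>))\<^sup>2"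
        using h2[of x y] by (rule abs_le_square_iff[THEN iffD1, OF order_trans]) simp
      also have "\<dots> \<le> 2 * A\<^sup>2 * ((f x - f y)\<^sup>2 + (g x - g y)\<^sup>2)"
        using sum_squares_bound[of "\<bar>f x - f y\<bar>" "\<bar>g x - g y\<bar>"]
          mult_left_mono[of "(\<bar>f x - f y\<bar> + \<bar>g x - g y\<bar>)\<^sup>2" "2 * ((f x - f y)\<^sup>2 + (g x - g y)\<^sup>2)" "A\<^sup>2"]
        by (simp add: power_mult_distrib power2_sum algebra_simps power2_eq_square)
      finally show ?thesis
        unfolding z dq_sq by (simp add: add_divide_distrib[symmetric] divide_right_mono)
    qed
    then show "AE z in PP. norm ((dq h z)\<^sup>2) \<le> norm (2 * A\<^sup>2 * ((dq f z)\<^sup>2 + (dq g z)\<^sup>2))" by auto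
  qed (use V_dq[OF f] V_dq[OF g] in auto)
  ultimately show ?thesis using out by (simp add: V_iff)
qed

lemma V_zero [simp]: "(\<lambda>_. 0) \<in> V"
  by (simp add: V_iff Lp_def dq_def case_prod_beta)

lemma V_add: "f \<in> V ==> g \<in> V ==> (\<lambda>x. f x + g x) \<in> V"
  by (rule V_contraction[of f g _ 1])
     (insert V_measurable[of f] V_measurable[of g], auto simp: V_outside abs_le_iff)

lemma V_cmult: "f \<in> V ==> (\<lambda>x. c * f x) \<in> V"
  by (rule V_contraction[of f "\<lambda>_. 0" _ "\<bar>c\<bar>"]) (insert V_measurable[of f], auto simp: V_outside abs_mult right_diff_distrib[symmetric])

lemma V_diff: "f \<in> V ==> g \<in> V ==> (\<lambda>x. f x - g x) \<in> V"
  using V_add[of f "\<lambda>x. (-1) * g x"] V_cmult[of g "-1"] by simp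

lemma V_trunc: "f \<in> V ==> 0 \<le> k ==> (\<lambda>x. max 0 (f x - k)) \<in> V"
  by (rule V_contraction[of f "\<lambda>_. 0" _ 1]) (insert V_measurable[of f], auto simp: V_outside)

lemma V_pos: "f \<in> V ==> (\<lambda>x. max 0 (f x)) \<in> V"
  using V_trunc[of f 0] by simp

lemma dq_add: "dq (\<lambda>x. f x + g x) z = dq f z + dq g z"
  by (cases z) (simp add: dq_def add_divide_distrib diff_divide_distrib)
lemma dq_diff: "dq (\<lambda>x. f x - g x) z = dq f z - dq g z"
  by (cases z) (simp add: dq_def diff_divide_distrib)
lemma dq_cmult: "dq (\<lambda>x. c * f x) z = c * dq f z"
  by (cases z) (simp add: dq_def right_diff_distrib diff_divide_distrib)

lemma E_sym: "E f g = E g f" by (simp add: E_eq mult.commute)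
lemma E_add_left: "f \<in> V ==> g \<in> V ==> h \<in> V ==> E (\<lambda>x. f x + g x) h = E f h + E g h"
  by (simp add: E_eq dq_add distrib_right V_mult distrib_left)
lemma E_diff_left: "f \<in> V ==> g \<in> V ==> h \<in> V ==> E (\<lambda>x. f x - g x) h = E f h - E g h"
  by (simp add: E_eq dq_diff left_diff_distrib V_mult right_diff_distrib)
lemma E_cmult_left: "E (\<lambda>x. c * f x) h = c * E f h"
  by (simp add: E_eq dq_cmult mult.assoc)
lemma E_add_right: "f \<in> V ==> g \<in> V ==> h \<in> V ==> E h (\<lambda>x. f x + g x) = E h f + E h g"
  using E_add_left[of f g h] by (simp add: E_sym)
lemma E_diff_right: "f \<in> V ==> g \<in> V ==> h \<in> V ==> E h (\<lambda>x. f x - g x) = E h f - E h g"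
  using E_diff_left[of f g h] by (simp add: E_sym)
lemma E_cmult_right: "E h (\<lambda>x. c * f x) = c * E h f"
  using E_cmult_left[of c f h] by (simp add: E_sym)

lemma E_self: "E f f = cn / 2 * (\<integral>z. (dq f z)\<^sup>2 \<partial>PP)"
  by (simp add: E_eq power2_eq_square)

lemma E_nonneg: "0 \<le> E f f"
  using cn_pos by (simp add: E_self)

text \<open>A seminorm, since elements of \<open>V\<close> are functions and not classes;
  \<open>nrm_0_AE\<close> shows that its null functions vanish almost everywhere.\<close>

definition nrm :: "('a => real) => real" where "nrm f = sqrt (E f f)"

lemma nrm_nonneg [simp]: "0 \<le> nrm f" by (simp add: nrm_def E_nonneg)
lemma nrm_sq: "(nrm f)\<^sup>2 = E f f" by (simp add: nrm_def E_nonneg)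

lemma E_CS: assumes "f \<in> V" "g \<in> V" shows "\<bar>E f g\<bar> \<le> nrm f * nrm g"
proof -
  have "(\<integral>z. dq f z * dq g z \<partial>PP)\<^sup>2 \<le> (\<integral>z. (dq f z)\<^sup>2 \<partial>PP) * (\<integral>z. (dq g z)\<^sup>2 \<partial>PP)"
    using assms by (intro Cauchy_Schwarz_integral V_dq dq_measurable V_measurable)
  then have "(E f g)\<^sup>2 \<le> E f f * E g g"
    unfolding E_eq[of f g] E_self power_mult_distrib
    by (drule_tac mult_left_mono[of _ _ "(cn / 2)\<^sup>2"]) (simp_all add: power2_eq_square mult_ac)
  then have "(E f g)\<^sup>2 \<le> (nrm f * nrm g)\<^sup>2" by (simp add: power_mult_distrib nrm_sq)
  then show ?thesis using abs_le_square_iff[of "E f g" "nrm f * nrm g"] by simp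
qed

lemma nrm_add: assumes "f \<in> V" "g \<in> V" shows "nrm (\<lambda>x. f x + g x) \<le> nrm f + nrm g"
proof -
  have "(nrm (\<lambda>x. f x + g x))\<^sup>2 = E f f + 2 * E f g + E g g"
    using assms by (simp add: nrm_sq E_add_left E_add_right V_add E_sym[of g f])
  also have "\<dots> \<le> (nrm f + nrm g)\<^sup>2"
    using E_CS[OF assms] by (simp add: power2_sum nrm_sq)
  finally show ?thesis by (rule power2_le_imp_le) simp
qed

lemma nrm_cmult: "nrm (\<lambda>x. c * f x) = \<bar>c\<bar> * nrm f"
  by (simp add: nrm_def E_cmult_left E_cmult_right real_sqrt_mult flip: mult.assoc)

lemma nrm_minus_commute: "nrm (\<lambda>x. f x - g x) = nrm (\<lambda>x. g x - f x)"
  using nrm_cmult[of "-1" "\<lambda>x. f x - g x"] by simp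

lemma nrm_triangle:
  assumes "f \<in> V" "g \<in> V" "h \<in> V"
  shows "nrm (\<lambda>x. f x - h x) \<le> nrm (\<lambda>x. f x - g x) + nrm (\<lambda>x. g x - h x)"
  using nrm_add[of "\<lambda>x. f x - g x" "\<lambda>x. g x - h x"] assms by (simp add: V_diff)

lemma nrm_abs_diff: assumes "f \<in> V" "g \<in> V" shows "\<bar>nrm f - nrm g\<bar> \<le> nrm (\<lambda>x. f x - g x)"
  using nrm_add[of "\<lambda>x. f x - g x" g] nrm_add[of "\<lambda>x. g x - f x" f] assms
  by (simp add: V_diff nrm_minus_commute[of f g])

text \<open>Pointwise, an increment of the truncation has the sign of the increment of
  \<open>f\<close> and is no larger. This inequality takes the place of the chain rule in the
  comparison arguments and in the energy estimates on level sets.\<close>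

lemma E_trunc:
  assumes f: "f \<in> V" and k: "0 \<le> k"
  shows "E (\<lambda>x. max 0 (f x - k)) (\<lambda>x. max 0 (f x - k)) \<le> E f (\<lambda>x. max 0 (f x - k))"
proof -
  let ?h = "\<lambda>x. max 0 (f x - k)"
  have h: "?h \<in> V" using V_trunc[OF f k] .
  have "(\<integral>z. dq ?h z * dq ?h z \<partial>PP) \<le> (\<integral>z. dq f z * dq ?h z \<partial>PP)"
  proof (rule integral_mono)
    fix z :: "'a \<times> 'a" obtain x y where z: "z = (x, y)" by (cases z)
    have "(max 0 (a - k) - max 0 (b - k)) * (max 0 (a - k) - max 0 (b - k)) \<le> (a - b) * (max 0 (a - k) - max 0 (b - k))" for a b :: real
      by (auto simp: max_def intro: mult_right_mono mult_right_mono_neg)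
    then show "dq ?h z * dq ?h z \<le> dq f z * dq ?h z"
      unfolding z dq_mult by (intro divide_right_mono) auto
  qed (use f h V_mult in auto)
  then show ?thesis unfolding E_eq using cn_pos by (intro mult_left_mono) auto
qed

subsection \<open>Sobolev inequality\<close>

lemma ennreal_sq_le_imp_le: "X \<le> Y" if "X\<^sup>2 \<le> Y\<^sup>2" for X Y :: ennreal
proof (cases X rule: ennreal_cases)
  case (real x)
  note X = this
  show ?thesis
  proof (cases Y rule: ennreal_cases)
    case (real y)
    then have "x\<^sup>2 \<le> y\<^sup>2" using that X by (simp add: ennreal_power)
    then show ?thesis using X real by (simp add: abs_le_square_iff[symmetric])
  qed simp
next
  case top
  then show ?thesis using that by (cases Y rule: ennreal_cases) (auto simp: ennreal_power top_unique)
qed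

text \<open>The energy density, a squared fractional gradient. It is extended-valued so that
  pointwise estimates can be stated before it is known to be finite almost everywhere.\<close>

definition sqD :: "('a => real) => 'a => ennreal" where
  "sqD f x = (\<integral>\<^sup>+y. ennreal ((f x - f y)\<^sup>2 / norm (x - y) powr \<nu>) \<partial>lborel)"

lemma sqD_measurable [measurable]:
  assumes [measurable]: "f \<in> borel_measurable lborel"
  shows "sqD f \<in> borel_measurable lborel"
  unfolding sqD_def by measurable

lemma nn_integral_dq:
  assumes [measurable]: "f \<in> borel_measurable lborel"
  shows "(\<integral>\<^sup>+z. ennreal ((dq f z)\<^sup>2) \<partial>PP) = (\<integral>\<^sup>+x. sqD f x \<partial>lborel)"
  unfolding sqD_def dq_sq[symmetric] by (rule lborel.nn_integral_fst[symmetric]) measurable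

lemma nn_integral_sqD:
  assumes "f \<in> V"
  shows "(\<integral>\<^sup>+x. sqD f x \<partial>lborel) = ennreal (2 / cn * E f f)"
proof -
  have "(\<integral>\<^sup>+z. ennreal ((dq f z)\<^sup>2) \<partial>PP) = ennreal (\<integral>z. (dq f z)\<^sup>2 \<partial>PP)"
    using V_dq[OF assms] by (intro nn_integral_eq_integral) auto
  then show ?thesis using nn_integral_dq[OF V_measurable[OF assms]] cn_pos by (simp add: E_self)
qed



lemma omg_pos: "0 < omg"
  unfolding omg_def by (rule content_ball_pos) simp

lemma emeasure_ball: "0 \<le> r ==> emeasure lborel (ball (c::'a) r) = ennreal (omg * r powr nn)"
  by (cases "r = 0") (simp_all add: emeasure_ball_eq omg_def nn_def powr_realpow mult.commute)

text \<open>On the ball the kernel is at least \<open>r powr (- \<nu>)\<close>, so Cauchy--Schwarz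
  bounds the oscillation around \<open>f x\<close> by the energy density at \<open>x\<close>. Both
  the Sobolev inequality and the rate of mollification derive from it.\<close>

lemma ball_deviation:
  assumes [measurable]: "f \<in> borel_measurable lborel" and r: "0 \<le> r"
  shows "(\<integral>\<^sup>+y. ennreal \<bar>f x - f y\<bar> * indicator (ball x r) y \<partial>lborel)\<^sup>2 \<le> ennreal (omg * r powr nn * r powr \<nu>) * sqD f x"
proof -
  have ballm [measurable]: "ball x r \<in> sets borel" by simp
  have "(\<integral>\<^sup>+y. ennreal \<bar>f x - f y\<bar> * indicator (ball x r) y \<partial>lborel)\<^sup>2
      = (\<integral>\<^sup>+y. (ennreal \<bar>f x - f y\<bar> * indicator (ball x r) y) * indicator (ball x r) y \<partial>lborel)\<^sup>2"
    by (intro arg_cong[of _ _ "\<lambda>t. t\<^sup>2"] nn_integral_cong) (auto simp: indicator_def)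
  also have "\<dots> \<le> (\<integral>\<^sup>+y. (ennreal \<bar>f x - f y\<bar> * indicator (ball x r) y)\<^sup>2 \<partial>lborel) * (\<integral>\<^sup>+y. (indicator (ball x r) y)\<^sup>2 \<partial>lborel)"
    by (rule Cauchy_Schwarz_nn_integral) (use ballm in measurable)
  also have "(\<integral>\<^sup>+y. (indicator (ball x r) y)\<^sup>2 \<partial>lborel) = ennreal (omg * r powr nn)"
  proof -
    have "(\<integral>\<^sup>+y. (indicator (ball x r) y)\<^sup>2 \<partial>lborel) = (\<integral>\<^sup>+y. indicator (ball x r) y \<partial>lborel)"
      by (intro nn_integral_cong) (auto simp: indicator_def)
    then show ?thesis using r by (simp add: emeasure_ball)
  qed
  also have "(\<integral>\<^sup>+y. (ennreal \<bar>f x - f y\<bar> * indicator (ball x r) y)\<^sup>2 \<partial>lborel) \<le> (\<integral>\<^sup>+y. ennreal (r powr \<nu>) * ennreal ((f x - f y)\<^sup>2 / norm (x - y) powr \<nu>) \<partial>lborel)"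
  proof (intro nn_integral_mono)
    fix y
    show "(ennreal \<bar>f x - f y\<bar> * indicator (ball x r) y)\<^sup>2 \<le> ennreal (r powr \<nu>) * ennreal ((f x - f y)\<^sup>2 / norm (x - y) powr \<nu>)"
    proof (cases "y \<in> ball x r \<and> y \<noteq> x")
      case True
      then have "norm (x - y) powr \<nu> \<le> r powr \<nu>" "0 < norm (x - y) powr \<nu>"
        using nu_pos by (auto intro!: powr_mono2 simp: dist_norm)
      then have "(f x - f y)\<^sup>2 \<le> r powr \<nu> * ((f x - f y)\<^sup>2 / norm (x - y) powr \<nu>)"
        by (simp add: pos_le_divide_eq mult.commute mult_right_mono)
      then have "ennreal ((f x - f y)\<^sup>2) \<le> ennreal (r powr \<nu> * ((f x - f y)\<^sup>2 / norm (x - y) powr \<nu>))"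
        by (rule ennreal_leI)
      then show ?thesis using True by (simp add: ennreal_power flip: ennreal_mult)
    qed (auto simp: indicator_def)
  qed
  also have "(\<integral>\<^sup>+y. ennreal (r powr \<nu>) * ennreal ((f x - f y)\<^sup>2 / norm (x - y) powr \<nu>) \<partial>lborel) = ennreal (r powr \<nu>) * sqD f x"
    unfolding sqD_def by (rule nn_integral_cmult) measurable
  finally show ?thesis
    using omg_pos by (simp add: ennreal_mult mult_ac mult_right_mono)
qed

text \<open>One summand stems from the mean of \<open>f\<close> over a ball, bounded by Hoelder, the
  other from the oscillation around \<open>f x\<close>.\<close>

definition KS :: real where "KS = omg powr (- 1 / qs) + omg powr (- 1 / 2)"

lemma KS_pos: "0 < KS" using omg_pos by (simp add: KS_def add_pos_pos)

text \<open>Interpolation in the manner of Hedberg: \<open>f x\<close> is compared with its mean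
  over a ball of free radius. A positive upper bound \<open>d\<close> stands in for the square root
  of the density, so that the radius makes sense even where the density vanishes.\<close>

lemma Sobolev_pointwise:
  assumes f: "f \<in> V" and fin: "sqD f x < \<infinity>" and d: "0 < d" "sqD f x \<le> ennreal (d\<^sup>2)" and F0: "0 < Lnorm qs f"
  shows "\<bar>f x\<bar> \<le> KS * Lnorm qs f powr (2 * \<sigma> / nn) * d powr ((nn - 2 * \<sigma>) / nn)"
proof -
  define F where "F = Lnorm qs f"
  \<comment> \<open>The radius that balances mean and oscillation; each then becomes
    \<open>W\<close> times a constant times the same product of powers of \<open>F\<close> and
    \<open>d\<close>.\<close>
  define r where "r = (F / d) powr (2 / nn)"
  have F: "0 < F" using F0 by (simp add: F_def)
  have r: "0 < r" using F d by (simp add: r_def)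
  define W where "W = omg * r powr nn"
  have W: "0 < W" using omg_pos r by (simp add: W_def)
  note [measurable] = V_measurable[OF f]
  define B where "B = ball x r"
  have Bm: "measure lborel B = W" "emeasure lborel B < \<infinity>"
    using emeasure_ball[of r x] r W by (auto simp: B_def W_def measure_def)
  have "(\<integral>\<^sup>+y. ennreal \<bar>f x - f y\<bar> * indicator B y \<partial>lborel)\<^sup>2 \<le> ennreal (W * r powr \<nu>) * sqD f x"
    using ball_deviation[of f r x] r by (simp add: B_def W_def)
  also have "\<dots> \<le> ennreal (W * r powr \<nu>) * ennreal (d\<^sup>2)" by (rule mult_left_mono) (use d in auto)
  also have "\<dots> = (ennreal (sqrt (W * r powr \<nu>) * d))\<^sup>2"
    using W d by (simp add: ennreal_power power_mult_distrib ennreal_mult)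
  finally have dev: "(\<integral>\<^sup>+y. ennreal \<bar>f x - f y\<bar> * indicator B y \<partial>lborel) \<le> ennreal (sqrt (W * r powr \<nu>) * d)"
    by (rule ennreal_sq_le_imp_le)
  define t where "t = qs / (qs - 1)"
  have t: "1 < qs" "1 < t" "1 / qs + 1 / t = 1" using qs_gt_2 by (auto simp: t_def field_simps)
  have Bs: "B \<in> sets lborel" by (simp add: B_def)
  note H = Holder_integral[OF t V_Lp_qs[OF f] Lp_indicator[OF Bs Bm(2), of t]]
  have iB: "(\<lambda>x. \<bar>indicator B x :: real\<bar> powr t) = indicator B" by (auto simp: indicator_def fun_eq_iff)
  have LB: "Lnorm t (indicator B) = W powr (1 - 1 / qs)"
  proof -
    have "1 / t = 1 - 1 / qs" using t(3) by linarith
    with iB show ?thesis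
      using Bm(1) Bs by (simp add: Lnorm_def)
  qed
  have "(\<integral>\<^sup>+y. ennreal \<bar>f y\<bar> * indicator B y \<partial>lborel) = (\<integral>\<^sup>+y. ennreal \<bar>f y * indicator B y\<bar> \<partial>lborel)"
    by (intro nn_integral_cong) (auto simp: indicator_def)
  also have "\<dots> = ennreal (LBINT y. \<bar>f y * indicator B y\<bar>)"
    using H(1) by (intro nn_integral_eq_integral) auto
  also have "\<dots> \<le> ennreal (F * W powr (1 - 1 / qs))"
    using H(2) unfolding LB F_def by (rule ennreal_leI)
  finally have av: "(\<integral>\<^sup>+y. ennreal \<bar>f y\<bar> * indicator B y \<partial>lborel) \<le> ennreal (F * W powr (1 - 1 / qs))" .
  have "ennreal (\<bar>f x\<bar> * W) = ennreal \<bar>f x\<bar> * emeasure lborel B"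
    using emeasure_ball[of r x] r W by (simp add: B_def W_def ennreal_mult)
  also have "\<dots> = (\<integral>\<^sup>+y. ennreal \<bar>f x\<bar> * indicator B y \<partial>lborel)"
    using Bs by (simp add: nn_integral_cmult_indicator)
  also have "\<dots> \<le> (\<integral>\<^sup>+y. ennreal \<bar>f y\<bar> * indicator B y + ennreal \<bar>f x - f y\<bar> * indicator B y \<partial>lborel)"
    by (intro nn_integral_mono) (auto simp: indicator_def simp flip: ennreal_plus intro!: ennreal_leI)
  also have "\<dots> = (\<integral>\<^sup>+y. ennreal \<bar>f y\<bar> * indicator B y \<partial>lborel) + (\<integral>\<^sup>+y. ennreal \<bar>f x - f y\<bar> * indicator B y \<partial>lborel)"
    using Bs by (intro nn_integral_add) auto
  also have "\<dots> \<le> ennreal (F * W powr (1 - 1 / qs)) + ennreal (sqrt (W * r powr \<nu>) * d)"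
    by (rule add_mono[OF av dev])
  also have "\<dots> = ennreal (F * W powr (1 - 1 / qs) + sqrt (W * r powr \<nu>) * d)"
    using F W d by (simp add: ennreal_plus)
  finally have main: "\<bar>f x\<bar> * W \<le> F * W powr (1 - 1 / qs) + sqrt (W * r powr \<nu>) * d"
    using F W d by (subst (asm) ennreal_le_iff) (auto intro!: add_nonneg_nonneg)
  define a where "a = (nn - 2 * \<sigma>) / nn"
  have a: "1 - a = 2 * \<sigma> / nn" "2 / qs = a" using nn_ge_1 dimn by (auto simp: a_def qs_def field_simps)
  have "F * W powr (1 - 1 / qs) = W * (F * W powr (- 1 / qs))"
    using W powr_add[of W 1 "- 1 / qs"] by simp
  also have "W powr (- 1 / qs) = omg powr (- 1 / qs) * (F / d) powr (2 / nn * (nn * (- 1 / qs)))"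
    unfolding W_def r_def using omg_pos F d by (simp add: powr_mult powr_powr mult.assoc)
  also have "2 / nn * (nn * (- 1 / qs)) = - a" using a nn_ge_1 by simp
  also have "F * (omg powr (- 1 / qs) * (F / d) powr (- a)) = omg powr (- 1 / qs) * (F powr (1 - a) * d powr a)"
  proof -
    have "(F / d) powr (- a) = F powr (- a) * d powr a" using F d by (simp add: powr_divide powr_minus_divide)
    moreover have "F * F powr (- a) = F powr (1 - a)" using powr_mult_base[of F "- a"] F by simp
    ultimately show ?thesis by (metis mult.assoc mult.left_commute)
  qed
  finally have e1: "F * W powr (1 - 1 / qs) = W * (omg powr (- 1 / qs) * (F powr (1 - a) * d powr a))" .
  have "sqrt (W * r powr \<nu>) = W powr (1 / 2) * r powr (\<nu> / 2)"
    using W r by (simp add: powr_half_sqrt[symmetric] powr_mult powr_powr)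
  also have "W powr (1 / 2) = W * W powr (- 1 / 2)" using W powr_add[of W 1 "- 1 / 2"] by simp
  also have "W powr (- 1 / 2) = omg powr (- 1 / 2) * r powr (- nn / 2)"
    unfolding W_def using omg_pos r by (simp add: powr_mult powr_powr)
  also have "W * (omg powr (- 1 / 2) * r powr (- nn / 2)) * r powr (\<nu> / 2) = W * omg powr (- 1 / 2) * r powr (- nn / 2 + \<nu> / 2)"
    by (simp only: powr_add mult.assoc)
  also have "- nn / 2 + \<nu> / 2 = \<sigma>" by (simp add: \<nu>_def add_divide_distrib)
  also have "r powr \<sigma> = (F / d) powr (1 - a)" using a by (simp add: r_def powr_powr)
  finally have "sqrt (W * r powr \<nu>) * d = W * omg powr (- 1 / 2) * ((F / d) powr (1 - a) * d)" by simp
  also have "(F / d) powr (1 - a) * d = F powr (1 - a) * d powr a"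
  proof -
    have "d = d powr (1 - a) * d powr a" using powr_add[of d "1 - a" a] d by simp
    then have "F powr (1 - a) / d powr (1 - a) * d = F powr (1 - a) / d powr (1 - a) * (d powr (1 - a) * d powr a)"
      by (rule arg_cong)
    then show ?thesis using F d by (simp add: powr_divide)
  qed
  finally have e2: "sqrt (W * r powr \<nu>) * d = W * (omg powr (- 1 / 2) * (F powr (1 - a) * d powr a))" by simp
  have "\<bar>f x\<bar> * W \<le> (KS * F powr (1 - a) * d powr a) * W"
    using main unfolding e1 e2 by (simp add: KS_def algebra_simps)
  then show ?thesis using W unfolding a(1) by (simp add: F_def a_def)
qed

definition SQ :: real where "SQ = KS powr qs * (2 / cn)"

lemma SQ_pos: "0 < SQ" using KS_pos cn_pos by (simp add: SQ_def)

text \<open>Raised to the power \<open>qs\<close>, the pointwise bound contains the density to the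
  first power, so it can be integrated. The factor \<open>F powr (qs - 2)\<close> may be cancelled
  because membership in \<open>V\<close> already makes \<open>F\<close> the norm of an integrable
  power.\<close>

lemma Sobolev:
  assumes f: "f \<in> V"
  shows "(Lnorm qs f)\<^sup>2 \<le> SQ * E f f"
proof (cases "Lnorm qs f = 0")
  case True
  then show ?thesis using SQ_pos E_nonneg[of f] by simp
next
  case False
  define F where "F = Lnorm qs f"
  define a where "a = (nn - 2 * \<sigma>) / nn"
  have a: "0 < a" "a * qs = 2" "2 * \<sigma> / nn * qs = qs - 2"
    using nn_ge_1 dimn by (auto simp: a_def qs_def field_simps)
  have F: "0 < F" using False Lnorm_nonneg[of qs f] unfolding F_def by linarith
  note [measurable] = V_measurable[OF f]
  have "AE x in lborel. sqD f x \<noteq> \<infinity>"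
    by (rule nn_integral_PInf_AE) (use nn_integral_sqD[OF f] in auto)
  then have "AE x in lborel. ennreal (\<bar>f x\<bar> powr qs) \<le> ennreal (KS powr qs * F powr (qs - 2)) * sqD f x"
  proof eventually_elim
    case (elim x)
    define d0 where "d0 = sqrt (enn2real (sqD f x))"
    have d0: "0 \<le> d0" "sqD f x = ennreal (d0\<^sup>2)" using elim by (auto simp: d0_def less_top)
    have *: "\<bar>f x\<bar> \<le> KS * F powr (2 * \<sigma> / nn) * d powr a" if "d > d0" for d
    proof -
      have "sqD f x \<le> ennreal (d\<^sup>2)" unfolding d0(2) using that d0 by (intro ennreal_leI power_mono) auto
      then show ?thesis
        using Sobolev_pointwise[OF f, of x d] that d0 elim F by (auto simp: F_def a_def less_top)
    qed
    \<comment> \<open>Letting \<open>d\<close> decrease to \<open>d0\<close> includes the case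
      \<open>d0 = 0\<close>, where the pointwise lemma cannot be applied directly.\<close>
    have "((\<lambda>d. KS * F powr (2 * \<sigma> / nn) * d powr a) \<longlongrightarrow> KS * F powr (2 * \<sigma> / nn) * d0 powr a) (at_right d0)"
      using a d0 by (intro tendsto_intros tendsto_powr2) (auto simp: eventually_at_right_less intro!: eventually_at_rightI[of d0 "d0 + 1"])
    then have le: "\<bar>f x\<bar> \<le> KS * F powr (2 * \<sigma> / nn) * d0 powr a"
      by (rule tendsto_lowerbound) (use * in \<open>auto intro!: eventually_at_rightI[of d0 "d0 + 1"]\<close>)
    have "\<bar>f x\<bar> powr qs \<le> (KS * F powr (2 * \<sigma> / nn) * d0 powr a) powr qs"
      by (rule powr_mono2) (use le qs_gt_2 in auto)
    also have "\<dots> = KS powr qs * F powr (qs - 2) * d0 powr 2"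
      using KS_pos F d0 unfolding powr_mult powr_powr a by simp
    also have "d0 powr 2 = d0\<^sup>2" using d0 by (simp add: powr_numeral)
    finally show ?case unfolding d0(2) by (simp add: ennreal_leI flip: ennreal_mult)
  qed
  then have "(\<integral>\<^sup>+x. ennreal (\<bar>f x\<bar> powr qs) \<partial>lborel) \<le> (\<integral>\<^sup>+x. ennreal (KS powr qs * F powr (qs - 2)) * sqD f x \<partial>lborel)"
    by (rule nn_integral_mono_AE)
  also have "\<dots> = ennreal (KS powr qs * F powr (qs - 2)) * ennreal (2 / cn * E f f)"
    unfolding nn_integral_sqD[OF f, symmetric] by (rule nn_integral_cmult) measurable
  also have "\<dots> = ennreal (F powr (qs - 2) * (SQ * E f f))"
    using cn_pos E_nonneg[of f] by (simp add: SQ_def mult_ac flip: ennreal_mult)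
  also have "(\<integral>\<^sup>+x. ennreal (\<bar>f x\<bar> powr qs) \<partial>lborel) = ennreal (LBINT x. \<bar>f x\<bar> powr qs)"
    using V_Lp_qs[OF f] by (intro nn_integral_eq_integral) (auto simp: Lp_def)
  also have "(LBINT x. \<bar>f x\<bar> powr qs) = F powr (qs - 2) * F\<^sup>2"
    using Lnorm_powr[of qs f] qs_gt_2 F by (simp add: F_def[symmetric] powr_diff powr_numeral)
  finally have "F powr (qs - 2) * F\<^sup>2 \<le> F powr (qs - 2) * (SQ * E f f)"
    using SQ_pos E_nonneg[of f] by simp
  then show ?thesis using F by (simp add: F_def)
qed

lemma Sobolev_nrm: "f \<in> V ==> Lnorm qs f \<le> sqrt SQ * nrm f"
  using Sobolev[of f] SQ_pos unfolding nrm_def by (simp add: real_le_rsqrt flip: real_sqrt_mult)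

definition CC :: "real => real" where
  "CC s = sqrt SQ * measure lborel \<Omega> powr (1 / s - 1 / qs)"

lemma CC_nonneg: "0 \<le> CC s" using SQ_pos by (simp add: CC_def)

lemma V_Lp:
  assumes f: "f \<in> V" and s: "0 < s" "s < qs"
  shows "Lp s f" and "Lnorm s f \<le> CC s * nrm f"
proof -
  note L = Lnorm_lower_exponent[OF s V_Lp_qs[OF f] _ Omega_finite V_outside[OF f]]
  show "Lp s f" using L(1) by simp
  have "Lnorm s f \<le> ((LBINT x. \<bar>f x\<bar> powr qs) powr (s / qs) * measure lborel \<Omega> powr (1 - s / qs)) powr (1 / s)"
    unfolding Lnorm_def using L(2) s by (intro powr_mono2) auto
  also have "\<dots> = Lnorm qs f * measure lborel \<Omega> powr (1 / s - 1 / qs)"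
  proof -
    have e: "s / qs * (1 / s) = 1 / qs" "(1 - s / qs) * (1 / s) = 1 / s - 1 / qs"
      using s by (auto simp: field_simps)
    show ?thesis by (simp only: powr_mult powr_powr e Lnorm_def)
  qed
  also have "\<dots> \<le> CC s * nrm f"
    unfolding CC_def using mult_right_mono[OF Sobolev_nrm[OF f], of "measure lborel \<Omega> powr (1 / s - 1 / qs)"]
    by (simp add: mult_ac)
  finally show "Lnorm s f \<le> CC s * nrm f" .
qed

lemma nrm_0_AE: assumes "f \<in> V" "nrm f = 0" shows "AE x in lborel. f x = 0"
proof (rule Lnorm_eq_0_AE[of qs])
  show "Lnorm qs f = 0" using Sobolev_nrm[OF assms(1)] Lnorm_nonneg[of qs f] assms(2) by simp
qed (use V_Lp_qs assms qs_gt_2 in auto)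

lemma V_integrable: "f \<in> V ==> integrable lborel f"
  using V_Lp(1)[of f 1] qs_gt_2 integrable_abs_iff[of f lborel] by (simp add: Lp_def)

end

context frac
begin

subsection \<open>Completeness\<close>

lemma E_tendsto:
  assumes f: "\<And>j. f j \<in> V" "g \<in> V" "(\<lambda>j. nrm (\<lambda>x. f j x - g x)) \<longlonglongrightarrow> 0" and h: "h \<in> V"
  shows "(\<lambda>j. E (f j) h) \<longlonglongrightarrow> E g h"
proof -
  have "(\<lambda>j. E (f j) h - E g h) \<longlonglongrightarrow> 0"
  proof (rule Lim_null_comparison)
    show "\<forall>\<^sub>F j in sequentially. norm (E (f j) h - E g h) \<le> nrm (\<lambda>x. f j x - g x) * nrm h"
      using E_CS[OF V_diff[OF f(1) f(2)] h] E_diff_left[OF f(1) f(2) h] by simp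
    show "(\<lambda>j. nrm (\<lambda>x. f j x - g x) * nrm h) \<longlonglongrightarrow> 0"
      using tendsto_mult[OF f(3) tendsto_const[of "nrm h"]] by simp
  qed
  then show ?thesis by (simp add: LIM_zero_cancel)
qed

lemma nrm_tendsto:
  assumes f: "\<And>j. f j \<in> V" "g \<in> V" "(\<lambda>j. nrm (\<lambda>x. f j x - g x)) \<longlonglongrightarrow> 0"
  shows "(\<lambda>j. nrm (f j)) \<longlonglongrightarrow> nrm g"
proof -
  have "(\<lambda>j. nrm (f j) - nrm g) \<longlonglongrightarrow> 0"
    by (rule Lim_null_comparison[OF _ f(3)]) (use nrm_abs_diff f in auto)
  then show ?thesis by (simp add: LIM_zero_cancel)
qed

text \<open>Summable increments in \<open>L^1\<close> give an almost everywhere limit, and Fatou's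
  lemma carries the bounds on \<open>h j - h (j + l)\<close> over to \<open>h j - g\<close>, both
  for the energy and for the exponent \<open>qs\<close>.\<close>

lemma V_complete_fast:
  assumes h: "\<And>j. h j \<in> V" and fast: "\<And>j. nrm (\<lambda>x. h (Suc j) x - h j x) \<le> (1 / 2) ^ j"
  obtains g where "g \<in> V" "(\<lambda>j. nrm (\<lambda>x. h j x - g x)) \<longlonglongrightarrow> 0" "AE x in lborel. (\<lambda>j. h j x) \<longlonglongrightarrow> g x"
proof -
  note hm [measurable] = V_measurable[OF h]
  have dist: "nrm (\<lambda>x. h j x - h (j + k) x) \<le> 2 * (1 / 2) ^ j" for j k
  proof -
    have "nrm (\<lambda>x. h j x - h (j + k) x) \<le> (\<Sum>i<k. (1 / 2) ^ (j + i))"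
    proof (induction k)
      case 0 then show ?case by (simp add: nrm_def E_self dq_def case_prod_beta)
    next
      case (Suc k)
      show ?case
        using nrm_triangle[OF h[of j] h[of "j + k"] h[of "j + Suc k"]] Suc fast[of "j + k"]
        by (simp add: nrm_minus_commute[of "h (j + k)"])
    qed
    also have "\<dots> = (1 / 2) ^ j * (\<Sum>i<k. (1 / 2) ^ i)" by (simp add: sum_distrib_left power_add)
    also have "\<dots> \<le> (1 / 2) ^ j * 2"
      by (intro mult_left_mono) (auto simp: sum_gp_strict)
    finally show ?thesis by simp
  qed
  define d where "d j x = \<bar>h (Suc j) x - h j x\<bar>" for j x
  have [measurable]: "d j \<in> borel_measurable borel" for j unfolding d_def using hm by measurable
  have d_int: "(\<integral>\<^sup>+x. ennreal (d j x) \<partial>lborel) \<le> ennreal (CC 1 * (1 / 2) ^ j)" for j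
  proof -
    have v: "(\<lambda>x. h (Suc j) x - h j x) \<in> V" using h by (intro V_diff)
    have "(\<integral>\<^sup>+x. ennreal (d j x) \<partial>lborel) = ennreal (LBINT x. d j x)"
      using V_integrable[OF v] by (intro nn_integral_eq_integral) (auto simp: d_def)
    also have "(LBINT x. d j x) = Lnorm 1 (\<lambda>x. h (Suc j) x - h j x)" by (simp add: Lnorm_def d_def)
    also have "ennreal \<dots> \<le> ennreal (CC 1 * (1 / 2) ^ j)"
      using V_Lp(2)[OF v, of 1] qs_gt_2 mult_left_mono[OF fast[of j] CC_nonneg[of 1]] by (intro ennreal_leI) auto
    finally show ?thesis .
  qed
  have "(\<integral>\<^sup>+x. (\<Sum>j. ennreal (d j x)) \<partial>lborel) = (\<Sum>j. \<integral>\<^sup>+x. ennreal (d j x) \<partial>lborel)"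
    by (rule nn_integral_suminf) measurable
  also have "\<dots> \<le> (\<Sum>j. ennreal (CC 1 * (1 / 2) ^ j))" by (intro suminf_le d_int) auto
  also have "\<dots> < \<infinity>"
    using CC_nonneg[of 1] by (subst suminf_ennreal2) (auto intro!: summable_mult summable_geometric)
  finally have "AE x in lborel. (\<Sum>j. ennreal (d j x)) \<noteq> \<infinity>"
    by (intro nn_integral_PInf_AE) auto
  then have conv: "AE x in lborel. convergent (\<lambda>j. h j x)"
  proof eventually_elim
    case (elim x)
    then have "summable (\<lambda>j. d j x)" by (intro summable_suminf_not_top) (auto simp: d_def)
    then have "summable (\<lambda>j. h (Suc j) x - h j x)" unfolding d_def by (rule summable_rabs_cancel)
    then have "convergent (\<lambda>n. \<Sum>j<n. h (Suc j) x - h j x)" by (simp add: summable_iff_convergent)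
    then have "convergent (\<lambda>n. h n x - h 0 x)"
      by (simp only: sum_lessThan_telescope[of "\<lambda>j. h j x"])
    then have "convergent (\<lambda>n. (h n x - h 0 x) + h 0 x)" by (intro convergent_add convergent_const)
    then show ?case by simp
  qed
  \<comment> \<open>A pointwise \<open>lim\<close> of zeros is zero, so \<open>g\<close> vanishes at
    every point outside \<Omega>, as membership in \<open>V\<close> requires.\<close>
  define g where "g x = lim (\<lambda>j. h j x)" for x
  have gm [measurable]: "g \<in> borel_measurable borel" unfolding g_def using hm by measurable
  have lim: "AE x in lborel. (\<lambda>j. h j x) \<longlonglongrightarrow> g x"
    using conv by eventually_elim (simp add: g_def convergent_LIMSEQ_iff)
  have g_out: "g x = 0" if "x \<notin> \<Omega>" for x using V_outside[OF h that] by (simp add: g_def)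
  have diff: "(\<lambda>x. h j x - g x) \<in> V \<and> nrm (\<lambda>x. h j x - g x) \<le> 2 * (1 / 2) ^ j" for j
  proof -
    let ?B = "2 * (1 / 2) ^ j :: real"
    have v: "(\<lambda>x. h j x - h (j + l) x) \<in> V" for l using h by (intro V_diff)
    have nB: "nrm (\<lambda>x. h j x - h (j + l) x) \<le> ?B" for l by (rule dist)
    have EB: "(\<integral>z. (dq (\<lambda>x. h j x - h (j + l) x) z)\<^sup>2 \<partial>PP) \<le> 2 / cn * ?B\<^sup>2" for l
    proof -
      have "E (\<lambda>x. h j x - h (j + l) x) (\<lambda>x. h j x - h (j + l) x) \<le> ?B\<^sup>2"
        unfolding nrm_sq[symmetric] by (intro power_mono nB) simp
      then show ?thesis using cn_pos by (simp add: E_self field_simps)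
    qed
    have lim': "AE z in PP. (\<lambda>l. (dq (\<lambda>x. h j x - h (j + l) x) z)\<^sup>2) \<longlonglongrightarrow> (dq (\<lambda>x. h j x - g x) z)\<^sup>2"
      using AE_lborel_pair[OF lim]
    proof eventually_elim
      case (elim z)
      obtain x y where z: "z = (x, y)" by (cases z)
      have "(\<lambda>l. h (j + l) x) \<longlonglongrightarrow> g x" "(\<lambda>l. h (j + l) y) \<longlonglongrightarrow> g y"
        using elim LIMSEQ_ignore_initial_segment[of _ _ j] by (auto simp: z add.commute[of j])
      then show ?case unfolding z dq_def prod.case divide_inverse
        by (intro tendsto_power tendsto_mult tendsto_diff tendsto_const)
    qed
    have m [measurable]: "(\<lambda>x. h j x - g x) \<in> borel_measurable lborel" using hm gm by simp
    have 1: "integrable PP (\<lambda>z. (dq (\<lambda>x. h j x - g x) z)\<^sup>2)"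
            "(\<integral>z. (dq (\<lambda>x. h j x - g x) z)\<^sup>2 \<partial>PP) \<le> 2 / cn * ?B\<^sup>2"
      using Fatou_bound[of "\<lambda>l z. (dq (\<lambda>x. h j x - h (j + l) x) z)\<^sup>2" PP "\<lambda>z. (dq (\<lambda>x. h j x - g x) z)\<^sup>2" "2 / cn * ?B\<^sup>2"]
        V_dq[OF v] EB lim' V_measurable[OF v] by auto
    have "(LBINT x. \<bar>h j x - h (j + l) x\<bar> powr qs) \<le> (sqrt SQ * ?B) powr qs" for l
    proof -
      have "Lnorm qs (\<lambda>x. h j x - h (j + l) x) \<le> sqrt SQ * ?B"
        by (rule order_trans[OF Sobolev_nrm[OF v[of l]] mult_left_mono[OF nB[of l]]]) (use SQ_pos in simp)
      then have "Lnorm qs (\<lambda>x. h j x - h (j + l) x) powr qs \<le> (sqrt SQ * ?B) powr qs"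
        using qs_gt_2 by (intro powr_mono2) auto
      then show ?thesis using qs_gt_2 by (simp add: Lnorm_powr)
    qed
    moreover have "AE x in lborel. (\<lambda>l. \<bar>h j x - h (j + l) x\<bar> powr qs) \<longlonglongrightarrow> \<bar>h j x - g x\<bar> powr qs"
      using lim
    proof eventually_elim
      case (elim x)
      have "(\<lambda>l. h (j + l) x) \<longlonglongrightarrow> g x"
        using elim LIMSEQ_ignore_initial_segment[of _ _ j] by (auto simp: add.commute[of j])
      then show ?case using qs_gt_2 by (intro tendsto_intros tendsto_powr2) auto
    qed
    ultimately have "integrable lborel (\<lambda>x. \<bar>h j x - g x\<bar> powr qs)"
      using Fatou_bound(1)[of "\<lambda>l x. \<bar>h j x - h (j + l) x\<bar> powr qs" lborel "\<lambda>x. \<bar>h j x - g x\<bar> powr qs" "(sqrt SQ * ?B) powr qs"]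
        V_Lp_qs[OF v] hm gm by (auto simp: Lp_def)
    then have "(\<lambda>x. h j x - g x) \<in> V"
      using 1 m g_out V_outside[OF h] by (simp add: V_iff Lp_def)
    moreover have "E (\<lambda>x. h j x - g x) (\<lambda>x. h j x - g x) \<le> ?B\<^sup>2"
      using 1(2) cn_pos by (simp add: E_self field_simps)
    then have "nrm (\<lambda>x. h j x - g x) \<le> ?B"
      unfolding nrm_sq[symmetric] by (rule power2_le_imp_le) simp
    ultimately show ?thesis by blast
  qed
  have gV: "g \<in> V" using V_diff[OF h[of 0] conjunct1[OF diff[of 0]]] by simp
  have "(\<lambda>j. 2 * (1 / 2) ^ j :: real) \<longlonglongrightarrow> 2 * 0"
    by (intro tendsto_mult tendsto_const LIMSEQ_power_zero) auto
  then have "(\<lambda>j. nrm (\<lambda>x. h j x - g x)) \<longlonglongrightarrow> 0"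
    by (intro Lim_null_comparison[of "\<lambda>j. nrm (\<lambda>x. h j x - g x)" "\<lambda>j. 2 * (1 / 2) ^ j"]) (use diff in auto)
  with gV lim show ?thesis using that by blast
qed

text \<open>The almost everywhere convergent subsequence is exported too: the minimisation uses it
  for the nonlinear term, and the limit of the rescaled potentials for uniform bounds.\<close>

lemma V_complete:
  assumes f: "\<And>j. f j \<in> V"
    and Cau: "\<And>e. e > 0 ==> \<exists>N. \<forall>i\<ge>N. \<forall>j\<ge>N. nrm (\<lambda>x. f i x - f j x) < e"
  obtains g r where "g \<in> V" "(\<lambda>j. nrm (\<lambda>x. f j x - g x)) \<longlonglongrightarrow> 0"
    "strict_mono (r :: nat => nat)" "AE x in lborel. (\<lambda>j. f (r j) x) \<longlonglongrightarrow> g x"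
proof -
  have "\<exists>r. \<forall>n. (\<forall>i\<ge>r n. \<forall>j\<ge>r n. nrm (\<lambda>x. f i x - f j x) < (1 / 2) ^ n) \<and> r n < r (Suc n)"
  proof (rule dependent_nat_choice)
    show "\<exists>N. \<forall>i\<ge>N. \<forall>j\<ge>N. nrm (\<lambda>x. f i x - f j x) < (1 / 2) ^ 0" by (rule Cau) simp
  next
    fix N n
    obtain M where "\<forall>i\<ge>M. \<forall>j\<ge>M. nrm (\<lambda>x. f i x - f j x) < (1 / 2) ^ Suc n" using Cau[of "(1 / 2) ^ Suc n"] by auto
    then show "\<exists>y. (\<forall>i\<ge>y. \<forall>j\<ge>y. nrm (\<lambda>x. f i x - f j x) < (1 / 2) ^ Suc n) \<and> N < y"
      by (intro exI[of _ "max M (Suc N)"]) auto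
  qed
  then obtain r :: "nat => nat" where r: "\<And>n i j. i \<ge> r n ==> j \<ge> r n ==> nrm (\<lambda>x. f i x - f j x) < (1 / 2) ^ n"
    and r1: "\<And>n. r n < r (Suc n)" by auto
  have sm: "strict_mono r" using r1 by (simp add: strict_mono_Suc_iff)
  have fast: "nrm (\<lambda>x. f (r (Suc j)) x - f (r j) x) \<le> (1 / 2) ^ j" for j
    using r[of j "r (Suc j)" "r j"] r1[of j] by simp
  obtain g where g: "g \<in> V" "(\<lambda>j. nrm (\<lambda>x. f (r j) x - g x)) \<longlonglongrightarrow> 0" "AE x in lborel. (\<lambda>j. f (r j) x) \<longlonglongrightarrow> g x"
    using V_complete_fast[of "\<lambda>j. f (r j)", OF f fast] by blast
  have "(\<lambda>j. nrm (\<lambda>x. f j x - g x)) \<longlonglongrightarrow> 0"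
  proof (rule LIMSEQ_I)
    fix e :: real assume e: "0 < e"
    obtain N where N: "\<And>i j. i \<ge> N ==> j \<ge> N ==> nrm (\<lambda>x. f i x - f j x) < e / 2"
      using Cau[of "e / 2"] e by auto
    obtain M where M: "\<And>j. j \<ge> M ==> nrm (\<lambda>x. f (r j) x - g x) < e / 2"
      using LIMSEQ_D[OF g(2), of "e / 2"] e by auto
    show "\<exists>no. \<forall>n\<ge>no. norm (nrm (\<lambda>x. f n x - g x) - 0) < e"
    proof (intro exI[of _ N] allI impI)
      fix n assume n: "N \<le> n"
      define j where "j = max M N"
      have "r j \<ge> N" using seq_suble[OF sm, of j] by (simp add: j_def)
      then show "norm (nrm (\<lambda>x. f n x - g x) - 0) < e"
        using nrm_triangle[OF f[of n] f[of "r j"] g(1)] N[of n "r j"] M[of j] n by (simp add: j_def)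
    qed
  qed
  with g sm show ?thesis using that by blast
qed

subsection \<open>Minimisation\<close>

text \<open>Functions that act as bounded functionals on the energy space. Integrability is a
  separate clause because the integral would otherwise be 0 by default.\<close>

definition dual :: "('a => real) => bool" where
  "dual g \<longleftrightarrow> (\<forall>\<psi>\<in>V. integrable lborel (\<lambda>x. g x * \<psi> x)) \<and>
     (\<exists>B\<ge>0. \<forall>\<psi>\<in>V. \<bar>\<integral>x. g x * \<psi> x \<partial>lborel\<bar> \<le> B * nrm \<psi>)"

lemma dual_integrable: "dual g ==> \<psi> \<in> V ==> integrable lborel (\<lambda>x. g x * \<psi> x)"
  by (simp add: dual_def)

lemma dual_Lp:
  assumes "1 < s" "1 < t" "1 / s + 1 / t = 1" "t < qs" "Lp s g"
  shows "dual g"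
  unfolding dual_def
proof (intro conjI ballI exI[of _ "Lnorm s g * CC t"])
  fix \<psi> assume \<psi>: "\<psi> \<in> V"
  note L = V_Lp[OF \<psi>, of t]
  have L1: "Lp t \<psi>" and L2: "Lnorm t \<psi> \<le> CC t * nrm \<psi>" using L assms by auto
  show "integrable lborel (\<lambda>x. g x * \<psi> x)"
    using Holder_integral(1)[OF assms(1-3,5) L1] .
  have "\<bar>\<integral>x. g x * \<psi> x \<partial>lborel\<bar> \<le> Lnorm s g * Lnorm t \<psi>"
    using Holder_integral(3)[OF assms(1-3,5) L1] .
  also have "\<dots> \<le> Lnorm s g * (CC t * nrm \<psi>)" using L2 by (intro mult_left_mono) auto
  finally show "\<bar>\<integral>x. g x * \<psi> x \<partial>lborel\<bar> \<le> Lnorm s g * CC t * nrm \<psi>" by (simp add: mult.assoc)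
qed (simp add: CC_nonneg)

text \<open>Direct method for a uniformly convex functional. With \<open>c = 0\<close> it is the
  Riesz representation behind \<open>sol_exists\<close>, with \<open>c = 1 / h\<close> an implicit
  Euler step; the positive part extends the power to a monotone nonlinearity on the whole
  line.\<close>

lemma minimiser:
  fixes c p :: real
  assumes g: "dual g" and c: "0 \<le> c" and p: "1 < p" "p + 1 < qs"
  obtains v where "v \<in> V"
    "\<And>\<psi>. \<psi> \<in> V ==> integrable lborel (\<lambda>x. max 0 (v x) powr p * \<psi> x)"
    "\<And>\<psi>. \<psi> \<in> V ==> c * (LBINT x. max 0 (v x) powr p * \<psi> x) + E v \<psi> = (LBINT x. g x * \<psi> x)"
proof -
  define Fi where "Fi v x = max 0 (v x) powr (p + 1) / (p + 1)" for v :: "'a => real" and x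
  define L where "L v = (LBINT x. g x * v x)" for v
  define J where "J v = c * (LBINT x. Fi v x) + E v v / 2 - L v" for v
  obtain B where B: "0 \<le> B" "\<And>\<psi>. \<psi> \<in> V ==> \<bar>L \<psi>\<bar> \<le> B * nrm \<psi>" using g by (auto simp: dual_def L_def)
  have L_add: "L (\<lambda>x. f x + h x) = L f + L h" if "f \<in> V" "h \<in> V" for f h
    using dual_integrable[OF g that(1)] dual_integrable[OF g that(2)] by (simp add: L_def distrib_left)
  have L_diff: "L (\<lambda>x. f x - h x) = L f - L h" if "f \<in> V" "h \<in> V" for f h
    using dual_integrable[OF g that(1)] dual_integrable[OF g that(2)] by (simp add: L_def right_diff_distrib)
  have L_cmult: "L (\<lambda>x. a * f x) = a * L f" for a f
    by (simp add: L_def mult.left_commute)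
  have Lp1: "Lp (p + 1) v" if "v \<in> V" for v using V_Lp(1)[OF that, of "p + 1"] p by simp
  have Fi_m: "Fi v \<in> borel_measurable lborel" if "v \<in> V" for v
    unfolding Fi_def using V_measurable[OF that] by measurable
  have Fi_nonneg: "0 \<le> Fi v x" for v x using p by (simp add: Fi_def)
  have Fi_int: "integrable lborel (Fi v)" if "v \<in> V" for v
  proof (rule Bochner_Integration.integrable_bound[of _ "\<lambda>x. \<bar>v x\<bar> powr (p + 1)"])
    have "norm (Fi v x) \<le> norm (\<bar>v x\<bar> powr (p + 1))" for x
    proof -
      have "max 0 (v x) powr (p + 1) \<le> \<bar>v x\<bar> powr (p + 1)" using p by (intro powr_mono2) auto
      moreover have "max 0 (v x) powr (p + 1) / (p + 1) \<le> max 0 (v x) powr (p + 1) / 1"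
        using p by (intro divide_left_mono) auto
      ultimately show ?thesis using p by (simp add: Fi_def)
    qed
    then show "AE x in lborel. norm (Fi v x) \<le> norm (\<bar>v x\<bar> powr (p + 1))" by simp
  qed (use Lp1[OF that] Fi_m[OF that] in \<open>auto simp: Lp_def\<close>)
  have D_int: "integrable lborel (\<lambda>x. max 0 (v x) powr p * \<psi> x)" if "v \<in> V" "\<psi> \<in> V" for v \<psi>
  proof (rule Holder_integral(1)[of "(p + 1) / p" "p + 1"])
    have e: "\<bar>max 0 (v x) powr p\<bar> powr ((p + 1) / p) = max 0 (v x) powr (p + 1)" for x
      using p by (simp add: powr_powr)
    show "Lp ((p + 1) / p) (\<lambda>x. max 0 (v x) powr p)"
      unfolding Lp_def e using Fi_int[OF that(1)] V_measurable[OF that(1)] p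
        integrable_mult_left[of "p + 1" lborel "Fi v"] by (simp add: Fi_def)
    show "1 / ((p + 1) / p) + 1 / (p + 1) = 1" using p by (simp add: add_divide_distrib[symmetric])
  qed (use p Lp1 that in auto)
  have J_lower: "- B\<^sup>2 / 2 \<le> J v" if "v \<in> V" for v
  proof -
    have "0 \<le> c * (LBINT x. Fi v x)" using c Fi_nonneg by simp
    moreover have "L v \<le> B * nrm v" using B(2)[OF that] by simp
    moreover have "0 \<le> (nrm v - B)\<^sup>2" by simp
    then have "B * nrm v \<le> (E v v) / 2 + B\<^sup>2 / 2"
      using sum_squares_bound[of B "nrm v"] nrm_sq[of v] by simp
    ultimately show ?thesis by (simp add: J_def)
  qed
  define I where "I = Inf (J ` V)"
  have bdd: "bdd_below (J ` V)" using J_lower by (intro bdd_belowI2) auto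
  have I_le: "I \<le> J v" if "v \<in> V" for v unfolding I_def using bdd that by (intro cInf_lower) auto
  have "\<exists>v\<in>V. J v < I + 1 / real (Suc k)" for k
  proof -
    have "J ` V \<noteq> {}" using V_zero by blast
    then show ?thesis
      using cInf_lessD[of "J ` V" "I + 1 / real (Suc k)"] unfolding I_def by auto
  qed
  then obtain v where v: "\<And>k. v k \<in> V" "\<And>k. J (v k) < I + 1 / real (Suc k)" by metis
  \<comment> \<open>Parallelogram law for the quadratic part and convexity for the rest: two almost
    minimisers are close in energy, so every minimising sequence is Cauchy.\<close>
  have mid: "E (\<lambda>x. a x - b x) (\<lambda>x. a x - b x) \<le> 4 * (J a - I) + 4 * (J b - I)" if a: "a \<in> V" and b: "b \<in> V" for a b
  proof -
    define m where "m x = 1 / 2 * (a x + b x)" for x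
    have mV: "m \<in> V" unfolding m_def by (intro V_cmult V_add a b)
    have "2 * Fi m x \<le> Fi a x + Fi b x" for x
      using powr_tangent[OF p(1), of "m x" "a x"] powr_tangent[OF p(1), of "m x" "b x"]
      unfolding Fi_def m_def by (simp add: field_simps)
    then have "(LBINT x. 2 * Fi m x) \<le> (LBINT x. Fi a x + Fi b x)"
      using Fi_int[OF mV] Fi_int[OF a] Fi_int[OF b] by (intro integral_mono) auto
    then have "2 * (LBINT x. Fi m x) \<le> (LBINT x. Fi a x) + (LBINT x. Fi b x)"
      using Fi_int[OF mV] Fi_int[OF a] Fi_int[OF b] by simp
    then have F: "2 * (c * (LBINT x. Fi m x)) \<le> c * (LBINT x. Fi a x) + c * (LBINT x. Fi b x)"
      by (drule_tac mult_left_mono[OF _ c]) (simp add: distrib_left mult.left_commute)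
    have "E m m = 1 / 4 * (E a a + 2 * E a b + E b b)"
      unfolding m_def E_cmult_left E_cmult_right
      using a b by (simp add: E_add_left E_add_right V_add E_sym[of b a])
    moreover have "E (\<lambda>x. a x - b x) (\<lambda>x. a x - b x) = E a a - 2 * E a b + E b b"
      using a b by (simp add: E_diff_left E_diff_right V_diff E_sym[of b a])
    moreover have "L m = 1 / 2 * (L a + L b)" unfolding m_def using a b by (simp only: L_cmult L_add)
    ultimately have "2 * J m \<le> J a + J b - E (\<lambda>x. a x - b x) (\<lambda>x. a x - b x) / 4"
      using F unfolding J_def by (simp only:) argo
    then show ?thesis using I_le[OF mV] by simp
  qed
  have Cau: "\<exists>N. \<forall>i\<ge>N. \<forall>j\<ge>N. nrm (\<lambda>x. v i x - v j x) < e" if "e > 0" for e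
  proof -
    have "0 < e\<^sup>2 / 8" using that by simp
    then obtain N where N: "1 / real (Suc N) < e\<^sup>2 / 8"
      using reals_Archimedean[of "e\<^sup>2 / 8"] unfolding inverse_eq_divide by blast
    have JN: "J (v i) - I < e\<^sup>2 / 8" if "N \<le> i" for i
    proof -
      have "1 / real (Suc i) \<le> 1 / real (Suc N)" using that by (intro divide_left_mono) auto
      then show ?thesis using v(2)[of i] N by linarith
    qed
    have "nrm (\<lambda>x. v i x - v j x) < e" if "N \<le> i" "N \<le> j" for i j
    proof -
      have "(nrm (\<lambda>x. v i x - v j x))\<^sup>2 < e\<^sup>2"
      proof -
        have a: "J (v i) - I < e\<^sup>2 / 8" "J (v j) - I < e\<^sup>2 / 8"
          using JN[OF that(1)] JN[OF that(2)] by simp_all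
        show ?thesis unfolding nrm_sq
          by (rule le_less_trans[OF mid[OF v(1) v(1)]]) (use add_strict_mono[OF mult_strict_left_mono[OF a(1), of 4] mult_strict_left_mono[OF a(2), of 4]] in \<open>(simp; fail) | argo | (smt (verit))\<close>)
      qed
      then show ?thesis using \<open>e > 0\<close> by (simp add: power2_less_imp_less)
    qed
    then show ?thesis by blast
  qed
  obtain w r where w: "w \<in> V" "(\<lambda>j. nrm (\<lambda>x. v j x - w x)) \<longlonglongrightarrow> 0"
    "strict_mono (r :: nat => nat)" "AE x in lborel. (\<lambda>j. v (r j) x) \<longlonglongrightarrow> w x"
    using V_complete[of v, OF v(1) Cau] by blast
  have JI: "(\<lambda>k. J (v k)) \<longlonglongrightarrow> I"
  proof (rule real_tendsto_sandwich[of "\<lambda>_. I" _ _ "\<lambda>k. I + 1 / real (Suc k)"])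
    have "(\<lambda>k. I + 1 / real (Suc k)) \<longlonglongrightarrow> I + 0"
      by (intro tendsto_add tendsto_const LIMSEQ_Suc[OF lim_1_over_n])
    then show "(\<lambda>k. I + 1 / real (Suc k)) \<longlonglongrightarrow> I" by simp
  qed (use v I_le in \<open>auto intro!: always_eventually less_imp_le\<close>)
  have EI: "(\<lambda>k. E (v k) (v k)) \<longlonglongrightarrow> E w w"
    using tendsto_power[OF nrm_tendsto[OF v(1) w(1,2)], of 2] by (simp add: nrm_sq)
  have LI: "(\<lambda>k. L (v k)) \<longlonglongrightarrow> L w"
  proof -
    have "(\<lambda>j. L (v j) - L w) \<longlonglongrightarrow> 0"
    proof (rule Lim_null_comparison)
      show "\<forall>\<^sub>F j in sequentially. norm (L (v j) - L w) \<le> B * nrm (\<lambda>x. v j x - w x)"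
        using B(2)[OF V_diff[OF v(1) w(1)]] L_diff[OF v(1) w(1)] by simp
      show "(\<lambda>j. B * nrm (\<lambda>x. v j x - w x)) \<longlonglongrightarrow> 0"
        using tendsto_mult[OF tendsto_const[of B] w(2)] by simp
    qed
    then show ?thesis by (simp add: LIM_zero_cancel)
  qed
  \<comment> \<open>The limit of the nonlinear terms is forced by the limits of the other three.
    Fatou's lemma only bounds the nonlinear term of \<open>w\<close> by it, which is the direction
    that minimality needs.\<close>
  define \<Lambda> where "\<Lambda> = I - E w w / 2 + L w"
  have cF: "(\<lambda>k. c * (LBINT x. Fi (v k) x)) \<longlonglongrightarrow> \<Lambda>"
  proof -
    have "(\<lambda>k. J (v k) - E (v k) (v k) / 2 + L (v k)) \<longlonglongrightarrow> \<Lambda>"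
      unfolding \<Lambda>_def by (intro tendsto_add tendsto_diff tendsto_divide JI EI LI tendsto_const) simp
    then show ?thesis by (simp add: J_def)
  qed
  have "c * (LBINT x. Fi w x) \<le> \<Lambda>"
  proof (cases "c = 0")
    case True
    then show ?thesis using cF LIMSEQ_const_iff[of "0::real" \<Lambda>] by simp
  next
    case False
    then have c0: "0 < c" using c by simp
    show ?thesis
    proof (rule field_le_epsilon)
      fix e :: real assume e: "0 < e"
      have "\<forall>\<^sub>F k in sequentially. c * (LBINT x. Fi (v (r k)) x) < \<Lambda> + e"
        using order_tendstoD(2)[OF LIMSEQ_subseq_LIMSEQ[OF cF w(3), unfolded o_def], of "\<Lambda> + e"] e by simp
      then have ev: "\<forall>\<^sub>F k in sequentially. (LBINT x. Fi (v (r k)) x) \<le> (\<Lambda> + e) / c"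
        by eventually_elim (use c0 in \<open>simp add: field_simps\<close>)
      have "AE x in lborel. (\<lambda>k. Fi (v (r k)) x) \<longlonglongrightarrow> Fi w x"
        using w(4)
      proof eventually_elim
        case (elim x)
        then show ?case unfolding Fi_def using p by (intro tendsto_intros tendsto_powr2 tendsto_max) auto
      qed
      then have "(LBINT x. Fi w x) \<le> (\<Lambda> + e) / c"
        using Fatou_bound(2)[of "\<lambda>k. Fi (v (r k))" lborel "Fi w" "(\<Lambda> + e) / c"] Fi_m Fi_int Fi_nonneg v(1) w(1) ev by auto
      then show "c * (LBINT x. Fi w x) \<le> \<Lambda> + e" using c0 by (simp add: field_simps)
    qed
  qed
  then have Jw: "J w \<le> I" by (simp add: J_def \<Lambda>_def)
  \<comment> \<open>First variation from one side, with the tangent taken at the perturbed point;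
    equality follows by applying it to \<open>\<psi>\<close> and to its negative.\<close>
  have half: "0 \<le> c * (LBINT x. max 0 (w x) powr p * \<psi> x) + E w \<psi> - L \<psi>" if \<psi>: "\<psi> \<in> V" for \<psi>
  proof -
    define t :: "nat => real" where "t k = 1 / real (Suc k)" for k
    have t0: "0 < t k" "t k \<le> 1" for k by (auto simp: t_def)
    have tlim: "t \<longlonglongrightarrow> 0" unfolding t_def by (rule LIMSEQ_Suc[OF lim_1_over_n])
    define D where "D k x = max 0 (w x + t k * \<psi> x) powr p * \<psi> x" for k x
    have wk: "(\<lambda>x. w x + t k * \<psi> x) \<in> V" for k by (intro V_add V_cmult w(1) \<psi>)
    have Dint: "integrable lborel (D k)" for k unfolding D_def by (rule D_int[OF wk \<psi>])
    have ge: "0 \<le> c * (LBINT x. D k x) + E w \<psi> + t k / 2 * E \<psi> \<psi> - L \<psi>" for k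
    proof -
      have "Fi (\<lambda>x. w x + t k * \<psi> x) x \<le> Fi w x + t k * D k x" for x
        using powr_tangent[OF p(1), of "w x + t k * \<psi> x" "w x"] by (simp add: Fi_def D_def algebra_simps)
      then have "(LBINT x. Fi (\<lambda>x. w x + t k * \<psi> x) x) \<le> (LBINT x. Fi w x + t k * D k x)"
        using Fi_int[OF wk] Fi_int[OF w(1)] Dint by (intro integral_mono) auto
      also have "\<dots> = (LBINT x. Fi w x) + t k * (LBINT x. D k x)"
        using Fi_int[OF w(1)] Dint by simp
      finally have "c * (LBINT x. Fi (\<lambda>x. w x + t k * \<psi> x) x) \<le> c * ((LBINT x. Fi w x) + t k * (LBINT x. D k x))"
        using c by (rule mult_left_mono)
      moreover have "E (\<lambda>x. w x + t k * \<psi> x) (\<lambda>x. w x + t k * \<psi> x) = E w w + 2 * t k * E w \<psi> + t k * t k * E \<psi> \<psi>"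
      proof -
        note k = V_cmult[OF \<psi>, of "t k"]
        show ?thesis
          unfolding E_add_left[OF w(1) k V_add[OF w(1) k]] E_add_right[OF w(1) k w(1)] E_add_right[OF w(1) k k]
            E_cmult_left E_cmult_right E_sym[of \<psi> w] by (simp add: algebra_simps)
      qed
      moreover have "L (\<lambda>x. w x + t k * \<psi> x) = L w + t k * L \<psi>"
        using L_add[OF w(1) V_cmult[OF \<psi>]] L_cmult by simp
      moreover have "J w \<le> J (\<lambda>x. w x + t k * \<psi> x)" by (rule order_trans[OF Jw I_le[OF wk]])
      ultimately have "0 \<le> t k * (c * (LBINT x. D k x) + E w \<psi> + t k / 2 * E \<psi> \<psi> - L \<psi>)"
        by (simp add: J_def algebra_simps add_divide_distrib)
      then show ?thesis using t0[of k] by (simp add: zero_le_mult_iff)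
    qed
    have "(\<lambda>k. LBINT x. D k x) \<longlonglongrightarrow> (LBINT x. max 0 (w x) powr p * \<psi> x)"
    proof (rule integral_dominated_convergence[where w="\<lambda>x. (\<bar>w x\<bar> + \<bar>\<psi> x\<bar>) powr (p + 1)"])
      show "(\<lambda>x. max 0 (w x) powr p * \<psi> x) \<in> borel_measurable lborel" using D_int[OF w(1) \<psi>] by simp
      show "D k \<in> borel_measurable lborel" for k using Dint[of k] by simp
      have "Lp (p + 1) (\<lambda>x. \<bar>w x\<bar> + \<bar>\<psi> x\<bar>)"
        using Lp_add[of "p + 1" "\<lambda>x. \<bar>w x\<bar>" "\<lambda>x. \<bar>\<psi> x\<bar>"] Lp1[OF w(1)] Lp1[OF \<psi>] p by (auto simp: Lp_def)
      then show "integrable lborel (\<lambda>x. (\<bar>w x\<bar> + \<bar>\<psi> x\<bar>) powr (p + 1))" by (simp add: Lp_def)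
      show "AE x in lborel. (\<lambda>k. D k x) \<longlonglongrightarrow> max 0 (w x) powr p * \<psi> x"
      proof (rule AE_I2)
        fix x
        have "(\<lambda>k. w x + t k * \<psi> x) \<longlonglongrightarrow> w x + 0 * \<psi> x" by (intro tendsto_intros tlim)
        then show "(\<lambda>k. D k x) \<longlonglongrightarrow> max 0 (w x) powr p * \<psi> x"
          unfolding D_def using p by (intro tendsto_mult tendsto_powr2 tendsto_max tendsto_const) auto
      qed
      fix k
      show "AE x in lborel. norm (D k x) \<le> (\<bar>w x\<bar> + \<bar>\<psi> x\<bar>) powr (p + 1)"
      proof (rule AE_I2)
        fix x
        have "\<bar>t k * \<psi> x\<bar> \<le> \<bar>\<psi> x\<bar>" using t0[of k] by (simp add: abs_mult mult_left_le_one_le)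
        then have "max 0 (w x + t k * \<psi> x) \<le> \<bar>w x\<bar> + \<bar>\<psi> x\<bar>" by linarith
        then have "max 0 (w x + t k * \<psi> x) powr p \<le> (\<bar>w x\<bar> + \<bar>\<psi> x\<bar>) powr p" using p by (intro powr_mono2) auto
        then have "norm (D k x) \<le> (\<bar>w x\<bar> + \<bar>\<psi> x\<bar>) powr p * (\<bar>w x\<bar> + \<bar>\<psi> x\<bar>)"
          unfolding D_def by (simp add: abs_mult mult_mono)
        also have "\<dots> = (\<bar>w x\<bar> + \<bar>\<psi> x\<bar>) powr (p + 1)"
          using powr_mult_base[of "\<bar>w x\<bar> + \<bar>\<psi> x\<bar>" p] by (simp add: mult.commute add.commute)
        finally show "norm (D k x) \<le> (\<bar>w x\<bar> + \<bar>\<psi> x\<bar>) powr (p + 1)" .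
      qed
    qed
    then have "(\<lambda>k. c * (LBINT x. D k x) + E w \<psi> + t k / 2 * E \<psi> \<psi> - L \<psi>) \<longlonglongrightarrow>
        c * (LBINT x. max 0 (w x) powr p * \<psi> x) + E w \<psi> + 0 / 2 * E \<psi> \<psi> - L \<psi>"
      by (intro tendsto_intros tlim) auto
    then have "0 \<le> c * (LBINT x. max 0 (w x) powr p * \<psi> x) + E w \<psi> + 0 / 2 * E \<psi> \<psi> - L \<psi>"
      by (rule LIMSEQ_le_const) (use ge in auto)
    then show ?thesis by simp
  qed
  have "c * (LBINT x. max 0 (w x) powr p * \<psi> x) + E w \<psi> = L \<psi>" if \<psi>: "\<psi> \<in> V" for \<psi>
  proof -
    have "(LBINT x. max 0 (w x) powr p * ((-1) * \<psi> x)) = - (LBINT x. max 0 (w x) powr p * \<psi> x)"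
      by simp
    then show ?thesis
      using half[OF \<psi>] half[OF V_cmult[OF \<psi>, of "-1"]] L_cmult[of "-1" \<psi>] E_cmult_right[of w "-1" \<psi>] by simp
  qed
  then show ?thesis using that[of w] w(1) D_int unfolding L_def by blast
qed

end

section \<open>Smooth bump functions\<close>

text \<open>The polynomial parameter makes the family closed under differentiation, so a single
  derivative lemma yields smoothness of every order, including at 0.\<close>

definition flat_exp :: "real poly => real => real" where
  "flat_exp P t = (if 0 < t then poly P (1 / t) * exp (- (1 / t)) else 0)"

text \<open>With \<open>s = 1 / t\<close>, the factor \<open>[:0, 0, 1:]\<close> is the
  \<open>s\<^sup>2\<close> of the chain rule, and \<open>P - pderiv P\<close> comes from
  differentiating \<open>poly P s * exp (- s)\<close>, up to sign.\<close>

definition flat_deriv :: "real poly => real poly" where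
  "flat_deriv P = [:0, 0, 1:] * (P - pderiv P)"

lemma poly_times_exp_tendsto_0: "((\<lambda>s. poly R s * exp (- s)) \<longlongrightarrow> (0::real)) at_top"
proof -
  have "((\<lambda>s. \<Sum>i\<le>degree R. coeff R i * (s ^ i / exp s)) \<longlongrightarrow> (\<Sum>i\<le>degree R. coeff R i * 0)) at_top"
    by (intro tendsto_sum tendsto_mult tendsto_const tendsto_power_div_exp_0)
  then show ?thesis by (simp add: poly_altdef sum_distrib_right exp_minus divide_inverse mult.assoc)
qed

lemma flat_exp_deriv: "(flat_exp P has_real_derivative flat_exp (flat_deriv P) t) (at t)"
proof -
  consider "t < 0" | "t = 0" | "0 < t" by linarith
  then show ?thesis
  proof cases
    case 1
    have "((\<lambda>_. 0) has_real_derivative 0) (at t)" by simp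
    then have "(flat_exp P has_real_derivative 0) (at t)"
      by (rule has_field_derivative_transform_within_open[of _ _ _ "{..<0}"]) (use 1 in \<open>auto simp: flat_exp_def\<close>)
    then show ?thesis using 1 by (simp add: flat_exp_def)
  next
    case 3
    have "((\<lambda>t. poly P (1 / t) * exp (- (1 / t))) has_real_derivative
        (poly (pderiv P) (1 / t) * (- 1 / t\<^sup>2)) * exp (- (1 / t)) + exp (- (1 / t)) * (1 / t\<^sup>2) * poly P (1 / t)) (at t)"
      using 3 by (auto intro!: derivative_eq_intros DERIV_chain2[OF poly_DERIV] simp: power2_eq_square field_simps)
    also have "(poly (pderiv P) (1 / t) * (- 1 / t\<^sup>2)) * exp (- (1 / t)) + exp (- (1 / t)) * (1 / t\<^sup>2) * poly P (1 / t) = flat_exp (flat_deriv P) t"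
      using 3 by (simp add: flat_exp_def flat_deriv_def power2_eq_square algebra_simps)
    finally show ?thesis
      by (rule has_field_derivative_transform_within_open[of _ _ _ "{0<..}"]) (use 3 in \<open>auto simp: flat_exp_def\<close>)
  next
    case 2
    have "((\<lambda>h. flat_exp P h / h) \<longlongrightarrow> 0) (at_right 0)"
    proof (rule Lim_transform_eventually)
      show "((\<lambda>h. poly (pCons 0 P) (inverse h) * exp (- inverse h)) \<longlongrightarrow> (0::real)) (at_right 0)"
        by (rule filterlim_compose[OF poly_times_exp_tendsto_0 filterlim_inverse_at_top_right])
      show "\<forall>\<^sub>F h in at_right (0::real). poly (pCons 0 P) (inverse h) * exp (- inverse h) = flat_exp P h / h"
        by (rule eventually_at_rightI[of 0 1]) (auto simp: flat_exp_def inverse_eq_divide)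
    qed
    moreover have "((\<lambda>h. flat_exp P h / h) \<longlongrightarrow> 0) (at_left 0)"
      by (rule Lim_transform_eventually[OF tendsto_const])
         (rule eventually_at_leftI[of "-1"], auto simp: flat_exp_def)
    ultimately have "((\<lambda>h. flat_exp P h / h) \<longlongrightarrow> 0) (at 0)" by (simp add: filterlim_split_at)
    then show ?thesis using 2 by (simp add: has_field_derivative_iff flat_exp_def)
  qed
qed

text \<open>A class of functions whose directional derivatives lie in the class again. Smoothness
  then needs one induction on the order, instead of product and chain rules at each order of
  \<open>Ck\<close>.\<close>

inductive smooth_alg :: "('a::euclidean_space => real) => bool" where
  const: "smooth_alg (\<lambda>_. c)"
| inner: "smooth_alg (\<lambda>x. x \<bullet> b)"
| add: "smooth_alg f ==> smooth_alg g ==> smooth_alg (\<lambda>x. f x + g x)"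
| mult: "smooth_alg f ==> smooth_alg g ==> smooth_alg (\<lambda>x. f x * g x)"
| flat: "smooth_alg f ==> smooth_alg (\<lambda>x. flat_exp P (f x))"

lemma smooth_alg_deriv:
  assumes "smooth_alg f"
  shows "\<exists>f'. (\<forall>x. (f has_derivative f' x) (at x)) \<and> (\<forall>v. smooth_alg (\<lambda>x. f' x v))"
  using assms
proof induction
  case (const c)
  show ?case by (rule exI[of _ "\<lambda>_ _. 0"]) (auto intro: smooth_alg.const)
next
  case (inner b)
  show ?case by (rule exI[of _ "\<lambda>_ v. v \<bullet> b"]) (auto intro: smooth_alg.const intro!: derivative_eq_intros)
next
  case (add f g)
  then obtain f' g' where "\<forall>x. (f has_derivative f' x) (at x)" "\<forall>v. smooth_alg (\<lambda>x. f' x v)"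
     "\<forall>x. (g has_derivative g' x) (at x)" "\<forall>v. smooth_alg (\<lambda>x. g' x v)" by blast
  then show ?case
    by (intro exI[of _ "\<lambda>x v. f' x v + g' x v"]) (auto intro: smooth_alg.add intro!: derivative_eq_intros)
next
  case (mult f g)
  then obtain f' g' where "\<forall>x. (f has_derivative f' x) (at x)" "\<forall>v. smooth_alg (\<lambda>x. f' x v)"
     "\<forall>x. (g has_derivative g' x) (at x)" "\<forall>v. smooth_alg (\<lambda>x. g' x v)" by blast
  then show ?case using mult.hyps
    by (intro exI[of _ "\<lambda>x v. f x * g' x v + f' x v * g x"])
       (auto intro!: smooth_alg.add smooth_alg.mult has_derivative_mult)
next
  case (flat f P)
  then obtain f' where f': "\<forall>x. (f has_derivative f' x) (at x)" "\<forall>v. smooth_alg (\<lambda>x. f' x v)" by blast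
  have "((\<lambda>x. flat_exp P (f x)) has_derivative (\<lambda>v. flat_exp (flat_deriv P) (f x) * f' x v)) (at x)" for x
    using has_derivative_compose[OF f'(1)[rule_format, of x] flat_exp_deriv[of P "f x", unfolded has_field_derivative_def]] .
  then show ?case using f' flat.hyps
    by (intro exI[of _ "\<lambda>x v. flat_exp (flat_deriv P) (f x) * f' x v"])
       (auto intro!: smooth_alg.mult smooth_alg.flat)
qed

lemma Ck_Suc_has_derivative:
  assumes "\<And>x. (f has_derivative f' x) (at x)" "\<And>v. Ck k UNIV (\<lambda>x. f' x v)"
  shows "Ck (Suc k) UNIV f"
proof -
  have "frechet_derivative f (at x) = f' x" for x using frechet_derivative_at[OF assms(1)] by simp
  then show ?thesis using assms by (auto simp: differentiable_on_def differentiable_def)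
qed

lemma smooth_alg_smooth: assumes "smooth_alg f" shows "smooth_on UNIV f"
proof -
  have "Ck k UNIV f" for k using assms
  proof (induction k arbitrary: f)
    case 0
    obtain f' where "\<forall>x. (f has_derivative f' x) (at x)" using smooth_alg_deriv[OF 0] by blast
    then show ?case by (auto intro!: continuous_at_imp_continuous_on dest: has_derivative_continuous)
  next
    case (Suc k)
    obtain f' where "\<forall>x. (f has_derivative f' x) (at x)" "\<forall>v. smooth_alg (\<lambda>x. f' x v)" using smooth_alg_deriv[OF Suc.prems] by blast
    then show ?case using Suc.IH by (intro Ck_Suc_has_derivative) auto
  qed
  then show ?thesis by (simp add: smooth_on_def)
qed

lemma smooth_alg_sum: "finite I ==> (\<And>i. i \<in> I ==> smooth_alg (f i)) ==> smooth_alg (\<lambda>x. \<Sum>i\<in>I. f i x)"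
  by (induction I rule: finite_induct) (auto intro: smooth_alg.const smooth_alg.add)

lemma smooth_alg_scale: "smooth_alg f ==> smooth_alg (\<lambda>x. f (c *\<^sub>R x))"
proof (induction rule: smooth_alg.induct)
  case (inner b)
  have "smooth_alg (\<lambda>x. c * (x \<bullet> b))" by (intro smooth_alg.mult smooth_alg.const smooth_alg.inner)
  then show ?case by simp
qed (auto intro: smooth_alg.intros)

text \<open>The standard bump is written as a polynomial in the coordinates so that it belongs to
  \<open>smooth_alg\<close>. The centre \<open>e\<close> is left free because at the boundary
  mollification has to shift functions into \<Omega>.\<close>

lemma exists_smooth_kernel:
  fixes e :: "'a::euclidean_space" assumes "0 < \<delta>"
  obtains \<kappa> M where "smooth_alg \<kappa>" "\<And>v. 0 \<le> \<kappa> v" "\<And>v. \<kappa> v \<le> M" "\<And>v. v \<notin> ball e \<delta> ==> \<kappa> v = 0"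
    "integrable lborel \<kappa>" "(LBINT v. \<kappa> v) = 1"
proof -
  define k0 where "k0 v = flat_exp 1 (\<delta>\<^sup>2 + (\<Sum>b\<in>Basis. (-1) * ((v \<bullet> b + (- (e \<bullet> b))) * (v \<bullet> b + (- (e \<bullet> b))))))" for v :: 'a
  have alg: "smooth_alg k0" unfolding k0_def
    by (intro smooth_alg.flat smooth_alg.add smooth_alg.const smooth_alg_sum smooth_alg.mult smooth_alg.inner) auto
  have k0: "k0 v = flat_exp 1 (\<delta>\<^sup>2 - (dist e v)\<^sup>2)" for v
  proof -
    have "(dist e v)\<^sup>2 = (\<Sum>b\<in>Basis. ((e - v) \<bullet> b) * ((e - v) \<bullet> b))"
      by (simp add: dist_norm power2_norm_eq_inner flip: euclidean_inner)
    also have "\<dots> = (\<Sum>b\<in>Basis. (v \<bullet> b + (- (e \<bullet> b))) * (v \<bullet> b + (- (e \<bullet> b))))"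
      by (intro sum.cong refl) (simp add: inner_diff_left square_diff_square_factored left_diff_distrib right_diff_distrib mult.commute)
    finally show ?thesis unfolding k0_def by (simp add: sum_negf)
  qed
  have pos: "0 < k0 v" if "v \<in> ball e \<delta>" for v
    using that assms power_strict_mono[of "dist e v" \<delta> 2] by (auto simp: k0 flat_exp_def)
  have zero: "k0 v = 0" if "v \<notin> ball e \<delta>" for v
    using that assms power_mono[of \<delta> "dist e v" 2] by (simp add: k0 flat_exp_def not_less)
  have nonneg: "0 \<le> k0 v" for v by (simp add: k0 flat_exp_def)
  have le1: "k0 v \<le> 1" for v by (simp add: k0 flat_exp_def)
  have "continuous_on UNIV k0" using smooth_alg_smooth[OF alg] unfolding smooth_on_def by (metis Ck.simps(1))
  then have [measurable]: "k0 \<in> borel_measurable borel" by (rule borel_measurable_continuous_onI)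
  have int: "integrable lborel k0"
  proof (rule Bochner_Integration.integrable_bound[of _ "indicator (ball e \<delta>) :: 'a => real"])
    show "integrable lborel (indicator (ball e \<delta>) :: 'a => real)"
      using emeasure_lborel_ball_finite[of e \<delta>] by (intro integrable_real_indicator) auto
    show "AE v in lborel. norm (k0 v) \<le> norm (indicator (ball e \<delta>) v :: real)"
      using le1 nonneg zero by (auto simp: indicator_def)
  qed simp
  define Z where "Z = (LBINT v. k0 v)"
  have "Z \<noteq> 0"
  proof
    assume "Z = 0"
    then have "AE v in lborel. k0 v = 0" unfolding Z_def using integral_nonneg_eq_0_iff_AE[OF int] nonneg by simp
    then have "AE v in lborel. v \<notin> ball e \<delta>" by eventually_elim (use pos in force)
    then have "emeasure lborel (ball e \<delta>) = 0" by (subst (asm) AE_iff_measurable[OF _ refl]) (auto simp: ball_def)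
    then show False using content_ball_pos[OF assms, of e] by (simp add: measure_def)
  qed
  then have Z: "0 < Z" using nonneg by (simp add: Z_def less_le)
  have sm: "smooth_alg (\<lambda>v. 1 / Z * k0 v)" by (intro smooth_alg.mult smooth_alg.const alg)
  show ?thesis
  proof (rule that[of "\<lambda>v. 1 / Z * k0 v" "1 / Z"])
    show "smooth_alg (\<lambda>v. 1 / Z * k0 v)" by (rule sm)
    show "(LBINT v. 1 / Z * k0 v) = 1" using Z unfolding integral_mult_right_zero by (simp add: Z_def)
    show "1 / Z * k0 v \<le> 1 / Z" for v using le1[of v] Z by (simp add: divide_right_mono)
  qed (use Z nonneg zero int in auto)
qed

section \<open>Convolution with smooth kernels\<close>

definition cutoff_smooth :: "('a::euclidean_space => real) => bool" where
  "cutoff_smooth \<eta> \<longleftrightarrow> smooth_on UNIV \<eta> \<and> (\<exists>R. \<forall>x. R < norm x \<longrightarrow> \<eta> x = 0)"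

definition conv :: "('a::euclidean_space => real) => ('a => real) => 'a => real" where
  "conv \<eta> f x = (LBINT y. \<eta> (x - y) * f y)"

lemma smooth_on_UNIV_deriv:
  assumes "smooth_on UNIV \<eta>"
  shows "(\<eta> has_derivative frechet_derivative \<eta> (at x)) (at x)"
    and "smooth_on UNIV (\<lambda>x. frechet_derivative \<eta> (at x) v)"
    and "continuous_on UNIV \<eta>"
proof -
  have Ck: "Ck k UNIV \<eta>" for k using assms by (simp add: smooth_on_def)
  from Ck[of 1] show "(\<eta> has_derivative frechet_derivative \<eta> (at x)) (at x)"
    by (auto simp: differentiable_on_def frechet_derivative_works[symmetric])
  show "smooth_on UNIV (\<lambda>x. frechet_derivative \<eta> (at x) v)"
    unfolding smooth_on_def using Ck[of "Suc k" for k] by simp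
  show "continuous_on UNIV \<eta>" using Ck[of 0] by simp
qed

lemma cutoff_smooth_deriv:
  assumes "cutoff_smooth \<eta>"
  shows "cutoff_smooth (\<lambda>x. frechet_derivative \<eta> (at x) v)"
proof -
  obtain R where R: "\<And>x. R < norm x ==> \<eta> x = 0" using assms by (auto simp: cutoff_smooth_def)
  have "frechet_derivative \<eta> (at x) v = 0" if "R < norm x" for x
  proof -
    have "((\<lambda>_. 0) has_derivative (\<lambda>_. 0)) (at x)" by simp
    then have "(\<eta> has_derivative (\<lambda>_. 0)) (at x)"
    proof (rule has_derivative_transform_within_open)
      show "open {x. R < norm x}" by (intro open_Collect_less continuous_intros)
    qed (use that R in auto)
    then show ?thesis using frechet_derivative_at by (metis)
  qed
  then show ?thesis using assms smooth_on_UNIV_deriv(2) by (auto simp: cutoff_smooth_def)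
qed

lemma cutoff_smooth_uniformly_continuous:
  assumes "cutoff_smooth \<eta>"
  shows "uniformly_continuous_on UNIV \<eta>"
proof -
  obtain R where R: "\<And>x. R < norm x ==> \<eta> x = 0" using assms by (auto simp: cutoff_smooth_def)
  have "continuous_on UNIV \<eta>" using assms smooth_on_UNIV_deriv(3) by (auto simp: cutoff_smooth_def)
  then have uc: "uniformly_continuous_on (cball 0 (R + 1)) \<eta>"
    by (intro compact_uniformly_continuous) (auto intro: continuous_on_subset)
  show ?thesis
    unfolding uniformly_continuous_on_def
  proof (intro allI impI)
    fix e :: real assume "0 < e"
    then obtain d where d: "0 < d" "\<And>x x'. x \<in> cball 0 (R + 1) ==> x' \<in> cball 0 (R + 1) ==> dist x' x < d ==> dist (\<eta> x') (\<eta> x) < e"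
      using uc unfolding uniformly_continuous_on_def by metis
    show "\<exists>d>0. \<forall>x\<in>UNIV. \<forall>x'\<in>UNIV. dist x' x < d \<longrightarrow> dist (\<eta> x') (\<eta> x) < e"
    proof (intro exI[of _ "min d 1"] conjI ballI impI)
      fix x x' :: 'a assume *: "dist x' x < min d 1"
      show "dist (\<eta> x') (\<eta> x) < e"
      proof (cases "norm x \<le> R + 1 \<and> norm x' \<le> R + 1")
        case True then show ?thesis using d * by simp
      next
        case False
        have "norm x \<le> norm x' + dist x' x" "norm x' \<le> norm x + dist x' x"
          by (metis dist_norm norm_triangle_sub dist_commute)+
        then have "R < norm x" "R < norm x'" using False * by auto
        then show ?thesis using R \<open>0 < e\<close> by simp
      qed
    qed (use d in auto)
  qed
qed

lemma cutoff_smooth_bounded: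
  assumes "cutoff_smooth \<eta>" obtains M where "\<And>x. \<bar>\<eta> x\<bar> \<le> M"
proof -
  obtain R where R: "\<And>x. R < norm x ==> \<eta> x = 0" using assms by (auto simp: cutoff_smooth_def)
  have "continuous_on UNIV \<eta>" using assms smooth_on_UNIV_deriv(3) by (auto simp: cutoff_smooth_def)
  then have "bounded (\<eta> ` cball 0 R)"
    by (intro compact_imp_bounded compact_continuous_image) (auto intro: continuous_on_subset)
  then obtain M where M: "\<And>x. x \<in> cball 0 R ==> \<bar>\<eta> x\<bar> \<le> M" unfolding bounded_iff by force
  show ?thesis
  proof (rule that[of "max M 0"])
    fix x show "\<bar>\<eta> x\<bar> \<le> max M 0" using M[of x] R[of x] by (cases "norm x \<le> R") auto
  qed
qed

lemma cutoff_smooth_measurable: "cutoff_smooth \<eta> ==> \<eta> \<in> borel_measurable borel"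
  by (auto simp: cutoff_smooth_def intro: borel_measurable_continuous_onI smooth_on_UNIV_deriv(3))

lemma conv_integrable:
  assumes \<eta>: "cutoff_smooth \<eta>" and f: "integrable lborel f"
  shows "integrable lborel (\<lambda>y. \<eta> (x - y) * f y)"
proof -
  obtain M where M: "\<And>x. \<bar>\<eta> x\<bar> \<le> M" using cutoff_smooth_bounded[OF \<eta>] by blast
  note [measurable] = cutoff_smooth_measurable[OF \<eta>] borel_measurable_integrable[OF f]
  have "integrable lborel (\<lambda>y. M * f y)" using f by simp
  then show ?thesis
  proof (rule Bochner_Integration.integrable_bound)
    have "\<bar>\<eta> (x - y)\<bar> * \<bar>f y\<bar> \<le> \<bar>M\<bar> * \<bar>f y\<bar>" for y
      using M[of "x - y"] by (intro mult_right_mono) auto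
    then show "AE y in lborel. norm (\<eta> (x - y) * f y) \<le> norm (M * f y)" by (simp add: abs_mult)
  qed simp
qed

text \<open>Partial derivatives of a compactly supported smooth function are uniformly continuous,
  so the mean value theorem makes the first-order remainder uniform. This allows differentiation
  under the integral for merely integrable \<open>f\<close>.\<close>

lemma cutoff_smooth_uniform_derivative:
  assumes \<eta>: "cutoff_smooth \<eta>" and e: "0 < e"
  obtains d where "0 < d" "\<And>x h. norm h < d ==> \<bar>\<eta> (x + h) - \<eta> x - frechet_derivative \<eta> (at x) h\<bar> \<le> e * norm h"
proof -
  define D where "D x = frechet_derivative \<eta> (at x)" for x
  define e' where "e' = e / real (DIM('a))"
  have e': "0 < e'" using e by (simp add: e'_def)
  have D: "(\<eta> has_derivative D x) (at x)" for x
    using smooth_on_UNIV_deriv(1) \<eta> by (auto simp: D_def cutoff_smooth_def)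
  have "\<exists>d>0. \<forall>x x'. dist x' x < d \<longrightarrow> dist (D x' b) (D x b) < e'" for b
    using cutoff_smooth_uniformly_continuous[OF cutoff_smooth_deriv[OF \<eta>, of b]] e'
    unfolding uniformly_continuous_on_def D_def by auto
  then obtain d where d: "\<And>b. 0 < d b" "\<And>b x x'. dist x' x < d b ==> dist (D x' b) (D x b) < e'" by metis
  define d0 where "d0 = Min (d ` (Basis :: 'a set))"
  have d0: "0 < d0" "\<And>b. b \<in> Basis ==> d0 \<le> d b" unfolding d0_def using d by (auto simp: Min_gr_iff)
  show ?thesis
  proof (rule that[OF d0(1)])
    fix x h :: 'a assume h: "norm h < d0"
    have der: "((\<lambda>t. \<eta> (x + t *\<^sub>R h)) has_real_derivative D (x + t *\<^sub>R h) h) (at t)" for t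
    proof -
      have "((\<lambda>t. x + t *\<^sub>R h) has_derivative (\<lambda>s. s *\<^sub>R h)) (at t)" by (auto intro!: derivative_eq_intros)
      from has_derivative_compose[OF this D] have "((\<lambda>t. \<eta> (x + t *\<^sub>R h)) has_derivative (\<lambda>s. D (x + t *\<^sub>R h) (s *\<^sub>R h))) (at t)" .
      moreover have "D y (s *\<^sub>R h) = D y h * s" for y s
        using linear_scale[OF has_derivative_linear[OF D]] by simp
      ultimately show ?thesis by (simp add: has_field_derivative_def)
    qed
    obtain t where t: "0 < t" "t < 1" "\<eta> (x + h) - \<eta> x = D (x + t *\<^sub>R h) h"
      using MVT2[of 0 1 "\<lambda>t. \<eta> (x + t *\<^sub>R h)" "\<lambda>t. D (x + t *\<^sub>R h) h"] der by auto
    have lin: "D y h = (\<Sum>b\<in>Basis. (h \<bullet> b) * D y b)" for y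
    proof -
      have "D y h = D y (\<Sum>b\<in>Basis. (h \<bullet> b) *\<^sub>R b)" by (simp add: euclidean_representation)
      also have "\<dots> = (\<Sum>b\<in>Basis. (h \<bullet> b) * D y b)"
        using linear_sum[OF has_derivative_linear[OF D[of y]], of "\<lambda>b. (h \<bullet> b) *\<^sub>R b" Basis]
          linear_scale[OF has_derivative_linear[OF D[of y]]] by simp
      finally show ?thesis .
    qed
    have "\<bar>D (x + t *\<^sub>R h) h - D x h\<bar> = \<bar>\<Sum>b\<in>Basis. (h \<bullet> b) * (D (x + t *\<^sub>R h) b - D x b)\<bar>"
      unfolding lin by (simp add: sum_subtractf[symmetric] right_diff_distrib)
    also have "\<dots> \<le> (\<Sum>b\<in>Basis. \<bar>h \<bullet> b\<bar> * \<bar>D (x + t *\<^sub>R h) b - D x b\<bar>)"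
      by (rule order_trans[OF sum_abs]) (simp add: abs_mult)
    also have "\<dots> \<le> (\<Sum>b\<in>(Basis::'a set). norm h * e')"
    proof (intro sum_mono mult_mono)
      fix b :: 'a assume b: "b \<in> Basis"
      show "\<bar>h \<bullet> b\<bar> \<le> norm h" using b by (rule Basis_le_norm)
      have "dist (x + t *\<^sub>R h) x \<le> norm h" using t by (simp add: dist_norm mult_left_le_one_le)
      then have "dist (x + t *\<^sub>R h) x < d b" using h d0(2)[OF b] by linarith
      then show "\<bar>D (x + t *\<^sub>R h) b - D x b\<bar> \<le> e'" using d(2) by (simp add: dist_real_def less_imp_le)
    qed auto
    also have "\<dots> = e * norm h" by (simp add: e'_def)
    finally show "\<bar>\<eta> (x + h) - \<eta> x - frechet_derivative \<eta> (at x) h\<bar> \<le> e * norm h"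
      unfolding t D_def[symmetric] .
  qed
qed

lemma conv_has_derivative:
  assumes \<eta>: "cutoff_smooth \<eta>" and f: "integrable lborel f"
  shows "(conv \<eta> f has_derivative (\<lambda>v. conv (\<lambda>x. frechet_derivative \<eta> (at x) v) f x)) (at x)"
  unfolding has_derivative_at_alt
proof (intro conjI allI impI)
  have lin: "linear (frechet_derivative \<eta> (at y))" for y
    using smooth_on_UNIV_deriv(1) \<eta> by (auto simp: cutoff_smooth_def intro: has_derivative_linear)
  have int: "integrable lborel (\<lambda>y. frechet_derivative \<eta> (at (x - y)) v * f y)" for v
    by (rule conv_integrable[OF cutoff_smooth_deriv[OF \<eta>] f])
  have "linear (\<lambda>v. conv (\<lambda>x. frechet_derivative \<eta> (at x) v) f x)"
    using int linear_add[OF lin] linear_scale[OF lin]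
    by (intro linearI) (simp_all add: conv_def distrib_right mult.assoc)
  then show "bounded_linear (\<lambda>v. conv (\<lambda>x. frechet_derivative \<eta> (at x) v) f x)"
    by (simp add: linear_conv_bounded_linear)
  fix e :: real assume e: "0 < e"
  define N where "N = (LBINT y. \<bar>f y\<bar>)"
  have N: "0 \<le> N" by (simp add: N_def)
  obtain d where d: "0 < d" "\<And>x h. norm h < d ==> \<bar>\<eta> (x + h) - \<eta> x - frechet_derivative \<eta> (at x) h\<bar> \<le> e / (N + 1) * norm h"
    using cutoff_smooth_uniform_derivative[OF \<eta>, of "e / (N + 1)"] e N by auto
  show "\<exists>d>0. \<forall>y. norm (y - x) < d \<longrightarrow>
        norm (conv \<eta> f y - conv \<eta> f x - conv (\<lambda>z. frechet_derivative \<eta> (at z) (y - x)) f x) \<le> e * norm (y - x)"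
  proof (intro exI[of _ d] conjI allI impI d)
    fix x' assume h: "norm (x' - x) < d"
    define h' where "h' = x' - x"
    have xy: "x - y + h' = x' - y" for y by (simp add: h'_def)
    have "conv \<eta> f x' - conv \<eta> f x - conv (\<lambda>z. frechet_derivative \<eta> (at z) (x' - x)) f x
      = (LBINT y. (\<eta> ((x - y) + h') - \<eta> (x - y) - frechet_derivative \<eta> (at (x - y)) h') * f y)"
      using conv_integrable[OF \<eta> f, of x'] conv_integrable[OF \<eta> f, of x] int[of h']
      unfolding xy conv_def h'_def left_diff_distrib by simp
    also have "norm \<dots> \<le> (LBINT y. e / (N + 1) * norm h' * \<bar>f y\<bar>)"
    proof (rule order_trans[OF integral_norm_bound integral_mono])
      show "integrable lborel (\<lambda>y. norm ((\<eta> (x - y + h') - \<eta> (x - y) - frechet_derivative \<eta> (at (x - y)) h') * f y))"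
        apply (rule integrable_norm)
        using conv_integrable[OF \<eta> f, of x'] conv_integrable[OF \<eta> f, of x] int[of h']
        unfolding xy h'_def left_diff_distrib by simp
      show "integrable lborel (\<lambda>y. e / (N + 1) * norm h' * \<bar>f y\<bar>)" using f by simp
      show "norm ((\<eta> (x - y + h') - \<eta> (x - y) - frechet_derivative \<eta> (at (x - y)) h') * f y) \<le> e / (N + 1) * norm h' * \<bar>f y\<bar>" for y
        using d(2)[of h' "x - y"] h unfolding real_norm_def abs_mult h'_def by (intro mult_right_mono) auto
    qed
    also have "\<dots> = e * (N / (N + 1)) * norm h'" by (simp add: N_def)
    also have "\<dots> \<le> e * 1 * norm h'" using e N by (intro mult_right_mono mult_left_mono) auto
    finally show "norm (conv \<eta> f x' - conv \<eta> f x - conv (\<lambda>z. frechet_derivative \<eta> (at z) (x' - x)) f x) \<le> e * norm (x' - x)"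
      by (simp add: h'_def)
  qed
qed

lemma conv_smooth:
  assumes \<eta>: "cutoff_smooth \<eta>" and f: "integrable lborel f"
  shows "smooth_on UNIV (conv \<eta> f)"
proof -
  have "Ck k UNIV (conv \<eta> f)" for k using \<eta>
  proof (induction k arbitrary: \<eta>)
    case 0
    show ?case using conv_has_derivative[OF 0 f]
      by (auto intro!: continuous_at_imp_continuous_on dest: has_derivative_continuous)
  next
    case (Suc k)
    show ?case
      by (rule Ck_Suc_has_derivative[OF conv_has_derivative[OF Suc.prems f]])
         (rule Suc.IH[OF cutoff_smooth_deriv[OF Suc.prems]])
  qed
  then show ?thesis by (simp add: smooth_on_def)
qed

context frac
begin

section \<open>Averaging with kernels\<close>

text \<open>The mollification error at \<open>x\<close> is a weighted mean of
  \<open>f y - f x\<close>, hence at most \<open>M\<close> times the oscillation in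
  \<open>ball_deviation\<close>.\<close>

lemma sqD_conv_le:
  fixes \<kappa> :: "'a => real"
  assumes f: "f \<in> borel_measurable lborel" "integrable lborel f"
    and \<kappa>: "cutoff_smooth \<kappa>" "\<And>v. 0 \<le> \<kappa> v" "\<And>v. \<kappa> v \<le> M" "\<And>v. r \<le> norm v ==> \<kappa> v = 0"
      "integrable lborel \<kappa>" "(LBINT v. \<kappa> v) = 1" and r: "0 < r"
  shows "ennreal ((conv \<kappa> f x - f x)\<^sup>2) \<le> ennreal (M\<^sup>2 * (omg * r powr nn * r powr \<nu>)) * sqD f x"
proof -
  note [measurable] = f(1) cutoff_smooth_measurable[OF \<kappa>(1)]
  have M0: "0 \<le> M" using \<kappa>(2)[of 0] \<kappa>(3)[of 0] by linarith
  have i1: "integrable lborel (\<lambda>y. \<kappa> (x - y) * f y)" by (rule conv_integrable[OF \<kappa>(1) f(2)])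
  have nn1: "(\<integral>\<^sup>+y. ennreal (\<kappa> (x - y)) \<partial>lborel) = 1"
    using nn_integral_lborel_reflect[of "\<lambda>v. ennreal (\<kappa> v)" x] \<kappa> by (simp add: nn_integral_eq_integral)
  have i2: "integrable lborel (\<lambda>y. \<kappa> (x - y))"
    using nn1 \<kappa>(2) by (intro integrableI_nonneg) auto
  have "ennreal (LBINT y. \<kappa> (x - y)) = 1" using nn1 i2 \<kappa>(2) by (simp add: nn_integral_eq_integral)
  then have i3: "(LBINT y. \<kappa> (x - y)) = 1" by (simp add: ennreal_eq_1)
  have eq: "conv \<kappa> f x - f x = (LBINT y. \<kappa> (x - y) * (f y - f x))"
  proof -
    have "(LBINT y. \<kappa> (x - y) * (f y - f x)) = (LBINT y. \<kappa> (x - y) * f y - \<kappa> (x - y) * f x)"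
      by (simp add: right_diff_distrib)
    also have "\<dots> = conv \<kappa> f x - (LBINT y. \<kappa> (x - y) * f x)"
      unfolding conv_def using i1 i2 by (intro Bochner_Integration.integral_diff) auto
    finally show ?thesis using i3 by simp
  qed
  have "ennreal \<bar>conv \<kappa> f x - f x\<bar> \<le> (\<integral>\<^sup>+y. ennreal \<bar>\<kappa> (x - y) * (f y - f x)\<bar> \<partial>lborel)"
    unfolding eq using integral_norm_bound_ennreal[of lborel "\<lambda>y. \<kappa> (x - y) * (f y - f x)"] i1 i2
    by (simp add: right_diff_distrib)
  also have "\<dots> \<le> (\<integral>\<^sup>+y. ennreal M * (ennreal \<bar>f x - f y\<bar> * indicator (ball x r) y) \<partial>lborel)"
  proof (intro nn_integral_mono)
    fix y
    show "ennreal \<bar>\<kappa> (x - y) * (f y - f x)\<bar> \<le> ennreal M * (ennreal \<bar>f x - f y\<bar> * indicator (ball x r) y)"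
    proof (cases "y \<in> ball x r")
      case True
      have "\<bar>\<kappa> (x - y) * (f y - f x)\<bar> \<le> M * \<bar>f x - f y\<bar>"
        unfolding abs_mult using \<kappa>(2,3)[of "x - y"] by (simp add: abs_minus_commute mult_right_mono)
      then show ?thesis using True M0 by (simp add: ennreal_leI flip: ennreal_mult)
    next
      case False
      then have "\<kappa> (x - y) = 0" by (intro \<kappa>(4)) (simp add: dist_norm)
      then show ?thesis by simp
    qed
  qed
  also have "\<dots> = ennreal M * (\<integral>\<^sup>+y. ennreal \<bar>f x - f y\<bar> * indicator (ball x r) y \<partial>lborel)"
  proof -
    have [measurable]: "ball x r \<in> sets borel" by simp
    show ?thesis by (rule nn_integral_cmult) measurable
  qed
  finally have "(ennreal \<bar>conv \<kappa> f x - f x\<bar>)\<^sup>2 \<le> (ennreal M * (\<integral>\<^sup>+y. ennreal \<bar>f x - f y\<bar> * indicator (ball x r) y \<partial>lborel))\<^sup>2"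
    by (intro power_mono) auto
  also have "\<dots> = (ennreal M)\<^sup>2 * (\<integral>\<^sup>+y. ennreal \<bar>f x - f y\<bar> * indicator (ball x r) y \<partial>lborel)\<^sup>2"
    by (rule power_mult_distrib)
  also have "\<dots> \<le> (ennreal M)\<^sup>2 * (ennreal (omg * r powr nn * r powr \<nu>) * sqD f x)"
    using ball_deviation[OF f(1), of r x] r by (intro mult_left_mono) auto
  also have "\<dots> = ennreal (M\<^sup>2 * (omg * r powr nn * r powr \<nu>)) * sqD f x"
    using M0 omg_pos by (simp add: ennreal_power ennreal_mult mult.assoc)
  finally show ?thesis by (simp add: ennreal_power)
qed

lemma V_square_integrable: "f \<in> V ==> integrable lborel (\<lambda>x. (f x)\<^sup>2)"
  using V_Lp(1)[of f 2] qs_gt_2 by (simp add: Lp_def powr_numeral)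

lemma conv_close:
  assumes f: "f \<in> V"
    and \<kappa>: "cutoff_smooth \<kappa>" "\<And>v. 0 \<le> \<kappa> v" "\<And>v. \<kappa> v \<le> M" "\<And>v. r \<le> norm v ==> \<kappa> v = 0"
      "integrable lborel \<kappa>" "(LBINT v. \<kappa> v) = 1" and r: "0 < r"
  shows "integrable lborel (\<lambda>x. (conv \<kappa> f x - f x)\<^sup>2)"
    and "(LBINT x. (conv \<kappa> f x - f x)\<^sup>2) \<le> M\<^sup>2 * (omg * r powr nn * r powr \<nu>) * (2 / cn * E f f)"
proof -
  have cm [measurable]: "conv \<kappa> f \<in> borel_measurable borel"
    using conv_smooth[OF \<kappa>(1) V_integrable[OF f]] by (intro borel_measurable_continuous_onI smooth_on_UNIV_deriv(3))
  note [measurable] = V_measurable[OF f]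
  have le: "(\<integral>\<^sup>+x. ennreal ((conv \<kappa> f x - f x)\<^sup>2) \<partial>lborel) \<le> ennreal (M\<^sup>2 * (omg * r powr nn * r powr \<nu>) * (2 / cn * E f f))"
  proof -
    have "(\<integral>\<^sup>+x. ennreal ((conv \<kappa> f x - f x)\<^sup>2) \<partial>lborel) \<le> (\<integral>\<^sup>+x. ennreal (M\<^sup>2 * (omg * r powr nn * r powr \<nu>)) * sqD f x \<partial>lborel)"
      by (intro nn_integral_mono sqD_conv_le V_measurable V_integrable f \<kappa> r)
    also have "\<dots> = ennreal (M\<^sup>2 * (omg * r powr nn * r powr \<nu>)) * ennreal (2 / cn * E f f)"
      unfolding nn_integral_sqD[OF f, symmetric] by (rule nn_integral_cmult) measurable
    also have "\<dots> = ennreal (M\<^sup>2 * (omg * r powr nn * r powr \<nu>) * (2 / cn * E f f))"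
      using omg_pos cn_pos E_nonneg[of f] by (intro ennreal_mult[symmetric]) auto
    finally show ?thesis .
  qed
  then show i: "integrable lborel (\<lambda>x. (conv \<kappa> f x - f x)\<^sup>2)"
    by (intro integrableI_nonneg) (auto simp: less_top[symmetric] top_unique)
  have "ennreal (LBINT x. (conv \<kappa> f x - f x)\<^sup>2) \<le> ennreal (M\<^sup>2 * (omg * r powr nn * r powr \<nu>) * (2 / cn * E f f))"
    using le i by (simp add: nn_integral_eq_integral)
  then show "(LBINT x. (conv \<kappa> f x - f x)\<^sup>2) \<le> M\<^sup>2 * (omg * r powr nn * r powr \<nu>) * (2 / cn * E f f)"
    using omg_pos cn_pos E_nonneg[of f] by (subst (asm) ennreal_le_iff) auto
qed

lemma conv_translate:
  fixes \<kappa> f :: "'a => real"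
  assumes \<kappa>: "cutoff_smooth \<kappa>" "\<And>v. 0 \<le> \<kappa> v" and f: "integrable lborel f"
  shows "integrable lborel (\<lambda>v. \<kappa> v * f (x - v))" "conv \<kappa> f x = (LBINT v. \<kappa> v * f (x - v))"
proof -
  note [measurable] = cutoff_smooth_measurable[OF \<kappa>(1)] borel_measurable_integrable[OF f]
  have *: "(LBINT y. g (x - y)) = (LBINT y. g y)" "integrable lborel (\<lambda>y. g (x - y)) \<longleftrightarrow> integrable lborel g"
    if [measurable]: "g \<in> borel_measurable borel" for g :: "'a => real"
  proof -
    have d: "(lborel :: 'a measure) = distr lborel borel (\<lambda>y. x - y)"
      using lborel_affine[of "-1" x] by (simp add: density_1)
    show "(LBINT y. g (x - y)) = (LBINT y. g y)"
      by (subst (2) d) (simp add: integral_distr)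
    show "integrable lborel (\<lambda>y. g (x - y)) \<longleftrightarrow> integrable lborel g"
      by (subst (2) d) (simp add: integrable_distr_eq)
  qed
  have [measurable]: "f \<in> borel_measurable borel" using f by simp
  have g: "(\<lambda>v. \<kappa> v * f (x - v)) \<in> borel_measurable borel" by measurable
  show "integrable lborel (\<lambda>v. \<kappa> v * f (x - v))"
    using *(2)[OF g] conv_integrable[OF \<kappa>(1) f, of x] by simp
  show "conv \<kappa> f x = (LBINT v. \<kappa> v * f (x - v))"
    using *(1)[OF g] by (simp add: conv_def)
qed

text \<open>Mollification averages translates, all of which have the energy of \<open>f\<close>; the
  square of an average is treated by Cauchy--Schwarz with weight \<open>sqrt (\<kappa> v)\<close>.
  This keeps the smooth approximations bounded in energy.\<close>

lemma conv_energy: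
  assumes f: "f \<in> V"
    and \<kappa>: "cutoff_smooth \<kappa>" "\<And>v. 0 \<le> \<kappa> v" "integrable lborel \<kappa>" "(LBINT v. \<kappa> v) = 1"
  shows "integrable PP (\<lambda>z. (dq (conv \<kappa> f) z)\<^sup>2)" "E (conv \<kappa> f) (conv \<kappa> f) \<le> E f f"
proof -
  have cm [measurable]: "conv \<kappa> f \<in> borel_measurable borel"
    using conv_smooth[OF \<kappa>(1) V_integrable[OF f]] by (intro borel_measurable_continuous_onI smooth_on_UNIV_deriv(3))
  note km [measurable] = cutoff_smooth_measurable[OF \<kappa>(1)]
  have fm [measurable]: "f \<in> borel_measurable borel" using V_measurable[OF f] by simp
  have pt: "ennreal ((dq (conv \<kappa> f) (x, y))\<^sup>2) \<le> (\<integral>\<^sup>+v. ennreal (\<kappa> v) * ennreal ((dq f (x - v, y - v))\<^sup>2) \<partial>lborel)" for x y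
  proof -
    define N where "N = norm (x - y) powr (\<nu> / 2)"
    note i = conv_translate[OF \<kappa>(1,2) V_integrable[OF f]]
    have e: "dq (conv \<kappa> f) (x, y) = (LBINT v. \<kappa> v * dq f (x - v, y - v))"
    proof -
      have "(LBINT v. \<kappa> v * dq f (x - v, y - v)) = (LBINT v. (\<kappa> v * f (x - v) - \<kappa> v * f (y - v)) / N)"
        by (intro Bochner_Integration.integral_cong refl) (simp add: dq_def N_def right_diff_distrib)
      also have "\<dots> = (conv \<kappa> f x - conv \<kappa> f y) / N" using i by simp
      also have "\<dots> = dq (conv \<kappa> f) (x, y)" by (simp add: dq_def N_def)
      finally show ?thesis by simp
    qed
    have int: "integrable lborel (\<lambda>v. \<kappa> v * dq f (x - v, y - v))"
    proof -
      have "integrable lborel (\<lambda>v. (\<kappa> v * f (x - v) - \<kappa> v * f (y - v)) / N)" using i by simp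
      then show ?thesis by (simp add: dq_def N_def right_diff_distrib)
    qed
    have [measurable]: "(\<lambda>v. dq f (x - v, y - v)) \<in> borel_measurable borel" unfolding dq_def by simp
    have "ennreal \<bar>dq (conv \<kappa> f) (x, y)\<bar> \<le> (\<integral>\<^sup>+v. ennreal \<bar>\<kappa> v * dq f (x - v, y - v)\<bar> \<partial>lborel)"
      unfolding e using integral_norm_bound_ennreal[OF int] by simp
    also have "\<dots> = (\<integral>\<^sup>+v. ennreal (sqrt (\<kappa> v)) * ennreal (sqrt (\<kappa> v) * \<bar>dq f (x - v, y - v)\<bar>) \<partial>lborel)"
      using \<kappa>(2) by (intro nn_integral_cong) (simp add: abs_mult flip: ennreal_mult mult.assoc)
    finally have "(ennreal \<bar>dq (conv \<kappa> f) (x, y)\<bar>)\<^sup>2 \<le> (\<integral>\<^sup>+v. ennreal (sqrt (\<kappa> v)) * ennreal (sqrt (\<kappa> v) * \<bar>dq f (x - v, y - v)\<bar>) \<partial>lborel)\<^sup>2"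
      by (intro power_mono) auto
    also have "\<dots> \<le> (\<integral>\<^sup>+v. (ennreal (sqrt (\<kappa> v)))\<^sup>2 \<partial>lborel) * (\<integral>\<^sup>+v. (ennreal (sqrt (\<kappa> v) * \<bar>dq f (x - v, y - v)\<bar>))\<^sup>2 \<partial>lborel)"
      by (rule Cauchy_Schwarz_nn_integral) measurable
    also have "(\<integral>\<^sup>+v. (ennreal (sqrt (\<kappa> v)))\<^sup>2 \<partial>lborel) = 1"
      using \<kappa> by (simp add: ennreal_power nn_integral_eq_integral)
    also have "(\<integral>\<^sup>+v. (ennreal (sqrt (\<kappa> v) * \<bar>dq f (x - v, y - v)\<bar>))\<^sup>2 \<partial>lborel) = (\<integral>\<^sup>+v. ennreal (\<kappa> v) * ennreal ((dq f (x - v, y - v))\<^sup>2) \<partial>lborel)"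
      using \<kappa>(2) by (intro nn_integral_cong) (simp add: ennreal_power power_mult_distrib flip: ennreal_mult)
    finally show ?thesis by (simp add: ennreal_power)
  qed
  have [measurable]: "(\<lambda>(v, z). dq f (fst z - v, snd z - v)) \<in> borel_measurable (borel \<Otimes>\<^sub>M PP)"
    unfolding dq_def by (simp add: case_prod_beta)
  have inv: "(\<integral>\<^sup>+z. ennreal ((dq f (fst z - v, snd z - v))\<^sup>2) \<partial>PP) = (\<integral>\<^sup>+z. ennreal ((dq f z)\<^sup>2) \<partial>PP)" for v
  proof -
    have [measurable]: "(\<lambda>z. dq f (fst z - v, snd z - v)) \<in> borel_measurable PP" unfolding dq_def by simp
    have "(\<integral>\<^sup>+z. ennreal ((dq f (fst z - v, snd z - v))\<^sup>2) \<partial>PP) = (\<integral>\<^sup>+x. \<integral>\<^sup>+y. ennreal ((dq f (x - v, y - v))\<^sup>2) \<partial>lborel \<partial>lborel)"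
      by (subst lborel.nn_integral_fst[symmetric]) auto
    also have "\<dots> = (\<integral>\<^sup>+x. sqD f (x - v) \<partial>lborel)"
    proof (rule nn_integral_cong)
      fix x
      show "(\<integral>\<^sup>+y. ennreal ((dq f (x - v, y - v))\<^sup>2) \<partial>lborel) = sqD f (x - v)"
        unfolding sqD_def dq_sq
        using nn_integral_lborel_shift[of "\<lambda>y. ennreal ((f (x - v) - f y)\<^sup>2 / norm (x - v - y) powr \<nu>)" "- v"] by simp
    qed
    also have "\<dots> = (\<integral>\<^sup>+x. sqD f x \<partial>lborel)"
      using nn_integral_lborel_shift[of "sqD f" "- v"] sqD_measurable[of f] by simp
    finally show ?thesis using nn_integral_dq[of f] by simp
  qed
  have "(\<integral>\<^sup>+z. ennreal ((dq (conv \<kappa> f) z)\<^sup>2) \<partial>PP) \<le> (\<integral>\<^sup>+z. \<integral>\<^sup>+v. ennreal (\<kappa> v) * ennreal ((dq f (fst z - v, snd z - v))\<^sup>2) \<partial>lborel \<partial>PP)"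
  proof (intro nn_integral_mono)
    fix z :: "'a \<times> 'a"
    show "ennreal ((dq (conv \<kappa> f) z)\<^sup>2) \<le> (\<integral>\<^sup>+v. ennreal (\<kappa> v) * ennreal ((dq f (fst z - v, snd z - v))\<^sup>2) \<partial>lborel)"
      using pt[of "fst z" "snd z"] by simp
  qed
  also have "\<dots> = (\<integral>\<^sup>+v. \<integral>\<^sup>+z. ennreal (\<kappa> v) * ennreal ((dq f (fst z - v, snd z - v))\<^sup>2) \<partial>PP \<partial>lborel)"
  proof -
    interpret PL: pair_sigma_finite "lborel :: 'a measure" PP
      unfolding pair_sigma_finite_def using lborel.sigma_finite_measure_axioms sigma_finite_pair_measure[OF lborel.sigma_finite_measure_axioms lborel.sigma_finite_measure_axioms] by blast
    show ?thesis by (rule PL.Fubini') measurable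
  qed
  also have "\<dots> = (\<integral>\<^sup>+v. ennreal (\<kappa> v) * (\<integral>\<^sup>+z. ennreal ((dq f z)\<^sup>2) \<partial>PP) \<partial>lborel)"
  proof (intro nn_integral_cong)
    fix v
    have [measurable]: "(\<lambda>z. dq f (fst z - v, snd z - v)) \<in> borel_measurable PP" unfolding dq_def by simp
    show "(\<integral>\<^sup>+z. ennreal (\<kappa> v) * ennreal ((dq f (fst z - v, snd z - v))\<^sup>2) \<partial>PP) = ennreal (\<kappa> v) * (\<integral>\<^sup>+z. ennreal ((dq f z)\<^sup>2) \<partial>PP)"
      unfolding inv[of v, symmetric] by (rule nn_integral_cmult) measurable
  qed
  also have "\<dots> = (\<integral>\<^sup>+z. ennreal ((dq f z)\<^sup>2) \<partial>PP)"
    using \<kappa> by (simp add: nn_integral_multc nn_integral_eq_integral)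
  also have "\<dots> = ennreal (\<integral>z. (dq f z)\<^sup>2 \<partial>PP)" using V_dq[OF f] by (intro nn_integral_eq_integral) auto
  finally have le: "(\<integral>\<^sup>+z. ennreal ((dq (conv \<kappa> f) z)\<^sup>2) \<partial>PP) \<le> ennreal (\<integral>z. (dq f z)\<^sup>2 \<partial>PP)" .
  then show i: "integrable PP (\<lambda>z. (dq (conv \<kappa> f) z)\<^sup>2)"
    by (intro integrableI_nonneg) (auto simp: less_top[symmetric] top_unique)
  have "ennreal (\<integral>z. (dq (conv \<kappa> f) z)\<^sup>2 \<partial>PP) \<le> ennreal (\<integral>z. (dq f z)\<^sup>2 \<partial>PP)"
    using le i by (simp add: nn_integral_eq_integral)
  then have "(\<integral>z. (dq (conv \<kappa> f) z)\<^sup>2 \<partial>PP) \<le> (\<integral>z. (dq f z)\<^sup>2 \<partial>PP)" by (subst (asm) ennreal_le_iff) auto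
  then show "E (conv \<kappa> f) (conv \<kappa> f) \<le> E f f" unfolding E_self using cn_pos by (intro mult_left_mono) auto
qed

section \<open>Lipschitz cutoffs and the truncated kernel\<close>

lemma V_boundedI:
  assumes [measurable]: "f \<in> borel_measurable lborel" and "\<And>x. x \<notin> \<Omega> ==> f x = 0" "\<And>x. \<bar>f x\<bar> \<le> B"
    and "integrable PP (\<lambda>z. (dq f z)\<^sup>2)"
  shows "f \<in> V"
proof -
  have "Lp qs (\<lambda>x. B * indicator \<Omega> x)" using Omega_finite by (intro Lp_cmult Lp_indicator) auto
  then have "Lp qs f"
  proof (rule Lp_bound(1))
    have "\<bar>f x\<bar> \<le> \<bar>B * indicator \<Omega> x\<bar>" for x using assms(2,3)[of x] by (cases "x \<in> \<Omega>") auto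
    then show "AE x in lborel. \<bar>f x\<bar> \<le> \<bar>B * indicator \<Omega> x\<bar>" by simp
  qed (use qs_gt_2 in auto)
  then show ?thesis using assms by (simp add: V_iff)
qed

text \<open>The mass of the kernel once its singularity is tamed by
  \<open>min 1 ((norm z)\<^sup>2)\<close>, the factor gained from squared increments of a bounded
  Lipschitz function.\<close>

definition ker_mass :: real where
  "ker_mass = enn2real (\<integral>\<^sup>+z. ennreal (min 1 ((norm z)\<^sup>2) / norm z powr \<nu>) \<partial>(lborel :: 'a measure))"


lemma ker_mass_nonneg: "0 \<le> ker_mass" by (simp add: ker_mass_def)

lemma ker_mass: "(\<integral>\<^sup>+x. ennreal (min 1 ((norm (x - y))\<^sup>2) / norm (x - y) powr \<nu>) \<partial>lborel) = ennreal ker_mass"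
  "(\<integral>\<^sup>+x. ennreal (min 1 ((norm (y - x))\<^sup>2) / norm (y - x) powr \<nu>) \<partial>lborel) = ennreal ker_mass"
  for y :: 'a
proof -
  have "(\<integral>\<^sup>+z. ennreal (min 1 ((norm z)\<^sup>2) / norm z powr \<nu>) \<partial>(lborel :: 'a measure)) = ennreal ker_mass"
    using singular_kernel_finite[OF s0 s1, where 'a='a, folded nn_def, folded \<nu>_def] unfolding ker_mass_def by simp
  then show "(\<integral>\<^sup>+x. ennreal (min 1 ((norm (x - y))\<^sup>2) / norm (x - y) powr \<nu>) \<partial>lborel) = ennreal ker_mass"
    "(\<integral>\<^sup>+x. ennreal (min 1 ((norm (y - x))\<^sup>2) / norm (y - x) powr \<nu>) \<partial>lborel) = ennreal ker_mass"
    using nn_integral_lborel_shift[of "\<lambda>z::'a. ennreal (min 1 ((norm z)\<^sup>2) / norm z powr \<nu>)" "- y"]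
      nn_integral_lborel_reflect[of "\<lambda>z::'a. ennreal (min 1 ((norm z)\<^sup>2) / norm z powr \<nu>)" y] by simp_all
qed

definition wk :: "'a \<times> 'a => real" where
  "wk z = min 1 ((norm (fst z - snd z))\<^sup>2) / norm (fst z - snd z) powr \<nu>"

lemma wk_measurable [measurable]: "wk \<in> borel_measurable PP"
  unfolding wk_def by measurable

lemma wk_nonneg: "0 \<le> wk z" by (simp add: wk_def)

lemma weighted_square:
  assumes [measurable]: "g \<in> borel_measurable lborel" and g: "integrable lborel (\<lambda>x. (g x)\<^sup>2)"
  shows "integrable PP (\<lambda>z. (g (fst z))\<^sup>2 * wk z)" "(\<integral>z. (g (fst z))\<^sup>2 * wk z \<partial>PP) = ker_mass * (LBINT x. (g x)\<^sup>2)"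
    "integrable PP (\<lambda>z. (g (snd z))\<^sup>2 * wk z)" "(\<integral>z. (g (snd z))\<^sup>2 * wk z \<partial>PP) = ker_mass * (LBINT x. (g x)\<^sup>2)"
proof -
  have gm [measurable]: "g \<in> borel_measurable borel" using assms by simp
  have i: "(\<integral>\<^sup>+x. ennreal ((g x)\<^sup>2) * ennreal ker_mass \<partial>lborel) = ennreal (ker_mass * (LBINT x. (g x)\<^sup>2))"
  proof -
    have "(\<integral>\<^sup>+x. ennreal ((g x)\<^sup>2) * ennreal ker_mass \<partial>lborel) = (\<integral>\<^sup>+x. ennreal ((g x)\<^sup>2) \<partial>lborel) * ennreal ker_mass"
      by (rule nn_integral_multc) measurable
    also have "\<dots> = ennreal (LBINT x. (g x)\<^sup>2) * ennreal ker_mass" using g by (simp add: nn_integral_eq_integral)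
    finally show ?thesis using ker_mass_nonneg by (simp add: mult.commute flip: ennreal_mult)
  qed
  have "(\<integral>\<^sup>+z. ennreal ((g (fst z))\<^sup>2 * wk z) \<partial>PP) = (\<integral>\<^sup>+x. \<integral>\<^sup>+y. ennreal ((g x)\<^sup>2 * wk (x, y)) \<partial>lborel \<partial>lborel)"
    by (subst lborel.nn_integral_fst[symmetric]) auto
  also have "\<dots> = (\<integral>\<^sup>+x. ennreal ((g x)\<^sup>2) * ennreal ker_mass \<partial>lborel)"
  proof (intro nn_integral_cong)
    fix x
    have "(\<integral>\<^sup>+y. ennreal ((g x)\<^sup>2 * wk (x, y)) \<partial>lborel) = (\<integral>\<^sup>+y. ennreal ((g x)\<^sup>2) * ennreal (min 1 ((norm (x - y))\<^sup>2) / norm (x - y) powr \<nu>) \<partial>lborel)"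
      by (intro nn_integral_cong) (simp add: wk_def flip: ennreal_mult)
    also have "\<dots> = ennreal ((g x)\<^sup>2) * ennreal ker_mass"
      unfolding ker_mass(2)[of x, symmetric] by (rule nn_integral_cmult) measurable
    finally show "(\<integral>\<^sup>+y. ennreal ((g x)\<^sup>2 * wk (x, y)) \<partial>lborel) = ennreal ((g x)\<^sup>2) * ennreal ker_mass" .
  qed
  finally have 1: "(\<integral>\<^sup>+z. ennreal ((g (fst z))\<^sup>2 * wk z) \<partial>PP) = ennreal (ker_mass * (LBINT x. (g x)\<^sup>2))"
    using i by simp
  have "(\<integral>\<^sup>+z. ennreal ((g (snd z))\<^sup>2 * wk z) \<partial>PP) = (\<integral>\<^sup>+y. \<integral>\<^sup>+x. ennreal ((g y)\<^sup>2 * wk (x, y)) \<partial>lborel \<partial>lborel)"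
    by (subst lborel_pair.nn_integral_snd[symmetric]) auto
  also have "\<dots> = (\<integral>\<^sup>+x. ennreal ((g x)\<^sup>2) * ennreal ker_mass \<partial>lborel)"
  proof (intro nn_integral_cong)
    fix y
    have "(\<integral>\<^sup>+x. ennreal ((g y)\<^sup>2 * wk (x, y)) \<partial>lborel) = (\<integral>\<^sup>+x. ennreal ((g y)\<^sup>2) * ennreal (min 1 ((norm (x - y))\<^sup>2) / norm (x - y) powr \<nu>) \<partial>lborel)"
      by (intro nn_integral_cong) (simp add: wk_def flip: ennreal_mult)
    also have "\<dots> = ennreal ((g y)\<^sup>2) * ennreal ker_mass"
      unfolding ker_mass(1)[of y, symmetric] by (rule nn_integral_cmult) measurable
    finally show "(\<integral>\<^sup>+x. ennreal ((g y)\<^sup>2 * wk (x, y)) \<partial>lborel) = ennreal ((g y)\<^sup>2) * ennreal ker_mass" .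
  qed
  finally have 2: "(\<integral>\<^sup>+z. ennreal ((g (snd z))\<^sup>2 * wk z) \<partial>PP) = ennreal (ker_mass * (LBINT x. (g x)\<^sup>2))"
    using i by simp
  have nn: "0 \<le> ker_mass * (LBINT x. (g x)\<^sup>2)" using ker_mass_nonneg by simp
  show "integrable PP (\<lambda>z. (g (fst z))\<^sup>2 * wk z)" "(\<integral>z. (g (fst z))\<^sup>2 * wk z \<partial>PP) = ker_mass * (LBINT x. (g x)\<^sup>2)"
    using nn_integral_eq_integrable[of "\<lambda>z. (g (fst z))\<^sup>2 * wk z" PP "ker_mass * (LBINT x. (g x)\<^sup>2)"] 1 nn wk_nonneg by auto
  show "integrable PP (\<lambda>z. (g (snd z))\<^sup>2 * wk z)" "(\<integral>z. (g (snd z))\<^sup>2 * wk z \<partial>PP) = ker_mass * (LBINT x. (g x)\<^sup>2)"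
    using nn_integral_eq_integrable[of "\<lambda>z. (g (snd z))\<^sup>2 * wk z" PP "ker_mass * (LBINT x. (g x)\<^sup>2)"] 2 nn wk_nonneg by auto
qed

lemma Lipschitz_square_le:
  assumes "\<And>x. 0 \<le> \<zeta> x" "\<And>x. \<zeta> x \<le> 1" "\<And>x y. \<bar>\<zeta> x - \<zeta> y\<bar> \<le> L * norm (x - y)"
  shows "(\<zeta> x - \<zeta> y)\<^sup>2 / norm (x - y) powr \<nu> \<le> (1 + L\<^sup>2) * wk (x, y)"
proof -
  have a: "(\<zeta> x - \<zeta> y)\<^sup>2 \<le> 1"
    using assms(1,2)[of x] assms(1,2)[of y] by (simp add: abs_square_le_1 abs_le_iff)
  have b: "(\<zeta> x - \<zeta> y)\<^sup>2 \<le> L\<^sup>2 * (norm (x - y))\<^sup>2"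
    using power_mono[OF assms(3)[of x y] abs_ge_zero, of 2] by (simp add: power_mult_distrib)
  have "(\<zeta> x - \<zeta> y)\<^sup>2 \<le> (1 + L\<^sup>2) * min 1 ((norm (x - y))\<^sup>2)"
  proof (cases "(norm (x - y))\<^sup>2 \<le> 1")
    case True
    then have "L\<^sup>2 * (norm (x - y))\<^sup>2 \<le> (1 + L\<^sup>2) * (norm (x - y))\<^sup>2" by (intro mult_right_mono) auto
    then show ?thesis using True b by (simp add: min_absorb2)
  next
    case False
    then show ?thesis using a zero_le_power2[of L] by (simp add: min_absorb1 add_increasing2)
  qed
  then have "(\<zeta> x - \<zeta> y)\<^sup>2 / norm (x - y) powr \<nu> \<le> ((1 + L\<^sup>2) * min 1 ((norm (x - y))\<^sup>2)) / norm (x - y) powr \<nu>"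
    by (intro divide_right_mono) auto
  then show ?thesis by (simp add: wk_def)
qed

lemma norm_mono_real: "0 \<le> a ==> a \<le> b ==> norm a \<le> norm b" for a b :: real
  by simp

text \<open>Discrete product rule: one part of the increment carries that of \<open>f\<close>, the
  other that of \<open>\<zeta>\<close>, whose square the kernel integrates. It makes the partition
  of unity in \<open>V_induct_test_fun\<close> possible.\<close>

lemma V_mult_Lipschitz:
  assumes f: "f \<in> V" and [measurable]: "\<zeta> \<in> borel_measurable borel"
    and \<zeta>: "\<And>x. 0 \<le> \<zeta> x" "\<And>x. \<zeta> x \<le> 1" "\<And>x y. \<bar>\<zeta> x - \<zeta> y\<bar> \<le> L * norm (x - y)"
  shows "(\<lambda>x. \<zeta> x * f x) \<in> V"
proof -
  note [measurable] = V_measurable[OF f]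
  have "Lp qs (\<lambda>x. \<zeta> x * f x)"
    by (rule Lp_bound(1)[OF V_Lp_qs[OF f]])
       (use qs_gt_2 \<zeta>(1,2) in \<open>auto simp: abs_mult intro!: mult_left_le_one_le\<close>)
  moreover have "integrable PP (\<lambda>z. (dq (\<lambda>x. \<zeta> x * f x) z)\<^sup>2)"
  proof (rule Bochner_Integration.integrable_bound[of _ "\<lambda>z. 2 * (dq f z)\<^sup>2 + 2 * (1 + L\<^sup>2) * ((f (snd z))\<^sup>2 * wk z)"])
    show "integrable PP (\<lambda>z. 2 * (dq f z)\<^sup>2 + 2 * (1 + L\<^sup>2) * ((f (snd z))\<^sup>2 * wk z))"
      using V_dq[OF f] weighted_square(3)[OF V_measurable[OF f] V_square_integrable[OF f]] by simp
    have "(dq (\<lambda>x. \<zeta> x * f x) (x, y))\<^sup>2 \<le> 2 * (dq f (x, y))\<^sup>2 + 2 * (1 + L\<^sup>2) * ((f y)\<^sup>2 * wk (x, y))" for x y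
    proof -
      define N where "N = norm (x - y) powr \<nu>"
      have N: "0 \<le> N" by (simp add: N_def)
      have "(\<zeta> x * f x - \<zeta> y * f y)\<^sup>2 = (\<zeta> x * (f x - f y) + f y * (\<zeta> x - \<zeta> y))\<^sup>2" by (simp add: algebra_simps)
      also have "\<dots> \<le> 2 * (\<zeta> x * (f x - f y))\<^sup>2 + 2 * (f y * (\<zeta> x - \<zeta> y))\<^sup>2"
        using sum_squares_bound[of "\<zeta> x * (f x - f y)" "f y * (\<zeta> x - \<zeta> y)"] by (simp add: power2_sum)
      also have "(\<zeta> x * (f x - f y))\<^sup>2 \<le> 1 * (f x - f y)\<^sup>2"
        unfolding power_mult_distrib using \<zeta>(1,2)[of x] by (intro mult_right_mono) (auto simp: power_le_one)
      finally have "(\<zeta> x * f x - \<zeta> y * f y)\<^sup>2 \<le> 2 * (f x - f y)\<^sup>2 + 2 * (f y)\<^sup>2 * (\<zeta> x - \<zeta> y)\<^sup>2"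
        by (simp add: power_mult_distrib)
      then have "(\<zeta> x * f x - \<zeta> y * f y)\<^sup>2 / N \<le> (2 * (f x - f y)\<^sup>2 + 2 * (f y)\<^sup>2 * (\<zeta> x - \<zeta> y)\<^sup>2) / N"
        using N by (rule divide_right_mono)
      also have "\<dots> = 2 * ((f x - f y)\<^sup>2 / N) + 2 * (f y)\<^sup>2 * ((\<zeta> x - \<zeta> y)\<^sup>2 / N)" by (simp add: add_divide_distrib)
      also have "\<dots> \<le> 2 * ((f x - f y)\<^sup>2 / N) + 2 * (f y)\<^sup>2 * ((1 + L\<^sup>2) * wk (x, y))"
        unfolding N_def using Lipschitz_square_le[OF \<zeta>] by (intro add_left_mono mult_left_mono) auto
      finally show ?thesis unfolding dq_sq N_def by (simp add: algebra_simps)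
    qed
    then have "(dq (\<lambda>x. \<zeta> x * f x) z)\<^sup>2 \<le> 2 * (dq f z)\<^sup>2 + 2 * (1 + L\<^sup>2) * ((f (snd z))\<^sup>2 * wk z)" for z
      by (cases z) (simp only: fst_conv snd_conv)
    then show "AE z in PP. norm ((dq (\<lambda>x. \<zeta> x * f x) z)\<^sup>2) \<le> norm (2 * (dq f z)\<^sup>2 + 2 * (1 + L\<^sup>2) * ((f (snd z))\<^sup>2 * wk z))"
      by (intro AE_I2 norm_mono_real) auto
  qed measurable
  ultimately show ?thesis using V_outside[OF f] by (simp add: V_iff)
qed

lemma V_Lipschitz:
  assumes [measurable]: "\<zeta> \<in> borel_measurable borel"
    and \<zeta>: "\<And>x. 0 \<le> \<zeta> x" "\<And>x. \<zeta> x \<le> 1" "\<And>x y. \<bar>\<zeta> x - \<zeta> y\<bar> \<le> L * norm (x - y)"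
    and out: "\<And>x. x \<notin> \<Omega> ==> \<zeta> x = 0"
  shows "\<zeta> \<in> V"
proof (rule V_boundedI[where B=1])
  define g :: "'a => real" where "g = indicator \<Omega>"
  have gm: "g \<in> borel_measurable lborel" by (simp add: g_def)
  have "(\<lambda>x. (g x)\<^sup>2) = indicator \<Omega>" by (auto simp: g_def indicator_def fun_eq_iff)
  then have gi: "integrable lborel (\<lambda>x. (g x)\<^sup>2)" using Omega_finite by simp
  show "integrable PP (\<lambda>z. (dq \<zeta> z)\<^sup>2)"
  proof (rule Bochner_Integration.integrable_bound[of _ "\<lambda>z. (1 + L\<^sup>2) * ((g (fst z))\<^sup>2 * wk z + (g (snd z))\<^sup>2 * wk z)"])
    show "integrable PP (\<lambda>z. (1 + L\<^sup>2) * ((g (fst z))\<^sup>2 * wk z + (g (snd z))\<^sup>2 * wk z))"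
      using weighted_square(1,3)[OF gm gi] by simp
    have "(dq \<zeta> (x, y))\<^sup>2 \<le> (1 + L\<^sup>2) * ((g x)\<^sup>2 * wk (x, y) + (g y)\<^sup>2 * wk (x, y))" for x y
    proof (cases "x \<in> \<Omega> \<or> y \<in> \<Omega>")
      case True
      then have "1 * wk (x, y) \<le> ((g x)\<^sup>2 + (g y)\<^sup>2) * wk (x, y)"
        using wk_nonneg[of "(x, y)"] by (intro mult_right_mono) (auto simp: g_def indicator_def)
      then have "(1 + L\<^sup>2) * wk (x, y) \<le> (1 + L\<^sup>2) * ((g x)\<^sup>2 * wk (x, y) + (g y)\<^sup>2 * wk (x, y))"
        by (intro mult_left_mono) (auto simp: distrib_right)
      then show ?thesis using Lipschitz_square_le[OF \<zeta>, of x y] unfolding dq_sq by linarith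
    next
      case False
      then show ?thesis using out wk_nonneg[of "(x, y)"] by (simp add: dq_sq)
    qed
    then have "(dq \<zeta> z)\<^sup>2 \<le> (1 + L\<^sup>2) * ((g (fst z))\<^sup>2 * wk z + (g (snd z))\<^sup>2 * wk z)" for z
      by (cases z) (simp only: fst_conv snd_conv)
    then show "AE z in PP. norm ((dq \<zeta> z)\<^sup>2) \<le> norm ((1 + L\<^sup>2) * ((g (fst z))\<^sup>2 * wk z + (g (snd z))\<^sup>2 * wk z))"
      by (intro AE_I2 norm_mono_real) auto
  qed measurable
qed (use assms in auto)

subsection \<open>Weak convergence\<close>

text \<open>Away from the diagonal the kernel has finite mass, so the energy of \<open>g j\<close>
  there is controlled by its \<open>L^2\<close> norm; near the diagonal the energy of the fixed
  \<open>w\<close> is small.\<close>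

lemma weak_convergence_0:
  assumes w: "w \<in> V" and g: "\<And>j. g j \<in> V" "\<And>j. nrm (g j) \<le> B"
    and lim: "(\<lambda>j. LBINT x. (g j x)\<^sup>2) \<longlonglongrightarrow> 0"
  shows "(\<lambda>j. E w (g j)) \<longlonglongrightarrow> 0"
proof (rule LIMSEQ_I)
  fix e :: real assume e: "0 < e"
  have B: "0 \<le> B" using g(2)[of 0] nrm_nonneg[of "g 0"] by linarith
  note [measurable] = V_measurable[OF w] V_measurable[OF g(1)]
  define nr where "nr i z = (if norm (fst z - snd z) < 1 / real (Suc i) then 1 else 0 :: real)" for i and z :: "'a \<times> 'a"
  have nrm_meas [measurable]: "nr i \<in> borel_measurable PP" for i unfolding nr_def by measurable
  define A where "A i = (\<integral>z. (dq w z * nr i z)\<^sup>2 \<partial>PP)" for i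
  have int_near: "integrable PP (\<lambda>z. (dq w z * nr i z)\<^sup>2)" for i
    by (rule Bochner_Integration.integrable_bound[OF V_dq[OF w]]) (auto simp: nr_def)
  have A_lim: "A \<longlonglongrightarrow> (\<integral>z. 0 \<partial>PP)"
    unfolding A_def
  proof (rule integral_dominated_convergence[where w="\<lambda>z. (dq w z)\<^sup>2"])
    show "AE z in PP. (\<lambda>i. (dq w z * nr i z)\<^sup>2) \<longlonglongrightarrow> 0"
    proof (rule AE_I2)
      fix z :: "'a \<times> 'a"
      show "(\<lambda>i. (dq w z * nr i z)\<^sup>2) \<longlonglongrightarrow> 0"
      proof (cases "fst z = snd z")
        case True
        then have "dq w z = 0" by (cases z) (simp add: dq_def)
        then show ?thesis by simp
      next
        case False
        then have "0 < norm (fst z - snd z)" by simp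
        moreover have "(\<lambda>i. 1 / real (Suc i)) \<longlonglongrightarrow> 0" by (rule LIMSEQ_Suc[OF lim_1_over_n])
        ultimately have "\<forall>\<^sub>F i in sequentially. 1 / real (Suc i) < norm (fst z - snd z)" by (rule order_tendstoD(2)[rotated])
        then have "\<forall>\<^sub>F i in sequentially. (dq w z * nr i z)\<^sup>2 = 0" by eventually_elim (simp add: nr_def)
        then show ?thesis by (rule tendsto_eventually)
      qed
    qed
  qed (use V_dq[OF w] in \<open>auto simp: nr_def\<close>)
  have A0: "0 \<le> A i" for i by (simp add: A_def)
  define Q where "Q = cn / 2 * sqrt (2 / cn) * B"
  have Q: "0 \<le> Q" using B cn_pos by (simp add: Q_def)
  have "(\<lambda>i. sqrt (A i) * Q) \<longlonglongrightarrow> sqrt 0 * Q" using A_lim by (intro tendsto_intros) auto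
  then obtain i where i: "sqrt (A i) * Q < e / 2"
    using e order_tendstoD(2)[of "\<lambda>i. sqrt (A i) * Q" 0 sequentially "e / 2"] by (auto simp: eventually_sequentially)
  \<comment> \<open>Off the strip of width \<open>1 / real (Suc i)\<close> the kernel is at most
    \<open>wk\<close> times the square of \<open>Suc i\<close>. The factor 4 consists of two from
    squaring a difference and two from the two variables.\<close>
  define S where "S = 4 * (real (Suc i))\<^sup>2 * ker_mass"
  have S: "0 \<le> S" using ker_mass_nonneg by (simp add: S_def)
  have far: "(\<integral>z. (dq (g j) z * (1 - nr i z))\<^sup>2 \<partial>PP) \<le> S * (LBINT x. (g j x)\<^sup>2)"
    and far_int: "integrable PP (\<lambda>z. (dq (g j) z * (1 - nr i z))\<^sup>2)" for j
  proof -
    show fi: "integrable PP (\<lambda>z. (dq (g j) z * (1 - nr i z))\<^sup>2)"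
      by (rule Bochner_Integration.integrable_bound[OF V_dq[OF g(1)[of j]]]) (auto simp: nr_def)
    note ws = weighted_square[OF V_measurable[OF g(1)[of j]] V_square_integrable[OF g(1)[of j]]]
    have "(\<integral>z. (dq (g j) z * (1 - nr i z))\<^sup>2 \<partial>PP) \<le> (\<integral>z. 2 * (real (Suc i))\<^sup>2 * ((g j (fst z))\<^sup>2 * wk z + (g j (snd z))\<^sup>2 * wk z) \<partial>PP)"
    proof (rule integral_mono[OF fi])
      show "integrable PP (\<lambda>z. 2 * (real (Suc i))\<^sup>2 * ((g j (fst z))\<^sup>2 * wk z + (g j (snd z))\<^sup>2 * wk z))"
        using ws(1,3) by simp
      fix z :: "'a \<times> 'a"
      obtain x y where z: "z = (x, y)" by (cases z)
      show "(dq (g j) z * (1 - nr i z))\<^sup>2 \<le> 2 * (real (Suc i))\<^sup>2 * ((g j (fst z))\<^sup>2 * wk z + (g j (snd z))\<^sup>2 * wk z)"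
      proof (cases "norm (x - y) < 1 / real (Suc i)")
        case True
        then show ?thesis using wk_nonneg[of z] by (simp add: z nr_def)
      next
        case False
        have "1 \<le> real (Suc i) * norm (x - y)" using False by (simp add: field_simps)
        then have "1 \<le> (real (Suc i))\<^sup>2 * (norm (x - y))\<^sup>2" unfolding power_mult_distrib[symmetric] by (rule one_le_power)
        then have m: "1 \<le> (real (Suc i))\<^sup>2 * min 1 ((norm (x - y))\<^sup>2)" by (simp add: min_def one_le_power)
        have "(g j x - g j y)\<^sup>2 \<le> 2 * (g j x)\<^sup>2 + 2 * (g j y)\<^sup>2"
          using sum_squares_bound[of "g j x" "- g j y"] by (simp add: power2_diff)
        also have "\<dots> \<le> (2 * (g j x)\<^sup>2 + 2 * (g j y)\<^sup>2) * ((real (Suc i))\<^sup>2 * min 1 ((norm (x - y))\<^sup>2))"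
          using mult_left_mono[OF m, of "2 * (g j x)\<^sup>2 + 2 * (g j y)\<^sup>2"] by simp
        finally have "(g j x - g j y)\<^sup>2 / norm (x - y) powr \<nu> \<le> (2 * (g j x)\<^sup>2 + 2 * (g j y)\<^sup>2) * ((real (Suc i))\<^sup>2 * min 1 ((norm (x - y))\<^sup>2)) / norm (x - y) powr \<nu>"
          by (intro divide_right_mono) auto
        also have "\<dots> = 2 * (real (Suc i))\<^sup>2 * ((g j x)\<^sup>2 * wk (x, y) + (g j y)\<^sup>2 * wk (x, y))"
          by (simp only: wk_def fst_conv snd_conv) (simp add: algebra_simps add_divide_distrib)
        finally show ?thesis using False by (simp add: z nr_def dq_sq)
      qed
    qed
    also have "\<dots> = S * (LBINT x. (g j x)\<^sup>2)" using ws by (simp add: S_def)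
    finally show "(\<integral>z. (dq (g j) z * (1 - nr i z))\<^sup>2 \<partial>PP) \<le> S * (LBINT x. (g j x)\<^sup>2)" .
  qed
  have bound: "\<bar>E w (g j)\<bar> \<le> sqrt (A i) * Q + cn / 2 * sqrt (\<integral>z. (dq w z)\<^sup>2 \<partial>PP) * sqrt (S * (LBINT x. (g j x)\<^sup>2))" for j
  proof -
    define G where "G = (\<integral>z. (dq (g j) z)\<^sup>2 \<partial>PP)"
    have G: "0 \<le> G" by (simp add: G_def)
    have "cn / 2 * G \<le> B\<^sup>2" unfolding G_def E_self[symmetric] nrm_sq[symmetric] using g(2) by (intro power_mono) auto
    then have "G \<le> 2 / cn * B\<^sup>2" using cn_pos by (simp add: field_simps)
    then have sG: "sqrt G \<le> sqrt (2 / cn) * B" using B by (metis real_sqrt_abs real_sqrt_le_mono real_sqrt_mult abs_of_nonneg)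
    have cs: "\<bar>\<integral>z. F z * H z \<partial>PP\<bar> \<le> sqrt (\<integral>z. (F z)\<^sup>2 \<partial>PP) * sqrt (\<integral>z. (H z)\<^sup>2 \<partial>PP)"
      if "F \<in> borel_measurable PP" "H \<in> borel_measurable PP" "integrable PP (\<lambda>z. (F z)\<^sup>2)" "integrable PP (\<lambda>z. (H z)\<^sup>2)" for F H :: "'a \<times> 'a => real"
      using real_sqrt_le_mono[OF Cauchy_Schwarz_integral[OF that]] by (simp add: real_sqrt_mult)
    have i1: "integrable PP (\<lambda>z. (dq w z * nr i z) * dq (g j) z)"
      by (rule integrable_mult_of_squares) (use int_near V_dq[OF g(1)] in auto)
    have i2: "integrable PP (\<lambda>z. dq w z * (dq (g j) z * (1 - nr i z)))"
      by (rule integrable_mult_of_squares) (use far_int V_dq[OF w] in auto)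
    have "E w (g j) = cn / 2 * (\<integral>z. (dq w z * nr i z) * dq (g j) z + dq w z * (dq (g j) z * (1 - nr i z)) \<partial>PP)"
      unfolding E_eq by (simp add: algebra_simps)
    also have "\<dots> = cn / 2 * ((\<integral>z. (dq w z * nr i z) * dq (g j) z \<partial>PP) + (\<integral>z. dq w z * (dq (g j) z * (1 - nr i z)) \<partial>PP))"
      using i1 i2 by simp
    finally have Ee: "E w (g j) = cn / 2 * ((\<integral>z. (dq w z * nr i z) * dq (g j) z \<partial>PP) + (\<integral>z. dq w z * (dq (g j) z * (1 - nr i z)) \<partial>PP))" .
    have "\<bar>E w (g j)\<bar> = cn / 2 * \<bar>(\<integral>z. (dq w z * nr i z) * dq (g j) z \<partial>PP) + (\<integral>z. dq w z * (dq (g j) z * (1 - nr i z)) \<partial>PP)\<bar>"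
      unfolding Ee abs_mult using cn_pos by simp
    also have "\<dots> \<le> cn / 2 * (\<bar>\<integral>z. (dq w z * nr i z) * dq (g j) z \<partial>PP\<bar> + \<bar>\<integral>z. dq w z * (dq (g j) z * (1 - nr i z)) \<partial>PP\<bar>)"
      using cn_pos by (intro mult_left_mono abs_triangle_ineq) auto
    also have "\<dots> \<le> cn / 2 * (sqrt (A i) * (sqrt (2 / cn) * B) + sqrt (\<integral>z. (dq w z)\<^sup>2 \<partial>PP) * sqrt (S * (LBINT x. (g j x)\<^sup>2)))"
    proof (intro mult_left_mono add_mono)
      have "\<bar>\<integral>z. (dq w z * nr i z) * dq (g j) z \<partial>PP\<bar> \<le> sqrt (A i) * sqrt G"
        unfolding A_def G_def by (rule cs) (use int_near V_dq[OF g(1)] in auto)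
      also have "\<dots> \<le> sqrt (A i) * (sqrt (2 / cn) * B)" using sG A0 by (intro mult_left_mono) auto
      finally show "\<bar>\<integral>z. (dq w z * nr i z) * dq (g j) z \<partial>PP\<bar> \<le> sqrt (A i) * (sqrt (2 / cn) * B)" .
      have "\<bar>\<integral>z. dq w z * (dq (g j) z * (1 - nr i z)) \<partial>PP\<bar> \<le> sqrt (\<integral>z. (dq w z)\<^sup>2 \<partial>PP) * sqrt (\<integral>z. (dq (g j) z * (1 - nr i z))\<^sup>2 \<partial>PP)"
        by (rule cs) (use far_int V_dq[OF w] in auto)
      also have "\<dots> \<le> sqrt (\<integral>z. (dq w z)\<^sup>2 \<partial>PP) * sqrt (S * (LBINT x. (g j x)\<^sup>2))"
        using far by (intro mult_left_mono real_sqrt_le_mono) auto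
      finally show "\<bar>\<integral>z. dq w z * (dq (g j) z * (1 - nr i z)) \<partial>PP\<bar> \<le> sqrt (\<integral>z. (dq w z)\<^sup>2 \<partial>PP) * sqrt (S * (LBINT x. (g j x)\<^sup>2))" .
    qed (use cn_pos in auto)
    also have "\<dots> = sqrt (A i) * Q + cn / 2 * sqrt (\<integral>z. (dq w z)\<^sup>2 \<partial>PP) * sqrt (S * (LBINT x. (g j x)\<^sup>2))"
      by (simp add: Q_def algebra_simps)
    finally show ?thesis .
  qed
  have "(\<lambda>j. cn / 2 * sqrt (\<integral>z. (dq w z)\<^sup>2 \<partial>PP) * sqrt (S * (LBINT x. (g j x)\<^sup>2))) \<longlonglongrightarrow> cn / 2 * sqrt (\<integral>z. (dq w z)\<^sup>2 \<partial>PP) * sqrt (S * 0)"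
    by (intro tendsto_mult tendsto_const tendsto_real_sqrt lim)
  then have "\<forall>\<^sub>F j in sequentially. cn / 2 * sqrt (\<integral>z. (dq w z)\<^sup>2 \<partial>PP) * sqrt (S * (LBINT x. (g j x)\<^sup>2)) < e / 2"
    using e by (intro order_tendstoD(2)[where y=0]) auto
  then have "\<forall>\<^sub>F j in sequentially. norm (E w (g j) - 0) < e"
  proof eventually_elim
    case (elim j)
    then show ?case using bound[of j] i by (simp only: real_norm_def diff_0_right)
  qed
  then show "\<exists>no. \<forall>n\<ge>no. norm (E w (g n) - 0) < e" by (simp add: eventually_sequentially)
qed

end

context frac
begin

section \<open>Density of test functions\<close>

lemma lborel_integral_scale:
  fixes f :: "'a => real" assumes c: "0 < c" and f: "integrable lborel f"
  shows "integrable lborel (\<lambda>v. c ^ DIM('a) * f (c *\<^sub>R v))" "(LBINT v. c ^ DIM('a) * f (c *\<^sub>R v)) = (LBINT v. f v)"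
proof -
  have [measurable]: "f \<in> borel_measurable borel" using f by simp
  have d: "(lborel :: 'a measure) = density (distr lborel borel (\<lambda>x. c *\<^sub>R x)) (\<lambda>_. ennreal (c ^ DIM('a)))"
    using lborel_affine[of c 0] c by simp
  have "integrable (density (distr lborel borel (\<lambda>x. c *\<^sub>R x)) (\<lambda>_. ennreal (c ^ DIM('a)))) f" using f d by simp
  then show "integrable lborel (\<lambda>v. c ^ DIM('a) * f (c *\<^sub>R v))"
    using c by (simp add: integrable_density integrable_distr_eq)
  show "(LBINT v. c ^ DIM('a) * f (c *\<^sub>R v)) = (LBINT v. f v)"
    using c by (subst (2) d) (simp add: integral_density integral_distr)
qed

text \<open>One bump rescaled by \<open>c = Suc j\<close>: its squared maximum grows like
  \<open>c^(2n)\<close>, while the volume and the weight of its ball shrink like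
  \<open>c^(-n)\<close> and \<open>c^(-n-2\<sigma>)\<close>, which leaves the rate. The support
  condition keeps the direction \<open>e\<close> visible at every scale.\<close>

lemma mollifier_family:
  fixes e :: 'a assumes \<delta>: "0 < \<delta>"
  obtains \<kappa> :: "nat => 'a => real" and C where
    "\<And>j. cutoff_smooth (\<kappa> j)" "\<And>j v. 0 \<le> \<kappa> j v"
    "\<And>j v. \<kappa> j v \<noteq> 0 ==> real (Suc j) *\<^sub>R v \<in> ball e \<delta>"
    "\<And>j. integrable lborel (\<kappa> j)" "\<And>j. (LBINT v. \<kappa> j v) = 1" "0 \<le> C"
    "\<And>j f. f \<in> V ==> integrable lborel (\<lambda>x. (conv (\<kappa> j) f x - f x)\<^sup>2)"
    "\<And>j f. f \<in> V ==> (LBINT x. (conv (\<kappa> j) f x - f x)\<^sup>2) \<le> C * real (Suc j) powr (- 2 * \<sigma>) * E f f"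
proof -
  obtain k0 :: "'a => real" and M where k0: "smooth_alg k0" "\<And>v. 0 \<le> k0 v" "\<And>v. k0 v \<le> M" "\<And>v. v \<notin> ball e \<delta> ==> k0 v = 0"
    "integrable lborel k0" "(LBINT v. k0 v) = 1"
    using exists_smooth_kernel[OF \<delta>, of e] by blast
  define R where "R = norm e + \<delta>"
  have R: "0 < R" using \<delta> by (simp add: R_def add_nonneg_pos)
  define c where "c j = real (Suc j)" for j
  have c: "1 \<le> c j" for j by (simp add: c_def)
  define \<kappa> where "\<kappa> j v = c j ^ DIM('a) * k0 (c j *\<^sub>R v)" for j v
  have supp: "c j *\<^sub>R v \<in> ball e \<delta>" if "\<kappa> j v \<noteq> 0" for j v using that k0(4) by (auto simp: \<kappa>_def)
  have zero: "\<kappa> j v = 0" if "R / c j \<le> norm v" for j v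
  proof (rule ccontr)
    assume "\<kappa> j v \<noteq> 0"
    then have "dist e (c j *\<^sub>R v) < \<delta>" using supp by simp
    then have "norm (c j *\<^sub>R v) < R" unfolding R_def using norm_triangle_sub[of "c j *\<^sub>R v" e] by (simp add: dist_norm norm_minus_commute)
    then show False using that c[of j] by (simp add: field_simps)
  qed
  have sm: "cutoff_smooth (\<kappa> j)" for j
  proof -
    have "smooth_alg (\<kappa> j)" unfolding \<kappa>_def by (intro smooth_alg.mult smooth_alg.const smooth_alg_scale k0)
    moreover have "\<kappa> j x = 0" if "R < norm x" for x
    proof (rule zero)
      have "R / c j \<le> R / 1" using c[of j] R by (intro divide_left_mono) auto
      then show "R / c j \<le> norm x" using that by simp
    qed
    ultimately show ?thesis unfolding cutoff_smooth_def using smooth_alg_smooth by blast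
  qed
  have nonneg: "0 \<le> \<kappa> j v" for j v using k0(2) c[of j] by (simp add: \<kappa>_def)
  have int: "integrable lborel (\<kappa> j)" "(LBINT v. \<kappa> j v) = 1" for j
    using lborel_integral_scale[of "c j" k0] k0(5,6) c[of j] unfolding \<kappa>_def by auto
  have bd: "\<kappa> j v \<le> c j ^ DIM('a) * M" for j v
    unfolding \<kappa>_def using k0(3) c[of j] by (intro mult_left_mono) auto
  define C where "C = M\<^sup>2 * omg * R powr (nn + \<nu>) * (2 / cn)"
  have M0: "0 \<le> M" using k0(2)[of 0] k0(3)[of 0] by linarith
  have C: "0 \<le> C" using omg_pos cn_pos by (simp add: C_def)
  have eq: "(c j ^ DIM('a) * M)\<^sup>2 * (omg * (R / c j) powr nn * (R / c j) powr \<nu>) * (2 / cn * X) = C * c j powr (- 2 * \<sigma>) * X" for j X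
  proof -
    have "(c j ^ DIM('a))\<^sup>2 = c j powr (nn + nn)"
      using c[of j] unfolding powr_add nn_def by (simp add: powr_realpow power2_eq_square)
    moreover have "(R / c j) powr nn * (R / c j) powr \<nu> = R powr (nn + \<nu>) * c j powr (- (nn + \<nu>))"
    proof -
      have "(R / c j) powr s = R powr s * c j powr (- s)" for s
        using R c[of j] by (simp add: powr_divide powr_minus_divide)
      then show ?thesis unfolding powr_add[symmetric] .
    qed
    ultimately have "(c j ^ DIM('a) * M)\<^sup>2 * (omg * (R / c j) powr nn * (R / c j) powr \<nu>) = M\<^sup>2 * omg * R powr (nn + \<nu>) * (c j powr (nn + nn) * c j powr (- (nn + \<nu>)))"
      unfolding power_mult_distrib by (simp only: mult.assoc) (simp only: mult_ac)
    also have "c j powr (nn + nn) * c j powr (- (nn + \<nu>)) = c j powr (- 2 * \<sigma>)"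
      unfolding powr_add[symmetric] by (simp add: \<nu>_def)
    finally have Y: "(c j ^ DIM('a) * M)\<^sup>2 * (omg * (R / c j) powr nn * (R / c j) powr \<nu>) = M\<^sup>2 * omg * R powr (nn + \<nu>) * c j powr (- 2 * \<sigma>)" .
    show ?thesis unfolding Y C_def by (simp only: mult_ac)
  qed
  show ?thesis
  proof (rule that[of \<kappa> C])
    fix j f assume f: "f \<in> V"
    have Rc: "0 < R / c j" using R c[of j] by simp
    note cc = conv_close[OF f sm[of j] nonneg bd zero int(1) int(2) Rc]
    show "integrable lborel (\<lambda>x. (conv (\<kappa> j) f x - f x)\<^sup>2)" using cc(1) .
    show "(LBINT x. (conv (\<kappa> j) f x - f x)\<^sup>2) \<le> C * real (Suc j) powr (- 2 * \<sigma>) * E f f"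
      using cc(2) unfolding eq by (simp add: c_def)
  qed (use sm nonneg supp int C in \<open>auto simp: c_def\<close>)
qed

text \<open>A uniform interior cone condition near \<open>p\<close>: a move from a point of the
  closure in any direction close to \<open>e\<close> enters \<Omega> at once. At interior points
  \<open>e = 0\<close> will do.\<close>

definition good :: "'a => real => 'a => real => bool" where
  "good p r e \<delta> \<longleftrightarrow> 0 < r \<and> 0 < \<delta> \<and>
     (\<forall>y\<in>closure \<Omega> \<inter> cball p r. \<forall>\<tau> v. 0 < \<tau> \<longrightarrow> \<tau> \<le> 1 \<longrightarrow> v \<in> ball e \<delta> \<longrightarrow> y + \<tau> *\<^sub>R v \<in> \<Omega>)"

lemma powr_minus_Suc_tendsto_0: "0 < a ==> (\<lambda>j. real (Suc j) powr (- a)) \<longlonglongrightarrow> 0"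
  by (rule LIMSEQ_Suc[OF tendsto_neg_powr[OF _ filterlim_real_sequentially]]) simp

text \<open>Kernels supported around \<open>e / Suc j\<close> push the support of \<open>f\<close>
  into \<Omega>, and the push tends to zero, so the boundary need not be flattened.\<close>

lemma mollify:
  assumes g: "good p r e \<delta>" and f: "f \<in> V" and f0: "\<And>x. x \<notin> cball p r ==> f x = 0"
  obtains \<psi> where "\<And>j. test_fun \<Omega> (\<psi> j)" "\<And>j. \<psi> j \<in> V" "\<And>j. nrm (\<psi> j) \<le> nrm f"
    "(\<lambda>j. LBINT x. (\<psi> j x - f x)\<^sup>2) \<longlonglongrightarrow> 0"
proof -
  \<comment> \<open>Half of the opening: the closed ball of directions is compact and still
    admissible, so \<open>K j\<close> below is a compact subset of \<Omega>.\<close>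
  have \<delta>: "0 < \<delta> / 2" using g by (simp add: good_def)
  obtain \<kappa> :: "nat => 'a => real" and C where \<kappa>: "\<And>j. cutoff_smooth (\<kappa> j)" "\<And>j v. 0 \<le> \<kappa> j v"
    "\<And>j v. \<kappa> j v \<noteq> 0 ==> real (Suc j) *\<^sub>R v \<in> ball e (\<delta> / 2)"
    "\<And>j. integrable lborel (\<kappa> j)" "\<And>j. (LBINT v. \<kappa> j v) = 1" "0 \<le> C"
    "\<And>j f. f \<in> V ==> integrable lborel (\<lambda>x. (conv (\<kappa> j) f x - f x)\<^sup>2)"
    "\<And>j f. f \<in> V ==> (LBINT x. (conv (\<kappa> j) f x - f x)\<^sup>2) \<le> C * real (Suc j) powr (- 2 * \<sigma>) * E f f"
    using mollifier_family[OF \<delta>, of e] by blast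
  define K where "K j = (\<lambda>(y, v). y + (1 / real (Suc j)) *\<^sub>R v) ` ((closure \<Omega> \<inter> cball p r) \<times> cball e (\<delta> / 2))" for j
  have K: "compact (K j)" for j unfolding K_def
    by (intro compact_continuous_image compact_Times)
       (auto intro!: continuous_intros compact_Int_closed simp: case_prod_beta bounded_Omega compact_closure)
  have KO: "K j \<subseteq> \<Omega>" for j
  proof
    fix x assume "x \<in> K j"
    then obtain y v where x: "x = y + (1 / real (Suc j)) *\<^sub>R v" and yv: "y \<in> closure \<Omega> \<inter> cball p r" "v \<in> cball e (\<delta> / 2)"
      by (auto simp: K_def)
    have "v \<in> ball e \<delta>" using yv \<delta> by simp
    then show "x \<in> \<Omega>" using g yv unfolding good_def x by simp
  qed
  have zero: "conv (\<kappa> j) f x = 0" if x: "x \<notin> K j" for j x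
  proof -
    have "\<kappa> j (x - y) * f y = 0" for y
    proof (rule ccontr)
      assume *: "\<kappa> j (x - y) * f y \<noteq> 0"
      then have "real (Suc j) *\<^sub>R (x - y) \<in> cball e (\<delta> / 2)" using \<kappa>(3)[of j "x - y"] by (auto simp: less_imp_le)
      moreover have "y \<in> closure \<Omega> \<inter> cball p r"
        using * f0[of y] V_outside[OF f, of y] closure_subset[of \<Omega>] by auto
      moreover have "x = y + (1 / real (Suc j)) *\<^sub>R (real (Suc j) *\<^sub>R (x - y))" by simp
      ultimately have "x \<in> K j" unfolding K_def by force
      then show False using x by simp
    qed
    then show ?thesis by (simp only: conv_def) simp
  qed
  show ?thesis
  proof (rule that[of "\<lambda>j. conv (\<kappa> j) f"])
    fix j
    show "test_fun \<Omega> (conv (\<kappa> j) f)"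
      unfolding test_fun_def
    proof (intro conjI exI[of _ "K j"] allI impI)
      show "smooth_on UNIV (conv (\<kappa> j) f)" by (rule conv_smooth[OF \<kappa>(1) V_integrable[OF f]])
    qed (use K KO zero in auto)
    note ce = conv_energy[OF f \<kappa>(1) \<kappa>(2) \<kappa>(4) \<kappa>(5)]
    have cm: "conv (\<kappa> j) f \<in> borel_measurable lborel"
      using conv_smooth[OF \<kappa>(1) V_integrable[OF f]]
      by (auto intro!: borel_measurable_continuous_onI smooth_on_UNIV_deriv(3))
    obtain M where M: "\<And>x. \<bar>\<kappa> j x\<bar> \<le> M" using cutoff_smooth_bounded[OF \<kappa>(1)] by blast
    have "\<bar>conv (\<kappa> j) f x\<bar> \<le> M * (LBINT y. \<bar>f y\<bar>)" for x
    proof -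
      have "\<bar>conv (\<kappa> j) f x\<bar> \<le> (LBINT y. \<bar>\<kappa> j (x - y) * f y\<bar>)" unfolding conv_def by (rule integral_abs_bound)
      also have "\<dots> \<le> (LBINT y. M * \<bar>f y\<bar>)"
        using integrable_abs[OF conv_integrable[OF \<kappa>(1) V_integrable[OF f], of j x]] V_integrable[OF f] M
        by (intro integral_mono) (auto simp: abs_mult intro!: mult_right_mono)
      finally show ?thesis by simp
    qed
    then show "conv (\<kappa> j) f \<in> V"
      by (rule V_boundedI[OF cm _ _ ce(1), rotated 1]) (use zero KO in blast)
    show "nrm (conv (\<kappa> j) f) \<le> nrm f" unfolding nrm_def using ce(2) by (rule real_sqrt_le_mono)
  next
    have "(\<lambda>j. C * real (Suc j) powr (- (2 * \<sigma>)) * E f f) \<longlonglongrightarrow> C * 0 * E f f"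
      using s0 by (intro tendsto_mult tendsto_const powr_minus_Suc_tendsto_0) auto
    then show "(\<lambda>j. LBINT x. (conv (\<kappa> j) f x - f x)\<^sup>2) \<longlonglongrightarrow> 0"
      by (intro Lim_null_comparison[of "\<lambda>j. \<integral>x. (conv (\<kappa> j) f x - f x)\<^sup>2 \<partial>lborel" "\<lambda>j. C * real (Suc j) powr (- (2 * \<sigma>)) * E f f"])
         (use \<kappa>(8)[OF f] in auto)
  qed
qed

lemma good_interior:
  assumes "p \<in> \<Omega>" obtains r e \<delta> where "good p r e \<delta>"
proof -
  obtain r where r: "0 < r" "cball p r \<subseteq> \<Omega>" using open_Omega assms open_contains_cball by blast
  have "good p (r / 2) 0 (r / 2)"
    unfolding good_def
  proof (intro conjI ballI allI impI)
    fix y v :: 'a and \<tau> :: real assume *: "y \<in> closure \<Omega> \<inter> cball p (r / 2)" "0 < \<tau>" "\<tau> \<le> 1" "v \<in> ball 0 (r / 2)"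
    have "dist p (y + \<tau> *\<^sub>R v) \<le> dist p y + norm (\<tau> *\<^sub>R v)" by (metis add_diff_cancel_left' dist_norm dist_triangle dist_commute)
    also have "norm (\<tau> *\<^sub>R v) \<le> norm v" using * by (simp add: mult_left_le_one_le)
    finally have "y + \<tau> *\<^sub>R v \<in> cball p r" using * by simp
    then show "y + \<tau> *\<^sub>R v \<in> \<Omega>" using r by blast
  qed (use r in auto)
  then show ?thesis using that by blast
qed

text \<open>In a direction along which the defining function decreases at \<open>p\<close>, it
  decreases at nearby points too, uniformly for nearby directions; on the closure its value is at
  most zero, so it becomes negative immediately.\<close>

lemma good_boundary:
  assumes sb: "smooth_boundary \<Omega>" and p: "p \<in> frontier \<Omega>"
  obtains r e \<delta> where "good p r e \<delta>"
proof -
  obtain U \<rho> where U: "open U" "p \<in> U" and sm: "smooth_on U \<rho>"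
    and nz: "\<And>x. x \<in> U ==> frechet_derivative \<rho> (at x) \<noteq> (\<lambda>v. 0)" and OU: "\<Omega> \<inter> U = {x\<in>U. \<rho> x < 0}"
    using bspec[OF sb[unfolded smooth_boundary_def] p] by (elim exE conjE) (rule that, auto)
  define D where "D x = frechet_derivative \<rho> (at x)" for x
  have Ck: "Ck 1 U \<rho>" using sm by (simp add: smooth_on_def)
  have der: "(\<rho> has_derivative D x) (at x)" if "x \<in> U" for x
  proof -
    have "\<rho> differentiable_on U" using Ck by simp
    then have "\<rho> differentiable (at x within U)" using that by (rule differentiable_onD)
    then have "\<rho> differentiable (at x)" using at_within_open[OF that U(1)] by simp
    then show ?thesis unfolding D_def frechet_derivative_works .
  qed
  have lin: "linear (D x)" if "x \<in> U" for x using der[OF that] by (rule has_derivative_linear)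
  have Dc: "continuous_on U (\<lambda>x. D x v)" for v using Ck by (simp add: D_def)
  have Dat: "((\<lambda>x. D x v) \<longlongrightarrow> D p v) (at p)" for v
    using Dc[of v] U continuous_on_eq_continuous_at[of U] by (auto simp: isCont_def)
  have rc: "continuous_on U \<rho>" using der by (meson continuous_at_imp_continuous_on has_derivative_continuous)
  obtain v1 where v1: "D p v1 \<noteq> 0" using nz[OF U(2)] by (auto simp: D_def fun_eq_iff)
  define e0 where "e0 = (if D p v1 < 0 then v1 else - v1)"
  have e0: "D p e0 < 0" using v1 linear_neg[OF lin[OF U(2)], of v1] by (auto simp: e0_def)
  define c where "c = - D p e0 / 2"
  have c: "0 < c" using e0 by (simp add: c_def)
  have "\<forall>\<^sub>F x in at p. D x e0 < - c" by (rule order_tendstoD(2)[OF Dat]) (use e0 in \<open>simp add: c_def\<close>)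
  moreover have "\<forall>\<^sub>F x in at p. \<forall>b\<in>Basis. \<bar>D x b\<bar> < \<bar>D p b\<bar> + 1"
  proof (rule eventually_ball_finite)
    show "\<forall>b\<in>Basis. \<forall>\<^sub>F x in at p. \<bar>D x b\<bar> < \<bar>D p b\<bar> + 1"
      by (intro ballI order_tendstoD(2)[OF tendsto_rabs[OF Dat]]) simp
  qed simp
  moreover have "\<forall>\<^sub>F x in at p. x \<in> U" using U by (intro eventually_at_in_open') auto
  ultimately have "\<forall>\<^sub>F x in at p. x \<in> U \<and> D x e0 < - c \<and> (\<forall>b\<in>Basis. \<bar>D x b\<bar> < \<bar>D p b\<bar> + 1)"
    by eventually_elim auto
  moreover have "D p e0 < - c" using e0 by (simp add: c_def)
  ultimately obtain r1 where r1: "0 < r1" "\<And>x. dist x p < r1 ==> x \<in> U \<and> D x e0 < - c \<and> (\<forall>b\<in>Basis. \<bar>D x b\<bar> < \<bar>D p b\<bar> + 1)"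
    unfolding eventually_at using U by (metis (mono_tags, lifting) UNIV_I less_add_one)
  define S where "S = (\<Sum>b\<in>(Basis :: 'a set). \<bar>D p b\<bar> + 1)"
  have S: "0 \<le> S" unfolding S_def by (intro sum_nonneg) auto
  define d0 where "d0 = c / (S + 1)"
  have d0: "0 < d0" "d0 * S < c" using c S by (auto simp: d0_def field_simps)
  have neg: "D x (e0 + z) < 0" if x: "dist x p < r1" and z: "norm z \<le> d0" for x z
  proof -
    note lx = lin[OF conjunct1[OF r1(2)[OF x]]]
    have "D x z = D x (\<Sum>b\<in>Basis. (z \<bullet> b) *\<^sub>R b)" by (simp add: euclidean_representation)
    also have "\<dots> = (\<Sum>b\<in>Basis. (z \<bullet> b) * D x b)"
      using linear_sum[OF lx, of "\<lambda>b. (z \<bullet> b) *\<^sub>R b" Basis] linear_scale[OF lx] by simp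
    also have "\<dots> \<le> (\<Sum>b\<in>Basis. norm z * (\<bar>D p b\<bar> + 1))"
    proof (rule sum_mono)
      fix b :: 'a assume b: "b \<in> Basis"
      have "(z \<bullet> b) * D x b \<le> \<bar>z \<bullet> b\<bar> * \<bar>D x b\<bar>" by (metis abs_ge_self abs_mult)
      also have "\<dots> \<le> norm z * (\<bar>D p b\<bar> + 1)" using Basis_le_norm[OF b, of z] r1(2)[OF x] b by (intro mult_mono) (auto simp: less_imp_le)
      finally show "(z \<bullet> b) * D x b \<le> norm z * (\<bar>D p b\<bar> + 1)" .
    qed
    also have "\<dots> = norm z * S" by (simp add: S_def sum_distrib_left)
    also have "\<dots> \<le> d0 * S" using z S by (rule mult_right_mono)
    finally have "D x z < c" using d0 by linarith
    then show ?thesis using r1(2)[OF x] linear_add[OF lx, of e0 z] by linarith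
  qed
  \<comment> \<open>Scales the direction so that a whole segment starting in
    \<open>cball p (r1 / 3)\<close> stays within distance \<open>r1\<close> of \<open>p\<close>,
    where the derivative is under control.\<close>
  define s where "s = r1 / (2 * (norm e0 + d0 + 1))"
  have s: "0 < s" unfolding s_def using r1 d0 by (intro divide_pos_pos) (auto intro: add_nonneg_pos)
  have snorm: "s * (norm e0 + d0) < r1 / 2"
  proof -
    have pos: "0 < norm e0 + d0 + 1" using d0 by (simp add: add_nonneg_pos)
    have "s * (norm e0 + d0) < s * (norm e0 + d0 + 1)" using s by simp
    also have "\<dots> = r1 / 2"
    proof -
      have "r1 / (2 * w) * w = r1 / 2" if "0 < w" for w :: real using that by simp
      from this[OF pos] show ?thesis by (simp only: s_def)
    qed
    finally show ?thesis .
  qed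
  have "good p (r1 / 3) (s *\<^sub>R e0) (s * d0)"
    unfolding good_def
  proof (intro conjI ballI allI impI)
    fix y v :: 'a and \<tau> :: real assume y: "y \<in> closure \<Omega> \<inter> cball p (r1 / 3)" and \<tau>: "0 < \<tau>" "\<tau> \<le> 1" and v: "v \<in> ball (s *\<^sub>R e0) (s * d0)"
    define z where "z = (1 / s) *\<^sub>R v - e0"
    have vz: "v = s *\<^sub>R (e0 + z)" using s by (simp add: z_def)
    have "norm (s *\<^sub>R z) < s * d0" using v unfolding vz by (simp add: dist_norm scaleR_add_right)
    then have z: "norm z \<le> d0" using s by simp
    have "norm v = s * norm (e0 + z)" using s by (simp add: vz)
    also have "\<dots> \<le> s * (norm e0 + d0)" using z s norm_triangle_ineq[of e0 z] by (intro mult_left_mono) auto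
    finally have nv: "norm v < r1 / 2" using snorm by linarith
    have seg: "dist (y + t *\<^sub>R v) p < r1" if "0 \<le> t" "t \<le> 1" for t
    proof -
      have "norm (t *\<^sub>R v) \<le> norm v" using that by (simp add: mult_left_le_one_le)
      moreover have "dist (y + t *\<^sub>R v) p \<le> dist y p + norm (t *\<^sub>R v)"
        by (metis add_diff_cancel_left' dist_norm dist_triangle2 dist_commute)
      moreover have "dist y p \<le> r1 / 3" using y by (simp add: dist_commute)
      ultimately show ?thesis using nv r1(1) by linarith
    qed
    have yU: "y \<in> U" using r1(2)[of y] seg[of 0] by simp
    have ry: "\<rho> y \<le> 0"
    proof (rule ccontr)
      assume "\<not> \<rho> y \<le> 0"
      moreover have "open {x\<in>U. 0 < \<rho> x}"
        using continuous_open_preimage[OF rc U(1), of "{0<..}"] by (simp add: Int_def vimage_def conj_commute)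
      ultimately have "\<Omega> \<inter> {x\<in>U. 0 < \<rho> x} \<noteq> {}"
        using y yU open_Int_closure_eq_empty[of "{x\<in>U. 0 < \<rho> x}" \<Omega>] by (auto simp: Int_commute)
      then obtain x where "x \<in> \<Omega>" "x \<in> U" "0 < \<rho> x" by blast
      then have "x \<in> {x\<in>U. \<rho> x < 0}" using OU by blast
      then show False using \<open>0 < \<rho> x\<close> by simp
    qed
    have "\<rho> (y + \<tau> *\<^sub>R v) < \<rho> (y + 0 *\<^sub>R v)"
    proof (rule DERIV_neg_imp_decreasing[OF \<tau>(1)])
      fix t assume t: "0 \<le> t" "t \<le> \<tau>"
      define x where "x = y + t *\<^sub>R v"
      have dx: "dist x p < r1" unfolding x_def using t \<tau> by (intro seg) auto
      have xU: "x \<in> U" using r1(2)[OF dx] by simp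
      have "((\<lambda>t. y + t *\<^sub>R v) has_derivative (\<lambda>h. h *\<^sub>R v)) (at t)" by (auto intro!: derivative_eq_intros)
      from has_derivative_compose[OF this der[OF xU[unfolded x_def]]]
      have "((\<lambda>t. \<rho> (y + t *\<^sub>R v)) has_derivative (\<lambda>h. D x (h *\<^sub>R v))) (at t)" by (simp add: x_def)
      moreover have "D x (h *\<^sub>R v) = D x v * h" for h using linear_scale[OF lin[OF xU]] by simp
      ultimately have "DERIV (\<lambda>t. \<rho> (y + t *\<^sub>R v)) t :> D x v" by (simp add: has_field_derivative_def)
      moreover have "D x v < 0"
        unfolding vz using linear_scale[OF lin[OF xU], of s] neg[OF dx z] s by (simp add: mult_pos_neg)
      ultimately show "\<exists>y'. DERIV (\<lambda>t. \<rho> (y + t *\<^sub>R v)) t :> y' \<and> y' < 0" by blast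
    qed
    then have "\<rho> (y + \<tau> *\<^sub>R v) < 0" using ry by simp
    moreover have "y + \<tau> *\<^sub>R v \<in> U" using r1(2)[OF seg[of \<tau>]] \<tau> by simp
    ultimately show "y + \<tau> *\<^sub>R v \<in> \<Omega>" using OU by blast
  qed (use r1 s d0 in auto)
  then show ?thesis using that by blast
qed

lemma good_exists:
  assumes "smooth_boundary \<Omega>" "p \<in> closure \<Omega>" obtains r e \<delta> where "good p r e \<delta>"
proof (cases "p \<in> \<Omega>")
  case True then show ?thesis using good_interior that by blast
next
  case False
  then have "p \<in> frontier \<Omega>" using assms open_Omega by (simp add: frontier_def interior_open)
  then show ?thesis using good_boundary[OF assms(1)] that by blast
qed

text \<open>Density of test functions phrased as an induction principle: limits in
  \<open>L^2\<close> with bounded energy suffice, so strong approximation in the energy norm is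
  avoided. The proof peels off one ball of a finite cover at a time with a Lipschitz cutoff.\<close>

theorem V_induct_test_fun:
  assumes sb: "smooth_boundary \<Omega>"
    and test: "\<And>\<psi>. test_fun \<Omega> \<psi> ==> \<psi> \<in> V ==> P \<psi>"
    and add: "\<And>f g. f \<in> V ==> g \<in> V ==> P f ==> P g ==> P (\<lambda>x. f x + g x)"
    and lim: "\<And>\<psi> f B. f \<in> V ==> (\<And>j. \<psi> j \<in> V) ==> (\<And>j. P (\<psi> j)) ==> (\<And>j. nrm (\<psi> j) \<le> B) ==>
        (\<lambda>j. LBINT x. (\<psi> j x - f x)\<^sup>2) \<longlonglongrightarrow> 0 ==> P f"
    and f: "f \<in> V"
  shows "P f"
proof -
  have "\<exists>r e \<delta>. good p r e \<delta>" if "p \<in> closure \<Omega>" for p using good_exists[OF sb that] by metis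
  then obtain r e \<delta> where good: "\<And>p. p \<in> closure \<Omega> ==> good p (r p) (e p) (\<delta> p)" by metis
  have rpos: "0 < r p" if "p \<in> closure \<Omega>" for p using good[OF that] by (simp add: good_def)
  have "compact (closure \<Omega>)" using bounded_Omega by (simp add: compact_closure)
  then obtain I where I: "I \<subseteq> closure \<Omega>" "finite I" "closure \<Omega> \<subseteq> (\<Union>p\<in>I. ball p (r p / 2))"
    by (rule compactE_image[of _ "closure \<Omega>" "\<lambda>p. ball p (r p / 2)"]) (use rpos in auto)
  have main: "P f" if "finite I" "I \<subseteq> closure \<Omega>" "f \<in> V" "\<And>x. x \<notin> (\<Union>p\<in>I. ball p (r p / 2)) ==> f x = 0" for I f
    using that
  proof (induction I arbitrary: f rule: finite_induct)
    case empty
    then have "f = (\<lambda>_. 0)" by auto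
    moreover have "smooth_on UNIV (\<lambda>_::'a. 0)" by (rule smooth_alg_smooth[OF smooth_alg.const])
    then have "test_fun \<Omega> (\<lambda>_. 0)" unfolding test_fun_def by (intro conjI exI[of _ "{}"]) auto
    ultimately show ?case using test V_zero by blast
  next
    case (insert p I)
    have pc: "p \<in> closure \<Omega>" using insert.prems by auto
    define \<rho> where "\<rho> = r p"
    have \<rho>: "0 < \<rho>" using rpos[OF pc] by (simp add: \<rho>_def)
    \<comment> \<open>Equal to 1 on the ball of half the radius, which the cover uses, and to 0
      outside the ball on which \<open>good\<close> is known.\<close>
    define \<zeta> where "\<zeta> x = max 0 (min 1 (2 - 2 / \<rho> * norm (x - p)))" for x
    have \<zeta>m: "\<zeta> \<in> borel_measurable borel" unfolding \<zeta>_def by measurable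
    have z01: "0 \<le> \<zeta> x" "\<zeta> x \<le> 1" for x by (auto simp: \<zeta>_def)
    have zL: "\<bar>\<zeta> x - \<zeta> y\<bar> \<le> 2 / \<rho> * norm (x - y)" for x y
    proof -
      have "\<bar>\<zeta> x - \<zeta> y\<bar> \<le> \<bar>2 / \<rho> * norm (x - p) - 2 / \<rho> * norm (y - p)\<bar>" unfolding \<zeta>_def by linarith
      also have "\<dots> = 2 / \<rho> * \<bar>norm (x - p) - norm (y - p)\<bar>" unfolding right_diff_distrib[symmetric] abs_mult using \<rho> by simp
      also have "\<dots> \<le> 2 / \<rho> * norm (x - y)"
        using norm_triangle_ineq3[of "x - p" "y - p"] \<rho> by (intro mult_left_mono) auto
      finally show ?thesis .
    qed
    have V1: "(\<lambda>x. \<zeta> x * f x) \<in> V" by (rule V_mult_Lipschitz[OF insert.prems(2) \<zeta>m z01 zL])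
    have V2: "(\<lambda>x. (1 - \<zeta> x) * f x) \<in> V"
      using V_diff[OF insert.prems(2) V1] by (simp add: left_diff_distrib)
    have P1: "P (\<lambda>x. \<zeta> x * f x)"
    proof -
      have "\<zeta> x * f x = 0" if "x \<notin> cball p \<rho>" for x
      proof -
        have "2 \<le> 2 / \<rho> * norm (x - p)" using that \<rho> by (simp add: dist_norm norm_minus_commute field_simps)
        then show ?thesis by (simp add: \<zeta>_def)
      qed
      then obtain \<psi> where "\<And>j. test_fun \<Omega> (\<psi> j)" "\<And>j. \<psi> j \<in> V" "\<And>j. nrm (\<psi> j) \<le> nrm (\<lambda>x. \<zeta> x * f x)"
          "(\<lambda>j. LBINT x. (\<psi> j x - \<zeta> x * f x)\<^sup>2) \<longlonglongrightarrow> 0"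
        using mollify[OF good[OF pc] V1] unfolding \<rho>_def by blast
      then show ?thesis by (intro lim[OF V1, of \<psi>]) (auto intro: test)
    qed
    have P2: "P (\<lambda>x. (1 - \<zeta> x) * f x)"
    proof (rule insert.IH)
      fix x assume x: "x \<notin> (\<Union>p\<in>I. ball p (r p / 2))"
      show "(1 - \<zeta> x) * f x = 0"
      proof (cases "x \<in> ball p (\<rho> / 2)")
        case True
        then have "2 / \<rho> * norm (x - p) \<le> 1" using \<rho> by (simp add: dist_norm norm_minus_commute field_simps)
        then show ?thesis by (simp add: \<zeta>_def)
      next
        case False
        then show ?thesis using x insert.prems(3)[of x] by (simp add: \<rho>_def)
      qed
    qed (use insert.prems V2 in auto)
    have "P (\<lambda>x. \<zeta> x * f x + (1 - \<zeta> x) * f x)" by (rule add[OF V1 V2 P1 P2])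
    then show ?case by (simp add: left_diff_distrib)
  qed
  show ?thesis
  proof (rule main[OF I(2,1) f])
    fix x assume "x \<notin> (\<Union>p\<in>I. ball p (r p / 2))"
    then have "x \<notin> \<Omega>" using I(3) closure_subset[of \<Omega>] by blast
    then show "f x = 0" by (rule V_outside[OF f])
  qed
qed

end

section \<open>Order tested in the energy space, and potentials\<close>

context frac
begin

text \<open>Indicators of open sets are increasing limits of Lipschitz functions in
  \<open>V\<close>, and outer regularity carries the sign of the integral from open sets to the set
  where \<open>g\<close> is negative.\<close>

lemma V_dominates_order:
  assumes g: "integrable lborel g" and out: "\<And>x. x \<notin> \<Omega> ==> g x = 0"
    and pos: "\<And>\<psi>. \<psi> \<in> V ==> (\<And>x. 0 \<le> \<psi> x) ==> 0 \<le> (LBINT x. g x * \<psi> x)"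
  shows "AE x in lborel. 0 \<le> g x"
proof -
  have gm [measurable]: "g \<in> borel_measurable borel" using g by simp
  have open_nonneg: "0 \<le> (LBINT x. g x * indicator U x)" if U: "open U" "U \<subseteq> \<Omega>" for U
  proof -
    have "bounded U" using U bounded_Omega bounded_subset by blast
    then have ne: "- U \<noteq> {}" using not_bounded_UNIV by (metis Compl_empty_eq double_compl)
    define \<psi> where "\<psi> n x = min 1 (real n * infdist x (- U))" for n :: nat and x
    have m [measurable]: "\<psi> n \<in> borel_measurable borel" for n
      unfolding \<psi>_def by (intro borel_measurable_continuous_onI continuous_intros continuous_on_infdist)
    have V: "\<psi> n \<in> V" for n
    proof (rule V_Lipschitz[where L="real n"])
      fix x y
      have "\<bar>\<psi> n x - \<psi> n y\<bar> \<le> \<bar>real n * infdist x (- U) - real n * infdist y (- U)\<bar>"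
        unfolding \<psi>_def by linarith
      also have "\<dots> = real n * \<bar>infdist x (- U) - infdist y (- U)\<bar>" unfolding right_diff_distrib[symmetric] abs_mult by simp
      also have "\<dots> \<le> real n * norm (x - y)"
        using infdist_triangle_abs[of x "- U" y] by (intro mult_left_mono) (auto simp: dist_norm)
      finally show "\<bar>\<psi> n x - \<psi> n y\<bar> \<le> real n * norm (x - y)" .
    next
      fix x assume "x \<notin> \<Omega>"
      then have "infdist x (- U) = 0" using U by (intro infdist_zero) auto
      then show "\<psi> n x = 0" by (simp add: \<psi>_def)
    qed (use m in \<open>auto simp: \<psi>_def infdist_nonneg\<close>)
    have lim: "(\<lambda>n. \<psi> n x) \<longlonglongrightarrow> indicator U x" for x
    proof (cases "x \<in> U")
      case True
      then have "infdist x (- U) \<noteq> 0"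
        using in_closed_iff_infdist_zero[of "- U" x] U ne by auto
      then have d: "0 < infdist x (- U)" using infdist_nonneg[of x "- U"] by linarith
      obtain N where N: "1 < real N * infdist x (- U)" using reals_Archimedean3[OF d] by blast
      have "\<forall>\<^sub>F n in sequentially. \<psi> n x = indicator U x"
      proof (rule eventually_sequentiallyI[of N])
        fix n assume "N \<le> n"
        then have "real N * infdist x (- U) \<le> real n * infdist x (- U)" using d by (intro mult_right_mono) auto
        then show "\<psi> n x = indicator U x" using N True by (simp add: \<psi>_def)
      qed
      then show ?thesis by (rule tendsto_eventually)
    next
      case False
      then have "\<psi> n x = 0" for n by (simp add: \<psi>_def infdist_zero)
      then show ?thesis using False by simp
    qed
    have "(\<lambda>n. LBINT x. g x * \<psi> n x) \<longlonglongrightarrow> (LBINT x. g x * indicator U x)"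
    proof (rule integral_dominated_convergence[where w="\<lambda>x. \<bar>g x\<bar>"])
      have [measurable]: "U \<in> sets borel" using U by simp
      show "(\<lambda>x. g x * indicator U x) \<in> borel_measurable lborel" by measurable
      show "AE x in lborel. (\<lambda>n. g x * \<psi> n x) \<longlonglongrightarrow> g x * indicator U x"
        by (intro AE_I2 tendsto_mult tendsto_const lim)
      have "\<bar>\<psi> n x\<bar> \<le> 1" for n x by (simp add: \<psi>_def infdist_nonneg)
      then show "AE x in lborel. norm (g x * \<psi> n x) \<le> \<bar>g x\<bar>" for n
        by (intro AE_I2) (simp add: abs_mult mult_left_le)
    qed (use g in auto)
    moreover have "0 \<le> (LBINT x. g x * \<psi> n x)" for n
      by (rule pos[OF V]) (simp add: \<psi>_def infdist_nonneg)
    ultimately show ?thesis by (intro LIMSEQ_le_const[of _ _ 0]) auto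
  qed
  define B where "B = {x. g x < 0}"
  have B [measurable]: "B \<in> sets borel" unfolding B_def by measurable
  have BO: "B \<subseteq> \<Omega>" using out by (force simp: B_def)
  have "\<exists>U. open U \<and> B \<subseteq> U \<and> emeasure lborel (U - B) < ennreal (1 / real (Suc n))" for n
    using outer_regular_lborel[OF B, of "1 / real (Suc n)"] by (metis zero_less_divide_1_iff of_nat_0_less_iff zero_less_Suc)
  then obtain U where U: "\<And>n. open (U n)" "\<And>n. B \<subseteq> U n" "\<And>n. emeasure lborel (U n - B) < ennreal (1 / real (Suc n))" by metis
  \<comment> \<open>Finite intersections make the open sets decrease, so dominated convergence
    applies; their limit exceeds \<open>B\<close> only by a null set.\<close>
  define W where "W n = \<Omega> \<inter> (\<Inter>i\<le>n. U i)" for n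
  have W: "open (W n)" "W n \<subseteq> \<Omega>" "B \<subseteq> W n" for n using U BO open_Omega by (auto simp: W_def)
  have [measurable]: "W n \<in> sets borel" for n using W by simp
  define W' where "W' = (\<Inter>n. W n)"
  have [measurable]: "W' \<in> sets borel" unfolding W'_def by measurable
  have "(\<lambda>n. LBINT x. g x * indicator (W n) x) \<longlonglongrightarrow> (LBINT x. g x * indicator W' x)"
  proof (rule integral_dominated_convergence[where w="\<lambda>x. \<bar>g x\<bar>"])
    show "AE x in lborel. (\<lambda>n. g x * indicator (W n) x) \<longlonglongrightarrow> g x * indicator W' x"
    proof (intro AE_I2 tendsto_mult tendsto_const)
      fix x
      have "decseq W" by (auto simp: decseq_def W_def)
      then show "(\<lambda>n. indicator (W n) x :: real) \<longlonglongrightarrow> indicator W' x"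
        unfolding W'_def by (rule LIMSEQ_indicator_decseq)
    qed
    show "AE x in lborel. norm (g x * indicator (W n) x) \<le> \<bar>g x\<bar>" for n
      by (intro AE_I2) (auto simp: indicator_def)
  qed (use g in auto)
  then have ge: "0 \<le> (LBINT x. g x * indicator W' x)"
    by (rule LIMSEQ_le_const) (use open_nonneg W in auto)
  have "emeasure lborel (W' - B) \<le> ennreal (1 / real (Suc n))" for n
  proof -
    have "emeasure lborel (W' - B) \<le> emeasure lborel (U n - B)"
      using U(1) by (intro emeasure_mono) (auto simp: W'_def W_def)
    then show ?thesis using U(3)[of n] by simp
  qed
  moreover have "(\<lambda>n. ennreal (1 / real (Suc n))) \<longlonglongrightarrow> ennreal 0"
    by (intro tendsto_ennrealI LIMSEQ_Suc[OF lim_1_over_n])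
  ultimately have "emeasure lborel (W' - B) \<le> ennreal 0" by (intro LIMSEQ_le_const) auto
  then have null: "emeasure lborel (W' - B) = 0" by simp
  then have AEB: "AE x in lborel. x \<notin> W' - B" by (intro AE_not_in) (auto simp: null_sets_def)
  have BW: "B \<subseteq> W'" unfolding W'_def using W(3) by blast
  have "AE x in lborel. g x * indicator W' x = g x * indicator B x"
    using AEB by eventually_elim (use BW in \<open>auto simp: indicator_def\<close>)
  then have "(LBINT x. g x * indicator W' x) = (LBINT x. g x * indicator B x)"
    by (intro integral_cong_AE) auto
  then have le: "(LBINT x. - (g x * indicator B x)) \<le> 0" using ge by simp
  have i: "integrable lborel (\<lambda>x. - (g x * indicator B x))" using g integrable_mult_indicator[of B lborel g] by (simp add: mult.commute)
  have nn: "0 \<le> - (g x * indicator B x)" for x by (auto simp: indicator_def B_def)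
  have "(LBINT x. - (g x * indicator B x)) = 0" using le nn by (intro antisym integral_nonneg_AE) auto
  then have "AE x in lborel. - (g x * indicator B x) = 0"
    using integral_nonneg_eq_0_iff_AE[OF i] nn by simp
  then show ?thesis by eventually_elim (auto simp: indicator_def B_def split: if_splits)
qed

text \<open>The weak Dirichlet problem, kept as a relation because functions in \<open>V\<close>
  that agree almost everywhere solve it alike.\<close>

definition sol :: "('a => real) => ('a => real) => bool" where
  "sol X g \<longleftrightarrow> X \<in> V \<and> dual g \<and> (\<forall>\<psi>\<in>V. E X \<psi> = (LBINT x. g x * \<psi> x))"

lemma sol_V: "sol X g ==> X \<in> V" by (simp add: sol_def)
lemma sol_E: "sol X g ==> \<psi> \<in> V ==> E X \<psi> = (LBINT x. g x * \<psi> x)" by (simp add: sol_def)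
lemma sol_integrable: "sol X g ==> \<psi> \<in> V ==> integrable lborel (\<lambda>x. g x * \<psi> x)" by (simp add: sol_def dual_integrable)

text \<open>Riesz representation, obtained as the case \<open>c = 0\<close> of the minimisation;
  \<open>qs / 2\<close> is an admissible exponent because \<open>qs > 2\<close>.\<close>

lemma sol_exists: assumes "dual g" obtains X where "sol X g"
proof -
  define p where "p = qs / 2"
  have p: "1 < p" "p + 1 < qs" using qs_gt_2 by (auto simp: p_def)
  obtain X where "X \<in> V" "\<And>\<psi>. \<psi> \<in> V ==> 0 * (LBINT x. max 0 (X x) powr p * \<psi> x) + E X \<psi> = (LBINT x. g x * \<psi> x)"
    using minimiser[OF assms order_refl p] by metis
  then have "sol X g" using assms by (simp add: sol_def)
  then show ?thesis by (rule that)
qed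

lemma dual_diff: assumes f: "dual f" and g: "dual g" shows "dual (\<lambda>x. f x - g x)"
proof -
  obtain A where A: "0 \<le> A" "\<forall>\<psi>\<in>V. \<bar>\<integral>x. f x * \<psi> x \<partial>lborel\<bar> \<le> A * nrm \<psi>" using f by (auto simp: dual_def)
  obtain B where B: "0 \<le> B" "\<forall>\<psi>\<in>V. \<bar>\<integral>x. g x * \<psi> x \<partial>lborel\<bar> \<le> B * nrm \<psi>" using g by (auto simp: dual_def)
  have "\<bar>\<integral>x. (f x - g x) * \<psi> x \<partial>lborel\<bar> \<le> (A + B) * nrm \<psi>" if "\<psi> \<in> V" for \<psi>
  proof -
    have "(LBINT x. (f x - g x) * \<psi> x) = (LBINT x. f x * \<psi> x) - (LBINT x. g x * \<psi> x)"
      using dual_integrable[OF f that] dual_integrable[OF g that] by (simp add: left_diff_distrib)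
    then show ?thesis using bspec[OF A(2) that] bspec[OF B(2) that] by (simp add: distrib_right)
  qed
  then show ?thesis using A(1) B(1) dual_integrable[OF f] dual_integrable[OF g]
    unfolding dual_def by (auto simp: left_diff_distrib intro!: exI[of _ "A + B"])
qed

lemma sol_diff:
  assumes "sol X f" "sol Y g" shows "sol (\<lambda>x. X x - Y x) (\<lambda>x. f x - g x)"
  using assms dual_diff[of f g] unfolding sol_def
  by (auto simp: V_diff E_diff_left left_diff_distrib dual_integrable)

lemma dual_cmult: assumes f: "dual f" shows "dual (\<lambda>x. c * f x)"
proof -
  obtain A where A: "0 \<le> A" "\<forall>\<psi>\<in>V. \<bar>\<integral>x. f x * \<psi> x \<partial>lborel\<bar> \<le> A * nrm \<psi>" using f by (auto simp: dual_def)
  then show ?thesis using dual_integrable[OF f] unfolding dual_def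
    by (auto simp: abs_mult mult.assoc intro!: exI[of _ "\<bar>c\<bar> * A"] mult_left_mono)
qed

lemma sol_cmult: assumes "sol X f" shows "sol (\<lambda>x. c * X x) (\<lambda>x. c * f x)"
  using assms dual_cmult[of f c] unfolding sol_def
  by (auto simp: V_cmult E_cmult_left mult.assoc)

lemma E_zero_left: assumes "f \<in> V" "nrm f = 0" "\<psi> \<in> V" shows "E f \<psi> = 0"
  using E_CS[OF assms(1,3)] assms(2) by simp

end

section \<open>Weak solutions of the fast diffusion equation\<close>

locale flow = frac \<sigma> \<Omega> nn cn omg
  for \<sigma> :: real and \<Omega> :: "'a::euclidean_space set" and nn cn omg :: real +
  fixes m p :: real and u0 :: "'a => real" and u :: "'a => real => real"
  assumes p_def: "p = 1 / m"
    and sb: "smooth_boundary \<Omega>"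
    and m_low: "(nn - 2 * \<sigma>) / (nn + 2 * \<sigma>) < m" and m1: "m < 1"
    and u0_nonneg: "0 \<le> u0 x" and u0_V: "(\<lambda>x. u0 x powr m) \<in> Hsigma0 \<sigma> \<Omega>"
    and u0_super: "weak_frac_lap_nonneg \<sigma> \<Omega> (\<lambda>x. u0 x powr m)"
    and wsol: "weak_sol_fde \<sigma> m \<Omega> u0 u"
begin

lemma m0: "0 < m"
proof -
  have "0 < (nn - 2 * \<sigma>) / (nn + 2 * \<sigma>)" using dimn s0 by (intro divide_pos_pos) auto
  then show ?thesis using m_low by linarith
qed

lemma p1: "1 < p" using m0 m1 by (simp add: p_def)

text \<open>This is what the lower bound on \<open>m\<close> means: the exponent
  \<open>p + 1\<close> of \<open>w\<close> is subcritical, which leaves the gap exploited by the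
  minimisation and by the level-set iteration.\<close>

lemma p_qs: "p + 1 < qs"
proof -
  have d: "0 < nn - 2 * \<sigma>" "0 < nn + 2 * \<sigma>" using dimn s0 by auto
  have "(nn - 2 * \<sigma>) < m * (nn + 2 * \<sigma>)" using m_low d by (simp add: pos_divide_less_eq)
  then have "1 / m * (nn - 2 * \<sigma>) < nn + 2 * \<sigma>" using m0 by (simp add: field_simps)
  then have "(p + 1) * (nn - 2 * \<sigma>) < 2 * nn" by (simp add: p_def distrib_right)
  then show ?thesis using d by (simp add: qs_def pos_less_divide_eq)
qed

lemma conj_exp: "1 < 1 + m" "1 < p + 1" "1 / (1 + m) + 1 / (p + 1) = 1" "m * (p + 1) = 1 + m" "p * m = 1"
  using m0 p1 by (auto simp: p_def field_simps)

abbreviation U :: "real => 'a => real" where "U t \<equiv> (\<lambda>x. u x t)"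
abbreviation w :: "real => 'a => real" where "w t \<equiv> (\<lambda>x. u x t powr m)"
definition dd :: "real => real => real" where "dd s t = Lnorm (1 + m) (\<lambda>x. u x s - u x t)"
definition nU :: "real => real" where "nU t = Lnorm (1 + m) (U t)"

lemma u_nonneg: "0 \<le> u x t" and u_outside: "x \<notin> \<Omega> ==> u x t = 0"
  and u_init: "AE x in lborel. u x 0 = u0 x"
  and u_cont: "0 \<le> t0 ==> ((\<lambda>t. integral\<^sup>L lborel (\<lambda>x. \<bar>u x t - u x t0\<bar> powr (1 + m))) \<longlongrightarrow> 0) (at t0 within {0..})"
  and w_V: "0 < t ==> w t \<in> V"
  and E_int: "0 < T' ==> set_integrable lborel {0<..T'} (\<lambda>t. E (w t) (w t))"
  and weak_test: "test_fun \<Omega> \<psi> ==> 0 \<le> t1 ==> t1 \<le> t2 ==> set_integrable lborel {t1..t2} (\<lambda>t. E (w t) \<psi>) \<and>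
        integral\<^sup>L lborel (\<lambda>x. u x t2 * \<psi> x) - integral\<^sup>L lborel (\<lambda>x. u x t1 * \<psi> x)
          = - set_lebesgue_integral lborel {t1..t2} (\<lambda>t. E (w t) \<psi>)"
  using wsol unfolding weak_sol_fde_def by blast+

lemma U_Lp: assumes "0 \<le> t" shows "Lp (1 + m) (U t)"
proof -
  have "(\<lambda>x. u x t) \<in> borel_measurable lborel \<and> integrable lborel (\<lambda>x. u x t powr (1 + m))"
    using wsol assms unfolding weak_sol_fde_def by blast
  then show ?thesis by (simp add: Lp_def u_nonneg)
qed

lemma U_measurable [measurable]: "0 \<le> t ==> U t \<in> borel_measurable borel"
  using U_Lp[of t] by (simp add: Lp_def)

lemma dual_of_Lp: "Lp (1 + m) g ==> dual g"
  using dual_Lp[OF conj_exp(1-3) p_qs] by blast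

lemma dual_U: "0 \<le> t ==> dual (U t)"
  by (intro dual_of_Lp U_Lp)

lemma powr_Lp:
  assumes v: "Lp (p + 1) v" and v0: "\<And>x. 0 \<le> v x"
  shows "Lp (1 + m) (\<lambda>x. v x powr p)"
proof -
  have "\<bar>v x powr p\<bar> powr (1 + m) = \<bar>v x\<bar> powr (p + 1)" for x
  proof -
    have "p * (1 + m) = p + 1" using conj_exp by (simp add: distrib_left)
    then show ?thesis using v0[of x] by (simp add: powr_powr)
  qed
  moreover note [measurable] = Lp_measurable[OF v]
  ultimately show ?thesis using v unfolding Lp_def by simp
qed

lemma w_Lp: assumes "0 \<le> t" shows "Lp (p + 1) (w t)" "Lnorm (p + 1) (w t) = nU t powr m"
proof -
  have e: "\<bar>u x t powr m\<bar> powr (p + 1) = \<bar>u x t\<bar> powr (1 + m)" for x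
    using u_nonneg[of x t] conj_exp(4) by (simp add: powr_powr)
  note [measurable] = U_measurable[OF assms]
  show "Lp (p + 1) (w t)" using U_Lp[OF assms] unfolding Lp_def e by simp
  have "1 / (p + 1) = 1 / (1 + m) * m" using m0 p1 by (simp add: p_def field_simps)
  then show "Lnorm (p + 1) (w t) = nU t powr m" by (simp only: Lnorm_def e nU_def powr_powr)
qed

lemma w_dist: assumes "0 \<le> s" "0 \<le> t" shows "Lnorm (p + 1) (\<lambda>x. u x s powr m - u x t powr m) \<le> dd s t powr m"
proof -
  have "Lp (p + 1) (\<lambda>x. \<bar>u x s - u x t\<bar> powr m)"
  proof -
    have "\<bar>\<bar>u x s - u x t\<bar> powr m\<bar> powr (p + 1) = \<bar>u x s - u x t\<bar> powr (1 + m)" for x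
      using conj_exp(4) by (simp add: powr_powr)
    moreover note [measurable] = U_measurable[OF assms(1)] U_measurable[OF assms(2)]
    ultimately show ?thesis using Lp_diff[OF U_Lp[OF assms(1)] U_Lp[OF assms(2)]] m0 unfolding Lp_def by simp
  qed
  moreover have "\<bar>u x s powr m - u x t powr m\<bar> \<le> \<bar>\<bar>u x s - u x t\<bar> powr m\<bar>" for x
    using powr_diff_le[OF m0 m1 u_nonneg u_nonneg] by simp
  ultimately have "Lnorm (p + 1) (\<lambda>x. u x s powr m - u x t powr m) \<le> Lnorm (p + 1) (\<lambda>x. \<bar>u x s - u x t\<bar> powr m)"
    using assms p1 by (intro Lp_bound(2)) auto
  also have "\<dots> = dd s t powr m"
  proof -
    have "\<bar>\<bar>u x s - u x t\<bar> powr m\<bar> powr (p + 1) = \<bar>u x s - u x t\<bar> powr (1 + m)" for x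
      using conj_exp(4) by (simp add: powr_powr)
    moreover have "1 / (p + 1) = 1 / (1 + m) * m" using m0 p1 by (simp add: p_def field_simps)
    ultimately show ?thesis by (simp add: Lnorm_def dd_def powr_powr)
  qed
  finally show ?thesis .
qed

lemma dd_triangle: "0 \<le> r ==> 0 \<le> s ==> 0 \<le> t ==> dd r t \<le> dd r s + dd s t"
  unfolding dd_def using Lnorm_diff_triangle[OF conj_exp(1) U_Lp U_Lp U_Lp] by blast

lemma dd_sym: "dd s t = dd t s" unfolding dd_def by (rule Lnorm_minus_commute)

lemma dd_tendsto: assumes "0 \<le> t0" shows "((\<lambda>t. dd t t0) \<longlongrightarrow> 0) (at t0 within {0..})"
proof -
  have "((\<lambda>t. integral\<^sup>L lborel (\<lambda>x. \<bar>u x t - u x t0\<bar> powr (1 + m)) powr (1 / (1 + m))) \<longlongrightarrow> 0 powr (1 / (1 + m))) (at t0 within {0..})"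
    using m0 by (intro tendsto_powr2 u_cont[OF assms] tendsto_const) auto
  then show ?thesis by (simp add: dd_def Lnorm_def)
qed

lemma nU_diff: "0 \<le> s ==> 0 \<le> t ==> \<bar>nU s - nU t\<bar> \<le> dd s t"
  unfolding nU_def dd_def using Lnorm_abs_diff_le[OF conj_exp(1) U_Lp U_Lp] by blast

lemma nU_continuous: "continuous_on {0..} nU"
  unfolding continuous_on_def
proof
  fix t0 :: real assume t0: "t0 \<in> {0..}"
  have "((\<lambda>t. nU t - nU t0) \<longlongrightarrow> 0) (at t0 within {0..})"
  proof (rule Lim_null_comparison)
    show "\<forall>\<^sub>F t in at t0 within {0..}. norm (nU t - nU t0) \<le> dd t t0"
      using nU_diff t0 by (auto simp: eventually_at_filter)
    show "((\<lambda>t. dd t t0) \<longlongrightarrow> 0) (at t0 within {0..})" using dd_tendsto t0 by simp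
  qed
  then show "(nU \<longlongrightarrow> nU t0) (at t0 within {0..})" by (simp add: LIM_zero_cancel)
qed

text \<open>Uniform continuity of \<open>u\<close> in time on a compact interval. A Lebesgue number
  of a cover by balls gives it directly for the two-point function \<open>dd\<close>.\<close>

lemma dd_uniform:
  assumes e: "0 < e"
  obtains \<delta> where "0 < \<delta>" "\<And>s t. s \<in> {0..T'} ==> t \<in> {0..T'} ==> \<bar>s - t\<bar> < \<delta> ==> dd s t < e"
proof -
  have "\<exists>d>0. \<forall>t. 0 \<le> t \<longrightarrow> \<bar>t - r\<bar> < d \<longrightarrow> dd t r < e / 2" if "0 \<le> r" for r
  proof -
    have "\<forall>\<^sub>F t in at r within {0..}. dd t r < e / 2"
      by (rule order_tendstoD(2)[OF dd_tendsto[OF that]]) (use e in simp)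
    then obtain d where d: "0 < d" "\<And>t. 0 \<le> t ==> t \<noteq> r ==> dist t r < d ==> dd t r < e / 2"
      by (auto simp: eventually_at)
    have "dd r r < e / 2" using e by (simp add: dd_def Lnorm_def)
    then show ?thesis using d by (intro exI[of _ d]) (metis dist_real_def)
  qed
  then obtain d where d: "\<And>r. 0 \<le> r ==> 0 < d r" "\<And>r t. 0 \<le> r ==> 0 \<le> t ==> \<bar>t - r\<bar> < d r ==> dd t r < e / 2" by metis
  have sub: "{0..T'} \<subseteq> \<Union>((\<lambda>r. ball r (d r)) ` {0..T'})"
  proof
    fix r assume "r \<in> {0..T'}"
    then show "r \<in> \<Union>((\<lambda>r. ball r (d r)) ` {0..T'})" using d(1)[of r] by (intro UnionI[of "ball r (d r)"]) auto
  qed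
  obtain \<delta> where \<delta>: "0 < \<delta>" "\<And>x. x \<in> {0..T'} ==> \<exists>G\<in>(\<lambda>r. ball r (d r)) ` {0..T'}. ball x \<delta> \<subseteq> G"
    using Heine_Borel_lemma[OF compact_Icc sub] by blast
  show ?thesis
  proof (rule that[OF \<delta>(1)])
    fix s t assume st: "s \<in> {0..T'}" "t \<in> {0..T'}" "\<bar>s - t\<bar> < \<delta>"
    obtain r where r: "r \<in> {0..T'}" "ball s \<delta> \<subseteq> ball r (d r)" using \<delta>(2)[OF st(1)] by blast
    have "s \<in> ball r (d r)" "t \<in> ball r (d r)" using r(2) st \<delta>(1) by (auto simp: dist_real_def subset_iff)
    then have "dd s r < e / 2" "dd t r < e / 2" using d(2)[of r] r st by (auto simp: dist_real_def abs_minus_commute)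
    then show "dd s t < e" using dd_triangle[of s r t] dd_sym[of t r] r st by auto
  qed
qed

lemma nU_bounded: obtains M where "\<And>t. t \<in> {0..T'} ==> nU t \<le> M"
proof -
  have "continuous_on {0..T'} nU" using nU_continuous by (rule continuous_on_subset) auto
  then have "bounded (nU ` {0..T'})" by (intro compact_imp_bounded compact_continuous_image) auto
  then obtain M where "\<And>t. t \<in> {0..T'} ==> \<bar>nU t\<bar> \<le> M" unfolding bounded_iff by force
  then show ?thesis using that[of M] by (meson abs_le_D1)
qed

subsection \<open>The weak formulation with general test functions\<close>

text \<open>The value at time 0 is discarded because the trace there need not lie in the energy space.\<close>

definition eW :: "('a => real) => real => real" where
  "eW \<psi> t = (if 0 < t then E (w t) \<psi> else 0)"

text \<open>The induction principle for the energy space carries the equation over from test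
  functions. In a limit, the energy pairing converges at every positive time and is dominated
  through the integrable energy of \<open>w\<close>.\<close>

lemma weak_form:
  assumes \<psi>: "\<psi> \<in> V" and t: "0 \<le> t1" "t1 \<le> t2"
  shows "integrable lborel (\<lambda>t. indicator {t1..t2} t * eW \<psi> t)"
    and "(LBINT x. u x t1 * \<psi> x) - (LBINT x. u x t2 * \<psi> x) = (LBINT t. indicator {t1..t2} t * eW \<psi> t)"
proof -
  define P where "P \<psi> \<longleftrightarrow> integrable lborel (\<lambda>t. indicator {t1..t2} t * eW \<psi> t) \<and>
    (LBINT x. u x t1 * \<psi> x) - (LBINT x. u x t2 * \<psi> x) = (LBINT t. indicator {t1..t2} t * eW \<psi> t)" for \<psi>
  have "P \<psi>"
  proof (rule V_induct_test_fun[OF sb, of P])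
    fix \<psi> assume "test_fun \<Omega> \<psi>"
    from weak_test[OF this t]
    have i: "integrable lborel (\<lambda>t. indicator {t1..t2} t * E (w t) \<psi>)"
      and eq: "(LBINT x. u x t2 * \<psi> x) - (LBINT x. u x t1 * \<psi> x) = - (LBINT t. indicator {t1..t2} t * E (w t) \<psi>)"
      by (auto simp: set_integrable_def set_lebesgue_integral_def)
    have e: "indicator {t1..t2} t * eW \<psi> t = indicator {0<..} t *\<^sub>R (indicator {t1..t2} t * E (w t) \<psi>)" for t
      by (auto simp: eW_def indicator_def)
    have i2: "integrable lborel (\<lambda>t. indicator {t1..t2} t * eW \<psi> t)"
      unfolding e by (rule integrable_mult_indicator[OF _ i]) simp
    have "(LBINT t. indicator {t1..t2} t * eW \<psi> t) = (LBINT t. indicator {t1..t2} t * E (w t) \<psi>)"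
    proof (rule integral_cong_AE)
      show "AE t in lborel. indicator {t1..t2} t * eW \<psi> t = indicator {t1..t2} t * E (w t) \<psi>"
        using AE_lborel_singleton[of "0::real"]
        by eventually_elim (use t in \<open>auto simp: eW_def indicator_def\<close>)
    qed (use i i2 in auto)
    then show "P \<psi>" using i2 eq by (simp add: P_def)
  next
    fix f g assume fg: "f \<in> V" "g \<in> V" "P f" "P g"
    have e: "eW (\<lambda>x. f x + g x) t = eW f t + eW g t" for t
      using fg w_V by (simp add: eW_def E_add_right)
    have "0 \<le> t2" using t by simp
    note I = dual_integrable[OF dual_U[OF t(1)] fg(1)] dual_integrable[OF dual_U[OF t(1)] fg(2)]
       dual_integrable[OF dual_U[OF \<open>0 \<le> t2\<close>] fg(1)] dual_integrable[OF dual_U[OF \<open>0 \<le> t2\<close>] fg(2)]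
    show "P (\<lambda>x. f x + g x)" using fg(3,4) I unfolding P_def e by (simp add: distrib_left)
  next
    fix \<psi> f B
    assume f: "f \<in> V" and \<psi>: "\<And>j. \<psi> j \<in> V" "\<And>j. P (\<psi> j)" "\<And>j. nrm (\<psi> j) \<le> B"
      and lim: "(\<lambda>j. LBINT x. (\<psi> j x - f x)\<^sup>2) \<longlonglongrightarrow> 0"
    have weak: "(\<lambda>j. E v (\<psi> j)) \<longlonglongrightarrow> E v f" if v: "v \<in> V" for v
    proof -
      have "nrm (\<lambda>x. \<psi> j x - f x) \<le> B + nrm f" for j
        using nrm_add[OF \<psi>(1)[of j] V_cmult[OF f, of "-1"]] \<psi>(3)[of j] nrm_cmult[of "-1" f] by simp
      then have "(\<lambda>j. E v (\<lambda>x. \<psi> j x - f x)) \<longlonglongrightarrow> 0"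
        by (intro weak_convergence_0[OF v V_diff[OF \<psi>(1) f] _ lim])
      then have "(\<lambda>j. E v (\<psi> j) - E v f) \<longlonglongrightarrow> 0" using E_diff_right[OF \<psi>(1) f v] by simp
      then show ?thesis by (simp add: LIM_zero_cancel)
    qed
    \<comment> \<open>Pairing with \<open>u t\<close> is the energy pairing with its potential, so
      weak convergence covers it as well.\<close>
    have pair: "(\<lambda>j. LBINT x. u x t * \<psi> j x) \<longlonglongrightarrow> (LBINT x. u x t * f x)" if t': "0 \<le> t" for t
    proof -
      obtain X where X: "sol X (U t)" using sol_exists[OF dual_U[OF t']] by blast
      show ?thesis using weak[OF sol_V[OF X]] sol_E[OF X \<psi>(1)] sol_E[OF X f] by simp
    qed
    \<comment> \<open>A norm is at most one plus its square, which makes the energy of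
      \<open>w\<close> the majorant. The interval ends at \<open>t2 + 1\<close> because
      integrability of the energy is given on intervals of positive length.\<close>
    define bd where "bd t = B * (indicator {0<..t2 + 1} t + indicator {0<..t2 + 1} t * E (w t) (w t))" for t
    have B: "0 \<le> B" using \<psi>(3)[of 0] nrm_nonneg[of "\<psi> 0"] by linarith
    have bd_int: "integrable lborel bd"
    proof -
      have "integrable lborel (\<lambda>t. indicator {0<..t2 + 1} t * E (w t) (w t))"
        using E_int[of "t2 + 1"] t by (simp add: set_integrable_def)
      then show ?thesis unfolding bd_def by (intro integrable_mult_right Bochner_Integration.integrable_add integrable_real_indicator) (use t in auto)
    qed
    have bd: "\<bar>indicator {t1..t2} s * eW (\<psi> j) s\<bar> \<le> bd s" for j s
    proof (cases "0 < s \<and> s \<in> {t1..t2}")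
      case True
      have "\<bar>E (w s) (\<psi> j)\<bar> \<le> nrm (w s) * nrm (\<psi> j)" using True by (intro E_CS w_V \<psi>) auto
      also have "\<dots> \<le> nrm (w s) * B" using \<psi>(3) by (intro mult_left_mono) auto
      also have "nrm (w s) \<le> 1 + (nrm (w s))\<^sup>2"
        using sum_squares_bound[of 1 "nrm (w s)"] zero_le_power2[of "nrm (w s)"] nrm_nonneg[of "w s"] by (simp del: nrm_nonneg)
      finally have "\<bar>E (w s) (\<psi> j)\<bar> \<le> (1 + E (w s) (w s)) * B"
        using B by (simp add: nrm_sq mult_right_mono)
      then show ?thesis using True t by (simp add: bd_def eW_def mult.commute)
    next
      case False
      have "0 \<le> bd s" using B E_nonneg by (simp add: bd_def)
      then show ?thesis using False by (auto simp: eW_def)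
    qed
    have ptlim: "(\<lambda>j. indicator {t1..t2} s * eW (\<psi> j) s) \<longlonglongrightarrow> indicator {t1..t2} s * eW f s" for s
      unfolding eW_def using weak[OF w_V[of s]] by (auto intro!: tendsto_mult)
    have mj: "(\<lambda>s. indicator {t1..t2} s * eW (\<psi> j) s) \<in> borel_measurable lborel" for j
      using \<psi>(2)[of j] unfolding P_def by (intro borel_measurable_integrable) simp
    have ml: "(\<lambda>s. indicator {t1..t2} s * eW f s) \<in> borel_measurable lborel"
      by (rule borel_measurable_LIMSEQ_real[OF ptlim mj])
    have c1: "integrable lborel (\<lambda>s. indicator {t1..t2} s * eW f s)"
      by (rule integrable_dominated_convergence[OF ml mj bd_int AE_I2[OF ptlim] AE_I2]) (use bd in auto)
    have c2: "(\<lambda>j. LBINT s. indicator {t1..t2} s * eW (\<psi> j) s) \<longlonglongrightarrow> (LBINT s. indicator {t1..t2} s * eW f s)"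
      by (rule integral_dominated_convergence[OF ml mj bd_int AE_I2[OF ptlim] AE_I2]) (use bd in auto)
    have "(\<lambda>j. (LBINT x. u x t1 * \<psi> j x) - (LBINT x. u x t2 * \<psi> j x)) \<longlonglongrightarrow> (LBINT x. u x t1 * f x) - (LBINT x. u x t2 * f x)"
      using t by (intro tendsto_diff pair) auto
    moreover have "(LBINT x. u x t1 * \<psi> j x) - (LBINT x. u x t2 * \<psi> j x) = (LBINT s. indicator {t1..t2} s * eW (\<psi> j) s)" for j
      using \<psi>(2)[of j] by (simp add: P_def)
    ultimately show "P f" using c1 c2 LIMSEQ_unique unfolding P_def by simp
  qed (rule \<psi>)
  then show "integrable lborel (\<lambda>t. indicator {t1..t2} t * eW \<psi> t)"
    and "(LBINT x. u x t1 * \<psi> x) - (LBINT x. u x t2 * \<psi> x) = (LBINT t. indicator {t1..t2} t * eW \<psi> t)"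
    by (auto simp: P_def)
qed

lemma weak_form_upper:
  assumes \<psi>: "\<psi> \<in> V" and t: "0 \<le> t1" "t1 \<le> t2" and c: "\<And>r. t1 < r ==> r \<le> t2 ==> E (w r) \<psi> \<le> c"
  shows "(LBINT x. u x t1 * \<psi> x) - (LBINT x. u x t2 * \<psi> x) \<le> c * (t2 - t1)"
proof -
  have "(LBINT t. indicator {t1..t2} t * eW \<psi> t) \<le> (LBINT t. indicator {t1..t2} t * c)"
  proof (rule integral_mono_AE[OF weak_form(1)[OF \<psi> t]])
    show "AE s in lborel. indicator {t1..t2} s * eW \<psi> s \<le> indicator {t1..t2} s * c"
      using AE_lborel_singleton[of t1]
      by eventually_elim (use t c in \<open>auto simp: eW_def indicator_def\<close>)
  qed (intro integrable_mult_left integrable_real_indicator, use t in auto)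
  then show ?thesis using weak_form(2)[OF \<psi> t] t by (simp add: mult.commute)
qed

lemma weak_form_lower:
  assumes \<psi>: "\<psi> \<in> V" and t: "0 \<le> t1" "t1 \<le> t2" and c: "\<And>r. t1 < r ==> r \<le> t2 ==> c \<le> E (w r) \<psi>"
  shows "c * (t2 - t1) \<le> (LBINT x. u x t1 * \<psi> x) - (LBINT x. u x t2 * \<psi> x)"
proof -
  have "(LBINT t. indicator {t1..t2} t * c) \<le> (LBINT t. indicator {t1..t2} t * eW \<psi> t)"
  proof (rule integral_mono_AE[OF _ weak_form(1)[OF \<psi> t]])
    show "AE s in lborel. indicator {t1..t2} s * c \<le> indicator {t1..t2} s * eW \<psi> s"
      using AE_lborel_singleton[of t1]
      by eventually_elim (use t c in \<open>auto simp: eW_def indicator_def\<close>)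
  qed (intro integrable_mult_left integrable_real_indicator, use t in auto)
  then show ?thesis using weak_form(2)[OF \<psi> t] t by (simp add: mult.commute)
qed

end

context flow
begin

subsection \<open>Implicit Euler scheme and monotonicity in time\<close>

text \<open>The invariant of the implicit scheme: being a supersolution forces the next step below
  the present one, and the next step is a supersolution again.\<close>

definition state :: "('a => real) => bool" where
  "state v \<longleftrightarrow> v \<in> V \<and> (\<forall>x. 0 \<le> v x) \<and> weak_frac_lap_nonneg \<sigma> \<Omega> v"

lemma V_Lp_p1: "v \<in> V ==> Lp (p + 1) v"
  using V_Lp(1)[of v "p + 1"] p_qs p1 by simp

lemma dual_powr: "v \<in> V ==> (\<And>x. 0 \<le> v x) ==> dual (\<lambda>x. v x powr p)"
  by (intro dual_of_Lp powr_Lp V_Lp_p1)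

text \<open>Testing with the positive part of \<open>v' - v\<close> sets the supersolution
  \<open>v\<close> against the monotone power, so the step decreases. Its fractional Laplacian is
  the decrease of the power divided by \<open>h\<close>, hence nonnegative.\<close>

lemma euler_step:
  assumes v: "state v" and h: "0 \<le> h"
  obtains v' where "state v'" "AE x in lborel. v' x \<le> v x"
    "\<And>\<psi>. \<psi> \<in> V ==> (LBINT x. v' x powr p * \<psi> x) + h * E v' \<psi> = (LBINT x. v x powr p * \<psi> x)"
proof (cases "h = 0")
  \<comment> \<open>Steps of length zero do occur: the time grid in \<open>u_antimono\<close> rests
    at the start when \<open>t1 = 0\<close>, and after reaching \<open>t2\<close>.\<close>
  case True
  then show ?thesis using that[of v] v by auto
next
  case False
  then have h0: "0 < h" using h by simp
  have vV: "v \<in> V" and v0: "\<And>x. 0 \<le> v x" and sup: "\<And>\<psi>. \<psi> \<in> V ==> (\<And>x. 0 \<le> \<psi> x) ==> 0 \<le> E v \<psi>"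
    using v by (auto simp: state_def weak_frac_lap_nonneg_def)
  have dv: "dual (\<lambda>x. v x powr p)" by (rule dual_powr[OF vV v0])
  obtain z where z: "z \<in> V" "\<And>\<psi>. \<psi> \<in> V ==> 1 / h * (LBINT x. max 0 (z x) powr p * \<psi> x) + E z \<psi> = (LBINT x. 1 / h * v x powr p * \<psi> x)"
  proof -
    have h1: "0 \<le> 1 / h" using h0 by simp
    show ?thesis using minimiser[OF dual_cmult[OF dv, of "1 / h"] h1 p1 p_qs] that by blast
  qed
  \<comment> \<open>The positive part of \<open>z\<close> vanishes wherever \<open>zm\<close> does
    not, so testing with \<open>zm\<close> gives \<open>0 \<le> E z zm\<close>, while truncation
    gives \<open>E zm zm \<le> - E z zm\<close>; the negative part has no energy.\<close>
  define zm where "zm x = max 0 (- z x)" for x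
  have zmV: "zm \<in> V" unfolding zm_def using V_pos[OF V_cmult[OF z(1), of "-1"]] by simp
  define v' where "v' x = max 0 (z x)" for x
  have v'V: "v' \<in> V" unfolding v'_def by (rule V_pos[OF z(1)])
  have v'0: "0 \<le> v' x" for x by (simp add: v'_def)
  have "E zm zm \<le> - E z zm"
    using E_trunc[OF V_cmult[OF z(1), of "-1"], of 0] E_cmult_left[of "-1" z zm] by (simp add: zm_def[abs_def])
  moreover have "0 \<le> E z zm"
  proof -
    have mz: "max 0 (z x) powr p * zm x = 0" for x by (simp add: zm_def max_def)
    have "(LBINT x. max 0 (z x) powr p * zm x) = 0" unfolding mz by simp
    then have "E z zm = (LBINT x. 1 / h * v x powr p * zm x)" using z(2)[OF zmV] by simp
    also have "0 \<le> \<dots>" using h0 by (intro integral_nonneg_AE) (auto simp: zm_def)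
    finally show ?thesis .
  qed
  ultimately have "E zm zm = 0" using E_nonneg[of zm] by linarith
  then have nzm: "nrm zm = 0" by (simp add: nrm_def)
  have "v' = (\<lambda>x. z x + zm x)" by (auto simp: v'_def zm_def max_def fun_eq_iff)
  then have Ev': "E v' \<psi> = E z \<psi>" if "\<psi> \<in> V" for \<psi>
    using E_add_left[OF z(1) zmV that] E_zero_left[OF zmV nzm that] by simp
  have eq: "(LBINT x. v' x powr p * \<psi> x) + h * E v' \<psi> = (LBINT x. v x powr p * \<psi> x)" if "\<psi> \<in> V" for \<psi>
  proof -
    have "1 / h * (LBINT x. v' x powr p * \<psi> x) + E v' \<psi> = 1 / h * (LBINT x. v x powr p * \<psi> x)"
      using z(2)[OF that] unfolding Ev'[OF that] v'_def mult.assoc by simp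
    then show ?thesis using h0 by (simp add: field_simps)
  qed
  have dv': "dual (\<lambda>x. v' x powr p)" by (rule dual_powr[OF v'V v'0])
  define \<psi> where "\<psi> x = max 0 (v' x - v x)" for x
  have \<psi>V: "\<psi> \<in> V" unfolding \<psi>_def by (rule V_pos[OF V_diff[OF v'V vV]])
  have le: "AE x in lborel. v' x \<le> v x"
  proof -
    have "(LBINT x. v' x powr p * \<psi> x) - (LBINT x. v x powr p * \<psi> x) = (LBINT x. (v' x powr p - v x powr p) * \<psi> x)"
      using dual_integrable[OF dv \<psi>V] dual_integrable[OF dv' \<psi>V] by (simp add: left_diff_distrib)
    also have "0 \<le> \<dots>"
    proof (intro integral_nonneg_AE AE_I2)
      fix x
      show "0 \<le> (v' x powr p - v x powr p) * \<psi> x"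
      proof (cases "v x \<le> v' x")
        case True
        then have "v x powr p \<le> v' x powr p" using v0 p1 by (intro powr_mono2) auto
        then show ?thesis by (simp add: \<psi>_def)
      qed (simp add: \<psi>_def)
    qed
    finally have "h * E v' \<psi> \<le> 0" using eq[OF \<psi>V] by simp
    then have "E v' \<psi> \<le> 0" using h0 by (simp add: mult_le_0_iff)
    moreover have "0 \<le> E v \<psi>" by (rule sup[OF \<psi>V]) (simp add: \<psi>_def)
    moreover have "E \<psi> \<psi> \<le> E (\<lambda>x. v' x - v x) \<psi>"
      using E_trunc[OF V_diff[OF v'V vV], of 0] by (simp add: \<psi>_def[abs_def])
    ultimately have "E \<psi> \<psi> \<le> 0" using E_diff_left[OF v'V vV \<psi>V] by linarith
    then have "nrm \<psi> = 0" using E_nonneg[of \<psi>] by (simp add: nrm_def)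
    then have "AE x in lborel. \<psi> x = 0" by (rule nrm_0_AE[OF \<psi>V])
    then show ?thesis by eventually_elim (auto simp: \<psi>_def max_def split: if_splits)
  qed
  have "0 \<le> E v' \<phi>" if \<phi>: "\<phi> \<in> V" "\<And>x. 0 \<le> \<phi> x" for \<phi>
  proof -
    have "(LBINT x. v' x powr p * \<phi> x) \<le> (LBINT x. v x powr p * \<phi> x)"
    proof (rule integral_mono_AE[OF dual_integrable[OF dv' \<phi>(1)] dual_integrable[OF dv \<phi>(1)]])
      show "AE x in lborel. v' x powr p * \<phi> x \<le> v x powr p * \<phi> x"
        using le by eventually_elim (use v'0 p1 \<phi>(2) in \<open>auto intro!: mult_right_mono powr_mono2\<close>)
    qed
    then have "0 \<le> h * E v' \<phi>" using eq[OF \<phi>(1)] by linarith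
    then show ?thesis using h0 by (simp add: zero_le_mult_iff)
  qed
  then have "state v'" using v'V v'0 by (simp add: state_def weak_frac_lap_nonneg_def)
  then show ?thesis using that le eq by blast
qed

lemma euler_scheme:
  assumes h: "\<And>k. 0 \<le> h k"
  obtains v where "\<And>k. state (v k)" "v 0 = (\<lambda>x. u0 x powr m)" "\<And>k. AE x in lborel. v (Suc k) x \<le> v k x"
    "\<And>k \<psi>. \<psi> \<in> V ==> (LBINT x. v (Suc k) x powr p * \<psi> x) + h k * E (v (Suc k)) \<psi> = (LBINT x. v k x powr p * \<psi> x)"
proof -
  have "\<exists>v. v 0 = (\<lambda>x. u0 x powr m) \<and> (\<forall>k. state (v k) \<and> ((AE x in lborel. v (Suc k) x \<le> v k x) \<and>
     (\<forall>\<psi>\<in>V. (LBINT x. v (Suc k) x powr p * \<psi> x) + h k * E (v (Suc k)) \<psi> = (LBINT x. v k x powr p * \<psi> x))))"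
  proof -
    have "\<exists>v. \<forall>k. (state (v k) \<and> (k = 0 \<longrightarrow> v k = (\<lambda>x. u0 x powr m))) \<and> ((AE x in lborel. v (Suc k) x \<le> v k x) \<and>
     (\<forall>\<psi>\<in>V. (LBINT x. v (Suc k) x powr p * \<psi> x) + h k * E (v (Suc k)) \<psi> = (LBINT x. v k x powr p * \<psi> x)))"
    proof (rule dependent_nat_choice)
      show "\<exists>v. state v \<and> (0 = (0::nat) \<longrightarrow> v = (\<lambda>x. u0 x powr m))"
        using u0_V u0_super by (auto simp: state_def)
    next
      fix v :: "'a => real" and k :: nat
      assume "state v \<and> (k = 0 \<longrightarrow> v = (\<lambda>x. u0 x powr m))"
      then obtain v' where "state v'" "AE x in lborel. v' x \<le> v x"
        "\<And>\<psi>. \<psi> \<in> V ==> (LBINT x. v' x powr p * \<psi> x) + h k * E v' \<psi> = (LBINT x. v x powr p * \<psi> x)"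
        using euler_step[of v "h k"] h by blast
      then show "\<exists>y. (state y \<and> (Suc k = 0 \<longrightarrow> y = (\<lambda>x. u0 x powr m))) \<and> (AE x in lborel. y x \<le> v x) \<and>
        (\<forall>\<psi>\<in>V. (LBINT x. y x powr p * \<psi> x) + h k * E y \<psi> = (LBINT x. v x powr p * \<psi> x))" by blast
    qed
    then show ?thesis by blast
  qed
  then show ?thesis using that by blast
qed

text \<open>A Gronwall-free comparison in the dual norm: the error is dissipated by the monotonicity of
  \<open>v \<mapsto> v powr p\<close> up to the modulus of continuity of \<open>u\<close> in time.\<close>

lemma euler_error:
  fixes s :: "nat => real"
  assumes s0': "s 0 = 0" and sm: "\<And>k. s k \<le> s (Suc k)" and sT: "\<And>k. s k \<le> T'"
    and om: "\<And>k r. s k < r ==> r \<le> s (Suc k) ==> dd (s (Suc k)) r \<le> \<epsilon>"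
    and M: "\<And>t. t \<in> {0..T'} ==> nU t \<le> M"
    and v: "\<And>k. state (v k)" "v 0 = (\<lambda>x. u0 x powr m)" "\<And>k. AE x in lborel. v (Suc k) x \<le> v k x"
      "\<And>k \<psi>. \<psi> \<in> V ==> (LBINT x. v (Suc k) x powr p * \<psi> x) + (s (Suc k) - s k) * E (v (Suc k)) \<psi> = (LBINT x. v k x powr p * \<psi> x)"
  obtains e where "\<And>k. sol (e k) (\<lambda>x. v k x powr p - u x (s k))" "\<And>k. E (e k) (e k) \<le> 4 * s k * M * \<epsilon> powr m"
proof -
  have sp: "0 \<le> s k" for k using s0' sm by (induction k) (auto intro: order_trans)
  have vV: "v k \<in> V" and v0: "0 \<le> v k x" for k x using v(1)[of k] by (auto simp: state_def)
  have dU: "dual (\<lambda>x. v k x powr p)" for k by (rule dual_powr[OF vV v0])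
  have "\<exists>e. sol e (\<lambda>x. v k x powr p - u x (s k))" for k
    using sol_exists[OF dual_diff[OF dU dual_U[OF sp]]] by metis
  then obtain e where e: "\<And>k. sol (e k) (\<lambda>x. v k x powr p - u x (s k))" by metis
  have eV: "e k \<in> V" for k by (rule sol_V[OF e])
  have vLp: "Lp (1 + m) (\<lambda>x. v k x powr p)" for k by (rule powr_Lp[OF V_Lp_p1[OF vV] v0])
  have vU: "(\<lambda>x. v 0 x powr p) = u0" using conj_exp(5) u0_nonneg by (simp add: v(2) powr_powr mult.commute fun_eq_iff)
  have vle: "AE x in lborel. v k x powr p \<le> u x 0" for k
  proof (induction k)
    case 0
    show ?case using u_init by eventually_elim (use vU in \<open>simp add: fun_eq_iff\<close>)
  next
    case (Suc k)
    show ?case using Suc v(3)[of k]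
    proof eventually_elim
      case (elim x)
      have "v (Suc k) x powr p \<le> v k x powr p" using elim v0 p1 by (intro powr_mono2) auto
      then show ?case using elim by linarith
    qed
  qed
  have vM: "Lnorm (1 + m) (\<lambda>x. v k x powr p) \<le> M" for k
  proof -
    have "Lnorm (1 + m) (\<lambda>x. v k x powr p) \<le> Lnorm (1 + m) (U 0)"
    proof (rule Lp_bound(2)[OF U_Lp])
      show "AE x in lborel. \<bar>v k x powr p\<bar> \<le> \<bar>u x 0\<bar>" using vle[of k] by eventually_elim (simp add: u_nonneg)
    qed (use m0 vLp[of k] in \<open>auto simp: Lp_def\<close>)
    also have "\<dots> \<le> M" using M[of 0] sT[of 0] s0' by (simp add: nU_def)
    finally show ?thesis .
  qed
  have M0: "0 \<le> M" using vM[of 0] Lnorm_nonneg order_trans by blast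
  have bound: "E (e k) (e k) \<le> 4 * s k * M * \<epsilon> powr m" for k
  proof (induction k)
    case 0
    have "(LBINT x. (v 0 x powr p - u x (s 0)) * e 0 x) = 0"
    proof (rule integral_eq_zero_AE)
      show "AE x in lborel. (v 0 x powr p - u x (s 0)) * e 0 x = 0"
        using u_init by eventually_elim (use vU s0' in \<open>simp add: fun_eq_iff\<close>)
    qed
    then show ?case using sol_E[OF e[of 0] eV[of 0]] s0' by simp
  next
    case (Suc k)
    define f where "f = e (Suc k)"
    have fV: "f \<in> V" unfolding f_def by (rule eV)
    define D where "D x = v (Suc k) x powr p - u x (s (Suc k))" for x
    have solf: "sol f D" unfolding f_def D_def by (rule e)
    define h where "h = s (Suc k) - s k"
    have h: "0 \<le> h" using sm by (simp add: h_def)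
    have ek: "E (e k) f = (LBINT x. v k x powr p * f x) - (LBINT x. u x (s k) * f x)"
      using sol_E[OF e fV] dual_integrable[OF dU fV] dual_integrable[OF dual_U[OF sp] fV] by (simp add: left_diff_distrib)
    have ek': "E f f = (LBINT x. v (Suc k) x powr p * f x) - (LBINT x. u x (s (Suc k)) * f x)"
      using sol_E[OF e[of "Suc k"] fV] dual_integrable[OF dU fV] dual_integrable[OF dual_U[OF sp] fV] by (simp add: f_def left_diff_distrib)
    have DL: "Lp (1 + m) D" unfolding D_def using m0 by (intro Lp_diff vLp U_Lp sp) auto
    have DM: "Lnorm (1 + m) D \<le> 2 * M"
    proof -
      have "Lnorm (1 + m) D \<le> Lnorm (1 + m) (\<lambda>x. v (Suc k) x powr p) + Lnorm (1 + m) (\<lambda>x. (-1) * u x (s (Suc k)))"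
        unfolding D_def using Minkowski_integral[OF conj_exp(1) vLp[of "Suc k"] Lp_cmult[OF U_Lp[OF sp], of "-1"]] by simp
      also have "Lnorm (1 + m) (\<lambda>x. (-1) * u x (s (Suc k))) = nU (s (Suc k))"
        using m0 Lnorm_cmult[of "1 + m" "-1" "U (s (Suc k))"] by (simp add: nU_def)
      finally show ?thesis using vM[of "Suc k"] M[of "s (Suc k)"] sp sT by auto
    qed
    \<comment> \<open>The difference splits into \<open>w r\<close> minus \<open>w\<close> at the
      end of the step, bounded by Hoelder and the modulus of continuity, and \<open>w\<close> at
      that end minus \<open>v (Suc k)\<close>, whose product with \<open>D\<close> is nonpositive by
      monotonicity of the power.\<close>
    have key: "E (w r) f \<le> E (v (Suc k)) f + 2 * M * \<epsilon> powr m" if r: "s k < r" "r \<le> s (Suc k)" for r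
    proof -
      have r0: "0 < r" using r sp[of k] by linarith
      have wV: "w r \<in> V" by (rule w_V[OF r0])
      have 1: "E (v (Suc k)) f = (LBINT x. D x * v (Suc k) x)" "E (w r) f = (LBINT x. D x * u x r powr m)"
        using sol_E[OF solf vV] sol_E[OF solf wV] by (simp_all add: E_sym)
      have i1: "integrable lborel (\<lambda>x. D x * v (Suc k) x)" "integrable lborel (\<lambda>x. D x * u x r powr m)"
        using sol_integrable[OF solf vV] sol_integrable[OF solf wV] by auto
      have wd: "Lp (p + 1) (\<lambda>x. u x r powr m - u x (s (Suc k)) powr m)"
        using p1 r0 by (intro Lp_diff w_Lp(1) sp) auto
      note Ho = Holder_integral[OF conj_exp(1-3) DL wd]
      have "E (w r) f - E (v (Suc k)) f = (LBINT x. D x * u x r powr m - D x * v (Suc k) x)"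
        unfolding 1 using i1 by simp
      also have "\<dots> \<le> (LBINT x. D x * (u x r powr m - u x (s (Suc k)) powr m))"
      proof (rule integral_mono)
        fix x
        have "D x * u x (s (Suc k)) powr m \<le> D x * v (Suc k) x"
        proof (cases "u x (s (Suc k)) powr m \<le> v (Suc k) x")
          case True
          then have "(u x (s (Suc k)) powr m) powr p \<le> v (Suc k) x powr p" using p1 by (intro powr_mono2) auto
          then have "0 \<le> D x" using u_nonneg[of x "s (Suc k)"] conj_exp(5) by (simp add: D_def powr_powr mult.commute)
          then show ?thesis using True by (simp add: mult_left_mono)
        next
          case False
          then have "v (Suc k) x powr p \<le> (u x (s (Suc k)) powr m) powr p" using p1 v0 by (intro powr_mono2) auto
          then have "D x \<le> 0" using u_nonneg[of x "s (Suc k)"] conj_exp(5) by (simp add: D_def powr_powr mult.commute)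
          then show ?thesis using False by (intro mult_left_mono_neg) auto
        qed
        then show "D x * u x r powr m - D x * v (Suc k) x \<le> D x * (u x r powr m - u x (s (Suc k)) powr m)"
          by (simp add: right_diff_distrib)
      qed (use i1 Ho(1) in auto)
      also have "\<dots> \<le> Lnorm (1 + m) D * Lnorm (p + 1) (\<lambda>x. u x r powr m - u x (s (Suc k)) powr m)"
        using Ho(3) by linarith
      also have "\<dots> \<le> (2 * M) * \<epsilon> powr m"
      proof (intro mult_mono DM)
        have "Lnorm (p + 1) (\<lambda>x. u x r powr m - u x (s (Suc k)) powr m) \<le> dd r (s (Suc k)) powr m"
          using r0 sp by (intro w_dist) auto
        also have "\<dots> \<le> \<epsilon> powr m"
          using om[OF r] m0 dd_sym[of r "s (Suc k)"] by (intro powr_mono2) (auto simp: dd_def)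
        finally show "Lnorm (p + 1) (\<lambda>x. u x r powr m - u x (s (Suc k)) powr m) \<le> \<epsilon> powr m" .
      qed (use M0 in auto)
      finally show ?thesis by simp
    qed
    have "(LBINT x. u x (s k) * f x) - (LBINT x. u x (s (Suc k)) * f x) \<le> (E (v (Suc k)) f + 2 * M * \<epsilon> powr m) * h"
      unfolding h_def by (rule weak_form_upper[OF fV sp sm key])
    then have "E f f - E (e k) f \<le> 2 * M * \<epsilon> powr m * h"
      using v(4)[OF fV, of k] unfolding ek ek' h_def by (simp add: algebra_simps)
    moreover have "0 \<le> E (\<lambda>x. f x - e k x) (\<lambda>x. f x - e k x)" by (rule E_nonneg)
    \<comment> \<open>Absorbs the mixed term; this doubles \<open>2 * M\<close> to the constant
      \<open>4 * M\<close> of the bound.\<close>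
    then have "2 * E (e k) f \<le> E f f + E (e k) (e k)"
      using fV eV[of k] by (simp add: E_diff_left E_diff_right V_diff E_sym[of f "e k"])
    ultimately have "E f f \<le> E (e k) (e k) + 4 * M * \<epsilon> powr m * h" by linarith
    also have "\<dots> \<le> 4 * s k * M * \<epsilon> powr m + 4 * M * \<epsilon> powr m * h" using Suc.IH by simp
    also have "\<dots> = 4 * s (Suc k) * M * \<epsilon> powr m" by (simp add: h_def algebra_simps)
    finally show ?case by (simp add: f_def)
  qed
  show ?thesis using that[OF e bound] .
qed

text \<open>The discrete solution decreases and is close to \<open>u\<close> in the dual norm.
  Tested against any nonnegative energy function, the inequality thus holds up to an error vanishing
  with the modulus of continuity, and \<open>V_dominates_order\<close> makes it pointwise.\<close>

theorem u_antimono: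
  assumes t: "0 \<le> t1" "t1 \<le> t2"
  shows "AE x in lborel. u x t2 \<le> u x t1"
proof -
  have t2: "0 \<le> t2" using t by simp
  have gL: "Lp (1 + m) (\<lambda>x. u x t1 - u x t2)" using m0 by (intro Lp_diff U_Lp t t2) auto
  have gi: "integrable lborel (\<lambda>x. u x t1 - u x t2)"
  proof -
    have "Lp 1 (\<lambda>x. u x t1 - u x t2)"
      by (rule Lnorm_lower_exponent(1)[OF _ _ gL _ Omega_finite]) (use m0 u_outside in auto)
    then show ?thesis using integrable_abs_iff[of "\<lambda>x. u x t1 - u x t2" lborel] by (simp add: Lp_def)
  qed
  have pos: "0 \<le> (LBINT x. (u x t1 - u x t2) * \<psi> x)" if \<psi>: "\<psi> \<in> V" "\<And>x. 0 \<le> \<psi> x" for \<psi>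
  proof -
    obtain M where M: "\<And>t. t \<in> {0..t2} ==> nU t \<le> M" using nU_bounded[of t2] by blast
    have "nU 0 \<le> M" using M[of 0] t2 by simp
    moreover have "0 \<le> nU 0" by (simp add: nU_def)
    ultimately have M0: "0 \<le> M" by linarith
    have est: "- (2 * sqrt (4 * t2 * M * \<epsilon> powr m) * nrm \<psi>) \<le> (LBINT x. (u x t1 - u x t2) * \<psi> x)" if \<epsilon>: "0 < \<epsilon>" for \<epsilon>
    proof -
      obtain \<delta> where \<delta>: "0 < \<delta>" "\<And>s t. s \<in> {0..t2} ==> t \<in> {0..t2} ==> \<bar>s - t\<bar> < \<delta> ==> dd s t < \<epsilon>"
        using dd_uniform[OF \<epsilon>, of t2] by blast
      obtain n :: nat where n: "t2 < real n * \<delta>" using reals_Archimedean3[OF \<delta>(1)] by blast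
      then have n0: "0 < real n" using t2 \<delta>(1) by (cases n) auto
      \<comment> \<open>Runs from 0 to \<open>t1\<close> in the first \<open>n\<close> steps and on
        to \<open>t2\<close> in the next \<open>n\<close>, so both times are grid points of one and
        the same scheme.\<close>
      define s where "s k = t1 * min 1 (real k / real n) + (t2 - t1) * max 0 (min 1 (real k / real n - 1))" for k
      have s0: "s 0 = 0" by (simp add: s_def)
      have step: "0 \<le> min 1 (real (Suc k) / real n) - min 1 (real k / real n)" "min 1 (real (Suc k) / real n) - min 1 (real k / real n) \<le> 1 / real n"
        "0 \<le> max 0 (min 1 (real (Suc k) / real n - 1)) - max 0 (min 1 (real k / real n - 1))" "max 0 (min 1 (real (Suc k) / real n - 1)) - max 0 (min 1 (real k / real n - 1)) \<le> 1 / real n" for k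
      proof -
        have "real (Suc k) / real n = real k / real n + 1 / real n" by (simp add: add_divide_distrib)
        moreover have "0 \<le> 1 / real n" by simp
        ultimately show "0 \<le> min 1 (real (Suc k) / real n) - min 1 (real k / real n)" "min 1 (real (Suc k) / real n) - min 1 (real k / real n) \<le> 1 / real n"
        "0 \<le> max 0 (min 1 (real (Suc k) / real n - 1)) - max 0 (min 1 (real k / real n - 1))" "max 0 (min 1 (real (Suc k) / real n - 1)) - max 0 (min 1 (real k / real n - 1)) \<le> 1 / real n"
          by linarith+
      qed
      have ds: "s (Suc k) - s k = t1 * (min 1 (real (Suc k) / real n) - min 1 (real k / real n)) + (t2 - t1) * (max 0 (min 1 (real (Suc k) / real n - 1)) - max 0 (min 1 (real k / real n - 1)))" for k
        by (simp add: s_def algebra_simps)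
      have sm: "s k \<le> s (Suc k)" for k
      proof -
        have "0 \<le> t2 - t1" using t by simp
        then have "0 \<le> s (Suc k) - s k"
          unfolding ds by (intro add_nonneg_nonneg mult_nonneg_nonneg step t)
        then show ?thesis by (simp only: diff_ge_0_iff_ge)
      qed
      have "s (Suc k) - s k \<le> t1 * (1 / real n) + (t2 - t1) * (1 / real n)" for k
        unfolding ds by (intro add_mono mult_left_mono step t) (use t in simp)
      then have "s (Suc k) - s k \<le> t2 / real n" for k by (simp add: diff_divide_distrib)
      moreover have "t2 / real n < \<delta>" using n n0 by (simp add: field_simps)
      ultimately have sd: "s (Suc k) - s k < \<delta>" for k by (meson le_less_trans)
      have sT: "s k \<le> t2" for k
      proof -
        have "s k \<le> t1 * 1 + (t2 - t1) * 1" unfolding s_def using t by (intro add_mono mult_left_mono) auto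
        then show ?thesis by simp
      qed
      have sp: "0 \<le> s k" for k using s0 sm by (induction k) (auto intro: order_trans)
      have sn: "s n = t1" "s (2 * n) = t2" using n0 by (simp_all add: s_def)
      have hk: "0 \<le> s (Suc k) - s k" for k using sm[of k] by simp
      obtain v where v: "\<And>k. state (v k)" "v 0 = (\<lambda>x. u0 x powr m)" "\<And>k. AE x in lborel. v (Suc k) x \<le> v k x"
        "\<And>k \<psi>. \<psi> \<in> V ==> (LBINT x. v (Suc k) x powr p * \<psi> x) + (s (Suc k) - s k) * E (v (Suc k)) \<psi> = (LBINT x. v k x powr p * \<psi> x)"
        by (rule euler_scheme[of "\<lambda>k. s (Suc k) - s k", OF hk]) (rule that)
      have om: "dd (s (Suc k)) r \<le> \<epsilon>" if "s k < r" "r \<le> s (Suc k)" for k r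
      proof -
        have "r \<in> {0..t2}" "s (Suc k) \<in> {0..t2}" "\<bar>s (Suc k) - r\<bar> < \<delta>" using that sd[of k] sp[of k] sp[of "Suc k"] sT[of "Suc k"] by auto
        then show ?thesis using \<delta>(2)[of "s (Suc k)" r] by simp
      qed
      obtain e where e: "\<And>k. sol (e k) (\<lambda>x. v k x powr p - u x (s k))" "\<And>k. E (e k) (e k) \<le> 4 * s k * M * \<epsilon> powr m"
        using euler_error[OF s0 sm sT om M v] by blast
      have ne: "nrm (e k) \<le> sqrt (4 * t2 * M * \<epsilon> powr m)" for k
      proof -
        have "4 * s k * M * \<epsilon> powr m \<le> 4 * t2 * M * \<epsilon> powr m" using sT[of k] M0 by (intro mult_right_mono) auto
        then show ?thesis unfolding nrm_def using e(2)[of k] by (intro real_sqrt_le_mono) linarith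
      qed
      have vV: "v k \<in> V" and v0: "0 \<le> v k x" for k x using v(1)[of k] by (auto simp: state_def)
      have iv: "integrable lborel (\<lambda>x. v k x powr p * \<psi> x)" for k by (rule dual_integrable[OF dual_powr[OF vV v0] \<psi>(1)])
      have iu: "0 \<le> t ==> integrable lborel (\<lambda>x. u x t * \<psi> x)" for t by (rule dual_integrable[OF dual_U \<psi>(1)])
      have "antimono (\<lambda>k. LBINT x. v k x powr p * \<psi> x)"
      proof (rule decseq_SucI)
        fix k
        show "(LBINT x. v (Suc k) x powr p * \<psi> x) \<le> (LBINT x. v k x powr p * \<psi> x)"
        proof (rule integral_mono_AE[OF iv iv])
          show "AE x in lborel. v (Suc k) x powr p * \<psi> x \<le> v k x powr p * \<psi> x"
            using v(3)[of k] by eventually_elim (use v0 p1 \<psi>(2) in \<open>auto intro!: mult_right_mono powr_mono2\<close>)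
        qed
      qed
      then have dec: "(LBINT x. v (2 * n) x powr p * \<psi> x) \<le> (LBINT x. v n x powr p * \<psi> x)"
        by (rule antimonoD) simp
      have err: "\<bar>(LBINT x. v k x powr p * \<psi> x) - (LBINT x. u x (s k) * \<psi> x)\<bar> \<le> sqrt (4 * t2 * M * \<epsilon> powr m) * nrm \<psi>" for k
      proof -
        have "(LBINT x. v k x powr p * \<psi> x) - (LBINT x. u x (s k) * \<psi> x) = E (e k) \<psi>"
          using sol_E[OF e(1) \<psi>(1), of k] iv[of k] iu[OF sp, of k] by (simp add: left_diff_distrib)
        also have "\<bar>\<dots>\<bar> \<le> nrm (e k) * nrm \<psi>" by (rule E_CS[OF sol_V[OF e(1)] \<psi>(1)])
        also have "\<dots> \<le> sqrt (4 * t2 * M * \<epsilon> powr m) * nrm \<psi>" using ne by (intro mult_right_mono) auto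
        finally show ?thesis .
      qed
      have "(LBINT x. (u x t1 - u x t2) * \<psi> x) = (LBINT x. u x t1 * \<psi> x) - (LBINT x. u x t2 * \<psi> x)"
        using iu t t2 by (simp add: left_diff_distrib)
      then show ?thesis using err[of n] err[of "2 * n"] dec unfolding sn by linarith
    qed
    define \<epsilon> where "\<epsilon> n = 1 / real (Suc n)" for n
    have "(\<lambda>n. - (2 * sqrt (4 * t2 * M * \<epsilon> n powr m) * nrm \<psi>)) \<longlonglongrightarrow> - (2 * sqrt (4 * t2 * M * 0 powr m) * nrm \<psi>)"
      unfolding \<epsilon>_def using m0
      by (intro tendsto_minus tendsto_mult tendsto_const tendsto_real_sqrt tendsto_powr2 LIMSEQ_Suc[OF lim_1_over_n]) auto
    moreover have "- (2 * sqrt (4 * t2 * M * \<epsilon> n powr m) * nrm \<psi>) \<le> (LBINT x. (u x t1 - u x t2) * \<psi> x)" for n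
      by (rule est) (simp add: \<epsilon>_def)
    ultimately have "- (2 * sqrt (4 * t2 * M * 0 powr m) * nrm \<psi>) \<le> (LBINT x. (u x t1 - u x t2) * \<psi> x)"
      by (intro LIMSEQ_le_const2) auto
    then show ?thesis by simp
  qed
  have "AE x in lborel. 0 \<le> u x t1 - u x t2"
    by (rule V_dominates_order[OF gi _ pos]) (simp add: u_outside)
  then show ?thesis by eventually_elim simp
qed

end

section \<open>Asymptotics near the extinction time\<close>

locale flow_ext = flow \<sigma> \<Omega> nn cn omg m p u0 u
  for \<sigma> :: real and \<Omega> :: "'a::euclidean_space set" and nn cn omg m p :: real
    and u0 :: "'a => real" and u :: "'a => real => real" +
  fixes T :: real
  assumes ext: "extinction_time m u T"
begin

lemma T_pos: "0 < T" and extinct_iff: "0 \<le> t ==> (AE x in lborel. u x t = 0) \<longleftrightarrow> T \<le> t"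
  using ext by (auto simp: extinction_time_def)

text \<open>\<open>X t\<close> is the potential of \<open>u t\<close>, so that formally \<open>X' = - w\<close> and \<open>\<integral>u t * X t = (nrm (X t))\<^sup>2\<close>.\<close>

definition X :: "real => 'a => real" where "X t = (SOME X. sol X (U t))"

lemma X_sol: assumes "0 \<le> t" shows "sol (X t) (U t)"
proof -
  obtain Y where "sol Y (U t)" using sol_exists[OF dual_U[OF assms]] by blast
  then show ?thesis unfolding X_def by (rule someI[of "\<lambda>X. sol X (U t)"])
qed

lemma X_V: "0 \<le> t ==> X t \<in> V" by (rule sol_V[OF X_sol])

definition K :: "real => real => real" where "K s t = E (X s) (X t)"
definition N :: "real => real" where "N t = nrm (X t)"
definition A :: "real => real" where "A t = nU t / N t"
definition y :: "real => real" where "y t = nU t powr (1 + m)"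

lemma K_sym: "K s t = K t s" by (simp add: K_def E_sym)

lemma K_eq: "0 \<le> s ==> 0 \<le> t ==> K s t = (LBINT x. u x s * X t x)"
  unfolding K_def using sol_E[OF X_sol X_V] by blast

lemma N_sq: "(N t)\<^sup>2 = K t t" by (simp add: N_def nrm_sq K_def)

lemma N_nonneg: "0 \<le> N t" by (simp add: N_def)
lemma nU_nonneg: "0 \<le> nU t" by (simp add: nU_def)

lemma K_le: "0 \<le> s ==> 0 \<le> t ==> K s t \<le> N s * N t"
  using E_CS[OF X_V X_V, of s t] by (simp add: K_def N_def)

lemma y_eq: "0 \<le> t ==> y t = (LBINT x. u x t * u x t powr m)"
proof -
  assume "0 \<le> t"
  have "u x t * u x t powr m = \<bar>u x t\<bar> powr (1 + m)" for x
    using u_nonneg[of x t] by (simp add: powr_mult_base)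
  then show ?thesis using m0 by (simp add: y_def nU_def Lnorm_powr)
qed

lemma uw_integrable: assumes "0 \<le> s" "0 \<le> t" shows "integrable lborel (\<lambda>x. u x s * u x t powr m)"
  using Holder_integral(1)[OF conj_exp(1-3) U_Lp[OF assms(1)] w_Lp(1)[OF assms(2)]] .

lemma E_w_X: assumes "0 \<le> s" "0 < r" shows "E (w r) (X s) = (LBINT x. u x s * u x r powr m)"
  using sol_E[OF X_sol[OF assms(1)] w_V[OF assms(2)]] by (simp add: E_sym)

lemma E_w_X_le: assumes "0 \<le> s" "0 < r" shows "E (w r) (X s) \<le> nU s * nU r powr m"
  using Holder_integral(3)[OF conj_exp(1-3) U_Lp[OF assms(1)] w_Lp(1)[of r]] w_Lp(2)[of r] assms
  unfolding E_w_X[OF assms] nU_def by simp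

lemma uw_mono:
  assumes "0 \<le> s" "s \<le> s'" "0 \<le> r" "r \<le> r'"
  shows "(LBINT x. u x s' * u x r' powr m) \<le> (LBINT x. u x s * u x r powr m)"
proof (rule integral_mono_AE)
  show "AE x in lborel. u x s' * u x r' powr m \<le> u x s * u x r powr m"
    using u_antimono[OF assms(1,2)] u_antimono[OF assms(3,4)]
    by eventually_elim (use u_nonneg m0 in \<open>auto intro!: mult_mono powr_mono2\<close>)
qed (use uw_integrable assms in auto)

lemma nU_antimono: assumes "0 \<le> s" "s \<le> t" shows "nU t \<le> nU s"
  unfolding nU_def
proof (rule Lp_bound(2)[OF U_Lp[OF assms(1)]])
  show "AE x in lborel. \<bar>u x t\<bar> \<le> \<bar>u x s\<bar>"
    using u_antimono[OF assms] by eventually_elim (simp add: u_nonneg)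
qed (use assms m0 in auto)

lemma nU_pos: assumes "0 \<le> t" "t < T" shows "0 < nU t"
proof (rule ccontr)
  assume "\<not> 0 < nU t"
  then have "nU t = 0" using nU_nonneg[of t] by linarith
  then have "AE x in lborel. u x t = 0" using Lnorm_eq_0_AE[OF U_Lp[OF assms(1)]] m0 by (simp add: nU_def)
  then show False using extinct_iff[OF assms(1)] assms by simp
qed

lemma N_pos: assumes t: "0 \<le> t" "t < T" shows "0 < N t"
proof (rule ccontr)
  assume "\<not> 0 < N t"
  then have "nrm (X t) = 0" using N_nonneg[of t] unfolding N_def by linarith
  then have E0: "E (X t) \<psi> = 0" if "\<psi> \<in> V" for \<psi> using E_zero_left[OF X_V[OF t(1)] _ that] by simp
  have "Lp 1 (U t)"
    by (rule Lnorm_lower_exponent(1)[OF _ _ U_Lp[OF t(1)] _ Omega_finite]) (use m0 u_outside in auto)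
  then have i: "integrable lborel (U t)" using integrable_abs_iff[of "U t" lborel] by (simp add: Lp_def)
  have "AE x in lborel. 0 \<le> - u x t"
  proof (rule V_dominates_order)
    fix \<psi> assume "\<psi> \<in> V"
    then have "(LBINT x. u x t * \<psi> x) = 0" using sol_E[OF X_sol[OF t(1)]] E0 by simp
    then show "0 \<le> (LBINT x. - u x t * \<psi> x)" by simp
  qed (use i u_outside in auto)
  then have "AE x in lborel. u x t = 0" by eventually_elim (use u_nonneg in \<open>auto intro: antisym\<close>)
  then show False using extinct_iff[OF t(1)] t by simp
qed

lemma N_T: "N T = 0"
proof -
  have T: "0 \<le> T" using T_pos by simp
  have "AE x in lborel. u x T = 0" using extinct_iff[OF T] by simp
  then have "K T T = 0" unfolding K_eq[OF T T] by (intro integral_eq_zero_AE) (auto elim!: eventually_mono)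
  then show ?thesis using N_sq[of T] by simp
qed

section \<open>Time derivative of the energy of the potential\<close>

lemma K_weak:
  assumes "0 \<le> s" "0 \<le> t1" "t1 \<le> t2"
  shows "K s t1 - K s t2 = (LBINT r. indicator {t1..t2} r * eW (X s) r)"
    and "integrable lborel (\<lambda>r. indicator {t1..t2} r * eW (X s) r)"
  using weak_form[OF X_V[OF assms(1)] assms(2,3)] assms by (simp_all add: K_eq K_sym[of s])

text \<open>In its second argument \<open>K s\<close> decreases at the rate
  \<open>\<integral> u s * w r\<close>. As \<open>u\<close> decreases in time, both factors can be
  moved to the same end of the interval, provided \<open>s\<close> lies on the proper side of that
  end; this is what the two side conditions say.\<close>

lemma K_bounds:
  assumes s: "0 \<le> s" and t: "0 \<le> t1" "t1 \<le> t2"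
  shows "s \<le> t2 ==> y t2 * (t2 - t1) \<le> K s t1 - K s t2"
    and "t1 \<le> s ==> K s t1 - K s t2 \<le> y t1 * (t2 - t1)"
proof -
  have t2: "0 \<le> t2" using t by simp
  have e: "K s t1 - K s t2 = (LBINT x. u x t1 * X s x) - (LBINT x. u x t2 * X s x)"
    using s t t2 by (simp add: K_eq K_sym[of s])
  show "y t2 * (t2 - t1) \<le> K s t1 - K s t2" if "s \<le> t2"
    unfolding e
  proof (rule weak_form_lower[OF X_V[OF s] t])
    fix r assume "t1 < r" "r \<le> t2"
    then show "y t2 \<le> E (w r) (X s)" using s t t2 that uw_mono[of s t2 r t2] by (simp add: E_w_X y_eq)
  qed
  show "K s t1 - K s t2 \<le> y t1 * (t2 - t1)" if "t1 \<le> s"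
    unfolding e
  proof (rule weak_form_upper[OF X_V[OF s] t])
    fix r assume "t1 < r" "r \<le> t2"
    then show "E (w r) (X s) \<le> y t1" using s t t2 that uw_mono[of t1 s t1 r] by (simp add: E_w_X y_eq)
  qed
qed

lemma K_diag_bounds:
  assumes t: "0 \<le> t1" "t1 \<le> t2"
  shows "2 * y t2 * (t2 - t1) \<le> K t1 t1 - K t2 t2" "K t1 t1 - K t2 t2 \<le> 2 * y t1 * (t2 - t1)"
proof -
  have t2: "0 \<le> t2" using t by simp
  show "2 * y t2 * (t2 - t1) \<le> K t1 t1 - K t2 t2" "K t1 t1 - K t2 t2 \<le> 2 * y t1 * (t2 - t1)"
    using K_bounds[OF t(1) t] K_bounds[OF t2 t] t K_sym[of t1 t2] by auto
qed

lemma y_continuous: "continuous_on {0..} y"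
  unfolding y_def using nU_continuous m0 by (intro continuous_on_powr' continuous_intros) (auto simp: nU_nonneg)

text \<open>The one-sided bounds squeeze the difference quotient between values of the continuous
  function \<open>- 2 * y\<close>, so a classical derivative arises although \<open>X\<close> itself
  is never differentiated in time.\<close>

lemma K_diag_derivative:
  assumes t: "0 < t"
  shows "((\<lambda>t. K t t) has_real_derivative - 2 * y t) (at t)"
proof -
  have yc: "isCont y t"
    using continuous_on_interior[OF y_continuous, of t] t by simp
  have "((\<lambda>h. (K (t + h) (t + h) - K t t) / h) \<longlongrightarrow> - 2 * y t) (at 0)"
  proof (rule LIM_I)
    fix e :: real assume e: "0 < e"
    obtain d where d: "0 < d" "\<And>s. \<bar>s - t\<bar> < d ==> \<bar>y s - y t\<bar> < e / 2"
      using yc e unfolding isCont_def LIM_def continuous_at_eps_delta by (metis (no_types, lifting) continuous_at_eps_delta dist_real_def half_gt_zero isCont_def yc)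
    show "\<exists>s>0. \<forall>h. h \<noteq> 0 \<and> norm (h - 0) < s \<longrightarrow> norm ((K (t + h) (t + h) - K t t) / h - - 2 * y t) < e"
    proof (intro exI[of _ "min d t"] conjI allI impI)
      fix h :: real assume h: "h \<noteq> 0 \<and> norm (h - 0) < min d t"
      have yh: "\<bar>y (t + h) - y t\<bar> < e / 2" using d(2)[of "t + h"] h by simp
      define q where "q = (K (t + h) (t + h) - K t t) / h"
      have "- 2 * y (t + h) \<le> q \<and> q \<le> - 2 * y t \<or> - 2 * y t \<le> q \<and> q \<le> - 2 * y (t + h)"
      proof (cases "0 < h")
        case True
        have "2 * y (t + h) * h \<le> K t t - K (t + h) (t + h)" "K t t - K (t + h) (t + h) \<le> 2 * y t * h"
          using K_diag_bounds[of t "t + h"] t True by simp_all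
        then show ?thesis using True by (simp add: q_def field_simps)
      next
        case False
        then have h': "h < 0" using h by simp
        have "2 * y t * (- h) \<le> K (t + h) (t + h) - K t t" "K (t + h) (t + h) - K t t \<le> 2 * y (t + h) * (- h)"
          using K_diag_bounds[of "t + h" t] t h h' by simp_all
        then show ?thesis using h' by (simp add: q_def field_simps)
      qed
      then show "norm ((K (t + h) (t + h) - K t t) / h - - 2 * y t) < e"
        using yh unfolding q_def[symmetric] real_norm_def by (elim disjE conjE) linarith+
    qed (use d t in auto)
  qed
  then show ?thesis by (simp add: DERIV_def)
qed

lemma N_eq_sqrt: "N t = sqrt (K t t)" using N_sq[of t] N_nonneg[of t] by (metis real_sqrt_unique)

lemma N_derivative:
  assumes t: "0 < t" "t < T"
  shows "(N has_real_derivative - (A t * nU t powr m)) (at t)"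
proof -
  have Kp: "0 < K t t" using N_pos[of t] t N_sq[of t] by (metis less_imp_le zero_less_power)
  have "((\<lambda>t. sqrt (K t t)) has_real_derivative (- 2 * y t) * (inverse (sqrt (K t t)) / 2)) (at t)"
    using DERIV_chain2[OF DERIV_real_sqrt[OF Kp] K_diag_derivative[OF t(1)]] by (simp add: mult.commute)
  moreover have "(- 2 * y t) * (inverse (sqrt (K t t)) / 2) = - (A t * nU t powr m)"
  proof -
    have "y t = nU t * nU t powr m" using nU_nonneg[of t] by (simp add: y_def powr_mult_base)
    then show ?thesis by (simp add: A_def N_eq_sqrt field_simps)
  qed
  moreover have "N = (\<lambda>t. sqrt (K t t))" using N_eq_sqrt by auto
  ultimately show ?thesis by simp
qed

lemma K_diag_continuous: "continuous_on {0..} (\<lambda>t. K t t)"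
  unfolding continuous_on_iff
proof (intro ballI allI impI)
  fix t e :: real assume t: "t \<in> {0..}" and e: "0 < e"
  define c where "c = 2 * y 0 + 1"
  have y0: "0 \<le> y s" for s by (simp add: y_def)
  have ymono: "y s \<le> y 0" if "0 \<le> s" for s unfolding y_def using nU_antimono[of 0 s] that m0 by (intro powr_mono2) (auto simp: nU_nonneg)
  have c: "0 < c" using y0[of 0] by (simp add: c_def)
  have lip: "\<bar>K r r - K s s\<bar> \<le> c * \<bar>r - s\<bar>" if "0 \<le> r" "r \<le> s" for r s
  proof -
    have "2 * y r * (s - r) \<le> c * (s - r)" using ymono[OF that(1)] that by (intro mult_right_mono) (auto simp: c_def)
    moreover have "0 \<le> 2 * y s * (s - r)" using y0 that by simp
    moreover have "0 \<le> c * (s - r)" using c that by simp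
    ultimately have "\<bar>K r r - K s s\<bar> \<le> c * (s - r)" using K_diag_bounds[OF that] by linarith
    moreover have "\<bar>r - s\<bar> = s - r" using that by simp
    ultimately show ?thesis by simp
  qed
  show "\<exists>d>0. \<forall>x'\<in>{0..}. dist x' t < d \<longrightarrow> dist (K x' x') (K t t) < e"
  proof (intro exI[of _ "e / c"] conjI ballI impI)
    fix s assume s: "s \<in> {0..}" "dist s t < e / c"
    have "\<bar>K s s - K t t\<bar> \<le> c * \<bar>s - t\<bar>"
      using lip[of s t] lip[of t s] s t by (cases "s \<le> t") (auto simp: abs_minus_commute)
    also have "\<dots> < e" using s c by (simp add: dist_real_def field_simps)
    finally show "dist (K s s) (K t t) < e" by (simp add: dist_real_def)
  qed (use e c in auto)
qed

lemma N_continuous: "continuous_on {0..} N"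
proof -
  have "continuous_on {0..} (\<lambda>t. sqrt (K t t))" by (intro continuous_intros K_diag_continuous)
  then show ?thesis using N_eq_sqrt by (metis (no_types, lifting) continuous_on_cong)
qed

lemma A_continuous: "continuous_on {0..<T} A"
  unfolding A_def using N_pos
  by (intro continuous_intros continuous_on_subset[OF nU_continuous] continuous_on_subset[OF N_continuous]) force+

text \<open>A new clock: by \<open>N_derivative\<close>, the derivative of \<open>N\<close> with
  respect to \<open>Im\<close> is \<open>- A\<close>, so monotonicity of \<open>A\<close> is
  convexity of \<open>N\<close> in this variable.\<close>

definition Im :: "real => real" where "Im t = integral {0..t} (\<lambda>r. nU r powr m)"

lemma nUm_continuous: "continuous_on {0..} (\<lambda>r. nU r powr m)"
  using nU_continuous m0 by (intro continuous_on_powr' continuous_intros) (auto simp: nU_nonneg)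

lemma Im_derivative: assumes "0 < t" shows "(Im has_real_derivative nU t powr m) (at t)"
proof -
  have "((\<lambda>s. integral {0..s} (\<lambda>r. nU r powr m)) has_vector_derivative nU t powr m) (at t within {0..t + 1})"
    using assms by (intro integral_has_vector_derivative continuous_on_subset[OF nUm_continuous]) auto
  then have "(Im has_vector_derivative nU t powr m) (at t)"
    unfolding Im_def[abs_def] using assms by (simp add: at_within_interior[of t "{0..t + 1}"])
  then show ?thesis by (simp add: has_real_derivative_iff_has_vector_derivative)
qed

lemma Im_continuous: "0 \<le> b ==> continuous_on {0..b} Im"
  unfolding Im_def[abs_def]
  by (intro indefinite_integral_continuous_1 integrable_continuous_interval continuous_on_subset[OF nUm_continuous]) auto

lemma K_lower:
  assumes t: "0 \<le> t1" "t1 \<le> t2"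
  shows "K t1 t1 - nU t1 * (Im t2 - Im t1) \<le> K t1 t2"
proof -
  define f where "f r = nU t1 * nU r powr m" for r
  have fc: "continuous_on {t1..t2} f"
    unfolding f_def using t by (intro continuous_intros continuous_on_subset[OF nUm_continuous]) auto
  have fi: "set_integrable lborel {t1..t2} f" by (rule borel_integrable_atLeastAtMost'[OF fc])
  have "K t1 t1 - K t1 t2 \<le> (LBINT r. indicator {t1..t2} r * f r)"
    unfolding K_weak(1)[OF t(1) t]
  proof (rule integral_mono[OF K_weak(2)[OF t(1) t]])
    show "integrable lborel (\<lambda>r. indicator {t1..t2} r * f r)" using fi by (simp add: set_integrable_def)
    fix r show "indicator {t1..t2} r * eW (X t1) r \<le> indicator {t1..t2} r * f r"
      using E_w_X_le[OF t(1), of r] nU_nonneg[of t1] by (auto simp: eW_def f_def indicator_def)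
  qed
  also have "\<dots> = integral {t1..t2} f"
    using set_borel_integral_eq_integral(2)[OF fi] by (simp add: set_lebesgue_integral_def)
  also have "\<dots> = nU t1 * integral {t1..t2} (\<lambda>r. nU r powr m)" unfolding f_def by simp
  also have "integral {t1..t2} (\<lambda>r. nU r powr m) = Im t2 - Im t1"
  proof -
    have "(\<lambda>r. nU r powr m) integrable_on {0..t2}"
      by (intro integrable_continuous_interval continuous_on_subset[OF nUm_continuous]) auto
    from Henstock_Kurzweil_Integration.integral_combine[OF t this] show ?thesis by (simp add: Im_def)
  qed
  finally show ?thesis by simp
qed

text \<open>In the clock \<open>Im\<close>, the tangent of \<open>N\<close> at \<open>t1\<close>
  lies below the graph to the right of \<open>t1\<close>: \<open>K_lower\<close> is Hoelder, and
  \<open>K_le\<close> is Cauchy--Schwarz.\<close>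

lemma N_tangent:
  assumes t: "0 \<le> t1" "t1 \<le> t2" "t2 < T"
  shows "N t1 - A t1 * (Im t2 - Im t1) \<le> N t2"
proof -
  have n1: "0 < N t1" using N_pos t by simp
  have "(N t1)\<^sup>2 - nU t1 * (Im t2 - Im t1) \<le> N t1 * N t2"
    using K_lower[OF t(1,2)] K_le[of t1 t2] t by (simp add: N_sq)
  then have "N t1 * (N t1 - A t1 * (Im t2 - Im t1)) \<le> N t1 * N t2"
    using n1 by (simp add: A_def power2_eq_square right_diff_distrib)
  then show ?thesis using n1 by simp
qed

text \<open>Tangents are available only to the right, hence the detour over the last time
  \<open>s\<close> at which \<open>A\<close> is at most \<open>A t1\<close>. Afterwards
  \<open>A\<close> exceeds \<open>A s\<close>, so \<open>N\<close> falls faster than its tangent at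
  \<open>s\<close>, against \<open>N_tangent\<close>.\<close>

lemma A_antimono:
  assumes t: "0 \<le> t1" "t1 \<le> t2" "t2 < T"
  shows "A t2 \<le> A t1"
proof (rule ccontr)
  assume "\<not> A t2 \<le> A t1"
  then have lt: "A t1 < A t2" by simp
  define S where "S = {s \<in> {t1..t2}. A s \<le> A t1}"
  have Ac: "continuous_on {t1..t2} A" using t by (intro continuous_on_subset[OF A_continuous]) auto
  have "closed S" unfolding S_def using continuous_on_closed_Collect_le[OF Ac continuous_on_const] by simp
  moreover have "bounded S" by (rule bounded_subset[of "{t1..t2}"]) (auto simp: S_def)
  moreover have "t1 \<in> S" using t by (simp add: S_def)
  ultimately obtain s where s: "s \<in> S" "\<And>r. r \<in> S ==> r \<le> s"
    using compact_attains_sup[of S] by (metis compact_eq_bounded_closed empty_iff)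
  have s1: "t1 \<le> s" "s < t2" "A s \<le> A t1" using s(1) lt by (auto simp: S_def le_less)
  have gt: "A t1 < A r" if "s < r" "r \<le> t2" for r
    using s(2)[of r] that s1 by (force simp: S_def)
  define h where "h r = - N r - A s * Im r" for r
  have "\<exists>l z. s < z \<and> z < t2 \<and> DERIV h z :> l \<and> h t2 - h s = (t2 - s) * l"
  proof (rule MVT[OF s1(2)])
    show "continuous_on {s..t2} h"
      unfolding h_def using s1 t
      by (intro continuous_intros continuous_on_subset[OF N_continuous] continuous_on_subset[OF Im_continuous[of t2]]) auto
    fix z assume "s < z" "z < t2"
    then have "0 < z" "z < T" using s1 t by auto
    then have "DERIV h z :> - (- (A z * nU z powr m)) - A s * nU z powr m"
      unfolding h_def by (intro DERIV_diff DERIV_minus DERIV_cmult N_derivative Im_derivative)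
    then show "h differentiable at z" using real_differentiable_def by blast
  qed
  then obtain l z where z: "s < z" "z < t2" "DERIV h z :> l" "h t2 - h s = (t2 - s) * l" by blast
  have z0: "0 < z" "z < T" using z s1 t by auto
  have "DERIV h z :> - (- (A z * nU z powr m)) - A s * nU z powr m"
    unfolding h_def using z0 by (intro DERIV_diff DERIV_minus DERIV_cmult N_derivative Im_derivative)
  then have "l = (A z - A s) * nU z powr m" using DERIV_unique[OF z(3)] by (simp add: left_diff_distrib)
  moreover have "0 < (A z - A s) * nU z powr m"
    using gt[of z] z s1 nU_pos[of z] z0 by simp
  ultimately have "0 < h t2 - h s" using z s1 by simp
  then show False using N_tangent[of s t2] s1 t by (simp add: h_def algebra_simps)
qed

text \<open>Pairing \<open>u\<close> with its own potential, Hoelder and the subcritical Sobolev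
  embedding give \<open>N t \<le> CC (p + 1) * nU t\<close>. Positivity of the constant is read off
  from \<open>N t > 0\<close>.\<close>

lemma A_lower: assumes t: "0 \<le> t" "t < T" shows "0 < CC (p + 1)" "1 / CC (p + 1) \<le> A t"
proof -
  have Np: "0 < N t" using N_pos t by simp
  have "(N t)\<^sup>2 = (LBINT x. u x t * X t x)" using N_sq K_eq t by simp
  also have "\<dots> \<le> nU t * Lnorm (p + 1) (X t)"
    using Holder_integral(3)[OF conj_exp(1-3) U_Lp[OF t(1)] V_Lp_p1[OF X_V[OF t(1)]]] by (simp add: nU_def)
  also have "\<dots> \<le> nU t * (CC (p + 1) * N t)"
    using V_Lp(2)[OF X_V[OF t(1)], of "p + 1"] p1 p_qs by (intro mult_left_mono) (auto simp: N_def nU_nonneg)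
  finally have "N t * N t \<le> (nU t * CC (p + 1)) * N t" by (simp add: power2_eq_square mult.assoc)
  then have le: "N t \<le> nU t * CC (p + 1)" using Np by simp
  then show c: "0 < CC (p + 1)" using Np CC_nonneg[of "p + 1"] by (cases "CC (p + 1) = 0") auto
  show "1 / CC (p + 1) \<le> A t" using le c Np by (simp add: A_def field_simps)
qed

section \<open>Limit of the quotient and the extinction rate\<close>

definition Ainf :: real where "Ainf = Inf (A ` {0..<T})"

lemma Ainf_pos: "0 < Ainf"
proof -
  have "1 / CC (p + 1) \<le> Ainf" unfolding Ainf_def using A_lower T_pos by (intro cInf_greatest) auto
  then show ?thesis using A_lower(1)[of 0] T_pos by (meson divide_pos_pos less_le_trans order_refl zero_less_one)
qed

lemma Ainf_le: "0 \<le> t ==> t < T ==> Ainf \<le> A t"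
  unfolding Ainf_def using A_lower by (intro cInf_lower bdd_belowI2[of _ "1 / CC (p + 1)"]) auto

lemma A_tendsto: "(A \<longlongrightarrow> Ainf) (at_left T)"
proof (rule order_tendstoI)
  fix c assume "c < Ainf"
  then show "\<forall>\<^sub>F t in at_left T. c < A t"
    by (intro eventually_at_leftI[of 0]) (use T_pos in \<open>auto intro!: less_le_trans[OF _ Ainf_le]\<close>)
next
  fix c assume "Ainf < c"
  then obtain s where s: "s \<in> {0..<T}" "A s < c"
    unfolding Ainf_def using cInf_lessD[of "A ` {0..<T}" c] T_pos by auto
  show "\<forall>\<^sub>F t in at_left T. A t < c"
  proof (rule eventually_at_leftI[of s])
    fix t assume "t \<in> {s<..<T}"
    then show "A t < c" using A_antimono[of s t] s by auto
  qed (use s in auto)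
qed

text \<open>From \<open>N' = - A powr (1 + m) * N powr m\<close>, the function
  \<open>N powr (1 - m)\<close> has derivative \<open>- (1 - m) * A powr (1 + m)\<close>, and it
  vanishes at \<open>T\<close>. The mean value theorem asks for the derivative only before
  \<open>T\<close>, where \<open>N\<close> is positive.\<close>

lemma N_powr_MVT:
  assumes t: "0 \<le> t" "t < T"
  obtains z where "t < z" "z < T" "N t powr (1 - m) = (T - t) * ((1 - m) * A z powr (1 + m))"
proof -
  define F where "F s = N s powr (1 - m)" for s
  have der: "DERIV F z :> - ((1 - m) * A z powr (1 + m))" if z: "t < z" "z < T" for z
  proof -
    have Nz: "0 < N z" "0 < nU z" using N_pos[of z] nU_pos[of z] t z by auto
    have "DERIV F z :> (1 - m) * N z powr (1 - m - 1) * - (A z * nU z powr m)"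
      using DERIV_fun_powr[OF N_derivative Nz(1), of "1 - m"] t z by (simp add: F_def[abs_def])
    moreover have "N z powr (1 - m - 1) * (A z * nU z powr m) = A z powr (1 + m)"
    proof -
      have "A z powr (1 + m) = A z * (nU z powr m / N z powr m)"
        using Nz by (simp add: A_def powr_add powr_divide)
      then show ?thesis using Nz by (simp add: powr_minus_divide)
    qed
    ultimately show ?thesis by (simp add: mult.assoc)
  qed
  have "\<exists>l z. t < z \<and> z < T \<and> DERIV F z :> l \<and> F T - F t = (T - t) * l"
  proof (rule MVT[OF t(2)])
    show "continuous_on {t..T} F"
      unfolding F_def using t m1 by (intro continuous_on_powr' continuous_on_subset[OF N_continuous] continuous_on_const) (auto simp: N_nonneg)
  qed (use der real_differentiable_def in blast)
  then obtain l z where z: "t < z" "z < T" "DERIV F z :> l" "F T - F t = (T - t) * l" by blast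
  have "l = - ((1 - m) * A z powr (1 + m))" using DERIV_unique[OF z(3) der[OF z(1,2)]] .
  then show ?thesis using that[OF z(1,2)] z(4) by (simp add: F_def N_T)
qed

definition al :: real where "al = 1 / (1 - m)"

lemma al_pos: "0 < al" using m1 by (simp add: al_def)

definition Ninf :: real where "Ninf = ((1 - m) * Ainf powr (1 + m)) powr al"

lemma Ninf_pos: "0 < Ninf" using Ainf_pos m1 by (simp add: Ninf_def)

lemma N_tendsto: "((\<lambda>t. N t / (T - t) powr al) \<longlongrightarrow> Ninf) (at_left T)"
proof -
  have "\<exists>z. 0 \<le> t \<longrightarrow> t < T \<longrightarrow> t < z \<and> z < T \<and> N t powr (1 - m) = (T - t) * ((1 - m) * A z powr (1 + m))" for t
    using N_powr_MVT[of t] by blast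
  then have "\<exists>z. \<forall>t. 0 \<le> t \<longrightarrow> t < T \<longrightarrow> t < z t \<and> z t < T \<and> N t powr (1 - m) = (T - t) * ((1 - m) * A (z t) powr (1 + m))"
    by (intro choice) blast
  then obtain z where z: "\<And>t. 0 \<le> t ==> t < T ==> t < z t \<and> z t < T \<and> N t powr (1 - m) = (T - t) * ((1 - m) * A (z t) powr (1 + m))" by blast
  have ev: "\<forall>\<^sub>F t in at_left T. 0 < t \<and> t < T" using T_pos by (intro eventually_at_leftI[of 0]) auto
  have zz: "t < z t" "z t < T" if "0 < t \<and> t < T" for t
    using z[of t] that by auto
  have zl: "filterlim z (at_left T) (at_left T)"
    unfolding filterlim_at
  proof
    show "\<forall>\<^sub>F t in at_left T. z t \<in> {..<T} \<and> z t \<noteq> T" using ev by eventually_elim (use zz in \<open>auto simp: less_imp_le less_imp_neq\<close>)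
    show "(z \<longlongrightarrow> T) (at_left T)"
    proof (rule tendsto_sandwich[of "\<lambda>t. t" z "at_left T" "\<lambda>_. T"])
      show "\<forall>\<^sub>F t in at_left T. t \<le> z t" using ev by eventually_elim (use zz in \<open>auto simp: less_imp_le less_imp_neq\<close>)
      show "\<forall>\<^sub>F t in at_left T. z t \<le> T" using ev by eventually_elim (use zz in \<open>auto simp: less_imp_le less_imp_neq\<close>)
      show "((\<lambda>t. t) \<longlongrightarrow> T) (at_left T)" by (rule tendsto_ident_at)
    qed simp
  qed
  have "((\<lambda>t. ((1 - m) * A (z t) powr (1 + m)) powr al) \<longlongrightarrow> Ninf) (at_left T)"
    unfolding Ninf_def using Ainf_pos m1
    by (intro tendsto_powr tendsto_mult tendsto_const filterlim_compose[OF A_tendsto zl]) auto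
  moreover have "\<forall>\<^sub>F t in at_left T. ((1 - m) * A (z t) powr (1 + m)) powr al = N t / (T - t) powr al"
    using ev
  proof eventually_elim
    case (elim t)
    then have "(N t powr (1 - m)) powr al = (T - t) powr al * ((1 - m) * A (z t) powr (1 + m)) powr al"
      using z[of t] m1 by (simp add: powr_mult)
    moreover have "(N t powr (1 - m)) powr al = N t" using m1 N_nonneg[of t] by (simp add: powr_powr al_def)
    ultimately show ?case using elim by simp
  qed
  ultimately show ?thesis by (rule Lim_transform_eventually)
qed

lemma nU_upper: obtains C where "0 \<le> C" "\<And>t. 0 \<le> t ==> t < T ==> nU t \<le> C * (T - t) powr al"
proof (rule that)
  define B where "B = A 0"
  have B: "0 < B" using Ainf_pos Ainf_le[of 0] T_pos by (simp add: B_def)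
  define C where "C = B * ((1 - m) * B powr (1 + m)) powr al"
  show "0 \<le> B * ((1 - m) * B powr (1 + m)) powr al" using B by simp
  fix t assume t: "0 \<le> t" "t < T"
  obtain z where z: "t < z" "z < T" "N t powr (1 - m) = (T - t) * ((1 - m) * A z powr (1 + m))" using N_powr_MVT[OF t] by blast
  have AB: "A s \<le> B" "0 \<le> A s" if "0 \<le> s" "s < T" for s
    using A_antimono[of 0 s] Ainf_le[of s] Ainf_pos that by (auto simp: B_def)
  have "N t = (N t powr (1 - m)) powr al" using m1 N_nonneg[of t] by (simp add: powr_powr al_def)
  also have "\<dots> \<le> ((T - t) * ((1 - m) * B powr (1 + m))) powr al"
    unfolding z(3) using AB[of z] t z m0 m1 al_pos by (intro powr_mono2 mult_left_mono mult_nonneg_nonneg) auto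
  also have "\<dots> = ((1 - m) * B powr (1 + m)) powr al * (T - t) powr al" by (simp add: powr_mult mult.commute)
  finally have "A t * N t \<le> B * (((1 - m) * B powr (1 + m)) powr al * (T - t) powr al)"
    using AB[OF t] N_nonneg by (intro mult_mono) auto
  then show "nU t \<le> B * ((1 - m) * B powr (1 + m)) powr al * (T - t) powr al"
    using N_pos[OF t] by (simp add: A_def mult.assoc)
qed

text \<open>The quantity on the right measures the failure of equality in the Cauchy--Schwarz inequality
  \<open>K t1 t2 \<le> N t1 * N t2\<close>.\<close>

lemma X_directions:
  assumes t: "0 \<le> t1" "t1 \<le> t2" "t2 < T"
  shows "(nrm (\<lambda>x. X t1 x / N t1 - X t2 x / N t2))\<^sup>2 \<le> 2 * (A t1 / A t2 - 1) * (N t1 / N t2 - 1)"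
proof -
  have t2: "0 \<le> t2" "t1 < T" using t by auto
  have n: "0 < N t1" "0 < N t2" using N_pos t t2 by auto
  have A2: "0 < A t2" using Ainf_pos Ainf_le[of t2] t t2 by simp
  have AA: "A t2 \<le> A t1" by (rule A_antimono[OF t])
  \<comment> \<open>On the interval \<open>A\<close> is at least \<open>A t2\<close>, so the clock
    advances by at most the drop of \<open>N\<close> divided by \<open>A t2\<close>; the final bound
    then involves quotients only.\<close>
  have I: "A t2 * (Im t2 - Im t1) \<le> N t1 - N t2"
  proof (cases "t1 = t2")
    case False
    then have lt: "t1 < t2" using t by simp
    define h where "h r = - N r - A t2 * Im r" for r
    have "h t1 \<le> h t2"
    proof (rule DERIV_nonneg_imp_increasing_open[OF less_imp_le[OF lt]])
      fix r assume r: "t1 < r" "r < t2"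
      then have r0: "0 < r" "r < T" using t by auto
      have "DERIV h r :> - (- (A r * nU r powr m)) - A t2 * nU r powr m"
        unfolding h_def using r0 by (intro DERIV_diff DERIV_minus DERIV_cmult N_derivative Im_derivative)
      moreover have "A t2 * nU r powr m \<le> A r * nU r powr m"
        using A_antimono[of r t2] r r0 t by (intro mult_right_mono) auto
      ultimately show "\<exists>l. DERIV h r :> l \<and> 0 \<le> l" by (metis diff_ge_0_iff_ge minus_minus)
    next
      show "continuous_on {t1..t2} h"
        unfolding h_def using t
        by (intro continuous_intros continuous_on_subset[OF N_continuous] continuous_on_subset[OF Im_continuous[of t2]]) auto
    qed
    then show ?thesis by (simp add: h_def algebra_simps)
  qed simp
  have "nU t1 * (Im t2 - Im t1) = (A t1 / A t2) * N t1 * (A t2 * (Im t2 - Im t1))"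
    using n A2 by (simp add: A_def[of t1])
  also have "\<dots> \<le> (A t1 / A t2) * N t1 * (N t1 - N t2)"
    using I n A2 AA by (intro mult_left_mono) auto
  finally have Kl: "N t1 * N t1 - (A t1 / A t2) * N t1 * (N t1 - N t2) \<le> K t1 t2"
    using K_lower[OF t(1,2)] N_sq[of t1] by (simp add: power2_eq_square)
  define q where "q = A t1 / A t2"
  have "(\<lambda>x. X t1 x / N t1 - X t2 x / N t2) = (\<lambda>x. (1 / N t1) * X t1 x - (1 / N t2) * X t2 x)" by simp
  then have "(nrm (\<lambda>x. X t1 x / N t1 - X t2 x / N t2))\<^sup>2 = E (\<lambda>x. (1 / N t1) * X t1 x - (1 / N t2) * X t2 x) (\<lambda>x. (1 / N t1) * X t1 x - (1 / N t2) * X t2 x)"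
    by (simp only: nrm_sq)
  also have "\<dots> = (1 / N t1) * ((1 / N t1) * K t1 t1) - 2 * ((1 / N t1) * ((1 / N t2) * K t1 t2)) + (1 / N t2) * ((1 / N t2) * K t2 t2)"
    using X_V[OF t(1)] X_V[OF t2(1)]
    by (simp only: E_diff_left E_diff_right V_diff V_cmult E_cmult_left E_cmult_right K_def[symmetric] K_sym[of t2 t1])
       (simp add: diff_divide_distrib mult.commute)
  \<comment> \<open>The squared distance of two unit vectors; the quotient on the right is their
    cosine, to which the lower bound for \<open>K t1 t2\<close> applies.\<close>
  also have "\<dots> = 2 - 2 * (K t1 t2 / (N t1 * N t2))"
    using n by (simp add: N_sq[symmetric] power2_eq_square)
  also have "\<dots> \<le> 2 - 2 * ((N t1 * N t1 - q * N t1 * (N t1 - N t2)) / (N t1 * N t2))"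
    using Kl n unfolding q_def by (intro diff_left_mono mult_left_mono divide_right_mono) auto
  also have "(N t1 * N t1 - q * N t1 * (N t1 - N t2)) / (N t1 * N t2) = N t1 / N t2 - q * (N t1 / N t2 - 1)"
    using n by (simp add: field_simps)
  also have "2 - 2 * (N t1 / N t2 - q * (N t1 / N t2 - 1)) = 2 * (q - 1) * (N t1 / N t2 - 1)"
  proof -
    have "2 - 2 * (a - q * (a - 1)) = 2 * (q - 1) * (a - 1)" for a by (simp add: algebra_simps)
    then show ?thesis .
  qed
  finally show ?thesis unfolding q_def .
qed

section \<open>Pointwise comparison of the power with difference quotients of the potential\<close>

lemma indicator_sol:
  assumes B: "B \<in> sets borel" "B \<subseteq> \<Omega>"
  obtains \<psi> where "sol \<psi> (indicator B)"
proof -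
  have "emeasure lborel B \<le> emeasure lborel \<Omega>" using B by (intro emeasure_mono) auto
  then have "Lp (1 + m) (indicator B :: 'a => real)" using B Omega_finite by (intro Lp_indicator) auto
  then show ?thesis using sol_exists dual_of_Lp that by blast
qed

lemma AE_le_of_indicator:
  assumes f: "f \<in> V" and g: "g \<in> V"
    and le: "\<And>B. B \<in> sets borel ==> B \<subseteq> \<Omega> ==> (LBINT x. indicator B x * f x) \<le> (LBINT x. indicator B x * g x)"
  shows "AE x in lborel. f x \<le> g x"
proof -
  have [measurable]: "f \<in> borel_measurable borel" "g \<in> borel_measurable borel" using V_measurable f g by auto
  define B where "B = {x. g x < f x}"
  have B: "B \<in> sets borel" unfolding B_def by measurable
  have BO: "B \<subseteq> \<Omega>" using V_outside[OF f] V_outside[OF g] by (force simp: B_def)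
  have i: "integrable lborel (\<lambda>x. indicator B x * f x)" "integrable lborel (\<lambda>x. indicator B x * g x)"
    using integrable_mult_indicator[of B lborel f] integrable_mult_indicator[of B lborel g] V_integrable f g B by auto
  have nn: "0 \<le> indicator B x * f x - indicator B x * g x" for x by (auto simp: indicator_def B_def)
  have "(LBINT x. indicator B x * f x - indicator B x * g x) \<le> 0" using le[OF B BO] i by simp
  then have "(LBINT x. indicator B x * f x - indicator B x * g x) = 0"
    using nn by (intro antisym integral_nonneg_AE) auto
  then have "AE x in lborel. indicator B x * f x - indicator B x * g x = 0"
    using integral_nonneg_eq_0_iff_AE[of lborel "\<lambda>x. indicator B x * f x - indicator B x * g x"] i nn by simp
  then show ?thesis by eventually_elim (auto simp: indicator_def B_def split: if_splits)
qed

text \<open>Testing with the potential of an indicator turns the weak equation into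
  \<open>X' = - w\<close> integrated over an arbitrary set \<open>B\<close>. As \<open>w\<close>
  decreases in time, its time average lies between its values at the ends, and varying
  \<open>B\<close> yields the pointwise bounds.\<close>

lemma X_sandwich:
  assumes t: "0 < t1" "t1 \<le> t2"
  shows "AE x in lborel. (t2 - t1) * u x t2 powr m \<le> X t1 x - X t2 x"
    and "AE x in lborel. X t1 x - X t2 x \<le> (t2 - t1) * u x t1 powr m"
proof -
  have t': "0 \<le> t1" "0 \<le> t2" "0 < t2" using t by auto
  have WV: "(\<lambda>x. X t1 x - X t2 x) \<in> V" by (intro V_diff X_V t')
  have ind: "(LBINT x. indicator B x * (X t1 x - X t2 x)) = (LBINT x. u x t1 * \<psi> x) - (LBINT x. u x t2 * \<psi> x)"
    and Ew: "\<And>r. 0 < r ==> E (w r) \<psi> = (LBINT x. indicator B x * u x r powr m)"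
    if \<psi>: "sol \<psi> (indicator B)" for B \<psi>
  proof -
    have "(LBINT x. indicator B x * (X t1 x - X t2 x)) = E (\<lambda>x. X t1 x - X t2 x) \<psi>"
      using sol_E[OF \<psi> WV] by (simp add: E_sym)
    also have "\<dots> = (LBINT x. u x t1 * \<psi> x) - (LBINT x. u x t2 * \<psi> x)"
      using E_diff_left[OF X_V X_V sol_V[OF \<psi>]] sol_E[OF X_sol sol_V[OF \<psi>]] t' by simp
    finally show "(LBINT x. indicator B x * (X t1 x - X t2 x)) = (LBINT x. u x t1 * \<psi> x) - (LBINT x. u x t2 * \<psi> x)" .
    show "\<And>r. 0 < r ==> E (w r) \<psi> = (LBINT x. indicator B x * u x r powr m)"
      using sol_E[OF \<psi> w_V] by (simp add: E_sym)
  qed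
  have mono: "(LBINT x. indicator B x * u x r' powr m) \<le> (LBINT x. indicator B x * u x r powr m)"
    if B: "B \<in> sets borel" and r: "0 < r" "r \<le> r'" for B :: "'a set" and r r'
  proof (rule integral_mono_AE)
    have r': "0 < r'" using r by simp
    show "integrable lborel (\<lambda>x. indicator B x * u x r' powr m)" "integrable lborel (\<lambda>x. indicator B x * u x r powr m)"
      using integrable_mult_indicator[of B lborel "w r'"] integrable_mult_indicator[of B lborel "w r"] B V_integrable[OF w_V[OF r(1)]] V_integrable[OF w_V[OF r']] by auto
    show "AE x in lborel. indicator B x * u x r' powr m \<le> indicator B x * u x r powr m"
      using u_antimono[OF less_imp_le[OF r(1)] r(2)]
      by eventually_elim (use m0 u_nonneg in \<open>auto intro!: mult_left_mono powr_mono2\<close>)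
  qed
  show "AE x in lborel. (t2 - t1) * u x t2 powr m \<le> X t1 x - X t2 x"
  proof (rule AE_le_of_indicator[OF V_cmult[OF w_V[OF t'(3)]] WV])
    fix B :: "'a set" assume B: "B \<in> sets borel" "B \<subseteq> \<Omega>"
    obtain \<psi> where \<psi>: "sol \<psi> (indicator B)" using indicator_sol[OF B] by blast
    have "(LBINT x. indicator B x * u x t2 powr m) * (t2 - t1) \<le> (LBINT x. indicator B x * (X t1 x - X t2 x))"
      unfolding ind[OF \<psi>]
    proof (rule weak_form_lower[OF sol_V[OF \<psi>] t'(1) t(2)])
      fix r assume "t1 < r" "r \<le> t2"
      then show "(LBINT x. indicator B x * u x t2 powr m) \<le> E (w r) \<psi>"
        using Ew[OF \<psi>, of r] mono[OF B(1), of r t2] t by simp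
    qed
    then show "(LBINT x. indicator B x * ((t2 - t1) * u x t2 powr m)) \<le> (LBINT x. indicator B x * (X t1 x - X t2 x))"
      by (simp add: mult.left_commute mult.commute)
  qed
  show "AE x in lborel. X t1 x - X t2 x \<le> (t2 - t1) * u x t1 powr m"
  proof (rule AE_le_of_indicator[OF WV V_cmult[OF w_V[OF t(1)]]])
    fix B :: "'a set" assume B: "B \<in> sets borel" "B \<subseteq> \<Omega>"
    obtain \<psi> where \<psi>: "sol \<psi> (indicator B)" using indicator_sol[OF B] by blast
    have "(LBINT x. indicator B x * (X t1 x - X t2 x)) \<le> (LBINT x. indicator B x * u x t1 powr m) * (t2 - t1)"
      unfolding ind[OF \<psi>]
    proof (rule weak_form_upper[OF sol_V[OF \<psi>] t'(1) t(2)])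
      fix r assume "t1 < r" "r \<le> t2"
      then show "E (w r) \<psi> \<le> (LBINT x. indicator B x * u x t1 powr m)"
        using Ew[OF \<psi>, of r] mono[OF B(1), of t1 r] t by simp
    qed
    then show "(LBINT x. indicator B x * (X t1 x - X t2 x)) \<le> (LBINT x. indicator B x * ((t2 - t1) * u x t1 powr m))"
      by (simp add: mult.left_commute mult.commute)
  qed
qed

end

context frac
begin

section \<open>Boundedness by level-set iteration\<close>

lemma power_powr_commute: "0 < x ==> (x ^ j) powr c = (x powr c) ^ j" for x c :: real
  by (simp add: powr_powr mult.commute flip: powr_realpow)

text \<open>The iteration common to the linear case \<open>s = 2\<close> and the nonlinear case
  \<open>s = p + 1\<close>: energy estimate, Chebyshev for the support, Hoelder between
  \<open>s\<close> and \<open>qs\<close>. The functions need not be truncations of a single one,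
  since in the nonlinear case they live at different times.\<close>

lemma level_iteration:
  fixes f :: "nat => 'a => real"
  assumes s: "1 < s" "s < qs"
    and f0: "\<And>j x. 0 \<le> f j x" and fs: "\<And>j. Lp s (f j)" and fq: "\<And>j. Lp qs (f (Suc j))"
    and out: "\<And>j x. x \<notin> \<Omega> ==> f j x = 0"
    and C: "0 < C" and b: "1 \<le> b"
    and en: "\<And>j. (Lnorm qs (f (Suc j)))\<^sup>2 \<le> C * b ^ j * (LBINT x. f j x powr s)"
    and k: "0 < k" and lev: "\<And>j. AE x in lborel. 0 < f (Suc j) x \<longrightarrow> k * (1 / 2) ^ Suc j \<le> f j x"
    and e_def: "e = s / 2 - s / qs"
    and small: "C powr (s / 2) * (2 / k) powr (s * (1 - s / qs)) * (LBINT x. f 0 x powr s) powr e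
        * (b powr (s / 2) * 2 powr (s * (1 - s / qs))) powr (1 / e) \<le> 1"
  shows "(\<lambda>j. LBINT x. f j x powr s) \<longlonglongrightarrow> 0"
proof -
  define Y where "Y j = (LBINT x. f j x powr s)" for j
  define g where "g = s * (1 - s / qs)"
  have q2: "2 < qs" by (rule qs_gt_2)
  have g: "0 < g" using s by (simp add: g_def)
  have "s / qs < s / 2" using s q2 by (intro divide_strict_left_mono) auto
  then have e: "0 < e" by (simp add: e_def)
  have Y0: "0 \<le> Y j" for j by (simp add: Y_def)
  define B where "B = b powr (s / 2) * 2 powr g"
  have B: "1 < B"
  proof -
    have "1 \<le> b powr (s / 2)" using b s by (intro ge_one_powr_ge_zero) auto
    moreover have "1 < (2::real) powr g" using g by (simp add: gr_one_powr)
    ultimately have "1 * 1 < b powr (s / 2) * 2 powr g" by (intro mult_le_less_imp_less) auto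
    then show ?thesis by (simp add: B_def)
  qed
  have step: "Y (Suc j) \<le> (C powr (s / 2) * (2 / k) powr g) * B ^ j * Y j powr (1 + e)" for j
  proof -
    have m [measurable]: "f j \<in> borel_measurable borel" for j using fs[of j] by (simp add: Lp_def)
    define S where "S = {x. 0 < f (Suc j) x}"
    have S [measurable]: "S \<in> sets borel" unfolding S_def by measurable
    have SO: "S \<subseteq> \<Omega>" using out by (force simp: S_def)
    have Sf: "emeasure lborel S < \<infinity>"
      using emeasure_mono[OF SO, of lborel] Omega_finite by (auto intro: le_less_trans)
    have z: "f (Suc j) x = 0" if "x \<notin> S" for x using that f0[of "Suc j" x] by (simp add: S_def)
    have iY: "integrable lborel (\<lambda>x. f j x powr s)" using fs[of j] f0 by (simp add: Lp_def)
    define \<eta> where "\<eta> = k * (1 / 2) ^ Suc j"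
    have \<eta>: "0 < \<eta>" using k by (simp add: \<eta>_def)
    \<comment> \<open>Chebyshev's inequality: on the support of \<open>f (Suc j)\<close> the
      preceding function is at least \<open>\<eta>\<close>.\<close>
    have "measure lborel S * \<eta> powr s = (LBINT x. \<eta> powr s * indicator S x)" by simp
    also have "\<dots> \<le> Y j"
      unfolding Y_def
    proof (rule integral_mono_AE[OF _ iY])
      show "integrable lborel (\<lambda>x. \<eta> powr s * indicator S x)"
        using S Sf by (intro integrable_mult_right integrable_real_indicator) auto
      show "AE x in lborel. \<eta> powr s * indicator S x \<le> f j x powr s"
        using lev[of j]
      proof eventually_elim
        case (elim x)
        show ?case
        proof (cases "x \<in> S")
          case True
          then have "\<eta> \<le> f j x" using elim by (simp add: S_def \<eta>_def)
          then show ?thesis using True \<eta> s by (simp add: powr_mono2)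
        qed simp
      qed
    qed
    finally have "measure lborel S \<le> Y j / \<eta> powr s" using \<eta> by (simp add: pos_le_divide_eq)
    then have "measure lborel S powr (1 - s / qs) \<le> (Y j / \<eta> powr s) powr (1 - s / qs)"
      using s by (intro powr_mono2) auto
    also have "\<dots> = Y j powr (1 - s / qs) * (1 / \<eta>) powr g"
      using \<eta> Y0 by (simp add: powr_divide powr_powr g_def)
    also have "1 / \<eta> = (2 / k) * 2 ^ j" by (simp add: \<eta>_def power_divide)
    also have "((2 / k) * 2 ^ j) powr g = (2 / k) powr g * (2 powr g) ^ j"
      unfolding powr_mult by (simp only: power_powr_commute[of 2, simplified])
    finally have mS: "measure lborel S powr (1 - s / qs) \<le> Y j powr (1 - s / qs) * ((2 / k) powr g * (2 powr g) ^ j)" .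
    have "((Lnorm qs (f (Suc j)))\<^sup>2) powr (s / 2) \<le> (C * b ^ j * Y j) powr (s / 2)"
      using en[of j] s by (intro powr_mono2) (auto simp: Y_def)
    also have "((Lnorm qs (f (Suc j)))\<^sup>2) powr (s / 2) = Lnorm qs (f (Suc j)) powr s"
      by (simp add: powr_powr flip: powr_numeral)
    also have "(C * b ^ j * Y j) powr (s / 2) = C powr (s / 2) * (b powr (s / 2)) ^ j * Y j powr (s / 2)"
      using b power_powr_commute[of b j "s / 2"] unfolding powr_mult by simp
    finally have L: "Lnorm qs (f (Suc j)) powr s \<le> C powr (s / 2) * (b powr (s / 2)) ^ j * Y j powr (s / 2)" .
    have "Y (Suc j) \<le> (LBINT x. \<bar>f (Suc j) x\<bar> powr qs) powr (s / qs) * measure lborel S powr (1 - s / qs)"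
      using Lnorm_lower_exponent(2)[OF _ s(2) fq[of j] _ Sf z] s S f0 by (simp add: Y_def)
    also have "(LBINT x. \<bar>f (Suc j) x\<bar> powr qs) powr (s / qs) = Lnorm qs (f (Suc j)) powr s"
      by (simp add: Lnorm_def powr_powr)
    also have "Lnorm qs (f (Suc j)) powr s * measure lborel S powr (1 - s / qs)
        \<le> (C powr (s / 2) * (b powr (s / 2)) ^ j * Y j powr (s / 2)) * (Y j powr (1 - s / qs) * ((2 / k) powr g * (2 powr g) ^ j))"
      using L mS C by (intro mult_mono) auto
    also have "\<dots> = (C powr (s / 2) * (2 / k) powr g) * B ^ j * (Y j powr (s / 2) * Y j powr (1 - s / qs))"
      unfolding B_def power_mult_distrib by (simp only: mult_ac)
    also have "Y j powr (s / 2) * Y j powr (1 - s / qs) = Y j powr (1 + e)"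
      unfolding powr_add[symmetric] e_def by (rule arg_cong[where f="\<lambda>t. Y j powr t"]) simp
    finally show ?thesis .
  qed
  have "Y \<longlonglongrightarrow> 0"
  proof (rule De_Giorgi_sequence[OF Y0 _ B e step])
    show "0 < C powr (s / 2) * (2 / k) powr g" using C k by simp
    show "C powr (s / 2) * (2 / k) powr g * Y 0 powr e * B powr (1 / e) \<le> 1"
      using small by (simp add: Y_def B_def g_def)
  qed
  then show ?thesis by (simp add: Y_def[abs_def])
qed

lemma AE_zero_of_integral_tendsto:
  fixes f :: "nat => 'a => real"
  assumes h: "h \<in> borel_measurable lborel" "\<And>x. 0 \<le> h x" and s: "0 < s"
    and f: "\<And>j. integrable lborel (\<lambda>x. f j x powr s)" and le: "\<And>j. AE x in lborel. h x \<le> f j x"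
    and lim: "(\<lambda>j. LBINT x. f j x powr s) \<longlonglongrightarrow> 0"
  shows "AE x in lborel. h x = 0"
proof -
  note [measurable] = h(1)
  have le': "AE x in lborel. h x powr s \<le> f j x powr s" for j
    using le[of j] by eventually_elim (use h s in \<open>auto intro!: powr_mono2\<close>)
  have i: "integrable lborel (\<lambda>x. h x powr s)"
    by (rule Bochner_Integration.integrable_bound[OF f[of 0]]) (use le'[of 0] in \<open>auto\<close>)
  have "(LBINT x. h x powr s) \<le> (LBINT x. f j x powr s)" for j
    by (rule integral_mono_AE[OF i f le'])
  then have "(LBINT x. h x powr s) \<le> 0" by (intro LIMSEQ_le_const[OF lim]) auto
  then have "(LBINT x. h x powr s) = 0" by (intro antisym integral_nonneg_AE) auto
  then have "AE x in lborel. h x powr s = 0" using integral_nonneg_eq_0_iff_AE[OF i] by simp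
  then show ?thesis by simp
qed

text \<open>The threshold depends on \<open>k\<close> and \<open>M\<close> only and not on the
  solution, so smallness in \<open>L^2\<close> becomes uniform smallness along a whole sequence of
  solutions.\<close>

lemma linear_sup_bound_one_sided:
  assumes k: "0 < k" and M: "0 < M"
  obtains \<delta> where "0 < \<delta>"
    "\<And>D d. sol D d ==> (AE x in lborel. d x \<le> M) ==> (LBINT x. (D x)\<^sup>2) \<le> \<delta> ==> AE x in lborel. D x \<le> k"
proof -
  \<comment> \<open>\<open>M\<close> comes from the right-hand side, \<open>SQ\<close> from the
    Sobolev inequality, and \<open>2 / k\<close> because on its support \<open>f (Suc j)\<close> is
    at most \<open>(2 / k) * 2 ^ j\<close> times the square of \<open>f j\<close>.\<close>
  define C where "C = SQ * M * (2 / k)"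
  have C: "0 < C" using SQ_pos M k by (simp add: C_def)
  define e where "e = (2::real) / 2 - 2 / qs"
  have e: "0 < e" using qs_gt_2 by (simp add: e_def)
  define Q where "Q = C powr (2 / 2) * (2 / k) powr (2 * (1 - 2 / qs)) * (2 powr (2 / 2) * 2 powr (2 * (1 - 2 / qs))) powr (1 / e)"
  have Q: "0 < Q" using C k by (simp add: Q_def)
  \<comment> \<open>The largest value for which the smallness condition of the iteration, here
    \<open>Q * \<delta> powr e \<le> 1\<close>, holds.\<close>
  define \<delta> where "\<delta> = (1 / Q) powr (1 / e)"
  show ?thesis
  proof (rule that[of \<delta>])
    show "0 < \<delta>" using Q by (simp add: \<delta>_def)
    fix D d assume D: "sol D d" and d: "AE x in lborel. d x \<le> M" and le: "(LBINT x. (D x)\<^sup>2) \<le> \<delta>"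
    have DV: "D \<in> V" by (rule sol_V[OF D])
    define kk where "kk j = k * (1 - (1 / 2) ^ j)" for j :: nat
    have kk: "0 \<le> kk j" "kk j \<le> k" for j using k by (auto simp: kk_def power_le_one mult_left_le)
    define f where "f j x = max 0 (D x - kk j)" for j x
    have fV: "f j \<in> V" for j unfolding f_def by (rule V_trunc[OF DV kk(1)])
    have f0: "0 \<le> f j x" for j x by (simp add: f_def)
    have kkS: "kk (Suc j) = kk j + k * (1 / 2) ^ Suc j" for j by (simp add: kk_def algebra_simps)
    have lev: "k * (1 / 2) ^ Suc j \<le> f j x" if "0 < f (Suc j) x" for j x
      using that kkS[of j] by (simp add: f_def max_def split: if_splits)
    have fi: "integrable lborel (\<lambda>x. (f j x)\<^sup>2)" for j by (rule V_square_integrable[OF fV])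
    have p2: "f j x powr 2 = (f j x)\<^sup>2" for j x using f0[of j x] by (simp add: powr_numeral)
    have "(\<lambda>j. LBINT x. f j x powr 2) \<longlonglongrightarrow> 0"
    proof (rule level_iteration[where C=C and b=2 and k=k and e=e])
      show "Lp 2 (f j)" for j using V_Lp(1)[OF fV, of 2] qs_gt_2 by simp
      show "Lp qs (f (Suc j))" for j by (rule V_Lp_qs[OF fV])
      show "x \<notin> \<Omega> ==> f j x = 0" for j x by (rule V_outside[OF fV])
      show "(Lnorm qs (f (Suc j)))\<^sup>2 \<le> C * 2 ^ j * (LBINT x. f j x powr 2)" for j
      proof -
        have "E (f (Suc j)) (f (Suc j)) \<le> E D (f (Suc j))"
          unfolding f_def by (rule E_trunc[OF DV kk(1)])
        also have "\<dots> = (LBINT x. d x * f (Suc j) x)" by (rule sol_E[OF D fV])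
        also have "\<dots> \<le> (LBINT x. M * (2 / k) * 2 ^ j * (f j x)\<^sup>2)"
        proof (rule integral_mono_AE[OF sol_integrable[OF D fV]])
          show "integrable lborel (\<lambda>x. M * (2 / k) * 2 ^ j * (f j x)\<^sup>2)" using fi by simp
          show "AE x in lborel. d x * f (Suc j) x \<le> M * (2 / k) * 2 ^ j * (f j x)\<^sup>2"
            using d
          proof eventually_elim
            case (elim x)
            show ?case
            proof (cases "0 < f (Suc j) x")
              case True
              have "kk j \<le> kk (Suc j)" using kkS[of j] k by simp
              then have "f (Suc j) x \<le> f j x" unfolding f_def by (intro max.mono) auto
              also have "\<dots> = f j x * 1" by simp
              also have "\<dots> \<le> f j x * ((2 / k) * 2 ^ j * f j x)"
              proof (rule mult_left_mono[OF _ f0])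
                have "(2 / k) * 2 ^ j * (k * (1 / 2) ^ Suc j) \<le> (2 / k) * 2 ^ j * f j x"
                  using lev[OF True] k by (intro mult_left_mono) auto
                moreover have "(2 / k) * 2 ^ j * (k * (1 / 2) ^ Suc j) = 1" using k by (simp add: power_divide)
                ultimately show "1 \<le> (2 / k) * 2 ^ j * f j x" by linarith
              qed
              finally have "M * f (Suc j) x \<le> M * (f j x * ((2 / k) * 2 ^ j * f j x))" using M by (intro mult_left_mono) auto
              moreover have "d x * f (Suc j) x \<le> M * f (Suc j) x" using elim f0 by (rule mult_right_mono)
              ultimately show ?thesis by (simp add: power2_eq_square mult_ac)
            next
              case False
              then have "f (Suc j) x = 0" using f0[of "Suc j" x] by simp
              then show ?thesis using M k by simp
            qed
          qed
        qed
        finally have "E (f (Suc j)) (f (Suc j)) \<le> M * (2 / k) * 2 ^ j * (LBINT x. (f j x)\<^sup>2)" by simp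
        then have "SQ * E (f (Suc j)) (f (Suc j)) \<le> SQ * (M * (2 / k) * 2 ^ j * (LBINT x. (f j x)\<^sup>2))"
          using SQ_pos by (intro mult_left_mono) auto
        then show ?thesis using Sobolev[OF fV[of "Suc j"]] unfolding p2 C_def by (simp add: mult_ac)
      qed
      have "(LBINT x. f 0 x powr 2) \<le> (LBINT x. (D x)\<^sup>2)"
        unfolding p2
      proof (rule integral_mono[OF fi V_square_integrable[OF DV]])
        fix x
        have "f 0 x \<le> \<bar>D x\<bar>" by (simp add: f_def kk_def)
        then show "(f 0 x)\<^sup>2 \<le> (D x)\<^sup>2" using f0[of 0 x] by (simp add: abs_le_square_iff[symmetric])
      qed
      then have "(LBINT x. f 0 x powr 2) powr e \<le> \<delta> powr e" using le e by (intro powr_mono2) auto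
      also have "\<dots> = 1 / Q" using e Q by (simp add: \<delta>_def powr_powr)
      finally have "(LBINT x. f 0 x powr 2) powr e * Q \<le> 1" using Q by (simp add: pos_le_divide_eq)
      then show "C powr (2 / 2) * (2 / k) powr (2 * (1 - 2 / qs)) * (LBINT x. f 0 x powr 2) powr e
        * (2 powr (2 / 2) * 2 powr (2 * (1 - 2 / qs))) powr (1 / e) \<le> 1"
        by (simp add: Q_def mult_ac)
    qed (use qs_gt_2 f0 C k lev in \<open>auto simp: e_def\<close>)
    then have "AE x in lborel. max 0 (D x - k) = 0"
    proof (rule AE_zero_of_integral_tendsto[rotated 5])
      show "(\<lambda>x. max 0 (D x - k)) \<in> borel_measurable lborel" using V_measurable[OF DV] by simp
      show "AE x in lborel. max 0 (D x - k) \<le> f j x" for j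
        using kk(2)[of j] by (intro AE_I2) (auto simp: f_def)
    qed (use fi p2 in auto)
    then show "AE x in lborel. D x \<le> k" by eventually_elim simp
  qed
qed

lemma linear_sup_bound:
  assumes k: "0 < k" and M: "0 < M"
  obtains \<delta> where "0 < \<delta>"
    "\<And>D d. sol D d ==> (AE x in lborel. \<bar>d x\<bar> \<le> M) ==> (LBINT x. (D x)\<^sup>2) \<le> \<delta> ==> AE x in lborel. \<bar>D x\<bar> \<le> k"
proof -
  obtain \<delta> where \<delta>: "0 < \<delta>"
    "\<And>D d. sol D d ==> (AE x in lborel. d x \<le> M) ==> (LBINT x. (D x)\<^sup>2) \<le> \<delta> ==> AE x in lborel. D x \<le> k"
    using linear_sup_bound_one_sided[OF k M] by blast
  show ?thesis
  proof (rule that[OF \<delta>(1)])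
    fix D d assume D: "sol D d" and d: "AE x in lborel. \<bar>d x\<bar> \<le> M" and le: "(LBINT x. (D x)\<^sup>2) \<le> \<delta>"
    have d1: "AE x in lborel. d x \<le> M" and d2: "AE x in lborel. - 1 * d x \<le> M"
      using d by (auto elim!: eventually_mono)
    have 1: "AE x in lborel. D x \<le> k" by (rule \<delta>(2)[OF D d1 le])
    have 2: "AE x in lborel. - 1 * D x \<le> k" by (rule \<delta>(2)[OF sol_cmult[OF D, of "-1"] d2]) (use le in simp)
    show "AE x in lborel. \<bar>D x\<bar> \<le> k" using 1 2 by eventually_elim auto
  qed
qed

section \<open>Compact embedding\<close>

lemma conv_abs_le:
  assumes \<kappa>: "cutoff_smooth \<kappa>" and f: "integrable lborel f" and b: "\<And>v. \<bar>\<kappa> v\<bar> \<le> M"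
  shows "\<bar>conv \<kappa> f x\<bar> \<le> M * (LBINT y. \<bar>f y\<bar>)"
proof -
  have "\<bar>conv \<kappa> f x\<bar> \<le> (LBINT y. \<bar>\<kappa> (x - y) * f y\<bar>)" unfolding conv_def by (rule integral_abs_bound)
  also have "\<dots> \<le> (LBINT y. M * \<bar>f y\<bar>)"
    using integrable_abs[OF conv_integrable[OF \<kappa> f, of x]] f b
    by (intro integral_mono) (auto simp: abs_mult intro!: mult_right_mono)
  finally show ?thesis by simp
qed

text \<open>Mollification errors are uniformly small for bounded energy. At each fixed scale the
  mollified functions are bounded and equicontinuous, so convergence on a countable dense set
  spreads to all points and dominated convergence gives \<open>L^2\<close>.\<close>

lemma Rellich:
  assumes f: "\<And>k. f k \<in> V" "\<And>k. nrm (f k) \<le> B"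
  obtains r :: "nat => nat" where "strict_mono r"
    "\<And>e. 0 < e ==> \<exists>N. \<forall>i\<ge>N. \<forall>j\<ge>N. (LBINT x. (f (r i) x - f (r j) x)\<^sup>2) < e"
proof -
  have B: "0 \<le> B" using f(2)[of 0] nrm_nonneg[of "f 0"] by linarith
  obtain \<kappa> :: "nat => 'a => real" and C where \<kappa>: "\<And>j. cutoff_smooth (\<kappa> j)" "\<And>j v. 0 \<le> \<kappa> j v"
    "\<And>j v. \<kappa> j v \<noteq> 0 ==> real (Suc j) *\<^sub>R v \<in> ball 0 1"
    "\<And>j. integrable lborel (\<kappa> j)" "\<And>j. (LBINT v. \<kappa> j v) = 1" "0 \<le> C"
    "\<And>j f. f \<in> V ==> integrable lborel (\<lambda>x. (conv (\<kappa> j) f x - f x)\<^sup>2)"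
    "\<And>j f. f \<in> V ==> (LBINT x. (conv (\<kappa> j) f x - f x)\<^sup>2) \<le> C * real (Suc j) powr (- 2 * \<sigma>) * E f f"
    using mollifier_family[OF zero_less_one, of 0] by blast
  define L where "L = CC 1 * B"
  have L: "0 \<le> L" using B CC_nonneg by (simp add: L_def)
  have fL: "(LBINT y. \<bar>f k y\<bar>) \<le> L" for k
  proof -
    have "(LBINT y. \<bar>f k y\<bar>) = Lnorm 1 (f k)" by (simp add: Lnorm_def)
    also have "\<dots> \<le> CC 1 * nrm (f k)" using V_Lp(2)[OF f(1), of 1] qs_gt_2 by simp
    also have "\<dots> \<le> L" unfolding L_def using f(2) CC_nonneg by (intro mult_left_mono)
    finally show ?thesis .
  qed
  have "\<exists>M. 0 \<le> M \<and> (\<forall>v. \<bar>\<kappa> j v\<bar> \<le> M)" for j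
  proof -
    obtain M where M: "\<And>v. \<bar>\<kappa> j v\<bar> \<le> M" using cutoff_smooth_bounded[OF \<kappa>(1)[of j]] by blast
    have "0 \<le> M" using M[of 0] abs_ge_zero[of "\<kappa> j 0"] by linarith
    then show ?thesis using M by blast
  qed
  then obtain M where M: "\<And>j. 0 \<le> M j" "\<And>j v. \<bar>\<kappa> j v\<bar> \<le> M j" by metis
  define G where "G j k = conv (\<kappa> j) (f k)" for j k
  have fi: "integrable lborel (f k)" for k by (rule V_integrable[OF f(1)])
  have Gb: "\<bar>G j k x\<bar> \<le> M j * L" for j k x
    using conv_abs_le[OF \<kappa>(1) fi M(2), of j k x] mult_left_mono[OF fL[of k] M(1)[of j]] by (simp add: G_def)
  obtain D :: "'a set" where D: "countable D" "\<And>U. open U ==> U \<noteq> {} ==> \<exists>d\<in>D. d \<in> U"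
    using countable_dense_exists by blast
  \<comment> \<open>Indexing by scale and point together lets one diagonal selection serve all
    scales; the quotient normalises the values to absolute value at most 1, and the added 1 keeps
    the denominator positive.\<close>
  define H where "H k z = G (fst z) k (snd z) / (M (fst z) * L + 1)" for k and z :: "nat \<times> 'a"
  have Hb: "norm (H k z) \<le> 1" for k z
  proof -
    have "0 \<le> M (fst z) * L" using M L by simp
    then show ?thesis using Gb[of "fst z" k "snd z"] by (simp add: H_def)
  qed
  have cD: "countable ((UNIV :: nat set) \<times> D)" using D(1) by simp
  obtain r :: "nat => nat" where r: "strict_mono r" "\<And>z. z \<in> UNIV \<times> D ==> \<exists>l. (\<lambda>n. H (r n) z) \<longlonglongrightarrow> l"
    by (rule function_convergent_subsequence[OF cD Hb]) (rule that)
  have convD: "convergent (\<lambda>n. G j (r n) x)" if x: "x \<in> D" for j x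
  proof -
    obtain l where "(\<lambda>n. H (r n) (j, x)) \<longlonglongrightarrow> l" using r(2)[of "(j, x)"] x by auto
    then have "(\<lambda>n. H (r n) (j, x) * (M j * L + 1)) \<longlonglongrightarrow> l * (M j * L + 1)" by (intro tendsto_mult tendsto_const)
    moreover have "0 \<le> M j * L" using M L by simp
    then have "H (r n) (j, x) * (M j * L + 1) = G j (r n) x" for n by (simp add: H_def)
    ultimately show ?thesis by (auto simp: convergent_def)
  qed
  have conv: "convergent (\<lambda>n. G j (r n) x)" for j x
  proof -
    have "Cauchy (\<lambda>n. G j (r n) x)"
    proof (rule metric_CauchyI)
      fix e :: real assume e: "0 < e"
      have "0 < e / (3 * (L + 1))" using e L by simp
      then obtain d where d: "0 < d" "\<And>a b. dist a b < d ==> dist (\<kappa> j a) (\<kappa> j b) < e / (3 * (L + 1))"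
        using cutoff_smooth_uniformly_continuous[OF \<kappa>(1)[of j]] unfolding uniformly_continuous_on_def by (metis UNIV_I)
      obtain x' where x': "x' \<in> D" "dist x x' < d" using D(2)[of "ball x d"] d(1) by auto
      have near: "\<bar>G j k x - G j k x'\<bar> \<le> e / 3" for k
      proof -
        have i: "integrable lborel (\<lambda>y. \<kappa> j (x - y) * f k y)" for j k x by (rule conv_integrable[OF \<kappa>(1) fi])
        have "G j k x - G j k x' = (LBINT y. (\<kappa> j (x - y) - \<kappa> j (x' - y)) * f k y)"
          unfolding G_def conv_def using i[of j x k] i[of j x' k] by (simp add: left_diff_distrib)
        also have "\<bar>\<dots>\<bar> \<le> (LBINT y. \<bar>(\<kappa> j (x - y) - \<kappa> j (x' - y)) * f k y\<bar>)" by (rule integral_abs_bound)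
        also have "\<dots> \<le> (LBINT y. e / (3 * (L + 1)) * \<bar>f k y\<bar>)"
        proof (rule integral_mono)
          show "integrable lborel (\<lambda>y. \<bar>(\<kappa> j (x - y) - \<kappa> j (x' - y)) * f k y\<bar>)"
            using i[of j x k] i[of j x' k] by (intro integrable_abs) (simp add: left_diff_distrib)
          show "integrable lborel (\<lambda>y. e / (3 * (L + 1)) * \<bar>f k y\<bar>)" using fi by simp
          fix y
          have "dist (x - y) (x' - y) < d" using x' by (simp add: dist_norm)
          from d(2)[OF this] show "\<bar>(\<kappa> j (x - y) - \<kappa> j (x' - y)) * f k y\<bar> \<le> e / (3 * (L + 1)) * \<bar>f k y\<bar>"
            unfolding abs_mult by (intro mult_right_mono) (auto simp: dist_real_def)
        qed
        also have "\<dots> = e / (3 * (L + 1)) * (LBINT y. \<bar>f k y\<bar>)" by simp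
        also have "\<dots> \<le> e / (3 * (L + 1)) * L" using fL e L by (intro mult_left_mono) auto
        also have "\<dots> \<le> e / 3" using e L by (simp add: field_simps)
        finally show ?thesis .
      qed
      have "Cauchy (\<lambda>n. G j (r n) x')" using convD[OF x'(1)] by (rule convergent_Cauchy)
      then obtain N where N: "\<And>a b. N \<le> a ==> N \<le> b ==> dist (G j (r a) x') (G j (r b) x') < e / 3"
        using e metric_CauchyD[of "\<lambda>n. G j (r n) x'" "e / 3"] by auto
      show "\<exists>N. \<forall>a\<ge>N. \<forall>b\<ge>N. dist (G j (r a) x) (G j (r b) x) < e"
      proof (intro exI[of _ N] allI impI)
        fix a b assume "N \<le> a" "N \<le> b"
        then show "dist (G j (r a) x) (G j (r b) x) < e"
          using N[of a b] near[of "r a"] near[of "r b"] unfolding dist_real_def by linarith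
      qed
    qed
    then show ?thesis by (rule Cauchy_convergent)
  qed
  define Gl where "Gl j x = lim (\<lambda>n. G j (r n) x)" for j x
  have lim: "(\<lambda>n. G j (r n) x) \<longlonglongrightarrow> Gl j x" for j x using conv by (simp add: Gl_def convergent_LIMSEQ_iff)
  have Gm [measurable]: "G j k \<in> borel_measurable borel" for j k
    unfolding G_def using conv_smooth[OF \<kappa>(1) fi]
    by (auto intro!: borel_measurable_continuous_onI smooth_on_UNIV_deriv(3))
  have Glm [measurable]: "Gl j \<in> borel_measurable borel" for j
    by (rule borel_measurable_LIMSEQ_real[OF lim Gm])
  have Glb: "\<bar>Gl j x\<bar> \<le> M j * L" for j x
    by (rule LIMSEQ_le_const2[OF tendsto_rabs[OF lim]]) (use Gb in auto)
  obtain R where R: "\<Omega> \<subseteq> ball 0 R" using bounded_Omega bounded_subset_ballD by blast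
  have Gout: "G j k x = 0" if x: "x \<notin> ball 0 (R + 1)" for j k x
  proof -
    have z: "\<kappa> j (x - y) * f k y = 0" for y
    proof (cases "y \<in> \<Omega>")
      case True
      then have "norm y < R" using R by auto
      then have "1 < norm (x - y)" using x norm_triangle_sub[of x y] by simp
      moreover have "1 * norm (x - y) \<le> real (Suc j) * norm (x - y)" by (intro mult_right_mono) auto
      ultimately have "1 < real (Suc j) * norm (x - y)" by linarith
      then have "real (Suc j) *\<^sub>R (x - y) \<notin> ball 0 1" by (simp add: dist_norm)
      then show ?thesis using \<kappa>(3)[of j "x - y"] by auto
    qed (use V_outside[OF f(1)] in simp)
    show ?thesis unfolding G_def conv_def z by simp
  qed
  have Glout: "Gl j x = 0" if "x \<notin> ball 0 (R + 1)" for j x using Gout[OF that] by (simp add: Gl_def)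
  have bi: "integrable lborel (indicator (ball 0 (R + 1)) :: 'a => real)"
    using emeasure_lborel_ball_finite[of "0::'a" "R + 1"] by (intro integrable_real_indicator) auto
  have sqb: "(G j k x - Gl j x)\<^sup>2 \<le> (2 * (M j * L))\<^sup>2 * indicator (ball 0 (R + 1)) x" for j k x
  proof (cases "x \<in> ball 0 (R + 1)")
    case True
    have "\<bar>G j k x - Gl j x\<bar> \<le> 2 * (M j * L)" using Gb[of j k x] Glb[of j x] by linarith
    then have "(G j k x - Gl j x)\<^sup>2 \<le> (2 * (M j * L))\<^sup>2" using power_mono[of "\<bar>G j k x - Gl j x\<bar>" "2 * (M j * L)" 2] by simp
    then show ?thesis using True by simp
  qed (simp add: Gout Glout)
  have sqi: "integrable lborel (\<lambda>x. (G j k x - Gl j x)\<^sup>2)" for j k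
  proof (rule Bochner_Integration.integrable_bound)
    show "integrable lborel (\<lambda>x. (2 * (M j * L))\<^sup>2 * indicator (ball (0::'a) (R + 1)) x)" using bi by simp
    show "AE x in lborel. norm ((G j k x - Gl j x)\<^sup>2) \<le> norm ((2 * (M j * L))\<^sup>2 * indicator (ball (0::'a) (R + 1)) x :: real)"
      using sqb by (intro AE_I2 norm_mono_real) auto
  qed simp
  have Gconv: "(\<lambda>n. LBINT x. (G j (r n) x - Gl j x)\<^sup>2) \<longlonglongrightarrow> 0" for j
  proof -
    have "(\<lambda>n. LBINT x. (G j (r n) x - Gl j x)\<^sup>2) \<longlonglongrightarrow> (\<integral>x. 0 \<partial>(lborel :: 'a measure))"
    proof (rule integral_dominated_convergence[where w="\<lambda>x. (2 * (M j * L))\<^sup>2 * indicator (ball (0::'a) (R + 1)) x"])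
      have "(\<lambda>n. (G j (r n) x - Gl j x)\<^sup>2) \<longlonglongrightarrow> (Gl j x - Gl j x)\<^sup>2" for x
        by (intro tendsto_intros lim)
      then show "AE x in lborel. (\<lambda>n. (G j (r n) x - Gl j x)\<^sup>2) \<longlonglongrightarrow> 0" by simp
      show "AE x in lborel. norm ((G j (r n) x - Gl j x)\<^sup>2) \<le> (2 * (M j * L))\<^sup>2 * indicator (ball 0 (R + 1)) x" for n
        using sqb[of j "r n"] by simp
    qed (use bi in auto)
    then show ?thesis by simp
  qed
  show ?thesis
  proof (rule that[OF r(1)])
    fix e :: real assume e: "0 < e"
    have "(\<lambda>j. C * real (Suc j) powr (- (2 * \<sigma>)) * B\<^sup>2) \<longlonglongrightarrow> C * 0 * B\<^sup>2"
      using s0 by (intro tendsto_mult tendsto_const powr_minus_Suc_tendsto_0) auto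
    \<comment> \<open>Splitting a square into four costs a factor 4, and there are four terms, hence
      sixteenths.\<close>
    then have "\<forall>\<^sub>F j in sequentially. C * real (Suc j) powr (- (2 * \<sigma>)) * B\<^sup>2 < e / 16"
      by (intro order_tendstoD(2)) (use e in auto)
    then obtain j where j: "C * real (Suc j) powr (- (2 * \<sigma>)) * B\<^sup>2 < e / 16" by (auto simp: eventually_sequentially)
    have c1: "(LBINT x. (G j k x - f k x)\<^sup>2) < e / 16" and c1i: "integrable lborel (\<lambda>x. (G j k x - f k x)\<^sup>2)" for k
    proof -
      have "(LBINT x. (G j k x - f k x)\<^sup>2) \<le> C * real (Suc j) powr (- 2 * \<sigma>) * E (f k) (f k)"
        unfolding G_def by (rule \<kappa>(8)[OF f(1)])
      also have "\<dots> \<le> C * real (Suc j) powr (- 2 * \<sigma>) * B\<^sup>2"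
        unfolding nrm_sq[symmetric] using f(2) \<kappa>(6) by (intro mult_left_mono power_mono) auto
      finally show "(LBINT x. (G j k x - f k x)\<^sup>2) < e / 16" using j by simp
      show "integrable lborel (\<lambda>x. (G j k x - f k x)\<^sup>2)" unfolding G_def by (rule \<kappa>(7)[OF f(1)])
    qed
    have "\<forall>\<^sub>F n in sequentially. (LBINT x. (G j (r n) x - Gl j x)\<^sup>2) < e / 16"
      by (rule order_tendstoD(2)[OF Gconv]) (use e in simp)
    then obtain N where N: "\<And>n. N \<le> n ==> (LBINT x. (G j (r n) x - Gl j x)\<^sup>2) < e / 16" by (auto simp: eventually_sequentially)
    show "\<exists>N. \<forall>a\<ge>N. \<forall>b\<ge>N. (LBINT x. (f (r a) x - f (r b) x)\<^sup>2) < e"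
    proof (intro exI[of _ N] allI impI)
      fix a b assume ab: "N \<le> a" "N \<le> b"
      have pt: "(f (r a) x - f (r b) x)\<^sup>2 \<le> 4 * ((G j (r a) x - f (r a) x)\<^sup>2 + (G j (r a) x - Gl j x)\<^sup>2 + (G j (r b) x - Gl j x)\<^sup>2 + (G j (r b) x - f (r b) x)\<^sup>2)" for x
      proof -
        have four: "(p + q + s + t)\<^sup>2 \<le> 4 * (p\<^sup>2 + q\<^sup>2 + s\<^sup>2 + t\<^sup>2)" for p q s t :: real
          using sum_squares_bound[of p q] sum_squares_bound[of p s] sum_squares_bound[of p t]
            sum_squares_bound[of q s] sum_squares_bound[of q t] sum_squares_bound[of s t]
          by (simp add: power2_eq_square algebra_simps)
        show ?thesis
          using four[of "- (G j (r a) x - f (r a) x)" "G j (r a) x - Gl j x" "- (G j (r b) x - Gl j x)" "G j (r b) x - f (r b) x"]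
          by (simp only: power2_minus) (simp add: algebra_simps)
      qed
      have "(LBINT x. (f (r a) x - f (r b) x)\<^sup>2) \<le> (LBINT x. 4 * ((G j (r a) x - f (r a) x)\<^sup>2 + (G j (r a) x - Gl j x)\<^sup>2 + (G j (r b) x - Gl j x)\<^sup>2 + (G j (r b) x - f (r b) x)\<^sup>2))"
        by (rule integral_mono[OF V_square_integrable[OF V_diff[OF f(1) f(1)]] _ pt]) (use c1i sqi in auto)
      also have "\<dots> = 4 * ((LBINT x. (G j (r a) x - f (r a) x)\<^sup>2) + (LBINT x. (G j (r a) x - Gl j x)\<^sup>2) + (LBINT x. (G j (r b) x - Gl j x)\<^sup>2) + (LBINT x. (G j (r b) x - f (r b) x)\<^sup>2))"
        using c1i sqi by simp
      also have "\<dots> < e" using c1[of "r a"] c1[of "r b"] N[OF ab(1)] N[OF ab(2)] by simp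
      finally show "(LBINT x. (f (r a) x - f (r b) x)\<^sup>2) < e" .
    qed
  qed
qed

end

context frac
begin

section \<open>Strong minimum principle\<close>

lemma V_AE_cong:
  assumes f: "f \<in> V" and h: "h \<in> borel_measurable lborel" "\<And>x. x \<notin> \<Omega> ==> h x = 0" and eq: "AE x in lborel. h x = f x"
  shows "h \<in> V" "\<psi> \<in> V ==> E h \<psi> = E f \<psi>" "nrm h = nrm f"
proof -
  note [measurable] = h(1) V_measurable[OF f]
  have d: "AE z in PP. dq h z = dq f z"
    using AE_lborel_pair[OF eq] by eventually_elim (simp add: dq_def case_prod_beta)
  have Eh: "E h \<psi> = E f \<psi>" if "\<psi> \<in> borel_measurable lborel" for \<psi>
  proof -
    note [measurable] = that
    have "(\<integral>z. dq h z * dq \<psi> z \<partial>PP) = (\<integral>z. dq f z * dq \<psi> z \<partial>PP)"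
      using d by (intro integral_cong_AE) (auto elim!: eventually_mono)
    then show ?thesis by (simp add: E_eq)
  qed
  have "Lp qs h" by (rule Lp_bound(1)[OF V_Lp_qs[OF f] h(1)]) (use eq qs_gt_2 in \<open>auto elim!: eventually_mono\<close>)
  moreover have "integrable PP (\<lambda>z. (dq h z)\<^sup>2)"
    by (rule Bochner_Integration.integrable_bound[OF V_dq[OF f]]) (use d in \<open>auto elim!: eventually_mono\<close>)
  ultimately show "h \<in> V" using h by (simp add: V_iff)
  show "\<psi> \<in> V ==> E h \<psi> = E f \<psi>" by (rule Eh[OF V_measurable])
  show "nrm h = nrm f"
    using Eh[OF h(1)] Eh[OF V_measurable[OF f]] by (simp add: nrm_def E_sym[of f h])
qed

lemma lborel_integral_reflect:
  fixes g :: "'a => real"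
  assumes [measurable]: "g \<in> borel_measurable borel"
  shows "(LBINT y. g (c - y)) = (LBINT y. g y)" "integrable lborel (\<lambda>y. g (c - y)) \<longleftrightarrow> integrable lborel g"
proof -
  have d: "(lborel :: 'a measure) = distr lborel borel (\<lambda>y. c - y)"
    using lborel_affine[of "-1" c] by (simp add: density_1)
  show "(LBINT y. g (c - y)) = (LBINT y. g y)"
    by (subst (2) d) (simp add: integral_distr)
  show "integrable lborel (\<lambda>y. g (c - y)) \<longleftrightarrow> integrable lborel g"
    by (subst (2) d) (simp add: integrable_distr_eq)
qed

text \<open>The positive part of the paraboloid
  \<open>r\<^sup>2 - (norm (x - x0))\<^sup>2\<close>.\<close>

definition cap :: "'a => real => 'a => real" where
  "cap x0 r x = r\<^sup>2 - (min r (norm (x - x0)))\<^sup>2"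

text \<open>The crucial bound is the last, on second differences: inside the ball it is the
  parallelogram identity, and outside the ball the central value is 0 while the other two values are
  nonnegative.\<close>

lemma cap_bounds:
  assumes "0 < r" "r \<le> 1"
  shows "0 \<le> cap x0 r x" "cap x0 r x \<le> 1" "\<bar>cap x0 r x - cap x0 r y\<bar> \<le> 2 * r * norm (x - y)"
    and "x \<in> ball x0 r ==> 0 < cap x0 r x" "x \<notin> ball x0 r ==> cap x0 r x = 0"
    and "2 * cap x0 r x - cap x0 r y - cap x0 r (2 *\<^sub>R x - y) \<le> 2 * min 1 ((norm (x - y))\<^sup>2)"
proof -
  define g where "g z = min r (norm (z - x0))" for z
  have g: "0 \<le> g z" "g z \<le> r" for z using assms by (auto simp: g_def)
  have c: "cap x0 r z = r\<^sup>2 - (g z)\<^sup>2" for z by (simp add: cap_def g_def)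
  have nonneg: "0 \<le> cap x0 r z" for z unfolding c using power_mono[OF g(2) g(1), of z 2] by simp
  have le1: "cap x0 r z \<le> 1" for z
  proof -
    have "r\<^sup>2 \<le> 1" using assms by (intro power_le_one) auto
    then show ?thesis unfolding c using zero_le_power2[of "g z"] by linarith
  qed
  show "0 \<le> cap x0 r x" "cap x0 r x \<le> 1" using nonneg le1 by auto
  have "\<bar>cap x0 r x - cap x0 r y\<bar> = \<bar>(g y - g x) * (g y + g x)\<bar>" unfolding c by (simp add: power2_eq_square algebra_simps)
  also have "\<dots> = \<bar>g y - g x\<bar> * (g y + g x)" using g[of x] g[of y] by (simp add: abs_mult)
  also have "\<dots> \<le> norm (x - y) * (2 * r)"
  proof (intro mult_mono)
    have "\<bar>g y - g x\<bar> \<le> \<bar>norm (y - x0) - norm (x - x0)\<bar>" unfolding g_def by linarith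
    also have "\<dots> \<le> norm (x - y)" using norm_triangle_ineq3[of "y - x0" "x - x0"] by (simp add: norm_minus_commute)
    finally show "\<bar>g y - g x\<bar> \<le> norm (x - y)" .
  qed (use g[of x] g[of y] in auto)
  finally show "\<bar>cap x0 r x - cap x0 r y\<bar> \<le> 2 * r * norm (x - y)" by (simp add: mult_ac)
  show "0 < cap x0 r x" if "x \<in> ball x0 r"
  proof -
    have "norm (x - x0) < r" using that by (simp add: dist_norm norm_minus_commute)
    then have "(norm (x - x0))\<^sup>2 < r\<^sup>2" by (intro power_strict_mono) auto
    then show ?thesis using \<open>norm (x - x0) < r\<close> by (simp add: cap_def)
  qed
  show "cap x0 r x = 0" if "x \<notin> ball x0 r"
    using that by (simp add: cap_def dist_norm norm_minus_commute min_absorb1)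
  have low: "r\<^sup>2 - (norm (z - x0))\<^sup>2 \<le> cap x0 r z" for z
  proof -
    have "(g z)\<^sup>2 \<le> (norm (z - x0))\<^sup>2" using g(1) by (intro power_mono) (auto simp: g_def)
    then show ?thesis unfolding c by simp
  qed
  have "2 * cap x0 r x - cap x0 r y - cap x0 r (2 *\<^sub>R x - y) \<le> 2 * (norm (x - y))\<^sup>2"
  proof (cases "norm (x - x0) < r")
    case True
    have "(norm (y - x0))\<^sup>2 + (norm (2 *\<^sub>R x - y - x0))\<^sup>2 = 2 * (norm (x - x0))\<^sup>2 + 2 * (norm (x - y))\<^sup>2"
      unfolding power2_norm_eq_inner by (simp add: inner_diff_left inner_diff_right inner_commute algebra_simps)
    moreover have "cap x0 r x = r\<^sup>2 - (norm (x - x0))\<^sup>2" using True by (simp add: cap_def)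
    ultimately show ?thesis using low[of y] low[of "2 *\<^sub>R x - y"] by linarith
  next
    case False
    then have "cap x0 r x = 0" by (simp add: cap_def min_absorb1)
    then show ?thesis using nonneg[of y] nonneg[of "2 *\<^sub>R x - y"] zero_le_power2[of "norm (x - y)"] by linarith
  qed
  moreover have "2 * cap x0 r x - cap x0 r y - cap x0 r (2 *\<^sub>R x - y) \<le> 2"
    using le1[of x] nonneg[of y] nonneg[of "2 *\<^sub>R x - y"] by linarith
  ultimately show "2 * cap x0 r x - cap x0 r y - cap x0 r (2 *\<^sub>R x - y) \<le> 2 * min 1 ((norm (x - y))\<^sup>2)"
    by (simp add: min_def)
qed

lemma cap_V:
  assumes r: "0 < r" "r \<le> 1" "ball x0 r \<subseteq> \<Omega>"
  shows "cap x0 r \<in> V"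
proof (rule V_Lipschitz[where L="2 * r"])
  show "cap x0 r \<in> borel_measurable borel" unfolding cap_def[abs_def] by measurable
  show "x \<notin> \<Omega> ==> cap x0 r x = 0" for x using cap_bounds(5)[OF r(1,2)] r(3) by blast
qed (use cap_bounds[OF r(1,2)] in auto)

text \<open>Semiconcavity of the paraboloid from below bounds its fractional Laplacian from above,
  tested against nonnegative functions.\<close>

lemma cap_energy_le:
  assumes r: "0 < r" "r \<le> 1" "ball x0 r \<subseteq> \<Omega>" and \<psi>: "\<psi> \<in> V" "\<And>x. 0 \<le> \<psi> x"
  shows "E (cap x0 r) \<psi> \<le> cn * ker_mass * (LBINT x. \<psi> x)"
proof -
  define \<beta> where "\<beta> = cap x0 r"
  have \<beta>V: "\<beta> \<in> V" unfolding \<beta>_def by (rule cap_V[OF r])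
  have \<beta>m [measurable]: "\<beta> \<in> borel_measurable borel" using V_measurable[OF \<beta>V] by simp
  have \<psi>m [measurable]: "\<psi> \<in> borel_measurable borel" using V_measurable[OF \<psi>(1)] by simp
  have \<beta>1: "\<bar>\<beta> x - \<beta> y\<bar> \<le> 1" for x y
    using cap_bounds(1,2)[OF r(1,2), of x0 x] cap_bounds(1,2)[OF r(1,2), of x0 y] by (simp add: \<beta>_def abs_le_iff)
  \<comment> \<open>Cutting out the diagonal makes the two halves of the product separately
    integrable; they have equal integrals after swapping the variables, whence the factor 2 in
    \<open>fd\<close>.\<close>
  define far where "far i z = (if 1 / real (Suc i) \<le> norm (fst z - snd z) then 1 else 0 :: real)" for i and z :: "'a \<times> 'a"
  have [measurable]: "far i \<in> borel_measurable PP" for i unfolding far_def by measurable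
  define Q where "Q i z = far i z * ((\<beta> (fst z) - \<beta> (snd z)) * \<psi> (fst z) / norm (fst z - snd z) powr \<nu>)" for i and z :: "'a \<times> 'a"
  have Qm [measurable]: "Q i \<in> borel_measurable PP" for i unfolding Q_def by measurable
  define g where "g x = sqrt (\<psi> x)" for x
  have gm: "g \<in> borel_measurable lborel" unfolding g_def by simp
  have g2: "(g x)\<^sup>2 = \<psi> x" for x using \<psi>(2)[of x] by (simp add: g_def)
  have gi: "integrable lborel (\<lambda>x. (g x)\<^sup>2)" unfolding g2 by (rule V_integrable[OF \<psi>(1)])
  have wi: "integrable PP (\<lambda>z. \<psi> (fst z) * wk z)" using weighted_square(1)[OF gm gi] by (simp add: g2)
  have Qi: "integrable PP (Q i)" for i
  proof (rule Bochner_Integration.integrable_bound)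
    show "integrable PP (\<lambda>z. (real (Suc i))\<^sup>2 * (\<psi> (fst z) * wk z))" using wi by simp
    have "\<bar>Q i z\<bar> \<le> (real (Suc i))\<^sup>2 * (\<psi> (fst z) * wk z)" for z
    proof (cases "1 / real (Suc i) \<le> norm (fst z - snd z)")
      case True
      define d where "d = norm (fst z - snd z)"
      have "1 \<le> real (Suc i) * d" using True by (simp add: d_def field_simps)
      then have "1 \<le> (real (Suc i))\<^sup>2 * d\<^sup>2" unfolding power_mult_distrib[symmetric] by (rule one_le_power)
      then have mm: "1 \<le> (real (Suc i))\<^sup>2 * min 1 (d\<^sup>2)" by (simp add: min_def one_le_power)
      have "\<bar>(\<beta> (fst z) - \<beta> (snd z)) * \<psi> (fst z)\<bar> \<le> 1 * \<psi> (fst z)"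
        unfolding abs_mult using \<beta>1 \<psi>(2) by (intro mult_mono) auto
      also have "\<dots> \<le> ((real (Suc i))\<^sup>2 * min 1 (d\<^sup>2)) * \<psi> (fst z)" using mm \<psi>(2) by (intro mult_right_mono)
      finally have "\<bar>(\<beta> (fst z) - \<beta> (snd z)) * \<psi> (fst z)\<bar> / d powr \<nu> \<le> ((real (Suc i))\<^sup>2 * min 1 (d\<^sup>2)) * \<psi> (fst z) / d powr \<nu>"
        by (intro divide_right_mono) auto
      then show ?thesis using True by (simp add: Q_def far_def wk_def d_def abs_mult mult_ac)
    next
      case False
      then show ?thesis using \<psi>(2)[of "fst z"] wk_nonneg[of z] by (simp add: Q_def far_def)
    qed
    then show "AE z in PP. norm (Q i z) \<le> norm ((real (Suc i))\<^sup>2 * (\<psi> (fst z) * wk z))"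
      by (intro AE_I2) (metis abs_ge_self order_trans real_norm_def)
  qed simp
  have Qle: "(\<integral>z. Q i z \<partial>PP) \<le> ker_mass * (LBINT x. \<psi> x)" for i
  proof -
    have "(\<integral>z. Q i z \<partial>PP) = (LBINT x. LBINT y. Q i (x, y))"
      using lborel_pair.integral_fst'[OF Qi[of i]] by simp
    also have "\<dots> \<le> (LBINT x. ker_mass * \<psi> x)"
    proof (rule integral_mono_AE)
      show "integrable lborel (\<lambda>x. LBINT y. Q i (x, y))" by (rule lborel_pair.integrable_fst'[OF Qi])
      show "integrable lborel (\<lambda>x. ker_mass * \<psi> x)" using V_integrable[OF \<psi>(1)] by simp
      show "AE x in lborel. (LBINT y. Q i (x, y)) \<le> ker_mass * \<psi> x"
        using lborel_pair.AE_integrable_fst'[OF Qi[of i]]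
      proof eventually_elim
        case (elim x)
        have qm: "(\<lambda>y. Q i (x, y)) \<in> borel_measurable borel" using elim by simp
        have e2: "(2::real) *\<^sub>R x - y = x + x - y" for y by (simp add: scaleR_2)
        note rf = lborel_integral_reflect[OF qm, of "2 *\<^sub>R x"]
        have wki: "integrable lborel (\<lambda>y. wk (x, y))" "(LBINT y. wk (x, y)) = ker_mass"
        proof -
          have wm: "(\<lambda>y. wk (x, y)) \<in> borel_measurable lborel" by measurable
          have "(\<integral>\<^sup>+y. ennreal (wk (x, y)) \<partial>lborel) = ennreal ker_mass" using ker_mass(2)[of x] by (simp add: wk_def)
          then show "integrable lborel (\<lambda>y. wk (x, y))" "(LBINT y. wk (x, y)) = ker_mass"
            using nn_integral_eq_integrable[OF wm, of ker_mass] wk_nonneg ker_mass_nonneg by auto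
        qed
        \<comment> \<open>Averaging over the reflection of \<open>y\<close> in \<open>x\<close>
          turns the first difference of \<open>\<beta>\<close> into the second difference bounded in
          \<open>cap_bounds\<close>.\<close>
        have "2 * (LBINT y. Q i (x, y)) = (LBINT y. Q i (x, y) + Q i (x, 2 *\<^sub>R x - y))"
          using elim rf by simp
        also have "\<dots> \<le> (LBINT y. 2 * \<psi> x * wk (x, y))"
        proof (rule integral_mono)
          show "integrable lborel (\<lambda>y. Q i (x, y) + Q i (x, 2 *\<^sub>R x - y))" using elim rf(2) by simp
          show "integrable lborel (\<lambda>y. 2 * \<psi> x * wk (x, y))" using wki by simp
          fix y
          define d where "d = norm (x - y)"
          have nd: "norm (x - (2 *\<^sub>R x - y)) = d" unfolding e2 d_def by (metis add_diff_cancel_left' diff_diff_eq2 minus_diff_eq norm_minus_cancel add.commute diff_diff_add)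
          define fa where "fa = far i (x, y)"
          have fa: "0 \<le> fa" "fa \<le> 1" "far i (x, 2 *\<^sub>R x - y) = fa" using nd by (auto simp: fa_def far_def d_def)
          have "Q i (x, y) + Q i (x, 2 *\<^sub>R x - y) = fa * ((2 * \<beta> x - \<beta> y - \<beta> (2 *\<^sub>R x - y)) * \<psi> x / d powr \<nu>)"
            unfolding Q_def fst_conv snd_conv nd fa(3) fa_def[symmetric] d_def[symmetric] by (simp add: field_simps add_divide_distrib diff_divide_distrib)
          also have "\<dots> \<le> fa * ((2 * min 1 (d\<^sup>2)) * \<psi> x / d powr \<nu>)"
            using cap_bounds(6)[OF r(1,2), of x0 x y] fa \<psi>(2)[of x] unfolding \<beta>_def d_def
            by (intro mult_left_mono divide_right_mono mult_right_mono) auto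
          also have "\<dots> \<le> 1 * ((2 * min 1 (d\<^sup>2)) * \<psi> x / d powr \<nu>)"
            using fa \<psi>(2)[of x] by (intro mult_right_mono) auto
          finally show "Q i (x, y) + Q i (x, 2 *\<^sub>R x - y) \<le> 2 * \<psi> x * wk (x, y)"
            by (simp add: wk_def d_def mult_ac)
        qed
        also have "\<dots> = 2 * (ker_mass * \<psi> x)" using wki by simp
        finally show ?case by simp
      qed
    qed
    also have "\<dots> = ker_mass * (LBINT x. \<psi> x)" by simp
    finally show ?thesis .
  qed
  have fd: "(\<integral>z. far i z * (dq \<beta> z * dq \<psi> z) \<partial>PP) \<le> 2 * (ker_mass * (LBINT x. \<psi> x))" for i
  proof -
    have sw: "integrable PP (\<lambda>z. Q i (snd z, fst z))" "(\<integral>z. Q i (snd z, fst z) \<partial>PP) = (\<integral>z. Q i z \<partial>PP)"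
      using lborel_pair.integrable_product_swap[OF Qi[of i]] lborel_pair.integral_product_swap[of "Q i"] Qm by (simp_all add: case_prod_unfold)
    have "far i z * (dq \<beta> z * dq \<psi> z) = Q i z + Q i (snd z, fst z)" for z
    proof -
      obtain x y where z: "z = (x, y)" by (cases z)
      show ?thesis unfolding z dq_mult Q_def far_def fst_conv snd_conv
        by (simp add: norm_minus_commute[of y x] left_diff_distrib right_diff_distrib diff_divide_distrib add_divide_distrib)
    qed
    then have "(\<integral>z. far i z * (dq \<beta> z * dq \<psi> z) \<partial>PP) = (\<integral>z. Q i z \<partial>PP) + (\<integral>z. Q i (snd z, fst z) \<partial>PP)"
      using Qi sw by simp
    then show ?thesis using sw Qle[of i] by simp
  qed
  have "(\<lambda>i. \<integral>z. far i z * (dq \<beta> z * dq \<psi> z) \<partial>PP) \<longlonglongrightarrow> (\<integral>z. dq \<beta> z * dq \<psi> z \<partial>PP)"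
  proof (rule integral_dominated_convergence[where w="\<lambda>z. \<bar>dq \<beta> z * dq \<psi> z\<bar>"])
    show "AE z in PP. (\<lambda>i. far i z * (dq \<beta> z * dq \<psi> z)) \<longlonglongrightarrow> dq \<beta> z * dq \<psi> z"
    proof (rule AE_I2)
      fix z :: "'a \<times> 'a"
      show "(\<lambda>i. far i z * (dq \<beta> z * dq \<psi> z)) \<longlonglongrightarrow> dq \<beta> z * dq \<psi> z"
      proof (cases "fst z = snd z")
        case True
        then have "dq \<beta> z = 0" by (cases z) (simp add: dq_def)
        then show ?thesis by simp
      next
        case False
        then have "0 < norm (fst z - snd z)" by simp
        moreover have "(\<lambda>i. 1 / real (Suc i)) \<longlonglongrightarrow> 0" by (rule LIMSEQ_Suc[OF lim_1_over_n])
        ultimately have "\<forall>\<^sub>F i in sequentially. 1 / real (Suc i) < norm (fst z - snd z)" by (rule order_tendstoD(2)[rotated])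
        then have "\<forall>\<^sub>F i in sequentially. far i z * (dq \<beta> z * dq \<psi> z) = dq \<beta> z * dq \<psi> z" by eventually_elim (simp add: far_def)
        then show ?thesis by (rule tendsto_eventually)
      qed
    qed
    show "AE z in PP. norm (far i z * (dq \<beta> z * dq \<psi> z)) \<le> \<bar>dq \<beta> z * dq \<psi> z\<bar>" for i
      by (intro AE_I2) (simp add: far_def)
  qed (use V_mult[OF \<beta>V \<psi>(1)] in auto)
  then have "(\<integral>z. dq \<beta> z * dq \<psi> z \<partial>PP) \<le> 2 * (ker_mass * (LBINT x. \<psi> x))"
    by (rule LIMSEQ_le_const2) (use fd in auto)
  then have "cn / 2 * (\<integral>z. dq \<beta> z * dq \<psi> z \<partial>PP) \<le> cn / 2 * (2 * (ker_mass * (LBINT x. \<psi> x)))"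
    using cn_pos by (intro mult_left_mono) auto
  then show ?thesis unfolding E_eq \<beta>_def[symmetric] by simp
qed

lemma pair_product_integral:
  fixes f g :: "'a => real"
  assumes f: "integrable lborel f" "\<And>x. 0 \<le> f x" and g: "integrable lborel g" "\<And>x. 0 \<le> g x"
  shows "integrable PP (\<lambda>z. f (fst z) * g (snd z))" "(\<integral>z. f (fst z) * g (snd z) \<partial>PP) = (LBINT x. f x) * (LBINT x. g x)"
proof -
  have [measurable]: "f \<in> borel_measurable borel" "g \<in> borel_measurable borel" using f g by auto
  have "(\<integral>\<^sup>+z. ennreal (f (fst z) * g (snd z)) \<partial>PP) = (\<integral>\<^sup>+x. \<integral>\<^sup>+y. ennreal (f x) * ennreal (g y) \<partial>lborel \<partial>lborel)"
    using f g by (subst lborel.nn_integral_fst[symmetric]) (auto simp: ennreal_mult)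
  also have "\<dots> = (\<integral>\<^sup>+x. ennreal (f x) * ennreal (LBINT y. g y) \<partial>lborel)"
    using g by (intro nn_integral_cong) (subst nn_integral_cmult, simp_all add: nn_integral_eq_integral)
  also have "\<dots> = (\<integral>\<^sup>+x. ennreal (f x) \<partial>lborel) * ennreal (LBINT y. g y)"
    by (rule nn_integral_multc) measurable
  also have "\<dots> = ennreal ((LBINT x. f x) * (LBINT x. g x))"
    using f g by (simp add: nn_integral_eq_integral ennreal_mult)
  finally have "(\<integral>\<^sup>+z. ennreal (f (fst z) * g (snd z)) \<partial>PP) = ennreal ((LBINT x. f x) * (LBINT x. g x))" .
  then show "integrable PP (\<lambda>z. f (fst z) * g (snd z))" "(\<integral>z. f (fst z) * g (snd z) \<partial>PP) = (LBINT x. f x) * (LBINT x. g x)"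
    using nn_integral_eq_integrable[of "\<lambda>z. f (fst z) * g (snd z)" PP "(LBINT x. f x) * (LBINT x. g x)"] f g by auto
qed

text \<open>The mass of the supersolution away from a ball pushes it up inside that ball: in
  the energy of the truncation against a small paraboloid, the long-range interaction with this
  mass dominates the contribution of the paraboloid.\<close>

lemma positive_in_ball:
  assumes \<phi>: "\<phi> \<in> V" "\<And>x. 0 \<le> \<phi> x" and sup: "\<And>\<psi>. \<psi> \<in> V ==> (\<And>x. 0 \<le> \<psi> x) ==> 0 \<le> E \<phi> \<psi>"
    and r: "0 < r" "r \<le> 1" "ball x0 r \<subseteq> \<Omega>"
    and mass: "0 < (LBINT x. \<phi> x * indicator (- ball x0 r) x)"
  shows "AE x in lborel. x \<in> ball x0 r \<longrightarrow> 0 < \<phi> x"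
proof -
  define c1 where "c1 = (LBINT x. \<phi> x * indicator (- ball x0 r) x)"
  obtain R where R: "0 < R" "\<Omega> \<subseteq> ball 0 R" using bounded_Omega bounded_subset_ballD by blast
  \<comment> \<open>Distances within \<Omega> are at most \<open>2 * R\<close>, so \<open>k0\<close>
    bounds the kernel from below there.\<close>
  define k0 where "k0 = 1 / (2 * R) powr \<nu>"
  have k0: "0 < k0" using R by (simp add: k0_def)
  define c0 where "c0 = cn / 2 * k0 * c1"
  have c0: "0 < c0" using cn_pos k0 mass by (simp add: c0_def c1_def)
  \<comment> \<open>Small enough that the paraboloid costs at most half of the gain
    \<open>c0\<close>; the added 1 keeps the denominator positive.\<close>
  define \<epsilon> where "\<epsilon> = c0 / (2 * (cn * ker_mass + 1))"
  have den: "0 < cn * ker_mass + 1" using cn_pos ker_mass_nonneg by (simp add: add_nonneg_pos)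
  have \<epsilon>: "0 < \<epsilon>" using c0 den by (simp add: \<epsilon>_def)
  define \<beta> where "\<beta> = cap x0 r"
  have \<beta>V: "\<beta> \<in> V" unfolding \<beta>_def by (rule cap_V[OF r])
  \<comment> \<open>Positive exactly where \<open>\<phi>\<close> drops below the scaled paraboloid;
    the aim is to show that this happens on a null set only.\<close>
  define q where "q x = \<epsilon> * \<beta> x - \<phi> x" for x
  have qV: "q \<in> V" unfolding q_def by (intro V_diff V_cmult \<beta>V \<phi>(1))
  define \<psi> where "\<psi> x = max 0 (q x)" for x
  have \<psi>V: "\<psi> \<in> V" unfolding \<psi>_def by (rule V_pos[OF qV])
  have \<psi>0: "0 \<le> \<psi> x" for x by (simp add: \<psi>_def)
  define g where "g x = \<phi> x * indicator (- ball x0 r) x" for x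
  have gi: "integrable lborel g"
    unfolding g_def using integrable_mult_indicator[of "- ball x0 r" lborel \<phi>] V_integrable[OF \<phi>(1)] by (simp add: mult.commute)
  have g0: "0 \<le> g x" for x using \<phi>(2) by (simp add: g_def)
  note pp = pair_product_integral[OF V_integrable[OF \<psi>V] \<psi>0 gi g0]
  have "(\<integral>z. k0 * (\<psi> (fst z) * g (snd z)) \<partial>PP) \<le> (\<integral>z. dq q z * dq \<psi> z \<partial>PP)"
  proof (rule integral_mono[OF _ V_mult[OF qV \<psi>V]])
    show "integrable PP (\<lambda>z. k0 * (\<psi> (fst z) * g (snd z)))" using pp(1) by simp
    fix z :: "'a \<times> 'a"
    obtain x y where z: "z = (x, y)" by (cases z)
    \<comment> \<open>Off the ball the paraboloid vanishes, so the increment of \<open>q\<close>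
      contains all of \<open>\<phi> y\<close>: this is the long-range term.\<close>
    have num: "\<psi> x * g y \<le> (q x - q y) * (\<psi> x - \<psi> y)"
    proof (cases "y \<in> ball x0 r")
      case True
      have "(max 0 a - max 0 b) * (max 0 a - max 0 b) \<le> (a - b) * (max 0 a - max 0 b)" for a b :: real
        using mult_nonneg_nonneg[of "-a" b] mult_nonneg_nonneg[of a "-b"] by (auto simp: max_def algebra_simps)
      from this[of "q x" "q y"] show ?thesis using True zero_le_square[of "\<psi> x - \<psi> y"] order_trans unfolding \<psi>_def g_def by (simp, blast)
    next
      case False
      then have qy: "q y = - \<phi> y" using cap_bounds(5)[OF r(1,2), of y x0] by (simp add: q_def \<beta>_def)
      then have \<psi>y: "\<psi> y = 0" using \<phi>(2)[of y] by (simp add: \<psi>_def)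
      have "\<psi> x * \<phi> y \<le> (q x + \<phi> y) * \<psi> x"
        using zero_le_square[of "q x"] by (cases "0 \<le> q x") (auto simp: \<psi>_def algebra_simps)
      then show ?thesis using False qy \<psi>y by (simp add: g_def)
    qed
    show "k0 * (\<psi> (fst z) * g (snd z)) \<le> dq q z * dq \<psi> z"
    proof (cases "\<psi> x * g y = 0 \<or> x = y")
      case True
      have "0 \<le> (q x - q y) * (\<psi> x - \<psi> y)" using num g0[of y] \<psi>0[of x] by (meson mult_nonneg_nonneg order_trans)
      then have "0 \<le> dq q z * dq \<psi> z" unfolding z dq_mult by simp
      moreover have "\<psi> x * g y = 0"
      proof (cases "x = y")
        case True
        show ?thesis
        proof (cases "y \<in> ball x0 r")
          case True then show ?thesis by (simp add: g_def)
        next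
          case False
          then have "q y = - \<phi> y" using cap_bounds(5)[OF r(1,2), of y x0] by (simp add: q_def \<beta>_def)
          then show ?thesis using \<open>x = y\<close> \<phi>(2)[of y] by (simp add: \<psi>_def)
        qed
      qed (use True in simp)
      ultimately show ?thesis unfolding z fst_conv snd_conv by (simp only: mult_zero_right)
    next
      case False
      then have "\<psi> x \<noteq> 0" "\<phi> y \<noteq> 0" by (auto simp: g_def)
      then have "x \<in> \<Omega>" "y \<in> \<Omega>" using V_outside[OF \<psi>V] V_outside[OF \<phi>(1)] by blast+
      then have "norm x < R" "norm y < R" using R by auto
      then have n: "norm (x - y) \<le> 2 * R" using norm_triangle_ineq4[of x y] by linarith
      have "norm (x - y) powr \<nu> \<le> (2 * R) powr \<nu>" using n nu_pos by (intro powr_mono2) auto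
      moreover have "0 < norm (x - y) powr \<nu>" using False by simp
      ultimately have "k0 \<le> 1 / norm (x - y) powr \<nu>" unfolding k0_def by (intro divide_left_mono mult_pos_pos) (use R in auto)
      then have "k0 * (\<psi> x * g y) \<le> (1 / norm (x - y) powr \<nu>) * (\<psi> x * g y)" using \<psi>0 g0 by (intro mult_right_mono) auto
      also have "\<dots> \<le> (1 / norm (x - y) powr \<nu>) * ((q x - q y) * (\<psi> x - \<psi> y))" using num by (intro mult_left_mono) auto
      finally show ?thesis unfolding z dq_mult fst_conv snd_conv by simp
    qed
  qed
  then have "cn / 2 * (k0 * ((LBINT x. \<psi> x) * c1)) \<le> cn / 2 * (\<integral>z. dq q z * dq \<psi> z \<partial>PP)"
    using pp(2) cn_pos by (intro mult_left_mono) (auto simp: c1_def g_def)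
  then have "c0 * (LBINT x. \<psi> x) \<le> E q \<psi>" unfolding E_eq c0_def by (simp add: mult_ac)
  also have "E q \<psi> = \<epsilon> * E \<beta> \<psi> - E \<phi> \<psi>"
    unfolding q_def using E_diff_left[OF V_cmult[OF \<beta>V] \<phi>(1) \<psi>V] by (simp add: E_cmult_left)
  also have "\<dots> \<le> \<epsilon> * (cn * ker_mass * (LBINT x. \<psi> x))"
    using cap_energy_le[OF r \<psi>V \<psi>0] sup[OF \<psi>V \<psi>0] \<epsilon> mult_left_mono[of "E \<beta> \<psi>" _ \<epsilon>] unfolding \<beta>_def by (smt (verit))
  also have "\<dots> \<le> c0 / 2 * (LBINT x. \<psi> x)"
  proof -
    have "\<epsilon> * (cn * ker_mass) \<le> \<epsilon> * (cn * ker_mass + 1)" using \<epsilon> by simp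
    also have "\<dots> = c0 / 2"
    proof -
      have "c0 / (2 * d) * d = c0 / 2" if "0 < d" for d :: real using that by simp
      from this[OF den] show ?thesis unfolding \<epsilon>_def .
    qed
    finally show ?thesis using \<psi>0 by (simp only: mult.assoc[symmetric]) (intro mult_right_mono integral_nonneg_AE, auto)
  qed
  finally have "c0 * (LBINT x. \<psi> x) \<le> 0" by simp
  then have "(LBINT x. \<psi> x) = 0" using c0 \<psi>0 by (intro antisym integral_nonneg_AE) (auto simp: mult_le_0_iff)
  then have "AE x in lborel. \<psi> x = 0"
    using integral_nonneg_eq_0_iff_AE[OF V_integrable[OF \<psi>V]] \<psi>0 by simp
  then show ?thesis
  proof eventually_elim
    case (elim x)
    show ?case
    proof
      assume "x \<in> ball x0 r"
      then have "0 < \<epsilon> * \<beta> x" using cap_bounds(4)[OF r(1,2)] \<epsilon> by (simp add: \<beta>_def)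
      moreover have "q x \<le> 0" using elim by (simp add: \<psi>_def max_def split: if_splits)
      ultimately show "0 < \<phi> x" by (simp add: q_def)
    qed
  qed
qed

text \<open>A single point carries no mass, so around each point a sufficiently small ball leaves
  mass outside it and \<open>positive_in_ball\<close> applies; countably many of these balls cover
  \<Omega>.\<close>

theorem strong_minimum_principle:
  assumes \<phi>: "\<phi> \<in> V" "\<And>x. 0 \<le> \<phi> x" and sup: "\<And>\<psi>. \<psi> \<in> V ==> (\<And>x. 0 \<le> \<psi> x) ==> 0 \<le> E \<phi> \<psi>"
    and nz: "\<not> (AE x in lborel. \<phi> x = 0)"
  shows "AE x in lborel. x \<in> \<Omega> \<longrightarrow> 0 < \<phi> x"
proof -
  have \<phi>i: "integrable lborel \<phi>" by (rule V_integrable[OF \<phi>(1)])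
  have \<phi>m [measurable]: "\<phi> \<in> borel_measurable borel" using \<phi>i by simp
  have I: "0 < (LBINT x. \<phi> x)"
    using nz integral_nonneg_eq_0_iff_AE[OF \<phi>i] \<phi>(2) integral_nonneg_AE[of \<phi> lborel] by (auto simp: less_le)
  have local: "\<exists>r>0. AE x in lborel. x \<in> ball x0 r \<longrightarrow> 0 < \<phi> x" if x0: "x0 \<in> \<Omega>" for x0
  proof -
    obtain r0 where r0: "0 < r0" "ball x0 r0 \<subseteq> \<Omega>" using open_Omega x0 open_contains_ball by blast
    have "(\<lambda>n. LBINT x. \<phi> x * indicator (- ball x0 (1 / real (Suc n))) x) \<longlonglongrightarrow> (LBINT x. \<phi> x)"
    proof (rule integral_dominated_convergence[where w=\<phi>])
      show "AE x in lborel. (\<lambda>n. \<phi> x * indicator (- ball x0 (1 / real (Suc n))) x) \<longlonglongrightarrow> \<phi> x"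
        using AE_lborel_singleton[of x0]
      proof eventually_elim
        case (elim x)
        then have "0 < dist x0 x" by simp
        moreover have "(\<lambda>i. 1 / real (Suc i)) \<longlonglongrightarrow> 0" by (rule LIMSEQ_Suc[OF lim_1_over_n])
        ultimately have "\<forall>\<^sub>F i in sequentially. 1 / real (Suc i) < dist x0 x" by (rule order_tendstoD(2)[rotated])
        then have "\<forall>\<^sub>F i in sequentially. \<phi> x * indicator (- ball x0 (1 / real (Suc i))) x = \<phi> x"
          by eventually_elim (simp add: indicator_def)
        then show ?case by (rule tendsto_eventually)
      qed
      show "AE x in lborel. norm (\<phi> x * indicator (- ball x0 (1 / real (Suc n))) x) \<le> \<phi> x" for n
        using \<phi>(2) by (intro AE_I2) (auto simp: indicator_def)
      show "(\<lambda>x. \<phi> x * indicator (- ball x0 (1 / real (Suc n))) x) \<in> borel_measurable lborel" for n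
        by (intro borel_measurable_times borel_measurable_indicator) auto
    qed (use \<phi>i in auto)
    then have "\<forall>\<^sub>F n in sequentially. 0 < (LBINT x. \<phi> x * indicator (- ball x0 (1 / real (Suc n))) x)"
      by (rule order_tendstoD(1)[OF _ I])
    moreover have "\<forall>\<^sub>F n in sequentially. 1 / real (Suc n) < r0"
      by (rule order_tendstoD(2)[OF LIMSEQ_Suc[OF lim_1_over_n] r0(1)])
    ultimately have "\<forall>\<^sub>F n in sequentially. 0 < (LBINT x. \<phi> x * indicator (- ball x0 (1 / real (Suc n))) x) \<and> 1 / real (Suc n) < r0"
      by eventually_elim auto
    then obtain n where n: "0 < (LBINT x. \<phi> x * indicator (- ball x0 (1 / real (Suc n))) x)" "1 / real (Suc n) < r0"
      by (auto simp: eventually_sequentially)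
    have "ball x0 (1 / real (Suc n)) \<subseteq> \<Omega>" using r0(2) n(2) by (meson less_imp_le order_trans subset_ball)
    then have "AE x in lborel. x \<in> ball x0 (1 / real (Suc n)) \<longrightarrow> 0 < \<phi> x"
      by (intro positive_in_ball[OF \<phi> sup]) (use n in auto)
    then show ?thesis by (intro exI[of _ "1 / real (Suc n)"]) auto
  qed
  then obtain r where r: "\<And>x0. x0 \<in> \<Omega> ==> 0 < r x0" "\<And>x0. x0 \<in> \<Omega> ==> AE x in lborel. x \<in> ball x0 (r x0) \<longrightarrow> 0 < \<phi> x" by metis
  obtain F where F: "F \<subseteq> (\<lambda>x0. ball x0 (r x0)) ` \<Omega>" "countable F" "\<Union>F = \<Union>((\<lambda>x0. ball x0 (r x0)) ` \<Omega>)"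
    by (rule Lindelof[of "(\<lambda>x0. ball x0 (r x0)) ` \<Omega>"]) auto
  have "AE x in lborel. \<forall>S\<in>F. x \<in> S \<longrightarrow> 0 < \<phi> x"
    using F(1,2) r(2) by (subst AE_ball_countable) auto
  then show ?thesis
  proof eventually_elim
    case (elim x)
    show ?case
    proof
      assume "x \<in> \<Omega>"
      then have "x \<in> \<Union>F" using r(1) unfolding F(3) by force
      then show "0 < \<phi> x" using elim by blast
    qed
  qed
qed

end

context flow_ext
begin

section \<open>The universal upper bound\<close>

text \<open>Scaling with the remaining time: \<open>u\<close> and \<open>X\<close> have exponent
  \<open>al\<close>, and \<open>w\<close> has \<open>m * al\<close>. The first identity matches
  \<open>X' = - w\<close>, the second \<open>u = w powr p\<close>.\<close>

lemma al_eq: "1 + m * al = al" "m * al * p = al"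
proof -
  show "1 + m * al = al" using m1 by (simp add: al_def field_simps)
  have "m * al * p = (p * m) * al" by (simp add: mult_ac)
  then show "m * al * p = al" unfolding conj_exp(5) by simp
qed

text \<open>De Giorgi iteration along increasing times \<open>tt j\<close> and levels \<open>kk j\<close>: the quotient of \<open>X\<close> over
  two consecutive times lies above the later power and carries a right-hand side controlled by the earlier one.\<close>

lemma w_upper:
  obtains \<kappa> where "0 < \<kappa>" "\<And>t. T / 2 \<le> t ==> t < T ==> AE x in lborel. w t x \<le> \<kappa> * (T - t) powr (m * al)"
proof -
  obtain C1 where C1: "0 \<le> C1" "\<And>t. 0 \<le> t ==> t < T ==> nU t \<le> C1 * (T - t) powr al"
    by (rule nU_upper) (rule that)
  define s where "s = p + 1"
  have s: "1 < s" "s < qs" using p1 p_qs by (auto simp: s_def)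
  define C where "C = SQ * 4 * 4 powr p"
  have C: "0 < C" using SQ_pos by (simp add: C_def)
  define b where "b = 2 * 2 powr p"
  have b: "1 \<le> b" using p1 ge_one_powr_ge_zero[of 2 p] by (simp add: b_def)
  define e where "e = s / 2 - s / qs"
  have "s / qs < s / 2" using s qs_gt_2 by (intro divide_strict_left_mono) auto
  then have e: "0 < e" by (simp add: e_def)
  define G where "G = s * (1 - s / qs)"
  have G: "0 < G" using s by (simp add: G_def)
  define Y0 where "Y0 = (C1 * (3 / 2) powr al) powr (1 + m)"
  \<comment> \<open>Collects the smallness condition except for the power of
    \<open>2 / \<kappa>\<close>. Then \<open>\<kappa>\<close> is chosen so that
    \<open>(2 / \<kappa>) powr G * Q = 1\<close>; the added 1 keeps \<open>Q\<close> away from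
    zero.\<close>
  define Q where "Q = C powr (s / 2) * Y0 powr e * (b powr (s / 2) * 2 powr G) powr (1 / e) + 1"
  have Q: "1 \<le> Q" by (simp add: Q_def)
  define \<kappa> where "\<kappa> = 2 * Q powr (1 / G)"
  have \<kappa>: "0 < \<kappa>" using Q by (simp add: \<kappa>_def)
  have \<kappa>G: "(2 / \<kappa>) powr G = 1 / Q" using Q G by (simp add: \<kappa>_def powr_divide powr_powr)
  show ?thesis
  proof (rule that[OF \<kappa>])
    fix t assume t: "T / 2 \<le> t" "t < T"
    \<comment> \<open>The remaining time sets the scale. It is at most \<open>t\<close> because
      \<open>T / 2 \<le> t\<close>, so the earlier times used below stay positive.\<close>
    define h where "h = T - t"
    have h: "0 < h" "h \<le> t" using t by (auto simp: h_def)
    define lam where "lam = h powr (m * al)"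
    have lam: "0 < lam" using h by (simp add: lam_def)
    \<comment> \<open>Here \<open>lam\<close> is the size of \<open>w\<close> predicted for
      remaining time \<open>h\<close>. This homogeneity of the equation removes \<open>t\<close>
      from the constants of the iteration.\<close>
    have lamp: "lam powr p = h * lam"
    proof -
      have "lam powr p = h powr al" unfolding lam_def powr_powr al_eq(2) ..
      also have "\<dots> = h powr (1 + m * al)" unfolding al_eq(1) ..
      also have "\<dots> = h * lam" unfolding powr_add lam_def using h by simp
      finally show ?thesis .
    qed
    \<comment> \<open>The times start at \<open>t - h / 2\<close> and increase to \<open>t\<close>;
      their gaps \<open>hh j\<close> halve in step with the gaps between the levels.\<close>
    define tt where "tt j = t - (h / 2) * (1 / 2) ^ j" for j :: nat
    have tt: "0 < tt j" "tt j \<le> t" "tt j \<le> tt (Suc j)" for j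
    proof -
      have "(h / 2) * (1 / 2) ^ j \<le> (h / 2) * 1" using h by (intro mult_left_mono power_le_one) auto
      then show "0 < tt j" unfolding tt_def using h by linarith
      show "tt j \<le> t" "tt j \<le> tt (Suc j)" using h by (auto simp: tt_def)
    qed
    define hh where "hh j = (h / 4) * (1 / 2) ^ j" for j :: nat
    have hh: "0 < hh j" "tt (Suc j) - tt j = hh j" for j using h by (auto simp: hh_def tt_def algebra_simps)
    define \<omega> where "\<omega> j x = (1 / lam) * w (tt j) x" for j x
    have \<omega>V: "\<omega> j \<in> V" for j unfolding \<omega>_def by (intro V_cmult w_V tt)
    have \<omega>0: "0 \<le> \<omega> j x" for j x using lam by (simp add: \<omega>_def)
    have up: "u x (tt j) = lam powr p * \<omega> j x powr p" for j x
    proof -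
      have "lam powr p * \<omega> j x powr p = (lam * \<omega> j x) powr p" using \<omega>0 lam by (simp add: powr_mult)
      also have "lam * \<omega> j x = u x (tt j) powr m" using lam by (simp add: \<omega>_def)
      also have "\<dots> powr p = u x (tt j)" using u_nonneg conj_exp(5) by (simp add: powr_powr mult.commute)
      finally show ?thesis ..
    qed
    define kk where "kk j = \<kappa> * (1 - (1 / 2) ^ j)" for j :: nat
    have kk: "0 \<le> kk j" "kk j \<le> \<kappa>" for j using \<kappa> by (auto simp: kk_def power_le_one mult_left_le)
    have kkS: "kk (Suc j) = kk j + \<kappa> * (1 / 2) ^ Suc j" for j by (simp add: kk_def algebra_simps)
    define f where "f j x = max 0 (\<omega> j x - kk j)" for j x
    have fV: "f j \<in> V" for j unfolding f_def by (rule V_trunc[OF \<omega>V kk(1)])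
    have f0: "0 \<le> f j x" for j x by (simp add: f_def)
    have anti: "AE x in lborel. \<omega> (Suc j) x \<le> \<omega> j x" for j
    proof -
      have "AE x in lborel. u x (tt (Suc j)) \<le> u x (tt j)" by (rule u_antimono) (use tt[of j] in auto)
      then show ?thesis
      proof eventually_elim
        case (elim x)
        then show ?case using m0 u_nonneg lam unfolding \<omega>_def by (intro mult_left_mono powr_mono2) auto
      qed
    qed
    have lev0: "\<kappa> * (1 / 2) ^ Suc j \<le> f j x" if "kk (Suc j) < \<omega> j x" for j x
      using that kkS[of j] by (simp add: f_def max_def split: if_splits)
    have lev: "AE x in lborel. 0 < f (Suc j) x \<longrightarrow> \<kappa> * (1 / 2) ^ Suc j \<le> f j x" for j
      using anti[of j]
    proof eventually_elim
      case (elim x)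
      show ?case
      proof
        assume "0 < f (Suc j) x"
        then have "kk (Suc j) < \<omega> j x" using elim by (simp add: f_def max_def split: if_splits)
        then show "\<kappa> * (1 / 2) ^ Suc j \<le> f j x" by (rule lev0)
      qed
    qed
    have fLp: "Lp s (f j)" for j unfolding s_def by (rule V_Lp_p1[OF fV])
    have fi: "integrable lborel (\<lambda>x. f j x powr s)" for j using fLp[of j] f0 by (simp add: Lp_def)
    have en: "(Lnorm qs (f (Suc j)))\<^sup>2 \<le> C * b ^ j * (LBINT x. f j x powr s)" for j
    proof -
      define Y where "Y = (LBINT x. f j x powr s)"
      define c where "c = hh j * lam"
      have c: "0 < c" using hh lam by (simp add: c_def)
      define W where "W x = X (tt j) x - X (tt (Suc j)) x" for x
      have W: "sol W (\<lambda>x. u x (tt j) - u x (tt (Suc j)))"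
        unfolding W_def using tt[of j] tt[of "Suc j"] by (intro sol_diff X_sol) auto
      have k: "0 \<le> c * kk (Suc j)" using c kk by simp
      define g where "g x = max 0 (W x - c * kk (Suc j))" for x
      have gV: "g \<in> V" unfolding g_def by (rule V_trunc[OF sol_V[OF W] k])
      note sw = X_sandwich[OF tt(1,3)[of j]]
      have low: "AE x in lborel. \<bar>c * f (Suc j) x\<bar> \<le> \<bar>g x\<bar>"
        using sw(1)
      proof eventually_elim
        case (elim x)
        then have "c * \<omega> (Suc j) x \<le> W x" using lam by (simp add: W_def \<omega>_def c_def hh(2))
        then have "c * (\<omega> (Suc j) x - kk (Suc j)) \<le> g x" by (simp add: g_def right_diff_distrib)
        moreover have "c * f (Suc j) x = max 0 (c * (\<omega> (Suc j) x - kk (Suc j)))"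
          using c by (simp add: f_def max_mult_distrib_left)
        moreover have "0 \<le> g x" by (simp add: g_def)
        ultimately show ?case by simp
      qed
      define D where "D = (2 ^ (j + 2)) powr p * lam powr p * c"
      have D: "0 \<le> D" using c by (simp add: D_def)
      have upp: "AE x in lborel. (u x (tt j) - u x (tt (Suc j))) * g x \<le> D * f j x powr s"
        using sw(2)
      proof eventually_elim
        case (elim x)
        have Wle: "W x \<le> c * \<omega> j x" using elim lam by (simp add: W_def \<omega>_def c_def hh(2))
        have g0: "0 \<le> g x" by (simp add: g_def)
        show ?case
        proof (cases "kk (Suc j) < \<omega> j x")
          case True
          have "\<kappa> * (1 / 2) ^ Suc j * 2 ^ Suc j \<le> f j x * 2 ^ Suc j" using lev0[OF True] by (intro mult_right_mono) auto
          moreover have "\<kappa> * (1 / 2) ^ Suc j * 2 ^ Suc j = \<kappa>" by (simp add: power_divide)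
          ultimately have k1: "\<kappa> \<le> f j x * 2 ^ Suc j" by linarith
          have "\<omega> j x \<le> f j x + \<kappa>" using kk(2)[of j] by (simp add: f_def)
          also have "\<dots> \<le> f j x * 1 + f j x * 2 ^ Suc j" using k1 by simp
          also have "\<dots> \<le> f j x * 2 ^ Suc j + f j x * 2 ^ Suc j"
            using f0[of j x] one_le_power[of "2::real" "Suc j"] by (intro add_right_mono mult_left_mono) auto
          also have "\<dots> = 2 ^ (j + 2) * f j x" by simp
          finally have \<omega>f: "\<omega> j x \<le> 2 ^ (j + 2) * f j x" .
          have "kk j \<le> kk (Suc j)" using kkS[of j] \<kappa> by simp
          then have "c * kk j \<le> c * kk (Suc j)" using c by (intro mult_left_mono) auto
          then have "g x \<le> max 0 (c * (\<omega> j x - kk j))"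
            unfolding g_def right_diff_distrib using Wle by (intro max.mono) linarith+
          also have "\<dots> = c * f j x" using c by (simp add: f_def max_mult_distrib_left)
          finally have gf: "g x \<le> c * f j x" .
          have "(u x (tt j) - u x (tt (Suc j))) * g x \<le> u x (tt j) * g x"
            using u_nonneg g0 by (intro mult_right_mono) auto
          also have "\<dots> = lam powr p * \<omega> j x powr p * g x" unfolding up[symmetric] ..
          also have "\<dots> \<le> lam powr p * (2 ^ (j + 2) * f j x) powr p * (c * f j x)"
            using \<omega>f \<omega>0[of j x] p1 gf g0 lam c f0[of j x] by (intro mult_mono powr_mono2) auto
          also have "\<dots> = D * (f j x powr p * f j x)" using f0[of j x] by (simp add: D_def powr_mult mult_ac)
          also have "f j x powr p * f j x = f j x powr s" using f0[of j x] by (cases "f j x = 0") (auto simp: s_def powr_add)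
          finally show ?thesis .
        next
          case False
          then have "c * \<omega> j x \<le> c * kk (Suc j)" using c by (intro mult_left_mono) auto
          then have "g x = 0" using Wle by (simp add: g_def)
          then show ?thesis using D by simp
        qed
      qed
      have "E g g \<le> E W g" unfolding g_def by (rule E_trunc[OF sol_V[OF W] k])
      also have "\<dots> = (LBINT x. (u x (tt j) - u x (tt (Suc j))) * g x)" by (rule sol_E[OF W gV])
      also have "\<dots> \<le> (LBINT x. D * f j x powr s)"
        using upp fi by (intro integral_mono_AE sol_integrable[OF W gV]) auto
      finally have Eg: "E g g \<le> D * Y" by (simp add: Y_def)
      have cf: "c * Lnorm qs (f (Suc j)) \<le> Lnorm qs g"
      proof -
        have "(\<lambda>x. c * f (Suc j) x) \<in> borel_measurable lborel" using V_measurable[OF fV] by simp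
        then have "Lnorm qs (\<lambda>x. c * f (Suc j) x) \<le> Lnorm qs g"
          by (intro Lp_bound(2)[OF V_Lp_qs[OF gV] _ _ low]) (use qs_gt_2 in auto)
        then show ?thesis using c qs_gt_2 by (simp add: Lnorm_cmult)
      qed
      have "(c * Lnorm qs (f (Suc j)))\<^sup>2 \<le> (Lnorm qs g)\<^sup>2" using cf c by (intro power_mono) auto
      also have "\<dots> \<le> SQ * E g g" by (rule Sobolev[OF gV])
      also have "\<dots> \<le> SQ * (D * Y)" using Eg SQ_pos by (intro mult_left_mono) auto
      finally have 1: "c\<^sup>2 * (Lnorm qs (f (Suc j)))\<^sup>2 \<le> SQ * (D * Y)" by (simp add: power_mult_distrib)
      \<comment> \<open>The powers of \<open>lam\<close> and \<open>h\<close> cancel here. In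
        \<open>b\<close>, the factor 2 stems from the shrinking time step and
        \<open>2 powr p\<close> from the shrinking level gap.\<close>
      have CD: "C * b ^ j * c\<^sup>2 = SQ * D"
      proof -
        have "(2 ^ (j + 2)) powr p = (2 powr p) ^ j * 4 powr (p :: real)"
        proof -
          have "(2 ^ (j + 2)) powr p = (2 ^ j) powr p * 4 powr p" by (simp add: power_add powr_mult)
          then show ?thesis by (simp add: power_powr_commute)
        qed
        moreover have "lam powr p = c * (4 * 2 ^ j)" unfolding lamp c_def hh_def by (simp add: power_divide)
        ultimately show ?thesis by (simp add: C_def D_def b_def power_mult_distrib power2_eq_square mult_ac)
      qed
      have "c\<^sup>2 * (C * b ^ j * Y) = (C * b ^ j * c\<^sup>2) * Y" by (simp add: mult_ac)
      also have "\<dots> = SQ * (D * Y)" unfolding CD by simp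
      finally have "c\<^sup>2 * (Lnorm qs (f (Suc j)))\<^sup>2 \<le> c\<^sup>2 * (C * b ^ j * Y)" using 1 by (simp only:)
      then show ?thesis using c unfolding Y_def by simp
    qed
    have "(\<lambda>j. LBINT x. f j x powr s) \<longlonglongrightarrow> 0"
    proof (rule level_iteration[where C=C and b=b and k=\<kappa> and e=e])
      show "Lp qs (f (Suc j))" for j by (rule V_Lp_qs[OF fV])
      show "x \<notin> \<Omega> ==> f j x = 0" for j x by (rule V_outside[OF fV])
      have "(LBINT x. f 0 x powr s) \<le> Y0"
      proof -
        have e1: "f 0 x powr s = (1 / lam) powr s * \<bar>u x (tt 0)\<bar> powr (1 + m)" for x
        proof -
          have "f 0 x = (1 / lam) * u x (tt 0) powr m" using \<omega>0[of 0 x] by (simp add: f_def kk_def \<omega>_def max_absorb2)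
          then have "f 0 x powr s = (1 / lam) powr s * (u x (tt 0) powr m) powr s" using lam by (simp only: powr_mult)
          then show ?thesis using conj_exp(4) u_nonneg by (simp add: powr_powr s_def)
        qed
        have "(LBINT x. f 0 x powr s) = (1 / lam) powr s * nU (tt 0) powr (1 + m)"
          unfolding e1 nU_def using m0 by (simp add: Lnorm_powr)
        also have "\<dots> \<le> (1 / lam) powr s * (C1 * (3 / 2 * h) powr al) powr (1 + m)"
        proof (intro mult_left_mono powr_mono2)
          have "T - tt 0 = 3 / 2 * h" by (simp add: tt_def h_def field_simps)
          moreover have "nU (tt 0) \<le> C1 * (T - tt 0) powr al" by (rule C1(2)) (use tt[of 0] t in auto)
          ultimately show "nU (tt 0) \<le> C1 * (3 / 2 * h) powr al" by (simp only:)
        qed (use m0 nU_nonneg in auto)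
        also have "\<dots> = Y0 * ((1 / lam) powr s * (h powr al) powr (1 + m))"
        proof -
          have "(3 / 2 * h) powr al = (3 / 2) powr al * h powr al" using powr_mult[of "3 / 2" h al] h by simp
          then have e2: "C1 * (3 / 2 * h) powr al = (C1 * (3 / 2) powr al) * h powr al" by (simp only: mult.assoc)
          have "(C1 * (3 / 2 * h) powr al) powr (1 + m) = Y0 * (h powr al) powr (1 + m)"
            unfolding e2 Y0_def using powr_mult[of "C1 * (3 / 2) powr al" "h powr al" "1 + m"] C1(1) by simp
          then show ?thesis by simp
        qed
        also have "(1 / lam) powr s * (h powr al) powr (1 + m) = 1"
        proof -
          have e3: "m * al * s = al * (1 + m)" using conj_exp(4) by (simp add: s_def mult_ac)
          show ?thesis using h unfolding lam_def powr_divide powr_powr e3 by simp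
        qed
        finally show ?thesis by simp
      qed
      then have "(LBINT x. f 0 x powr s) powr e \<le> Y0 powr e" using e by (intro powr_mono2) auto
      then have "C powr (s / 2) * (LBINT x. f 0 x powr s) powr e * (b powr (s / 2) * 2 powr G) powr (1 / e)
        \<le> C powr (s / 2) * Y0 powr e * (b powr (s / 2) * 2 powr G) powr (1 / e)"
        by (intro mult_right_mono mult_left_mono) auto
      also have "\<dots> \<le> Q" by (simp add: Q_def)
      finally have "(C powr (s / 2) * (LBINT x. f 0 x powr s) powr e * (b powr (s / 2) * 2 powr G) powr (1 / e)) / Q \<le> 1"
        using Q by (simp add: pos_divide_le_eq)
      then show "C powr (s / 2) * (2 / \<kappa>) powr (s * (1 - s / qs)) * (LBINT x. f 0 x powr s) powr e
        * (b powr (s / 2) * 2 powr (s * (1 - s / qs))) powr (1 / e) \<le> 1"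
        unfolding G_def[symmetric] \<kappa>G by (simp add: mult_ac)
    qed (use s f0 fLp C b en \<kappa> lev in \<open>auto simp: e_def\<close>)
    then have "AE x in lborel. max 0 ((1 / lam) * w t x - \<kappa>) = 0"
    proof (rule AE_zero_of_integral_tendsto[rotated 5])
      have "0 < t" using t T_pos by simp
      then show "(\<lambda>x. max 0 ((1 / lam) * w t x - \<kappa>)) \<in> borel_measurable lborel" using V_measurable[OF w_V] by simp
      fix j
      have "AE x in lborel. u x t \<le> u x (tt j)" by (rule u_antimono) (use tt[of j] in auto)
      then show "AE x in lborel. max 0 ((1 / lam) * w t x - \<kappa>) \<le> f j x"
      proof eventually_elim
        case (elim x)
        then have "(1 / lam) * w t x \<le> \<omega> j x" using m0 u_nonneg lam unfolding \<omega>_def by (intro mult_left_mono powr_mono2) auto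
        then show ?case using kk(2)[of j] by (auto simp: f_def)
      qed
    qed (use fi s in auto)
    then show "AE x in lborel. w t x \<le> \<kappa> * (T - t) powr (m * al)"
    proof eventually_elim
      case (elim x)
      then have "(1 / lam) * w t x \<le> \<kappa>" by (simp add: max_def split: if_splits)
      then have "w t x \<le> \<kappa> * lam" using lam by (simp add: pos_divide_le_eq)
      then show ?case by (simp add: lam_def h_def)
    qed
  qed
qed

end

text \<open>Convergence in the essential supremum norm; the exceptional null set may depend on
  \<open>k\<close> and on \<open>e\<close>.\<close>

definition AE_uniform :: "(nat => 'a::euclidean_space => real) => ('a => real) => bool" where
  "AE_uniform f g \<longleftrightarrow> (\<forall>e>0. \<forall>\<^sub>F k in sequentially. AE x in lborel. \<bar>f k x - g x\<bar> \<le> e)"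

context flow_ext
begin

section \<open>Convergence of the rescaled solution\<close>

definition xi :: "real => 'a => real" where "xi t x = (T - t) powr (- al) * X t x"
definition uh :: "real => 'a => real" where "uh t x = (T - t) powr (- al) * u x t"

lemma xi_sol: "0 \<le> t ==> sol (xi t) (uh t)"
  unfolding xi_def[abs_def] uh_def[abs_def] by (intro sol_cmult X_sol)

lemma xi_V: "0 \<le> t ==> xi t \<in> V" by (rule sol_V[OF xi_sol])

lemma nrm_xi: "t < T ==> nrm (xi t) = N t / (T - t) powr al"
  unfolding xi_def[abs_def] nrm_cmult N_def by (simp add: powr_minus divide_inverse mult.commute)

lemma nrm_xi_tendsto: "filterlim s (at_left T) sequentially ==> (\<lambda>k. nrm (xi (s k))) \<longlonglongrightarrow> Ninf"
proof -
  assume s: "filterlim s (at_left T) sequentially"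
  have "\<forall>\<^sub>F t in at_left T. N t / (T - t) powr al = nrm (xi t)"
    by (intro eventually_at_leftI[of 0]) (use T_pos nrm_xi in auto)
  then have "((\<lambda>t. nrm (xi t)) \<longlongrightarrow> Ninf) (at_left T)" using N_tendsto by (rule Lim_transform_eventually[rotated])
  then show ?thesis by (rule filterlim_compose[OF _ s])
qed

lemma uh_bounded: obtains M where "0 < M" "\<And>t. T / 2 \<le> t ==> t < T ==> AE x in lborel. \<bar>uh t x\<bar> \<le> M"
proof -
  obtain \<kappa> where \<kappa>: "0 < \<kappa>" "\<And>t. T / 2 \<le> t ==> t < T ==> AE x in lborel. w t x \<le> \<kappa> * (T - t) powr (m * al)"
    by (rule w_upper) (rule that)
  show ?thesis
  proof (rule that[of "\<kappa> powr p"])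
    fix t assume t: "T / 2 \<le> t" "t < T"
    show "AE x in lborel. \<bar>uh t x\<bar> \<le> \<kappa> powr p"
      using \<kappa>(2)[OF t]
    proof eventually_elim
      case (elim x)
      have "u x t = (u x t powr m) powr p" using u_nonneg[of x t] conj_exp(5) by (simp add: powr_powr mult.commute)
      also have "\<dots> \<le> (\<kappa> * (T - t) powr (m * al)) powr p" using elim p1 by (intro powr_mono2) auto
      also have "\<dots> = \<kappa> powr p * (T - t) powr al" unfolding powr_mult powr_powr al_eq(2) ..
      finally have "(T - t) powr (- al) * u x t \<le> (T - t) powr (- al) * (\<kappa> powr p * (T - t) powr al)"
        by (intro mult_left_mono) auto
      also have "\<dots> = \<kappa> powr p" using t by (simp add: powr_minus)
      finally show ?case using u_nonneg[of x t] by (simp add: uh_def)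
    qed
  qed (use \<kappa>(1) in simp)
qed

lemma near_T: assumes s: "filterlim s (at_left T) sequentially" and a: "a < T"
  shows "\<forall>\<^sub>F k in sequentially. a < s k \<and> s k < T"
  using s eventually_at_left_field[of "\<lambda>t. a < t \<and> t < T" T] a by (auto simp: filterlim_iff)

lemma integral_sq_le: assumes "f \<in> V" shows "(LBINT x. (f x)\<^sup>2) \<le> (CC 2 * nrm f)\<^sup>2"
proof -
  have "(LBINT x. (f x)\<^sup>2) = (Lnorm 2 f)\<^sup>2" using Lnorm_powr[of 2 f] by (simp add: powr_numeral)
  also have "\<dots> \<le> (CC 2 * nrm f)\<^sup>2" using V_Lp(2)[OF assms, of 2] qs_gt_2 by (intro power_mono) auto
  finally show ?thesis .
qed

text \<open>A difference of rescaled potentials has a right-hand side bounded by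
  \<open>2 * M\<close>, so \<open>linear_sup_bound\<close> upgrades convergence in energy to uniform
  convergence.\<close>

lemma xi_diff_small:
  assumes a: "filterlim a (at_left T) sequentially" and b: "filterlim b (at_left T) sequentially"
    and lim: "(\<lambda>k. nrm (\<lambda>x. xi (a k) x - xi (b k) x)) \<longlonglongrightarrow> 0" and e: "0 < e"
  shows "\<forall>\<^sub>F k in sequentially. AE x in lborel. \<bar>xi (a k) x - xi (b k) x\<bar> \<le> e"
proof -
  obtain M where M: "0 < M" "\<And>t. T / 2 \<le> t ==> t < T ==> AE x in lborel. \<bar>uh t x\<bar> \<le> M" by (rule uh_bounded) (rule that)
  have M2: "0 < 2 * M" using M by simp
  obtain \<delta> where \<delta>: "0 < \<delta>" "\<And>D d. sol D d ==> (AE x in lborel. \<bar>d x\<bar> \<le> 2 * M) ==> (LBINT x. (D x)\<^sup>2) \<le> \<delta> ==> AE x in lborel. \<bar>D x\<bar> \<le> e"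
    by (rule linear_sup_bound[OF e M2]) (rule that)
  have "(\<lambda>k. (CC 2 * nrm (\<lambda>x. xi (a k) x - xi (b k) x))\<^sup>2) \<longlonglongrightarrow> (CC 2 * 0)\<^sup>2" by (intro tendsto_intros lim)
  then have "\<forall>\<^sub>F k in sequentially. (CC 2 * nrm (\<lambda>x. xi (a k) x - xi (b k) x))\<^sup>2 < \<delta>"
    by (rule order_tendstoD(2)) (use \<delta> in simp)
  moreover have "\<forall>\<^sub>F k in sequentially. T / 2 < a k \<and> a k < T" "\<forall>\<^sub>F k in sequentially. T / 2 < b k \<and> b k < T"
    using near_T[OF a, of "T / 2"] near_T[OF b, of "T / 2"] T_pos by simp_all
  ultimately show ?thesis
  proof eventually_elim
    case (elim k)
    have ab: "0 \<le> a k" "0 \<le> b k" using elim T_pos by auto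
    show ?case
    proof (rule \<delta>(2)[OF sol_diff[OF xi_sol[OF ab(1)] xi_sol[OF ab(2)]]])
      have "AE x in lborel. \<bar>uh (a k) x\<bar> \<le> M" "AE x in lborel. \<bar>uh (b k) x\<bar> \<le> M" using elim by (auto intro: M(2))
      then show "AE x in lborel. \<bar>uh (a k) x - uh (b k) x\<bar> \<le> 2 * M" by eventually_elim simp
      show "(LBINT x. (xi (a k) x - xi (b k) x)\<^sup>2) \<le> \<delta>"
        using integral_sq_le[OF V_diff[OF xi_V[OF ab(1)] xi_V[OF ab(2)]]] elim by simp
    qed
  qed
qed

text \<open>On the scale of the remaining time the direction of \<open>X\<close> is asymptotically constant, since
  the quotient \<open>A\<close> is monotone and bounded below.\<close>

lemma xi_shift_ordered:
  assumes b: "filterlim b (at_left T) sequentially" and a: "filterlim a (at_left T) sequentially"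
    and ab: "\<And>k. T - a k = \<theta> * (T - b k)" and \<theta>: "1 \<le> \<theta>"
  shows "(\<lambda>k. nrm (\<lambda>x. xi (a k) x - xi (b k) x)) \<longlonglongrightarrow> 0"
proof (rule Lim_null_comparison)
  define n where "n t = N t / (T - t) powr al" for t
  \<comment> \<open>The bound of \<open>X_directions\<close> with the quotient of the norms
    expressed through \<open>n\<close>. The factor with \<open>A\<close> tends to zero, while the
    other tends to the finite value \<open>\<theta> powr al - 1\<close>.\<close>
  define R where "R k = sqrt (2 * (A (a k) / A (b k) - 1) * (n (a k) / n (b k) * \<theta> powr al - 1))" for k
  note na = filterlim_compose[OF N_tendsto a, folded n_def] and nb = filterlim_compose[OF N_tendsto b, folded n_def]
  note Aa = filterlim_compose[OF A_tendsto a] and Ab = filterlim_compose[OF A_tendsto b]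
  have "R \<longlonglongrightarrow> sqrt (2 * (Ainf / Ainf - 1) * (Ninf / Ninf * \<theta> powr al - 1))"
    unfolding R_def using Ainf_pos Ninf_pos by (intro tendsto_intros na nb Aa Ab) auto
  then have R: "R \<longlonglongrightarrow> 0" using Ainf_pos by simp
  have "(\<lambda>k. n (a k) * R k + \<bar>n (a k) - n (b k)\<bar>) \<longlonglongrightarrow> Ninf * 0 + \<bar>Ninf - Ninf\<bar>"
    by (intro tendsto_intros na nb R)
  then show "(\<lambda>k. n (a k) * R k + \<bar>n (a k) - n (b k)\<bar>) \<longlonglongrightarrow> 0" by simp
  show "\<forall>\<^sub>F k in sequentially. norm (nrm (\<lambda>x. xi (a k) x - xi (b k) x)) \<le> n (a k) * R k + \<bar>n (a k) - n (b k)\<bar>"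
    using near_T[OF a T_pos] near_T[OF b T_pos]
  proof eventually_elim
    case (elim k)
    then have t: "0 \<le> a k" "0 \<le> b k" "0 < T - b k" "b k < T" "a k < T" "0 < T - a k" by auto
    have "1 * (T - b k) \<le> \<theta> * (T - b k)" using \<theta> t by (intro mult_right_mono) auto
    then have le: "a k \<le> b k" using ab[of k] by simp
    have Np: "0 < N (a k)" "0 < N (b k)" using N_pos t by auto
    have np: "0 < n (a k)" "0 < n (b k)" using Np t by (auto simp: n_def)
    define d where "d t x = X t x / N t" for t x
    have dV: "d (a k) \<in> V" "d (b k) \<in> V"
      unfolding d_def divide_inverse using V_cmult[OF X_V[OF t(1)], of "inverse (N (a k))"] V_cmult[OF X_V[OF t(2)], of "inverse (N (b k))"]
      by (simp_all add: mult.commute)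
    have xid: "xi t x = n t * d t x" if "0 < N t" for t x
      using that by (simp add: xi_def n_def d_def powr_minus field_simps)
    have nd: "nrm (d (b k)) = 1"
      using nrm_cmult[of "inverse (N (b k))" "X (b k)"] Np(2) by (simp add: d_def[abs_def] divide_inverse mult.commute flip: N_def)
    have "(T - a k) powr al = \<theta> powr al * (T - b k) powr al" unfolding ab using \<theta> t by (simp add: powr_mult)
    then have q: "N (a k) / N (b k) = n (a k) / n (b k) * \<theta> powr al"
      using t \<theta> by (simp add: n_def field_simps)
    have "nrm (\<lambda>x. d (a k) x - d (b k) x) \<le> R k"
      unfolding R_def q[symmetric] d_def by (intro real_le_rsqrt X_directions[OF t(1) le t(4)])
    then have 1: "nrm (\<lambda>x. n (a k) * (d (a k) x - d (b k) x)) \<le> n (a k) * R k"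
      unfolding nrm_cmult using np by simp
    have 2: "nrm (\<lambda>x. (n (a k) - n (b k)) * d (b k) x) = \<bar>n (a k) - n (b k)\<bar>"
      unfolding nrm_cmult nd by simp
    have "(\<lambda>x. xi (a k) x - xi (b k) x) = (\<lambda>x. n (a k) * (d (a k) x - d (b k) x) + (n (a k) - n (b k)) * d (b k) x)"
      unfolding xid[OF Np(1)] xid[OF Np(2)] by (simp add: algebra_simps)
    then have "nrm (\<lambda>x. xi (a k) x - xi (b k) x) \<le> n (a k) * R k + \<bar>n (a k) - n (b k)\<bar>"
      using nrm_add[OF V_cmult[OF V_diff[OF dV], of "n (a k)"] V_cmult[OF dV(2), of "n (a k) - n (b k)"]] 1 2 by simp
    then show ?case by simp
  qed
qed

lemma xi_shift:
  assumes s: "filterlim s (at_left T) sequentially" and \<theta>: "0 < \<theta>" and e: "0 < e"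
  shows "\<forall>\<^sub>F k in sequentially. AE x in lborel. \<bar>xi (T - \<theta> * (T - s k)) x - xi (s k) x\<bar> \<le> e"
    and "filterlim (\<lambda>k. T - \<theta> * (T - s k)) (at_left T) sequentially"
proof -
  have sT: "s \<longlonglongrightarrow> T" and sl: "\<forall>\<^sub>F k in sequentially. s k < T"
    using s near_T[OF s T_pos] by (auto simp: filterlim_at elim: eventually_mono)
  have "(\<lambda>k. T - \<theta> * (T - s k)) \<longlonglongrightarrow> T - \<theta> * (T - T)" by (intro tendsto_intros sT)
  then have aT: "(\<lambda>k. T - \<theta> * (T - s k)) \<longlonglongrightarrow> T" by simp
  show a: "filterlim (\<lambda>k. T - \<theta> * (T - s k)) (at_left T) sequentially"
  proof (rule tendsto_imp_filterlim_at_left[OF aT])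
    show "\<forall>\<^sub>F k in sequentially. T - \<theta> * (T - s k) < T" using sl by eventually_elim (use \<theta> in simp)
  qed
  show "\<forall>\<^sub>F k in sequentially. AE x in lborel. \<bar>xi (T - \<theta> * (T - s k)) x - xi (s k) x\<bar> \<le> e"
  proof (cases "1 \<le> \<theta>")
    case True
    show ?thesis by (rule xi_diff_small[OF a s xi_shift_ordered[OF s a _ True] e]) simp
  next
    case False
    \<comment> \<open>For \<open>\<theta> < 1\<close> the shifted time is the later one, so the
      roles are exchanged and the factor is inverted.\<close>
    have "(\<lambda>k. nrm (\<lambda>x. xi (s k) x - xi (T - \<theta> * (T - s k)) x)) \<longlonglongrightarrow> 0"
      by (rule xi_shift_ordered[OF a s, of "1 / \<theta>"]) (use \<theta> False in auto)
    then have "(\<lambda>k. nrm (\<lambda>x. xi (T - \<theta> * (T - s k)) x - xi (s k) x)) \<longlonglongrightarrow> 0" by (simp add: nrm_minus_commute)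
    then show ?thesis by (rule xi_diff_small[OF a s _ e])
  qed
qed

text \<open>Three upgrades: Rellich gives convergence in \<open>L^2\<close>,
  \<open>linear_sup_bound\<close> makes it uniform because the right-hand sides are bounded, and
  pairing the equation with the difference makes it strong in energy. The last one carries the limit
  \<open>Ninf\<close> of the norms over to \<open>g\<close>.\<close>

lemma xi_subsequence:
  assumes s: "filterlim s (at_left T) sequentially" and s0': "\<And>k. 0 \<le> s k"
  obtains r g where "strict_mono (r :: nat => nat)" "g \<in> V" "(\<lambda>k. nrm (\<lambda>x. xi (s (r k)) x - g x)) \<longlonglongrightarrow> 0"
    "AE_uniform (\<lambda>k. xi (s (r k))) g" "nrm g = Ninf"
proof -
  obtain B where B: "\<And>k. nrm (xi (s k)) \<le> B"
  proof -
    have "Bseq (\<lambda>k. nrm (xi (s k)))" using nrm_xi_tendsto[OF s] by (intro convergent_imp_Bseq convergentI)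
    then obtain B where "\<forall>k. norm (nrm (xi (s k))) \<le> B" by (auto simp: Bseq_def)
    then show ?thesis by (intro that[of B]) simp
  qed
  obtain r :: "nat => nat" where r: "strict_mono r"
    and L2: "\<And>e. 0 < e ==> \<exists>N. \<forall>i\<ge>N. \<forall>j\<ge>N. (LBINT x. (xi (s (r i)) x - xi (s (r j)) x)\<^sup>2) < e"
    by (rule Rellich[OF xi_V[OF s0'] B]) (rule that)
  define f where "f k = xi (s (r k))" for k
  have fV: "f k \<in> V" for k unfolding f_def by (rule xi_V[OF s0'])
  obtain M where M: "0 < M" "\<And>t. T / 2 \<le> t ==> t < T ==> AE x in lborel. \<bar>uh t x\<bar> \<le> M" by (rule uh_bounded) (rule that)
  have sr: "filterlim (\<lambda>k. s (r k)) (at_left T) sequentially"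
    by (rule filterlim_compose[OF s filterlim_subseq[OF r]])
  obtain n0 where n0: "\<And>k. n0 \<le> k ==> T / 2 < s (r k) \<and> s (r k) < T"
    using near_T[OF sr, of "T / 2"] T_pos unfolding eventually_sequentially by auto
  have db: "AE x in lborel. \<bar>uh (s (r i)) x - uh (s (r j)) x\<bar> \<le> 2 * M" if "n0 \<le> i" "n0 \<le> j" for i j
  proof -
    have "AE x in lborel. \<bar>uh (s (r i)) x\<bar> \<le> M" "AE x in lborel. \<bar>uh (s (r j)) x\<bar> \<le> M"
      using n0[OF that(1)] n0[OF that(2)] by (auto intro: M(2))
    then show ?thesis by eventually_elim simp
  qed
  have dsol: "sol (\<lambda>x. f i x - f j x) (\<lambda>x. uh (s (r i)) x - uh (s (r j)) x)" for i j
    unfolding f_def by (rule sol_diff[OF xi_sol[OF s0'] xi_sol[OF s0']])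
  have sup: "\<exists>N\<ge>n0. \<forall>i\<ge>N. \<forall>j\<ge>N. AE x in lborel. \<bar>f i x - f j x\<bar> \<le> e" if e: "0 < e" for e
  proof -
    have M2: "0 < 2 * M" using M by simp
    obtain \<delta> where \<delta>: "0 < \<delta>" "\<And>D d. sol D d ==> (AE x in lborel. \<bar>d x\<bar> \<le> 2 * M) ==> (LBINT x. (D x)\<^sup>2) \<le> \<delta> ==> AE x in lborel. \<bar>D x\<bar> \<le> e"
      by (rule linear_sup_bound[OF e M2]) (rule that)
    obtain N1 where N1: "\<forall>i\<ge>N1. \<forall>j\<ge>N1. (LBINT x. (xi (s (r i)) x - xi (s (r j)) x)\<^sup>2) < \<delta>" using L2[OF \<delta>(1)] by blast
    show ?thesis
    proof (intro exI[of _ "max n0 N1"] conjI allI impI)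
      fix i j assume "max n0 N1 \<le> i" "max n0 N1 \<le> j"
      then have ij: "n0 \<le> i" "n0 \<le> j" "N1 \<le> i" "N1 \<le> j" by auto
      have "(LBINT x. (f i x - f j x)\<^sup>2) \<le> \<delta>" using N1 ij(3,4) unfolding f_def by (intro less_imp_le) blast
      then show "AE x in lborel. \<bar>f i x - f j x\<bar> \<le> e" by (rule \<delta>(2)[OF dsol db[OF ij(1,2)]])
    qed simp
  qed
  have Cau: "\<exists>N. \<forall>i\<ge>N. \<forall>j\<ge>N. nrm (\<lambda>x. f i x - f j x) < e" if e: "0 < e" for e
  proof -
    define L where "L = measure lborel \<Omega>"
    \<comment> \<open>Chosen so that \<open>2 * M * \<eta>\<close> times the volume of \<Omega>
      stays below the square of \<open>e\<close>.\<close>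
    define \<eta> where "\<eta> = e\<^sup>2 / (2 * M * L + 1)"
    have L: "0 \<le> L" by (simp add: L_def)
    have den: "0 < 2 * M * L + 1" using M(1) L by (simp add: add_nonneg_pos)
    have \<eta>: "0 < \<eta>" using e den by (simp add: \<eta>_def)
    obtain N1 where N1: "n0 \<le> N1" "\<forall>i\<ge>N1. \<forall>j\<ge>N1. AE x in lborel. \<bar>f i x - f j x\<bar> \<le> \<eta>" using sup[OF \<eta>] by blast
    show ?thesis
    proof (intro exI[of _ N1] allI impI)
      fix i j assume ij: "N1 \<le> i" "N1 \<le> j"
      define D where "D x = f i x - f j x" for x
      have DV: "D \<in> V" unfolding D_def by (rule V_diff[OF fV fV])
      have sD: "sol D (\<lambda>x. uh (s (r i)) x - uh (s (r j)) x)" unfolding D_def by (rule dsol)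
      have "(nrm D)\<^sup>2 = (LBINT x. (uh (s (r i)) x - uh (s (r j)) x) * D x)"
        unfolding nrm_sq by (rule sol_E[OF sD DV])
      also have "\<dots> \<le> (LBINT x. (2 * M * \<eta>) * indicator \<Omega> x)"
      proof (rule integral_mono_AE[OF sol_integrable[OF sD DV]])
        show "integrable lborel (\<lambda>x. (2 * M * \<eta>) * indicator \<Omega> x)"
          using Omega_finite by (intro integrable_mult_right integrable_real_indicator) auto
        have a1: "AE x in lborel. \<bar>uh (s (r i)) x - uh (s (r j)) x\<bar> \<le> 2 * M" using db ij N1(1) by simp
        have a2: "AE x in lborel. \<bar>D x\<bar> \<le> \<eta>" unfolding D_def using N1(2) ij by blast
        show "AE x in lborel. (uh (s (r i)) x - uh (s (r j)) x) * D x \<le> (2 * M * \<eta>) * indicator \<Omega> x"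
          using a1 a2
        proof eventually_elim
          case (elim x)
          show ?case
          proof (cases "x \<in> \<Omega>")
            case True
            have "\<bar>(uh (s (r i)) x - uh (s (r j)) x) * D x\<bar> \<le> 2 * M * \<eta>"
              unfolding abs_mult using elim M(1) by (intro mult_mono) auto
            then show ?thesis using True by simp
          qed (simp add: V_outside[OF DV])
        qed
      qed
      also have "\<dots> = (2 * M * L) * \<eta>" by (simp add: L_def)
      also have "\<dots> < (2 * M * L + 1) * \<eta>" using \<eta> by simp
      also have "\<dots> = e\<^sup>2" using den by (simp add: \<eta>_def)
      finally have "nrm D < e" using e by (simp add: power_less_imp_less_base)
      then show "nrm (\<lambda>x. f i x - f j x) < e" by (simp add: D_def[abs_def])
    qed
  qed
  obtain g r2 where g: "g \<in> V" "(\<lambda>j. nrm (\<lambda>x. f j x - g x)) \<longlonglongrightarrow> 0"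
    "strict_mono (r2 :: nat => nat)" "AE x in lborel. (\<lambda>j. f (r2 j) x) \<longlonglongrightarrow> g x"
    by (rule V_complete[OF fV Cau]) (assumption, rule that)
  show ?thesis
  proof (rule that[OF r g(1)])
    show "(\<lambda>k. nrm (\<lambda>x. xi (s (r k)) x - g x)) \<longlonglongrightarrow> 0" using g(2) unfolding f_def .
    show "AE_uniform (\<lambda>k. xi (s (r k))) g"
      unfolding AE_uniform_def f_def[symmetric]
    proof (intro allI impI)
      fix e :: real assume "0 < e"
      then obtain N1 where N1: "\<forall>i\<ge>N1. \<forall>j\<ge>N1. AE x in lborel. \<bar>f i x - f j x\<bar> \<le> e" using sup by blast
      show "\<forall>\<^sub>F k in sequentially. AE x in lborel. \<bar>f k x - g x\<bar> \<le> e"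
        unfolding eventually_sequentially
      proof (intro exI[of _ N1] allI impI)
        fix k assume k: "N1 \<le> k"
        have "AE x in lborel. \<forall>j. N1 \<le> j \<longrightarrow> \<bar>f k x - f j x\<bar> \<le> e"
          unfolding AE_all_countable using N1 k by auto
        then show "AE x in lborel. \<bar>f k x - g x\<bar> \<le> e" using g(4)
        proof eventually_elim
          case (elim x)
          have "(\<lambda>j. \<bar>f k x - f (r2 j) x\<bar>) \<longlonglongrightarrow> \<bar>f k x - g x\<bar>" by (intro tendsto_intros elim(2))
          moreover have "\<forall>j\<ge>N1. \<bar>f k x - f (r2 j) x\<bar> \<le> e" using elim(1) seq_suble[OF g(3)] by (meson order_trans)
          ultimately show ?case by (intro LIMSEQ_le_const2) auto
        qed
      qed
    qed
    have "(\<lambda>k. nrm (f k)) \<longlonglongrightarrow> nrm g" by (rule nrm_tendsto[OF fV g(1,2)])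
    moreover have "(\<lambda>k. nrm (f k)) \<longlonglongrightarrow> Ninf" unfolding f_def by (rule nrm_xi_tendsto[OF sr])
    ultimately show "nrm g = Ninf" by (rule LIMSEQ_unique)
  qed
qed

end

section \<open>Uniform convergence of the rescaled powers, and the limit profile\<close>

context flow_ext
begin

definition wh :: "real => 'a => real" where "wh t x = (T - t) powr (- (m * al)) * u x t powr m"

lemma uh_wh: "uh t x = wh t x powr p"
proof -
  have "wh t x powr p = (T - t) powr (- (m * al * p)) * u x t powr (m * p)"
    unfolding wh_def powr_mult powr_powr by simp
  also have "\<dots> = uh t x"
    unfolding al_eq(2) uh_def using conj_exp(5) u_nonneg[of x t] by (simp add: mult.commute[of m p])
  finally show ?thesis ..
qed

text \<open>\<open>X_sandwich\<close> over time steps \<open>\<delta> * (T - t)\<close> before and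
  after \<open>t\<close>. The factors \<open>(1 + \<delta>) powr al\<close> and
  \<open>(1 - \<delta>) powr al\<close> convert between the normalisations at the two times.\<close>

lemma wh_sandwich:
  assumes t: "0 < T - (1 + \<delta>) * (T - t)" "t < T" and \<delta>: "0 < \<delta>" "\<delta> < 1"
  shows "AE x in lborel. \<delta> * wh t x \<le> (1 + \<delta>) powr al * xi (T - (1 + \<delta>) * (T - t)) x - xi t x"
    and "AE x in lborel. xi t x - (1 - \<delta>) powr al * xi (T - (1 - \<delta>) * (T - t)) x \<le> \<delta> * wh t x"
proof -
  define h where "h = T - t"
  have h: "0 < h" using t by (simp add: h_def)
  have dh: "0 < \<delta> * h" using h \<delta> by simp
  have e: "h powr (- al) * h = h powr (- (m * al))"
  proof -
    have "- al + 1 = - (m * al)" using al_eq(1) by linarith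
    then show ?thesis using powr_add[of h "- al" 1] h by simp
  qed
  have sc: "h powr (- al) * X (T - c * h) x = c powr al * xi (T - c * h) x" if "0 < c" for c x
    using that h unfolding xi_def by (simp add: powr_mult powr_minus)
  have a: "T - (1 + \<delta>) * h = t - \<delta> * h" and c: "T - (1 - \<delta>) * h = t + \<delta> * h" by (simp_all add: h_def algebra_simps)
  have tp: "0 < t - \<delta> * h" "0 < t" using t(1) dh unfolding h_def[symmetric] a by auto
  have "AE x in lborel. (t - (t - \<delta> * h)) * u x t powr m \<le> X (t - \<delta> * h) x - X t x"
    by (rule X_sandwich(1)[OF tp(1)]) (use dh in simp)
  then have "AE x in lborel. \<delta> * wh t x \<le> (1 + \<delta>) powr al * xi (T - (1 + \<delta>) * h) x - xi t x"
  proof eventually_elim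
    case (elim x)
    then have "h powr (- al) * ((\<delta> * h) * u x t powr m) \<le> h powr (- al) * (X (t - \<delta> * h) x - X t x)"
      by (intro mult_left_mono) auto
    also have "h powr (- al) * ((\<delta> * h) * u x t powr m) = \<delta> * wh t x"
      unfolding wh_def h_def[symmetric] e[symmetric] by (simp add: mult_ac)
    also have "h powr (- al) * (X (t - \<delta> * h) x - X t x) = (1 + \<delta>) powr al * xi (T - (1 + \<delta>) * h) x - xi t x"
      using sc[of "1 + \<delta>" x] \<delta> unfolding right_diff_distrib a by (simp add: xi_def h_def)
    finally show ?case .
  qed
  then show "AE x in lborel. \<delta> * wh t x \<le> (1 + \<delta>) powr al * xi (T - (1 + \<delta>) * (T - t)) x - xi t x" unfolding h_def .
  have "AE x in lborel. X t x - X (t + \<delta> * h) x \<le> ((t + \<delta> * h) - t) * u x t powr m"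
    by (rule X_sandwich(2)[OF tp(2)]) (use dh in simp)
  then have "AE x in lborel. xi t x - (1 - \<delta>) powr al * xi (T - (1 - \<delta>) * h) x \<le> \<delta> * wh t x"
  proof eventually_elim
    case (elim x)
    then have "h powr (- al) * (X t x - X (t + \<delta> * h) x) \<le> h powr (- al) * ((\<delta> * h) * u x t powr m)"
      by (intro mult_left_mono) auto
    also have "h powr (- al) * ((\<delta> * h) * u x t powr m) = \<delta> * wh t x"
      unfolding wh_def h_def[symmetric] e[symmetric] by (simp add: mult_ac)
    also have "h powr (- al) * (X t x - X (t + \<delta> * h) x) = xi t x - (1 - \<delta>) powr al * xi (T - (1 - \<delta>) * h) x"
      using sc[of "1 - \<delta>" x] \<delta> unfolding right_diff_distrib c by (simp add: xi_def h_def)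
    finally show ?case .
  qed
  then show "AE x in lborel. xi t x - (1 - \<delta>) powr al * xi (T - (1 - \<delta>) * (T - t)) x \<le> \<delta> * wh t x" unfolding h_def .
qed

lemma wh_bounded: obtains \<kappa> where "0 < \<kappa>" "\<And>t. T / 2 \<le> t ==> t < T ==> AE x in lborel. wh t x \<le> \<kappa>"
proof -
  obtain \<kappa> where \<kappa>: "0 < \<kappa>" "\<And>t. T / 2 \<le> t ==> t < T ==> AE x in lborel. w t x \<le> \<kappa> * (T - t) powr (m * al)"
    by (rule w_upper) (rule that)
  show ?thesis
  proof (rule that[OF \<kappa>(1)])
    fix t assume t: "T / 2 \<le> t" "t < T"
    show "AE x in lborel. wh t x \<le> \<kappa>"
      using \<kappa>(2)[OF t]
    proof eventually_elim
      case (elim x)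
      then have "(T - t) powr (- (m * al)) * u x t powr m \<le> (T - t) powr (- (m * al)) * (\<kappa> * (T - t) powr (m * al))"
        by (intro mult_left_mono) auto
      also have "\<dots> = \<kappa>" using t by (simp add: powr_minus)
      finally show ?case by (simp add: wh_def)
    qed
  qed
qed

lemma wh_nonneg: "0 \<le> wh t x" by (simp add: wh_def)

text \<open>At the shifted times the rescaled potential has the same uniform limit \<open>g\<close>,
  by \<open>xi_shift\<close>, so for fixed \<open>\<delta>\<close> only the normalising factors
  remain in the sandwich.\<close>

lemma wh_limit_bounds:
  assumes s: "filterlim s (at_left T) sequentially" and g: "AE_uniform (\<lambda>k. xi (s k)) g"
    and \<delta>: "0 < \<delta>" "\<delta> < 1" and e: "0 < e"
  shows "\<forall>\<^sub>F k in sequentially. AE x in lborel.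
    \<delta> * wh (s k) x \<le> ((1 + \<delta>) powr al - 1) * g x + e \<and> (1 - (1 - \<delta>) powr al) * g x - e \<le> \<delta> * wh (s k) x"
proof -
  define c where "c = (1 + \<delta>) powr al"
  define c' where "c' = (1 - \<delta>) powr al"
  \<comment> \<open>Each shifted potential is within \<open>2 * \<eta>\<close> of \<open>g\<close>,
    weighted by \<open>c\<close> or \<open>c'\<close>, and the unshifted one within
    \<open>\<eta>\<close>; this is the error budget of \<open>e\<close>.\<close>
  define \<eta> where "\<eta> = e / (2 * c + 2 * c' + 1)"
  have c: "0 \<le> c" "0 \<le> c'" by (auto simp: c_def c'_def)
  have den: "0 < 2 * c + 2 * c' + 1" using c by linarith
  have \<eta>: "0 < \<eta>" using e den by (simp add: \<eta>_def)
  have \<eta>e: "2 * (c * \<eta>) + 2 * (c' * \<eta>) + \<eta> = e"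
  proof -
    have "2 * (c * \<eta>) + 2 * (c' * \<eta>) + \<eta> = (2 * c + 2 * c' + 1) * \<eta>" by (simp add: algebra_simps)
    also have "\<dots> = e" using den by (simp add: \<eta>_def)
    finally show ?thesis .
  qed
  have d1: "0 < 1 + \<delta>" "0 < 1 - \<delta>" using \<delta> by auto
  have x0: "\<forall>\<^sub>F k in sequentially. AE x in lborel. \<bar>xi (s k) x - g x\<bar> \<le> \<eta>" using g \<eta> by (simp add: AE_uniform_def)
  note x1 = xi_shift(1)[OF s d1(1) \<eta>] and x2 = xi_shift(1)[OF s d1(2) \<eta>]
  note n1 = near_T[OF xi_shift(2)[OF s d1(1) \<eta>] T_pos] and n2 = near_T[OF s T_pos]
  show ?thesis
  proof (rule eventually_elim2[OF eventually_conj[OF x0 eventually_conj[OF x1 x2]] eventually_conj[OF n1 n2]])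
    fix k
    assume 1: "(AE x in lborel. \<bar>xi (s k) x - g x\<bar> \<le> \<eta>) \<and>
      (AE x in lborel. \<bar>xi (T - (1 + \<delta>) * (T - s k)) x - xi (s k) x\<bar> \<le> \<eta>) \<and>
      (AE x in lborel. \<bar>xi (T - (1 - \<delta>) * (T - s k)) x - xi (s k) x\<bar> \<le> \<eta>)"
      and 2: "(0 < T - (1 + \<delta>) * (T - s k) \<and> T - (1 + \<delta>) * (T - s k) < T) \<and> 0 < s k \<and> s k < T"
    have t: "0 < T - (1 + \<delta>) * (T - s k)" "s k < T" using 2 by auto
    note sw = wh_sandwich[OF t \<delta>]
    show "AE x in lborel. \<delta> * wh (s k) x \<le> ((1 + \<delta>) powr al - 1) * g x + e \<and> (1 - (1 - \<delta>) powr al) * g x - e \<le> \<delta> * wh (s k) x"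
      using conjunct1[OF 1] conjunct1[OF conjunct2[OF 1]] conjunct2[OF conjunct2[OF 1]] sw
      unfolding c_def[symmetric] c'_def[symmetric]
    proof eventually_elim
      case (elim x)
      define a b where "a = xi (T - (1 + \<delta>) * (T - s k)) x" and "b = xi (T - (1 - \<delta>) * (T - s k)) x"
      have "a \<le> g x + 2 * \<eta>" "b \<le> g x + 2 * \<eta>" using elim(1-3) unfolding a_def b_def by linarith+
      then have "c * a \<le> c * (g x + 2 * \<eta>)" "c' * b \<le> c' * (g x + 2 * \<eta>)" using c by (auto intro: mult_left_mono)
      then have "c * a \<le> c * g x + 2 * (c * \<eta>)" "c' * b \<le> c' * g x + 2 * (c' * \<eta>)" by (simp_all add: algebra_simps)
      moreover have "0 \<le> c * \<eta>" "0 \<le> c' * \<eta>" using c \<eta> by auto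
      moreover have "xi (s k) x \<le> g x + \<eta>" "g x - \<eta> \<le> xi (s k) x" using elim(1) by linarith+
      ultimately have "\<delta> * wh (s k) x \<le> c * g x - g x + e" "g x - c' * g x - e \<le> \<delta> * wh (s k) x"
        using elim(4,5) \<eta>e unfolding a_def b_def by linarith+
      then show ?case by (simp add: left_diff_distrib)
    qed
  qed
qed

lemma powr_difference_quotients:
  fixes a e :: real
  assumes "0 < e"
  obtains \<delta> where "0 < \<delta>" "\<delta> < 1" "\<bar>((1 + \<delta>) powr a - 1) / \<delta> - a\<bar> \<le> e" "\<bar>(1 - (1 - \<delta>) powr a) / \<delta> - a\<bar> \<le> e"
proof -
  have "((\<lambda>x. x powr a) has_real_derivative a * 1 powr (a - 1)) (at 1)" by (rule has_real_derivative_powr) simp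
  then have "((\<lambda>h. ((1 + h) powr a - 1) / h) \<longlongrightarrow> a) (at 0)" by (simp add: DERIV_def)
  then have "\<forall>\<^sub>F h in at 0. dist (((1 + h) powr a - 1) / h) a < e" using assms by (rule tendstoD)
  then obtain d where d: "0 < d" "\<And>h. h \<noteq> 0 ==> \<bar>h\<bar> < d ==> \<bar>((1 + h) powr a - 1) / h - a\<bar> < e"
    by (auto simp: eventually_at dist_real_def)
  define \<delta> where "\<delta> = min d 1 / 2"
  have \<delta>: "0 < \<delta>" "\<delta> < 1" "\<delta> < d" using d(1) by (auto simp: \<delta>_def min_def)
  show ?thesis
  proof (rule that[OF \<delta>(1,2)])
    show "\<bar>((1 + \<delta>) powr a - 1) / \<delta> - a\<bar> \<le> e" using d(2)[of \<delta>] \<delta> by simp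
    have "((1 + - \<delta>) powr a - 1) / (- \<delta>) = (1 - (1 - \<delta>) powr a) / \<delta>" by (simp add: divide_simps)
    then show "\<bar>(1 - (1 - \<delta>) powr a) / \<delta> - a\<bar> \<le> e" using d(2)[of "- \<delta>"] \<delta> by simp
  qed
qed

text \<open>The step \<open>\<delta> = 1 / 2\<close> transfers the bounds
  \<open>0 \<le> wh \<le> \<kappa>\<close> to \<open>g\<close>; the lower bound emerges as the error
  tends to zero along a sequence.\<close>

lemma profile_bounded:
  assumes s: "filterlim s (at_left T) sequentially" and g: "AE_uniform (\<lambda>k. xi (s k)) g"
  obtains B where "0 < B" "AE x in lborel. 0 \<le> g x \<and> g x \<le> B"
proof -
  obtain \<kappa> where \<kappa>: "0 < \<kappa>" "\<And>t. T / 2 \<le> t ==> t < T ==> AE x in lborel. wh t x \<le> \<kappa>" by (rule wh_bounded) (rule that)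
  have d: "0 < (1 / 2 :: real)" "(1 / 2 :: real) < 1" by auto
  have T2: "T / 2 < T" using T_pos by simp
  define c where "c = (1 + 1 / 2) powr al - (1 :: real)"
  define c' where "c' = 1 - (1 - 1 / 2 :: real) powr al"
  have "1 < (1 + 1 / 2 :: real) powr al" using al_pos by (intro gr_one_powr) auto
  then have c: "0 < c" by (simp add: c_def)
  have "(1 - 1 / 2 :: real) powr al < 1 powr al" using al_pos by (intro powr_less_mono2) auto
  then have c': "0 < c'" by (simp add: c'_def)
  have bd: "AE x in lborel. - e \<le> c * g x \<and> c' * g x \<le> \<kappa> + e" if e: "0 < e" for e
  proof -
    have "\<forall>\<^sub>F k in sequentially. (AE x in lborel. 1 / 2 * wh (s k) x \<le> c * g x + e \<and> c' * g x - e \<le> 1 / 2 * wh (s k) x)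
        \<and> (T / 2 < s k \<and> s k < T)"
      by (rule eventually_conj[OF wh_limit_bounds[OF s g d e, folded c_def c'_def] near_T[OF s T2]])
    then obtain k where k: "AE x in lborel. 1 / 2 * wh (s k) x \<le> c * g x + e \<and> c' * g x - e \<le> 1 / 2 * wh (s k) x" "T / 2 < s k" "s k < T"
      unfolding eventually_sequentially by blast
    have "AE x in lborel. wh (s k) x \<le> \<kappa>" using k by (intro \<kappa>(2)) auto
    with k(1) show ?thesis
    proof eventually_elim
      case (elim x)
      then show ?case using wh_nonneg[of "s k" x] \<kappa>(1) by linarith
    qed
  qed
  have "AE x in lborel. \<forall>n. - (1 / real (Suc n)) \<le> c * g x" unfolding AE_all_countable
  proof
    fix n
    show "AE x in lborel. - (1 / real (Suc n)) \<le> c * g x" using bd[of "1 / real (Suc n)"] by (auto elim!: eventually_mono)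
  qed
  moreover have "AE x in lborel. c' * g x \<le> \<kappa> + 1" using bd[of 1] by (auto elim!: eventually_mono)
  ultimately have "AE x in lborel. 0 \<le> g x \<and> g x \<le> (\<kappa> + 1) / c'"
  proof eventually_elim
    case (elim x)
    have "(\<lambda>n. - (1 / real (Suc n))) \<longlonglongrightarrow> - 0" by (intro tendsto_minus LIMSEQ_Suc[OF lim_1_over_n])
    then have "- 0 \<le> c * g x" by (rule LIMSEQ_le_const2) (use elim(1) in auto)
    then have "0 \<le> g x" using c by (simp add: zero_le_mult_iff)
    moreover have "g x \<le> (\<kappa> + 1) / c'" using elim(2) c' by (simp add: pos_le_divide_eq mult.commute)
    ultimately show ?case by simp
  qed
  then show ?thesis by (rule that[rotated]) (use \<kappa>(1) c' in simp)
qed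

text \<open>Divided by \<open>\<delta>\<close>, both coefficients of \<open>g\<close> tend to
  \<open>al\<close>, the derivative of \<open>r powr al\<close> at 1. The boundedness of
  \<open>g\<close> allows \<open>\<delta>\<close> to be fixed before \<open>k\<close> tends to
  infinity.\<close>

lemma wh_limit:
  assumes s: "filterlim s (at_left T) sequentially" and g: "AE_uniform (\<lambda>k. xi (s k)) g"
  shows "AE_uniform (\<lambda>k. wh (s k)) (\<lambda>x. al * g x)"
  unfolding AE_uniform_def
proof (intro allI impI)
  fix e :: real assume e: "0 < e"
  obtain B where B: "0 < B" "AE x in lborel. 0 \<le> g x \<and> g x \<le> B" by (rule profile_bounded[OF s g]) (rule that)
  define e1 where "e1 = e / (2 * B)"
  have e1: "0 < e1" "e1 * B = e / 2" using e B(1) by (auto simp: e1_def)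
  obtain \<delta> where \<delta>: "0 < \<delta>" "\<delta> < 1" "\<bar>((1 + \<delta>) powr al - 1) / \<delta> - al\<bar> \<le> e1" "\<bar>(1 - (1 - \<delta>) powr al) / \<delta> - al\<bar> \<le> e1"
    by (rule powr_difference_quotients[OF e1(1)]) (rule that)
  have e2: "0 < \<delta> * (e / 2)" using \<delta> e by simp
  define a where "a = ((1 + \<delta>) powr al - 1) / \<delta>"
  define b where "b = (1 - (1 - \<delta>) powr al) / \<delta>"
  have ab: "(1 + \<delta>) powr al - 1 = \<delta> * a" "1 - (1 - \<delta>) powr al = \<delta> * b" using \<delta>(1) by (auto simp: a_def b_def)
  show "\<forall>\<^sub>F k in sequentially. AE x in lborel. \<bar>wh (s k) x - al * g x\<bar> \<le> e"
    using wh_limit_bounds[OF s g \<delta>(1,2) e2]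
  proof (rule eventually_mono)
    fix k
    assume "AE x in lborel. \<delta> * wh (s k) x \<le> ((1 + \<delta>) powr al - 1) * g x + \<delta> * (e / 2) \<and>
      (1 - (1 - \<delta>) powr al) * g x - \<delta> * (e / 2) \<le> \<delta> * wh (s k) x"
    then show "AE x in lborel. \<bar>wh (s k) x - al * g x\<bar> \<le> e"
      using B(2) unfolding ab
    proof eventually_elim
      case (elim x)
      have "\<delta> * wh (s k) x \<le> \<delta> * (a * g x + e / 2)" "\<delta> * (b * g x - e / 2) \<le> \<delta> * wh (s k) x"
        using elim(1) by (simp_all add: algebra_simps)
      then have w: "wh (s k) x \<le> a * g x + e / 2" "b * g x - e / 2 \<le> wh (s k) x" using \<delta>(1) by auto
      have "(a - al) * g x \<le> e1 * B" "(al - b) * g x \<le> e1 * B"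
        using \<delta>(3,4) elim(2) e1(1) unfolding a_def[symmetric] b_def[symmetric] by (auto intro!: mult_mono)
      then have "a * g x \<le> al * g x + e / 2" "al * g x - e / 2 \<le> b * g x" unfolding e1(2) left_diff_distrib by linarith+
      then show ?case using w by linarith
    qed
  qed
qed

lemma uh_limit:
  assumes s: "filterlim s (at_left T) sequentially" and g: "AE_uniform (\<lambda>k. xi (s k)) g"
  shows "AE_uniform (\<lambda>k. uh (s k)) (\<lambda>x. (al * g x) powr p)"
  unfolding AE_uniform_def
proof (intro allI impI)
  fix e :: real assume e: "0 < e"
  obtain B where B: "0 < B" "AE x in lborel. 0 \<le> g x \<and> g x \<le> B" by (rule profile_bounded[OF s g]) (rule that)
  define I where "I = {0..al * B + 1}"
  have "uniformly_continuous_on I (\<lambda>r. r powr p)"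
    unfolding I_def using p1 by (intro compact_uniformly_continuous continuous_on_powr' continuous_intros) auto
  then obtain d where d: "0 < d" "\<And>r r'. r \<in> I ==> r' \<in> I ==> \<bar>r' - r\<bar> < d ==> \<bar>r' powr p - r powr p\<bar> < e"
    unfolding uniformly_continuous_on_def dist_real_def using e by blast
  define e' where "e' = min (d / 2) 1"
  have e': "0 < e'" "e' < d" "e' \<le> 1" using d(1) by (auto simp: e'_def min_def)
  have "\<forall>\<^sub>F k in sequentially. AE x in lborel. \<bar>wh (s k) x - al * g x\<bar> \<le> e'"
    using wh_limit[OF s g] e'(1) by (simp add: AE_uniform_def)
  then show "\<forall>\<^sub>F k in sequentially. AE x in lborel. \<bar>uh (s k) x - (al * g x) powr p\<bar> \<le> e"
  proof (rule eventually_mono)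
    fix k assume "AE x in lborel. \<bar>wh (s k) x - al * g x\<bar> \<le> e'"
    then show "AE x in lborel. \<bar>uh (s k) x - (al * g x) powr p\<bar> \<le> e"
      using B(2)
    proof eventually_elim
      case (elim x)
      have "0 \<le> al * g x" "al * g x \<le> al * B" using elim(2) al_pos by (auto intro: mult_left_mono)
      then have "al * g x \<in> I" "wh (s k) x \<in> I" using elim(1) e'(3) wh_nonneg[of "s k" x] by (auto simp: I_def)
      then have "\<bar>wh (s k) x powr p - (al * g x) powr p\<bar> < e" using elim(1) e'(2) by (intro d(2)) auto
      then show ?case by (simp add: uh_wh)
    qed
  qed
qed

text \<open>The potential equation is linear in the pair of \<open>xi\<close> and \<open>uh\<close>:
  the left side converges in energy, the right side uniformly, against an integrable
  \<open>\<psi>\<close>.\<close>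

lemma profile_equation:
  assumes s: "filterlim s (at_left T) sequentially" and s0': "\<And>k. 0 \<le> s k" and gV: "g \<in> V"
    and gn: "(\<lambda>k. nrm (\<lambda>x. xi (s k) x - g x)) \<longlonglongrightarrow> 0" and g: "AE_uniform (\<lambda>k. xi (s k)) g"
    and \<psi>: "\<psi> \<in> V" and i: "integrable lborel (\<lambda>x. (al * g x) powr p * \<psi> x)"
  shows "E g \<psi> = (LBINT x. (al * g x) powr p * \<psi> x)"
proof -
  have l1: "(\<lambda>k. E (xi (s k)) \<psi>) \<longlonglongrightarrow> E g \<psi>" by (rule E_tendsto[OF xi_V[OF s0'] gV gn \<psi>])
  define J where "J = (LBINT x. \<bar>\<psi> x\<bar>)"
  have J: "0 \<le> J" by (simp add: J_def)
  have "(\<lambda>k. E (xi (s k)) \<psi>) \<longlonglongrightarrow> (LBINT x. (al * g x) powr p * \<psi> x)"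
  proof (rule tendstoI)
    fix e :: real assume e: "0 < e"
    define \<eta> where "\<eta> = e / (J + 1)"
    have \<eta>: "0 < \<eta>" using e J by (simp add: \<eta>_def add_nonneg_pos)
    have "\<forall>\<^sub>F k in sequentially. AE x in lborel. \<bar>uh (s k) x - (al * g x) powr p\<bar> \<le> \<eta>"
      using uh_limit[OF s g] \<eta> by (simp add: AE_uniform_def)
    then show "\<forall>\<^sub>F k in sequentially. dist (E (xi (s k)) \<psi>) (LBINT x. (al * g x) powr p * \<psi> x) < e"
    proof (rule eventually_mono)
      fix k assume k: "AE x in lborel. \<bar>uh (s k) x - (al * g x) powr p\<bar> \<le> \<eta>"
      have ui: "integrable lborel (\<lambda>x. uh (s k) x * \<psi> x)" by (rule sol_integrable[OF xi_sol[OF s0'] \<psi>])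
      have "E (xi (s k)) \<psi> - (LBINT x. (al * g x) powr p * \<psi> x) = (LBINT x. (uh (s k) x - (al * g x) powr p) * \<psi> x)"
        unfolding sol_E[OF xi_sol[OF s0'] \<psi>] left_diff_distrib using ui i by simp
      also have "\<bar>\<dots>\<bar> \<le> (LBINT x. \<eta> * \<bar>\<psi> x\<bar>)"
      proof (rule order_trans[OF integral_abs_bound integral_mono_AE])
        show "integrable lborel (\<lambda>x. \<bar>(uh (s k) x - (al * g x) powr p) * \<psi> x\<bar>)"
          unfolding left_diff_distrib by (intro integrable_abs Bochner_Integration.integrable_diff ui i)
        show "integrable lborel (\<lambda>x. \<eta> * \<bar>\<psi> x\<bar>)" using V_integrable[OF \<psi>] by simp
        show "AE x in lborel. \<bar>(uh (s k) x - (al * g x) powr p) * \<psi> x\<bar> \<le> \<eta> * \<bar>\<psi> x\<bar>"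
          using k by eventually_elim (simp add: abs_mult mult_right_mono)
      qed
      also have "\<dots> = \<eta> * J" by (simp add: J_def)
      also have "\<dots> < \<eta> * (J + 1)" using \<eta> by simp
      also have "\<dots> = e" using J by (simp add: \<eta>_def)
      finally show "dist (E (xi (s k)) \<psi>) (LBINT x. (al * g x) powr p * \<psi> x) < e" by (simp add: dist_real_def)
    qed
  qed
  with l1 show ?thesis by (rule LIMSEQ_unique)
qed

text \<open>If \<open>g\<close> is the limit of the rescaled potentials, then \<open>al * g\<close>
  is the limit of the rescaled powers, and multiplying the equation of \<open>g\<close> by
  \<open>al = 1 / (1 - m)\<close> produces the constant of the elliptic equation.\<close>

theorem rescaled_convergence:
  assumes tn: "\<And>k. 0 \<le> tn k" "\<And>k. tn k < T" "tn \<longlonglongrightarrow> T"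
  obtains r \<phi> where "strict_mono (r :: nat => nat)" "weak_sol_elliptic \<sigma> m \<Omega> \<phi>"
    "\<And>x. x \<in> \<Omega> ==> 0 < \<phi> x" "\<And>x. x \<notin> \<Omega> ==> \<phi> x = 0"
    "AE_uniform (\<lambda>k. uh (tn (r k))) (\<lambda>x. \<phi> x powr p)"
proof -
  have tl: "filterlim tn (at_left T) sequentially"
    by (rule tendsto_imp_filterlim_at_left[OF tn(3)]) (use tn(2) in simp)
  obtain r g where r: "strict_mono (r :: nat => nat)" and gV: "g \<in> V" and gn: "(\<lambda>k. nrm (\<lambda>x. xi (tn (r k)) x - g x)) \<longlonglongrightarrow> 0"
    and g: "AE_uniform (\<lambda>k. xi (tn (r k))) g" and gN: "nrm g = Ninf"
    by (rule xi_subsequence[OF tl tn(1)]) (rule that)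
  have s: "filterlim (\<lambda>k. tn (r k)) (at_left T) sequentially"
    by (rule filterlim_compose[OF tl filterlim_subseq[OF r]])
  obtain B where B: "0 < B" "AE x in lborel. 0 \<le> g x \<and> g x \<le> B" by (rule profile_bounded[OF s g]) (rule that)
  note gm [measurable] = V_measurable[OF gV]
  define G where "G x = al * g x" for x
  have GV: "G \<in> V" unfolding G_def by (rule V_cmult[OF gV])
  have Gm [measurable]: "G \<in> borel_measurable lborel" by (rule V_measurable[OF GV])
  \<comment> \<open>A representative that is nonnegative at every point, as the minimum principle
    requires.\<close>
  define G' where "G' x = max 0 (G x)" for x
  have G'V: "G' \<in> V" unfolding G'_def by (rule V_pos[OF GV])
  have G'0: "0 \<le> G' x" for x by (simp add: G'_def)
  have GG': "AE x in lborel. G' x = G x"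
    using B(2) by eventually_elim (use al_pos in \<open>simp add: G'_def G_def\<close>)
  have EG': "E G' \<psi> = al * (LBINT x. G' x powr p * \<psi> x)" if \<psi>: "\<psi> \<in> V" for \<psi>
  proof -
    note [measurable] = V_measurable[OF \<psi>] V_measurable[OF G'V]
    have i': "integrable lborel (\<lambda>x. G' x powr p * \<psi> x)" by (rule dual_integrable[OF dual_powr[OF G'V G'0] \<psi>])
    have eq: "AE x in lborel. G' x powr p * \<psi> x = (al * g x) powr p * \<psi> x" using GG' by eventually_elim (simp add: G_def)
    have i: "integrable lborel (\<lambda>x. (al * g x) powr p * \<psi> x)"
      by (rule integrable_cong_AE_imp[OF i']) (use eq in \<open>auto elim!: eventually_mono\<close>)
    have "E G' \<psi> = E G \<psi>" by (rule V_AE_cong(2)[OF GV V_measurable[OF G'V] V_outside[OF G'V] GG' \<psi>])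
    also have "\<dots> = al * E g \<psi>" unfolding G_def[abs_def] by (rule E_cmult_left)
    also have "E g \<psi> = (LBINT x. (al * g x) powr p * \<psi> x)" by (rule profile_equation[OF s tn(1) gV gn g \<psi> i])
    also have "\<dots> = (LBINT x. G' x powr p * \<psi> x)"
      by (rule integral_cong_AE) (use eq in \<open>auto elim!: eventually_mono\<close>)
    finally show ?thesis .
  qed
  have nz: "\<not> (AE x in lborel. G' x = 0)"
  proof
    assume "AE x in lborel. G' x = 0"
    then have "AE x in lborel. g x = 0" using GG' by eventually_elim (use al_pos in \<open>simp add: G_def\<close>)
    then have "nrm g = nrm (\<lambda>_. 0)" by (intro V_AE_cong(3)[OF V_zero]) (auto simp: V_outside[OF gV])
    also have "\<dots> = 0" using nrm_cmult[of 0 g] by simp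
    finally show False using gN Ninf_pos by simp
  qed
  have pos: "AE x in lborel. x \<in> \<Omega> \<longrightarrow> 0 < G' x"
  proof (rule strong_minimum_principle[OF G'V G'0 _ nz])
    fix \<psi> assume "\<psi> \<in> V" and \<psi>0: "\<And>x. 0 \<le> \<psi> x"
    show "0 \<le> E G' \<psi>" unfolding EG'[OF \<open>\<psi> \<in> V\<close>]
      using al_pos \<psi>0 by (intro mult_nonneg_nonneg integral_nonneg_AE AE_I2) auto
  qed
  \<comment> \<open>The value 1 is assigned on the null subset of \<Omega> where \<open>G'\<close>
    fails to be positive, since positivity is claimed at every point.\<close>
  define \<phi> where "\<phi> x = (if x \<in> \<Omega> then if 0 < G' x then G' x else 1 else 0)" for x
  have \<phi>m: "\<phi> \<in> borel_measurable lborel"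
  proof -
    note [measurable] = V_measurable[OF G'V]
    show ?thesis unfolding \<phi>_def[abs_def] by measurable
  qed
  have \<phi>out: "x \<notin> \<Omega> ==> \<phi> x = 0" and \<phi>pos: "x \<in> \<Omega> ==> 0 < \<phi> x" for x by (auto simp: \<phi>_def)
  have \<phi>0: "0 \<le> \<phi> x" for x by (auto simp: \<phi>_def)
  have \<phi>eq: "AE x in lborel. \<phi> x = G' x"
    using pos by eventually_elim (simp add: \<phi>_def V_outside[OF G'V])
  note \<phi>V = V_AE_cong(1)[OF G'V \<phi>m \<phi>out \<phi>eq]
  show ?thesis
  proof (rule that[OF r _ \<phi>pos \<phi>out])
    show "weak_sol_elliptic \<sigma> m \<Omega> \<phi>"
      unfolding weak_sol_elliptic_def
    proof (intro conjI ballI)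
      show "\<phi> \<in> Hsigma0 \<sigma> \<Omega>" by (rule \<phi>V)
      fix \<psi> assume \<psi>: "\<psi> \<in> Hsigma0 \<sigma> \<Omega>"
      note [measurable] = V_measurable[OF \<psi>] V_measurable[OF G'V] \<phi>m
      show "integrable lborel (\<lambda>x. \<phi> x powr (1 / m) * \<psi> x)"
        using dual_integrable[OF dual_powr[OF \<phi>V \<phi>0] \<psi>] unfolding p_def .
      have "E \<phi> \<psi> = E G' \<psi>" by (rule V_AE_cong(2)[OF G'V \<phi>m \<phi>out \<phi>eq \<psi>])
      also have "\<dots> = al * (LBINT x. G' x powr p * \<psi> x)" by (rule EG'[OF \<psi>])
      also have "(LBINT x. G' x powr p * \<psi> x) = (LBINT x. \<phi> x powr p * \<psi> x)"
        by (rule integral_cong_AE) (use \<phi>eq in \<open>auto elim!: eventually_mono\<close>)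
      finally show "E \<phi> \<psi> = 1 / (1 - m) * (LBINT x. \<phi> x powr (1 / m) * \<psi> x)" unfolding p_def al_def .
    qed
    show "AE_uniform (\<lambda>k. uh (tn (r k))) (\<lambda>x. \<phi> x powr p)"
      unfolding AE_uniform_def
    proof (intro allI impI)
      fix e :: real assume "0 < e"
      then have "\<forall>\<^sub>F k in sequentially. AE x in lborel. \<bar>uh (tn (r k)) x - (al * g x) powr p\<bar> \<le> e"
        using uh_limit[OF s g] by (simp add: AE_uniform_def)
      then show "\<forall>\<^sub>F k in sequentially. AE x in lborel. \<bar>uh (tn (r k)) x - \<phi> x powr p\<bar> \<le> e"
      proof (rule eventually_mono)
        fix k assume "AE x in lborel. \<bar>uh (tn (r k)) x - (al * g x) powr p\<bar> \<le> e"
        then show "AE x in lborel. \<bar>uh (tn (r k)) x - \<phi> x powr p\<bar> \<le> e"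
          using GG' \<phi>eq by eventually_elim (simp add: G_def)
      qed
    qed
  qed
qed

end

theorem mainTheorem17:
  fixes \<sigma> m T :: real and \<Omega> :: "'a::euclidean_space set"
    and u0 :: "'a \<Rightarrow> real" and u :: "'a \<Rightarrow> real \<Rightarrow> real"
  assumes sigma: "0 < \<sigma>" "\<sigma> < 1"
    and dim: "2 * \<sigma> < real DIM('a)"
    and Omega: "open \<Omega>" "bounded \<Omega>" "smooth_boundary \<Omega>"
    and m: "(real DIM('a) - 2 * \<sigma>) / (real DIM('a) + 2 * \<sigma>) < m" "m < 1"
    and u0: "\<forall>x. 0 \<le> u0 x" "(\<lambda>x. u0 x powr m) \<in> Hsigma0 \<sigma> \<Omega>"
            "weak_frac_lap_nonneg \<sigma> \<Omega> (\<lambda>x. u0 x powr m)"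
    and sol: "weak_sol_fde \<sigma> m \<Omega> u0 u"
    and ext: "extinction_time m u T"
  shows "\<forall>tn :: nat \<Rightarrow> real. (\<forall>k. 0 \<le> tn k \<and> tn k < T) \<and> tn \<longlonglongrightarrow> T \<longrightarrow>
     (\<exists>r \<phi>. strict_mono r \<and>
        weak_sol_elliptic \<sigma> m \<Omega> \<phi> \<and> (\<forall>x\<in>\<Omega>. 0 < \<phi> x) \<and> (\<forall>x. x \<notin> \<Omega> \<longrightarrow> \<phi> x = 0) \<and>
        (\<forall>K. compact K \<and> K \<subseteq> \<Omega> \<longrightarrow> (\<forall>\<epsilon>>0. eventually (\<lambda>k.
           AE x in lborel. x \<in> K \<longrightarrow>
             (T - tn (r k)) powr (- 1 / (1 - m)) *
               \<bar>u x (tn (r k)) - (T - tn (r k)) powr (1 / (1 - m)) * \<phi> x powr (1 / m)\<bar> \<le> \<epsilon>)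
           sequentially)))"
proof (intro allI impI)
  interpret flow_ext \<sigma> \<Omega> "real DIM('a)" "Cns TYPE('a) \<sigma>" "measure lborel (ball (0::'a) 1)" m "1 / m" u0 u T
    by unfold_locales (use assms in auto)
  fix tn :: "nat \<Rightarrow> real" assume tn: "(\<forall>k. 0 \<le> tn k \<and> tn k < T) \<and> tn \<longlonglongrightarrow> T"
  obtain r \<phi> where r: "strict_mono (r :: nat \<Rightarrow> nat)" and \<phi>: "weak_sol_elliptic \<sigma> m \<Omega> \<phi>"
    "\<And>x. x \<in> \<Omega> \<Longrightarrow> 0 < \<phi> x" "\<And>x. x \<notin> \<Omega> \<Longrightarrow> \<phi> x = 0"
    and lim: "AE_uniform (\<lambda>k. uh (tn (r k))) (\<lambda>x. \<phi> x powr (1 / m))"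
    by (rule rescaled_convergence[of tn]) (use tn in auto)
  \<comment> \<open>The weight in front cancels the extinction rate, so the weighted error is the
    error of \<open>uh\<close> itself.\<close>
  have eq: "(T - t) powr (- 1 / (1 - m)) * \<bar>u x t - (T - t) powr (1 / (1 - m)) * \<phi> x powr (1 / m)\<bar>
      = \<bar>uh t x - \<phi> x powr (1 / m)\<bar>" if "t < T" for t x
  proof -
    have h: "(T - t) powr (- al) * (T - t) powr al = 1" using that by (simp add: powr_minus)
    have "(T - t) powr (- al) * \<bar>u x t - (T - t) powr al * \<phi> x powr (1 / m)\<bar>
        = \<bar>(T - t) powr (- al) * (u x t - (T - t) powr al * \<phi> x powr (1 / m))\<bar>" by (simp add: abs_mult)
    also have "(T - t) powr (- al) * (u x t - (T - t) powr al * \<phi> x powr (1 / m))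
        = uh t x - ((T - t) powr (- al) * (T - t) powr al) * \<phi> x powr (1 / m)" by (simp only: uh_def right_diff_distrib mult.assoc)
    finally have "(T - t) powr (- al) * \<bar>u x t - (T - t) powr al * \<phi> x powr (1 / m)\<bar> = \<bar>uh t x - 1 * \<phi> x powr (1 / m)\<bar>"
      unfolding h .
    then show ?thesis by (simp add: al_def)
  qed
  show "\<exists>r \<phi>. strict_mono r \<and>
        weak_sol_elliptic \<sigma> m \<Omega> \<phi> \<and> (\<forall>x\<in>\<Omega>. 0 < \<phi> x) \<and> (\<forall>x. x \<notin> \<Omega> \<longrightarrow> \<phi> x = 0) \<and>
        (\<forall>K. compact K \<and> K \<subseteq> \<Omega> \<longrightarrow> (\<forall>\<epsilon>>0. eventually (\<lambda>k.
           AE x in lborel. x \<in> K \<longrightarrow>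
             (T - tn (r k)) powr (- 1 / (1 - m)) *
               \<bar>u x (tn (r k)) - (T - tn (r k)) powr (1 / (1 - m)) * \<phi> x powr (1 / m)\<bar> \<le> \<epsilon>)
           sequentially))"
  proof (intro exI[of _ r] exI[of _ \<phi>] conjI allI ballI impI)
    fix K :: "'a set" and \<epsilon> :: real assume "0 < \<epsilon>"
    then have "\<forall>\<^sub>F k in sequentially. AE x in lborel. \<bar>uh (tn (r k)) x - \<phi> x powr (1 / m)\<bar> \<le> \<epsilon>"
      using lim by (simp add: AE_uniform_def)
    then show "\<forall>\<^sub>F k in sequentially. AE x in lborel. x \<in> K \<longrightarrow>
             (T - tn (r k)) powr (- 1 / (1 - m)) *
               \<bar>u x (tn (r k)) - (T - tn (r k)) powr (1 / (1 - m)) * \<phi> x powr (1 / m)\<bar> \<le> \<epsilon>"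
    proof (rule eventually_mono)
      fix k assume k: "AE x in lborel. \<bar>uh (tn (r k)) x - \<phi> x powr (1 / m)\<bar> \<le> \<epsilon>"
      have tk: "tn (r k) < T" using tn by blast
      show "AE x in lborel. x \<in> K \<longrightarrow>
             (T - tn (r k)) powr (- 1 / (1 - m)) *
               \<bar>u x (tn (r k)) - (T - tn (r k)) powr (1 / (1 - m)) * \<phi> x powr (1 / m)\<bar> \<le> \<epsilon>"
        using k unfolding eq[OF tk] by eventually_elim simp
    qed
  qed (use r \<phi> in auto)
qed

end
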